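(* Let $n, b$ be positive integers and let $f \in \mathbb{Z}[x]$ be a square-free polynomial of degree $n$ satisfying $\|f\|_\infty < 2^b$. Let $1 \le t \le n$ be an additional integer parameter. Then one can find (by a deterministic algorithm), in $\tilde{O}\left(\frac{n^2 b}{t}\right)$ time, a prime number $p$ such that the following three requirements are satisfied: 1. $p \le \tilde{O}\left(\frac{nb}{t}\right)$; 2. $\deg(\gcd(f_p, f_p')) < t$; 3. $p$ does not divide the leading coefficient of $f$.
   Context: $\|f\|_\infty$ denotes the largest absolute value of a coefficient of $f$; $f_p \in \mathbb{F}_p[x]$ denotes the reduction of $f$ modulo $p$, and $f_p'$ is its derivative. Square-free means that $f$ has no repeated non-constant factor (over $\mathbb{Q}$). Running time is measured in bit operations, and $\tilde{O}(T)$ suppresses factors that are polylogarithmic in the input parameters $n, b$. *)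

theory Defs
  imports
    Complex_Main
    "HOL-Computational_Algebra.Polynomial"
    "HOL-Computational_Algebra.Squarefree"
    "HOL-Library.Log_Nat"
    "HOL-Number_Theory.Residues"
    "HOL-Algebra.Divisibility"
    "HOL-Algebra.UnivPoly"
begin

section \<open>Deterministic algorithms and bit operations\<close>

text \<open>
  The machine model is the random access machine with logarithmic costs, programmed in a
  structured language. The memory cells are addressed by integers and hold integers of arbitrary
  size. Each primitive is charged a number of bit operations that suffices to perform it naively
  on its operands; in particular multiplication and division are charged the schoolbook cost, and
  memory accesses are charged the length of the address in addition to the length of the contents.
\<close>

type_synonym memory = "int \<Rightarrow> int"

datatype operator = Add | Sub | Mul | Quo | Rem | Shl | Shr | Lt

datatype expr =
    Num int
  | Mem expr
  | Bin operator expr expr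

datatype program =
    Assign expr expr  \<comment> \<open>the first expression is the address of the cell to be overwritten\<close>
  | Seq program program
  | Cond expr program program
  | Loop expr program

definition bit_size :: "int \<Rightarrow> nat" where
  "bit_size x = floorlog 2 (nat \<bar>x\<bar>) + 1"

text \<open>
  Division rounds down, as in HOL. Division by zero and negative shift distances follow the
  HOL conventions for \<open>div\<close>, \<open>mod\<close> and \<open>nat\<close>.
\<close>

fun op_val :: "operator \<Rightarrow> int \<Rightarrow> int \<Rightarrow> int" where
  "op_val Add x y = x + y"
| "op_val Sub x y = x - y"
| "op_val Mul x y = x * y"
| "op_val Quo x y = x div y"
| "op_val Rem x y = x mod y"
| "op_val Shl x y = push_bit (nat y) x"
| "op_val Shr x y = drop_bit (nat y) x"
| "op_val Lt x y = (if x < y then 1 else 0)"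

fun op_cost :: "operator \<Rightarrow> int \<Rightarrow> int \<Rightarrow> nat" where
  "op_cost Add x y = bit_size x + bit_size y"
| "op_cost Sub x y = bit_size x + bit_size y"
| "op_cost Mul x y = bit_size x * bit_size y"
| "op_cost Quo x y = bit_size x * bit_size y"
| "op_cost Rem x y = bit_size x * bit_size y"
| "op_cost Shl x y = bit_size x + bit_size y + nat y"
| "op_cost Shr x y = bit_size x + bit_size y"
| "op_cost Lt x y = bit_size x + bit_size y"

fun expr_val :: "memory \<Rightarrow> expr \<Rightarrow> int" where
  "expr_val s (Num k) = k"
| "expr_val s (Mem a) = s (expr_val s a)"
| "expr_val s (Bin f a b) = op_val f (expr_val s a) (expr_val s b)"

fun expr_cost :: "memory \<Rightarrow> expr \<Rightarrow> nat" where
  "expr_cost s (Num k) = bit_size k"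
| "expr_cost s (Mem a) = expr_cost s a + bit_size (expr_val s a) + bit_size (s (expr_val s a))"
| "expr_cost s (Bin f a b) =
     expr_cost s a + expr_cost s b + op_cost f (expr_val s a) (expr_val s b)"

text \<open>
  \<open>exec c s T s'\<close>: started in memory \<open>s\<close>, the program \<open>c\<close> halts in memory \<open>s'\<close> after exactly
  \<open>T\<close> bit operations. A test succeeds iff its value is nonzero.
\<close>

inductive exec :: "program \<Rightarrow> memory \<Rightarrow> nat \<Rightarrow> memory \<Rightarrow> bool" where
  exec_Assign: "exec (Assign a e) s
     (expr_cost s a + expr_cost s e + bit_size (expr_val s a) + bit_size (expr_val s e))
     (s(expr_val s a := expr_val s e))"
| exec_Seq: "exec c s T s' \<Longrightarrow> exec d s' U s'' \<Longrightarrow> exec (Seq c d) s (T + U) s''"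
| exec_Cond_true: "expr_val s e \<noteq> 0 \<Longrightarrow> exec c s T s' \<Longrightarrow>
     exec (Cond e c d) s (expr_cost s e + bit_size (expr_val s e) + T) s'"
| exec_Cond_false: "expr_val s e = 0 \<Longrightarrow> exec d s T s' \<Longrightarrow>
     exec (Cond e c d) s (expr_cost s e + bit_size (expr_val s e) + T) s'"
| exec_Loop_true: "expr_val s e \<noteq> 0 \<Longrightarrow> exec c s T s' \<Longrightarrow> exec (Loop e c) s' U s'' \<Longrightarrow>
     exec (Loop e c) s (expr_cost s e + bit_size (expr_val s e) + T + U) s''"
| exec_Loop_false: "expr_val s e = 0 \<Longrightarrow>
     exec (Loop e c) s (expr_cost s e + bit_size (expr_val s e)) s"

inductive_cases exec_AssignE: "exec (Assign a e) s T s'"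
inductive_cases exec_SeqE: "exec (Seq c d) s T s'"
inductive_cases exec_CondE: "exec (Cond e c d) s T s'"
inductive_cases exec_LoopE: "exec (Loop e c) s T s'"

lemma exec_deterministic:
  assumes "exec c s T s'" and "exec c s U s''"
  shows "T = U \<and> s' = s''"
  using assms
proof (induction arbitrary: U s'' rule: exec.induct)
  case (exec_Assign a e s)
  from exec_Assign.prems show ?case by (rule exec_AssignE) simp
next
  case (exec_Seq c s T s' d V u)
  from exec_Seq.prems obtain T' V' m
    where "exec c s T' m" "exec d m V' s''" "U = T' + V'"
    by (rule exec_SeqE)
  with exec_Seq.IH show ?case by metis
next
  case (exec_Cond_true s e c T s' d)
  from exec_Cond_true.prems exec_Cond_true.hyps(1) obtain T'
    where "exec c s T' s''" "U = expr_cost s e + bit_size (expr_val s e) + T'"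
    by (elim exec_CondE) simp_all
  with exec_Cond_true.IH show ?case by metis
next
  case (exec_Cond_false s e d T s' c)
  from exec_Cond_false.prems exec_Cond_false.hyps(1) obtain T'
    where "exec d s T' s''" "U = expr_cost s e + bit_size (expr_val s e) + T'"
    by (elim exec_CondE) simp_all
  with exec_Cond_false.IH show ?case by metis
next
  case (exec_Loop_true s e c T s' V u)
  from exec_Loop_true.prems obtain T' V' m
    where "exec c s T' m" "exec (Loop e c) m V' s''"
      "U = expr_cost s e + bit_size (expr_val s e) + T' + V'"
    by (rule exec_LoopE) (use exec_Loop_true.hyps(1) in simp_all)
  with exec_Loop_true.IH show ?case by metis
next
  case (exec_Loop_false s e c)
  from exec_Loop_false.prems show ?case
    by (rule exec_LoopE) (use exec_Loop_false.hyps in simp_all)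
qed

text \<open>
  Cells 0, 1, 2 hold \<open>n\<close>, \<open>b\<close>, \<open>t\<close>, the cells from 3 on hold the coefficients of \<open>f\<close>, constant
  coefficient first, and all other cells are zero; the cells with negative addresses are
  available as work space. The result of a computation is read off cell 0.
\<close>

definition input_memory :: "nat \<Rightarrow> nat \<Rightarrow> nat \<Rightarrow> int poly \<Rightarrow> memory" where
  "input_memory n b t f = (\<lambda>a.
     if a = 0 then int n
     else if a = 1 then int b
     else if a = 2 then int t
     else if 3 \<le> a then Polynomial.coeff f (nat (a - 3))
     else 0)"

text \<open>
  Functions bounded by \<open>g\<close> up to a constant and a factor polylogarithmic in \<open>n\<close> and \<open>b\<close>, uniformly
  in the range \<open>n, b \<ge> 1\<close>, \<open>1 \<le> t \<le> n\<close>. The argument \<open>n + b + 1\<close> keeps the logarithm above 1.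
\<close>

definition soft_O :: "(nat \<Rightarrow> nat \<Rightarrow> nat \<Rightarrow> real) \<Rightarrow> (nat \<Rightarrow> nat \<Rightarrow> nat \<Rightarrow> real) set" where
  "soft_O g = {h. \<exists>(C::real) (k::nat). \<forall>n b t. 1 \<le> n \<and> 1 \<le> b \<and> 1 \<le> t \<and> t \<le> n \<longrightarrow>
     h n b t \<le> C * g n b t * ln (real (n + b + 1)) ^ k}"


section \<open>Polynomials over the integers and modulo a prime\<close>

definition coeff_norm_inf :: "int poly \<Rightarrow> int" where
  "coeff_norm_inf f = Max ((\<lambda>i. \<bar>Polynomial.coeff f i\<bar>) ` {..Polynomial.degree f})"

definition reduce_mod :: "nat \<Rightarrow> int poly \<Rightarrow> (nat \<Rightarrow> int)" where
  "reduce_mod p f = (\<lambda>i. Polynomial.coeff f i mod int p)"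

lemma reduce_mod_carrier:
  assumes "0 < p"
  shows "reduce_mod p f \<in> carrier (UP (residue_ring (int p)))"
proof -
  have "bound 0 (Polynomial.degree f) (reduce_mod p f)"
    by (rule bound.intro) (simp add: reduce_mod_def Polynomial.coeff_eq_0)
  moreover have "reduce_mod p f i \<in> {0..int p - 1}" for i
    using assms by (simp add: reduce_mod_def)
  ultimately show ?thesis
    unfolding UP_def up_def residue_ring_def by auto
qed

definition UP_deriv :: "('a, 'm) ring_scheme \<Rightarrow> (nat \<Rightarrow> 'a) \<Rightarrow> (nat \<Rightarrow> 'a)" where
  "UP_deriv R q = (\<lambda>i. [Suc i] \<cdot>\<^bsub>R\<^esub> q (Suc i))"

lemma residue_ring_add_pow:
  "[(k::nat)] \<cdot>\<^bsub>residue_ring m\<^esub> (x mod m) = (int k * x) mod m"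
proof (induction k)
  case 0
  show ?case by (simp add: add_pow_def nat_pow_def residue_ring_def)
next
  case (Suc k)
  have "[Suc k] \<cdot>\<^bsub>residue_ring m\<^esub> (x mod m)
      = ([k] \<cdot>\<^bsub>residue_ring m\<^esub> (x mod m) + x mod m) mod m"
    by (simp add: add_pow_def nat_pow_def residue_ring_def)
  also have "\<dots> = (int (Suc k) * x) mod m"
    by (simp add: Suc.IH mod_simps algebra_simps)
  finally show ?case .
qed

lemma UP_deriv_reduce_mod:
  "UP_deriv (residue_ring (int p)) (reduce_mod p f) = reduce_mod p (pderiv f)"
  by (simp add: UP_deriv_def reduce_mod_def residue_ring_add_pow coeff_pderiv)

end

theory Submission
  imports Defs "Berlekamp_Zassenhaus.Square_Free_Int_To_Square_Free_GFp"
begin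

text \<open>
  If \<open>p\<close> does not divide the leading coefficient of \<open>f\<close> and the gcd of \<open>f\<close> and \<open>f'\<close> modulo \<open>p\<close> has
  degree at least \<open>t\<close>, then \<open>p ^ t\<close> divides the resultant of \<open>f\<close> and \<open>f'\<close>, as long division by a monic
  lift of the gcd makes \<open>t\<close> columns of the Sylvester matrix divisible by \<open>p\<close>. The resultant is
  nonzero with \<open>O(n (b + log n))\<close> bits, so only \<open>O(n (b + log n) / t + b)\<close> primes fail, whereas
  Chebyshev's lower bound provides more primes below a bound of size \<open>n b / t\<close> up to logarithms.

  The algorithm tests all odd primes of a sieve below this bound. The coefficients of \<open>f\<close> are reduced
  modulo all of these primes at once by descending a product tree with Montgomery reductions, which
  avoids divisions. For a single prime the degree of the gcd is read off a divide-and-conquer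
  version of the division steps of Bernstein and Yang. All multiplications are those of Schoenhage
  and Strassen, as the machine charges the schoolbook cost for its own multiplication. The programs
  are written in a first-order functional language, which is compiled to the machine with
  a logarithmic overhead.
\<close>

text \<open>The time bound is a count of bits. Up to logarithms there are \<open>n * b / t\<close>
  candidates, and each is charged \<open>n\<close> for its gcd. At a node of the product tree the
  reduction of the coefficients costs \<open>n\<close> times the length of the modulus, and the
  moduli of one level have \<open>n * b / t\<close> bits together. So even trying every candidate
  stays within \<open>n^2 * b / t\<close>. The coefficients must not be longer than the root
  modulus; for this reason too, \<open>b\<close> is a summand of \<open>budget\<close>, which is
  harmless because \<open>t <= n\<close> gives \<open>b <= n * b / t\<close>. Montgomery reduction
  yields residues only up to a factor that is a unit modulo the prime. Neither the degree of a gcd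
  nor the vanishing of the leading coefficient sees such a factor, so it is never removed; the price
  is that the prime 2 is excluded. Likewise the division steps scale by units instead of inverting
  in the field. Their number is fixed in advance, which allows splitting them in halves, and at the
  end the counter \<open>\<delta>\<close> together with \<open>n\<close> and the number of steps
  gives the degree of the gcd.\<close>

hide_const (open) UnivPoly.coeff UnivPoly.monom Module.smult Divisibility.prime order.Lt

section \<open>Sizes of integers\<close>

text \<open>Besides the binary digits \<open>bit_size\<close> counts one sign bit; the
  \<open>Suc\<close> form keeps this offset out of the exponent in all later size estimates.\<close>

lemma bit_size_le_iff: "bit_size x \<le> Suc k \<longleftrightarrow> \<bar>x\<bar> < 2 ^ k"
proof -
  have "bit_size x \<le> Suc k \<longleftrightarrow> nat \<bar>x\<bar> < 2 ^ k"
    by (simp add: bit_size_def floorlog_le_iff)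
  also have "\<dots> \<longleftrightarrow> \<bar>x\<bar> < 2 ^ k"
    by (simp add: nat_less_iff)
  finally show ?thesis .
qed

lemma bit_size_pos [simp]: "0 < bit_size x" "bit_size x \<noteq> 0" "Suc 0 \<le> bit_size x"
  by (simp_all add: bit_size_def)

lemma abs_less_bit_size: "\<bar>x\<bar> < 2 ^ (bit_size x - 1)"
  using bit_size_le_iff[of x "bit_size x - 1"] by simp

lemma bit_size_mono: "\<bar>x\<bar> \<le> \<bar>y\<bar> ==> bit_size x \<le> bit_size y"
  using bit_size_le_iff[of x "bit_size y - 1"] abs_less_bit_size[of y] by simp

lemma bit_size_minus [simp]: "bit_size (- x) = bit_size x"
  by (simp add: bit_size_def)

lemma bit_size_add: "bit_size (x + y) \<le> bit_size x + bit_size y"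
proof -
  obtain a b where ab: "bit_size x = Suc a" "bit_size y = Suc b"
    by (metis bit_size_pos(2) not0_implies_Suc)
  then have "\<bar>x\<bar> < 2 ^ a" "\<bar>y\<bar> < 2 ^ b"
    using abs_less_bit_size[of x] abs_less_bit_size[of y] by simp_all
  moreover have "(2::int) ^ a \<le> 2 ^ (a + b)" "(2::int) ^ b \<le> 2 ^ (a + b)"
    by (simp_all add: power_increasing)
  moreover have "\<bar>x + y\<bar> \<le> \<bar>x\<bar> + \<bar>y\<bar>"
    by (rule abs_triangle_ineq)
  ultimately have "\<bar>x + y\<bar> < 2 ^ Suc (a + b)"
    unfolding power_Suc by linarith
  then have "bit_size (x + y) \<le> Suc (Suc (a + b))"
    unfolding bit_size_le_iff .
  then show ?thesis
    using ab by simp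
qed

lemma bit_size_diff: "bit_size (x - y) \<le> bit_size x + bit_size y"
  using bit_size_add[of x "- y"] by simp

lemma bit_size_mult: "bit_size (x * y) \<le> bit_size x + bit_size y"
proof -
  obtain a b where ab: "bit_size x = Suc a" "bit_size y = Suc b"
    by (metis bit_size_pos(2) not0_implies_Suc)
  then have "\<bar>x\<bar> < 2 ^ a" "\<bar>y\<bar> < 2 ^ b"
    using abs_less_bit_size[of x] abs_less_bit_size[of y] by simp_all
  then have "\<bar>x * y\<bar> < 2 ^ (a + b)"
    unfolding abs_mult power_add by (intro mult_strict_mono) auto
  then have "bit_size (x * y) \<le> Suc (a + b)"
    unfolding bit_size_le_iff .
  then show ?thesis
    using ab by simp
qed

text \<open>Rounding down pushes a negative quotient away from zero, but not beyond the dividend,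
  because \<open>x * y <= x\<close> for \<open>x < 0\<close> and \<open>y >= 1\<close>.\<close>

lemma abs_div_le: "0 \<le> (y::int) ==> \<bar>x div y\<bar> \<le> \<bar>x\<bar>"
proof -
  assume y: "0 \<le> y"
  show ?thesis
  proof (cases "y = 0")
    case False
    then have y: "1 \<le> y" using y by simp
    show ?thesis
    proof (cases "0 \<le> x")
      case True
      then have "0 \<le> x div y" "x div y \<le> x"
        using y True by (auto simp: pos_imp_zdiv_nonneg_iff div_le_dividend zdiv_mono2[of x 1 y, simplified])
      then show ?thesis using True by simp
    next
      case False
      then have "x div y < 0" using y by (simp add: div_neg_pos_less0)
      moreover have "x \<le> x div y"
      proof -
        have "x * y \<le> x" using y False by (simp add: mult_le_cancel_left1)
        then have "x * y div y \<le> x div y" using y by (intro zdiv_mono1) auto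
        then show ?thesis using y by simp
      qed
      ultimately show ?thesis using False by simp
    qed
  qed simp
qed

lemma bit_size_drop_bit: "bit_size (drop_bit k x) \<le> bit_size x"
  by (rule bit_size_mono) (simp add: drop_bit_eq_div abs_div_le)

lemma bit_size_push_bit: "bit_size (push_bit k x) \<le> bit_size x + k"
proof -
  obtain a where a: "bit_size x = Suc a"
    by (metis bit_size_pos(2) not0_implies_Suc)
  then have "\<bar>x\<bar> < 2 ^ a"
    using abs_less_bit_size[of x] by simp
  then have "\<bar>push_bit k x\<bar> < 2 ^ (a + k)"
    by (simp add: push_bit_eq_mult abs_mult power_add)
  then have "bit_size (push_bit k x) \<le> Suc (a + k)"
    unfolding bit_size_le_iff .
  then show ?thesis using a by simp
qed

lemma bit_size_mod: "0 < y ==> bit_size (x mod y) \<le> bit_size y"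
proof (rule bit_size_mono)
  assume "0 < y"
  then have "0 \<le> x mod y" "x mod y < y" by simp_all
  then show "\<bar>x mod y\<bar> \<le> \<bar>y\<bar>" by simp
qed

lemma bit_size_small: "\<bar>x\<bar> < 2 ^ k ==> bit_size x \<le> Suc k"
  by (simp add: bit_size_le_iff)

lemma bit_size_of_nat: "bit_size (int n) \<le> Suc n"
proof (rule bit_size_small)
  have "n < 2 ^ n" by (rule less_exp)
  then show "\<bar>int n\<bar> < 2 ^ n"
    by (metis abs_of_nat of_nat_less_iff of_nat_numeral of_nat_power)
qed

lemma bit_size_0 [simp]: "bit_size 0 = 1" and bit_size_1 [simp]: "bit_size 1 = 2"
  by (simp_all add: bit_size_def floorlog_def)


section \<open>A functional language\<close>

text \<open>
  Expressions are evaluated in an environment that is a single value. \<open>Rec b e\<close> applies the function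
  with body \<open>b\<close> to \<open>e\<close>; inside \<open>b\<close>, the function is called by \<open>Self\<close>.
\<close>

datatype val = Atom int | Node val val

datatype fexp = Env | Const int | Input fexp | Prim operator fexp fexp | Join fexp fexp
  | Left fexp | Right fexp | Test fexp fexp fexp | Bind fexp fexp | Self fexp | Rec fexp fexp

text \<open>A pair is stored as an address and charged 1 here; the length of addresses enters later
  as the logarithmic factor \<open>bit_size h\<close> of the simulation.\<close>

fun vsize :: "val => nat" where
  "vsize (Atom k) = bit_size k"
| "vsize (Node _ _) = 1"

lemma vsize_pos [simp]: "0 < vsize v" "Suc 0 \<le> vsize v"
  by (cases v; simp)+

text \<open>The second argument is the body of the function being executed, to which
  \<open>Self\<close> refers. Calls are charged for argument, environment and result because the
  machine copies all three when it enters and leaves a body.\<close>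

inductive eval :: "memory => fexp => val => fexp => val => nat => bool" for M where
  eval_Env: "eval M s E Env E (1 + vsize E)"
| eval_Const: "eval M s E (Const k) (Atom k) (1 + bit_size k)"
| eval_Input: "eval M s E a (Atom x) c ==> 0 \<le> x ==>
    eval M s E (Input a) (Atom (M x)) (c + 1 + bit_size x + bit_size (M x))"
| eval_Prim: "eval M s E a (Atom x) c ==> eval M s E b (Atom y) d ==>
    eval M s E (Prim f a b) (Atom (op_val f x y)) (c + d + 1 + op_cost f x y + bit_size (op_val f x y))"
| eval_Join: "eval M s E a u c ==> eval M s E b v d ==>
    eval M s E (Join a b) (Node u v) (c + d + 1 + vsize u + vsize v)"
| eval_Left: "eval M s E a (Node u v) c ==> eval M s E (Left a) u (c + 1 + vsize u)"
| eval_Right: "eval M s E a (Node u v) c ==> eval M s E (Right a) v (c + 1 + vsize v)"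
| eval_Test: "eval M s E e (Atom x) c ==> eval M s E (if x \<noteq> 0 then a else b) v d ==>
    eval M s E (Test e a b) v (c + d + 1 + bit_size x)"
| eval_Bind: "eval M s E a u c ==> eval M s u b v d ==>
    eval M s E (Bind a b) v (c + d + 1 + vsize u + vsize E + vsize v)"
| eval_Self: "eval M s E a u c ==> eval M s u s v d ==>
    eval M s E (Self a) v (c + d + 1 + vsize u + vsize E + vsize v)"
| eval_Rec: "eval M s E a u c ==> eval M b u b v d ==>
    eval M s E (Rec b a) v (c + d + 1 + vsize u + vsize E + vsize v)"


section \<open>An agenda machine for the language\<close>

text \<open>A task is a frame of the continuation. Evaluation tasks carry the body \<open>s\<close>,
  so functions never exist as run-time values.\<close>

datatype task = TEval fexp fexp | TInput | TPrim operator | TJoin | TLeft | TRight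
  | TTest fexp fexp fexp | TEnter fexp fexp | TRestore

text \<open>All tasks that evaluating an expression can put on the agenda; being finitely many, they
  can be named by numbers. \<open>Self\<close> does not unfold \<open>s\<close> again, which would
  not terminate; \<open>simulation\<close> assumes separately that \<open>tasks s s\<close> is
  covered.\<close>

fun tasks :: "fexp => fexp => task list" where
  "tasks s Env = [TEval s Env]"
| "tasks s (Const k) = [TEval s (Const k)]"
| "tasks s (Input a) = TEval s (Input a) # TInput # tasks s a"
| "tasks s (Prim f a b) = TEval s (Prim f a b) # TPrim f # tasks s a @ tasks s b"
| "tasks s (Join a b) = TEval s (Join a b) # TJoin # tasks s a @ tasks s b"
| "tasks s (Left a) = TEval s (Left a) # TLeft # tasks s a"
| "tasks s (Right a) = TEval s (Right a) # TRight # tasks s a"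
| "tasks s (Test e a b) = TEval s (Test e a b) # TTest s a b # tasks s e @ tasks s a @ tasks s b"
| "tasks s (Bind a b) = TEval s (Bind a b) # TEnter s b # TRestore # tasks s a @ tasks s b"
| "tasks s (Self a) = TEval s (Self a) # TEnter s s # TRestore # tasks s a"
| "tasks s (Rec b a) = TEval s (Rec b a) # TEnter b b # TRestore # tasks s a @ tasks b b"

text \<open>
  The cells -1, -2, -3 hold the agenda, the stack of intermediate results and the environment,
  cell -4 the first free address of the heap, which grows downwards; -5 holds the current task and
  -6, -7 are scratch registers.
\<close>

abbreviation reg :: "int => expr" where "reg r \<equiv> Mem (Num r)"

text \<open>Only these registers hold represented values: cell -4 is a bare address and cell -5 a
  bare task number.\<close>

definition regs :: "int set" where "regs = {-1, -2, -3, -6, -7}"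

definition mov :: "int => expr => program" where
  "mov r e = Assign (Num r) e"

text \<open>The new pair occupies \<open>h\<close> and \<open>h - 1\<close>. The old content of
  \<open>r\<close> becomes its second component before \<open>r\<close> is redirected, which makes a
  register a linked stack.\<close>

definition push :: "int => expr => program" where
  "push r e = Seq (Assign (reg (-4)) e) (Seq (Assign (Bin Sub (reg (-4)) (Num 1)) (reg r))
     (Seq (Assign (Num r) (reg (-4))) (Assign (Num (-4)) (Bin Sub (reg (-4)) (Num 2)))))"

abbreviation cdr :: "int => expr" where "cdr r \<equiv> Mem (Bin Sub (reg r) (Num 1))"

definition pop :: "int => program" where
  "pop x = Seq (mov x (Mem (reg (-2)))) (mov (-2) (cdr (-2)))"

text \<open>Task lists contain repetitions, so a task is numbered by its first occurrence.\<close>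

definition task_code :: "task list => task => int" where
  "task_code ts t = int (LEAST i. i < length ts \<and> ts ! i = t)"

definition push_task :: "task list => task => program" where
  "push_task ts t = push (-1) (Num (task_code ts t))"

text \<open>The agenda is a stack: the continuation is pushed first and the first operand last, so
  operands are evaluated from left to right and the continuation runs after them.\<close>

fun eval_block :: "task list => fexp => fexp => program" where
  "eval_block ts s Env = push (-2) (reg (-3))"
| "eval_block ts s (Const k) = push (-2) (Num k)"
| "eval_block ts s (Input a) = Seq (push_task ts TInput) (push_task ts (TEval s a))"
| "eval_block ts s (Prim f a b) =
     Seq (push_task ts (TPrim f)) (Seq (push_task ts (TEval s b)) (push_task ts (TEval s a)))"
| "eval_block ts s (Join a b) =
     Seq (push_task ts TJoin) (Seq (push_task ts (TEval s b)) (push_task ts (TEval s a)))"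
| "eval_block ts s (Left a) = Seq (push_task ts TLeft) (push_task ts (TEval s a))"
| "eval_block ts s (Right a) = Seq (push_task ts TRight) (push_task ts (TEval s a))"
| "eval_block ts s (Test e a b) = Seq (push_task ts (TTest s a b)) (push_task ts (TEval s e))"
| "eval_block ts s (Bind a b) = Seq (push_task ts (TEnter s b)) (push_task ts (TEval s a))"
| "eval_block ts s (Self a) = Seq (push_task ts (TEnter s s)) (push_task ts (TEval s a))"
| "eval_block ts s (Rec b a) = Seq (push_task ts (TEnter b b)) (push_task ts (TEval s a))"

fun block :: "task list => task => program" where
  "block ts (TEval s e) = eval_block ts s e"
| "block ts TInput = Seq (pop (-6)) (push (-2) (Mem (reg (-6))))"
| "block ts (TPrim f) = Seq (pop (-7)) (Seq (pop (-6)) (push (-2) (Bin f (reg (-6)) (reg (-7)))))"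
| "block ts TJoin = Seq (pop (-7)) (Seq (pop (-6)) (Seq (push (-7) (reg (-6))) (push (-2) (reg (-7)))))"
| "block ts TLeft = Seq (pop (-6)) (push (-2) (Mem (reg (-6))))"
| "block ts TRight = Seq (pop (-6)) (push (-2) (cdr (-6)))"
| "block ts (TTest s a b) =
     Seq (pop (-6)) (Cond (reg (-6)) (push_task ts (TEval s a)) (push_task ts (TEval s b)))"
| "block ts (TEnter s b) = Seq (pop (-6)) (Seq (push (-2) (reg (-3))) (Seq (mov (-3) (reg (-6)))
     (Seq (push_task ts TRestore) (push_task ts (TEval s b)))))"
| "block ts TRestore = Seq (pop (-6)) (Seq (pop (-3)) (push (-2) (reg (-6))))"

text \<open>Linear search is affordable because the number of tasks depends on the program only. The
  last branch writes to a spare cell and is never reached by a valid task number.\<close>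

fun switch :: "nat => program list => program" where
  "switch i [] = Assign (Num (-8)) (Num 0)"
| "switch i (b # bs) = Cond (Bin Sub (reg (-5)) (Num (int i))) (switch (Suc i) bs) b"

definition machine_body :: "task list => program" where
  "machine_body ts = Seq (mov (-5) (Mem (reg (-1)))) (Seq (mov (-1) (cdr (-1))) (switch 0 (map (block ts) ts)))"

text \<open>An empty agenda is the number 0 and a nonempty one an address of at most -10, so the
  loop can test the register itself; the heap starts at -10 to stay clear of the registers. The main
  expression serves as its own body.\<close>

definition compile :: "fexp => program" where
  "compile e = (let ts = tasks e e in
     Seq (mov (-4) (Num (-10))) (Seq (push_task ts (TEval e e))
      (Seq (Loop (reg (-1)) (machine_body ts)) (mov 0 (Mem (reg (-2)))))))"

section \<open>Values in memory and straight-line programs\<close>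

fun rep :: "memory => int => int => val => bool" where
  "rep m h w (Atom k) \<longleftrightarrow> w = k"
| "rep m h w (Node a b) \<longleftrightarrow> h + 2 \<le> w \<and> w \<le> -10 \<and> rep m h (m w) a \<and> rep m h (m (w - 1)) b"

text \<open>A node at \<open>w\<close> uses the cells \<open>w\<close> and \<open>w - 1\<close>,
  both above the first free address \<open>h\<close> because of \<open>h + 2 <= w\<close>. Programs
  write only into registers or at and below \<open>h\<close>, so represented values persist.\<close>

lemma rep_mono:
  assumes "rep m h w v" "h' \<le> h" "\<And>a. h < a ==> a \<le> -10 ==> m' a = m a"
  shows "rep m' h' w v"
  using assms(1)
proof (induction v arbitrary: w)
  case (Node a b)
  then show ?case using assms(2) assms(3)[of w] assms(3)[of "w - 1"] by auto
qed simp

lemma rep_bit_size: "rep m h w v ==> bit_size w \<le> vsize v + bit_size h"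
proof (cases v)
  case (Node a b)
  assume "rep m h w v"
  then have "\<bar>w\<bar> \<le> \<bar>h\<bar>" using Node by simp
  then show ?thesis using Node bit_size_mono by fastforce
qed simp

text \<open>
  The contents of the registers are described by a valuation; \<open>M\<close> is the initial memory, whose
  nonnegative part is never changed while the machine runs.
\<close>

definition state :: "memory => (int => val) => int => memory => bool" where
  "state M rg h m \<longleftrightarrow> m (-4) = h \<and> h \<le> -10 \<and> (\<forall>r\<in>regs. rep m h (m r) (rg r)) \<and> (\<forall>a\<ge>0. m a = M a)"

definition runs :: "memory => (int => val) => int => program => nat => (int => val) => int => bool" where
  "runs M rg h c B rg' h' \<longleftrightarrow> (\<forall>m. state M rg h m \<longrightarrow> (\<exists>T m'. T \<le> B \<and> exec c m T m' \<and> state M rg' h' m'))"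

definition denotes :: "memory => (int => val) => int => expr => val => nat => bool" where
  "denotes M rg h e v B \<longleftrightarrow> (\<forall>m. state M rg h m \<longrightarrow> rep m h (expr_val m e) v \<and> expr_cost m e \<le> B)"

lemma runs_weaken: "runs M rg h c B rg' h' ==> B \<le> B' ==> runs M rg h c B' rg' h'"
  unfolding runs_def by (meson le_trans)

lemma runs_Seq:
  assumes "runs M rg h c A rg1 h1" "runs M rg1 h1 d B rg2 h2"
  shows "runs M rg h (Seq c d) (A + B) rg2 h2"
  using assms unfolding runs_def by (meson exec_Seq add_mono)

lemma bit_size_reg: "r \<in> regs ==> bit_size r \<le> 5"
  using bit_size_small[of r 4] by (auto simp: regs_def)

lemma bit_size_consts: "bit_size 2 \<le> 5" "bit_size 4 \<le> 5" "bit_size 5 \<le> 5" "bit_size 8 \<le> 5"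
    "bit_size 10 \<le> 5"
  using bit_size_small[of _ 4] by simp_all

lemma runs_mov:
  assumes "denotes M rg h e v B" "r \<in> regs"
  shows "runs M rg h (mov r e) (B + 10 + vsize v + bit_size h) (rg(r := v)) h"
  unfolding runs_def
proof (intro allI impI)
  fix m assume st: "state M rg h m"
  let ?w = "expr_val m e"
  let ?m = "m(r := ?w)"
  have w: "rep m h ?w v" "expr_cost m e \<le> B"
    using assms(1) st by (auto simp: denotes_def)
  have keep: "?m a = m a" if "a \<le> -10" for a
    using that assms(2) by (auto simp: regs_def)
  have old: "rep ?m h x u" if "rep m h x u" for x u
    by (rule rep_mono[OF that order_refl]) (rule keep)
  have "state M (rg(r := v)) h ?m"
    unfolding state_def
  proof (intro conjI ballI allI impI)
    fix q assume q: "q \<in> regs"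
    show "rep ?m h (?m q) ((rg(r := v)) q)"
      using st q w(1) by (cases "q = r") (auto intro!: old simp: state_def)
  qed (use st assms(2) in \<open>auto simp: state_def regs_def\<close>)
  moreover have "exec (mov r e) m (bit_size r + expr_cost m e + bit_size r + bit_size ?w) ?m"
    using exec_Assign[of "Num r" e m] by (simp add: mov_def)
  moreover have "bit_size r + expr_cost m e + bit_size r + bit_size ?w \<le> B + 10 + vsize v + bit_size h"
    using bit_size_reg[OF assms(2)] w rep_bit_size[OF w(1)] by simp
  ultimately show "\<exists>T m'. T \<le> B + 10 + vsize v + bit_size h \<and> exec (mov r e) m T m' \<and> state M (rg(r := v)) h m'"
    by blast
qed

lemma runs_push:
  assumes "denotes M rg h e v B" "r \<in> {-1, -2, -7}" "h' = h - 2"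
  shows "runs M rg h (push r e) (B + 150 + vsize v + 2 * vsize (rg r) + 15 * bit_size h') (rg(r := Node v (rg r))) h'"
  unfolding runs_def
proof (intro allI impI)
  fix m assume st: "state M rg h m"
  let ?w = "expr_val m e"
  have h: "m (-4) = h" "h \<le> -10"
    using st by (auto simp: state_def)
  have w: "rep m h ?w v" "expr_cost m e \<le> B"
    using assms(1) st by (auto simp: denotes_def)
  have r: "r \<in> regs" "r < 0" "-10 < r" "r \<noteq> -4"
    using assms(2) by (auto simp: regs_def)
  have mr: "rep m h (m r) (rg r)"
    using st r by (auto simp: state_def)
  define m1 where "m1 = m(h := ?w)"
  define m2 where "m2 = m1(h - 1 := m r)"
  define m3 where "m3 = m2(r := h)"
  define m4 where "m4 = m3(-4 := h - 2)"
  have vals: "m1 (-4) = h" "m1 r = m r" "m2 (-4) = h" "m3 (-4) = h"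
    using r h by (auto simp: m1_def m2_def m3_def)
  have keep: "m4 a = m a" if "h < a" "a \<noteq> r" "a \<noteq> -4" for a
    using that by (simp add: m1_def m2_def m3_def m4_def)
  have old: "rep m4 h' x u" if "rep m h x u" for x u
    using that r assms(3) by (intro rep_mono[OF that]) (auto intro: keep)
  have new: "m4 h = ?w" "m4 (h - 1) = m r" "m4 r = h" "m4 (-4) = h'"
    using h r assms(3) by (auto simp: m1_def m2_def m3_def m4_def)
  have st': "state M (rg(r := Node v (rg r))) h' m4"
    unfolding state_def
  proof (intro conjI ballI allI impI)
    fix q assume q: "q \<in> regs"
    show "rep m4 h' (m4 q) ((rg(r := Node v (rg r))) q)"
    proof (cases "q = r")
      case True
      then show ?thesis using new h old[OF w(1)] old[OF mr] assms(3) by simp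
    next
      case False
      have "m4 q = m q" by (rule keep) (use q h False in \<open>auto simp: regs_def\<close>)
      then show ?thesis using False old st q by (simp add: state_def)
    qed
  next
    fix a :: int assume "0 \<le> a"
    then have "m4 a = m a" by (intro keep) (use h r in auto)
    then show "m4 a = M a" using st \<open>0 \<le> a\<close> by (simp add: state_def)
  qed (use h new assms(3) in auto)
  define T1 where "T1 = expr_cost m (reg (-4)) + expr_cost m e + bit_size h + bit_size ?w"
  define T2 where "T2 = expr_cost m1 (Bin Sub (reg (-4)) (Num 1)) + expr_cost m1 (reg r) + bit_size (h - 1) + bit_size (m r)"
  define T3 where "T3 = bit_size r + expr_cost m2 (reg (-4)) + bit_size r + bit_size h"
  define T4 where "T4 = bit_size (-4) + expr_cost m3 (Bin Sub (reg (-4)) (Num 2)) + bit_size (-4) + bit_size (h - 2)"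
  have e1: "exec (Assign (reg (-4)) e) m T1 m1"
    using exec_Assign[of "reg (-4)" e m] h by (simp add: T1_def m1_def)
  have e2: "exec (Assign (Bin Sub (reg (-4)) (Num 1)) (reg r)) m1 T2 m2"
    using exec_Assign[of "Bin Sub (reg (-4)) (Num 1)" "reg r" m1] vals by (simp add: T2_def m2_def)
  have e3: "exec (Assign (Num r) (reg (-4))) m2 T3 m3"
    using exec_Assign[of "Num r" "reg (-4)" m2] vals by (simp add: T3_def m3_def)
  have e4: "exec (Assign (Num (-4)) (Bin Sub (reg (-4)) (Num 2))) m3 T4 m4"
    using exec_Assign[of "Num (-4)" "Bin Sub (reg (-4)) (Num 2)" m3] vals by (simp add: T4_def m4_def)
  have ex: "exec (push r e) m (T1 + (T2 + (T3 + T4))) m4"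
    unfolding push_def by (rule exec_Seq[OF e1 exec_Seq[OF e2 exec_Seq[OF e3 e4]]])
  have bh: "bit_size h \<le> bit_size h'" "bit_size (h - 1) \<le> bit_size h'" "bit_size (h - 2) \<le> bit_size h'"
    using h assms(3) by (auto intro!: bit_size_mono)
  have "T1 + (T2 + (T3 + T4)) \<le> B + 150 + vsize v + 2 * vsize (rg r) + 15 * bit_size h'"
    using bh w(2) rep_bit_size[OF w(1)] rep_bit_size[OF mr] bit_size_reg[OF r(1)] bit_size_consts
    unfolding T1_def T2_def T3_def T4_def by (simp add: vals h)
  with ex st' show "\<exists>T m'. T \<le> B + 150 + vsize v + 2 * vsize (rg r) + 15 * bit_size h' \<and>
      exec (push r e) m T m' \<and> state M (rg(r := Node v (rg r))) h' m'"
    by blast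
qed

lemma denotes_Num: "denotes M rg h (Num k) (Atom k) (bit_size k)"
  by (simp add: denotes_def)

lemma denotes_reg:
  assumes "r \<in> regs"
  shows "denotes M rg h (reg r) (rg r) (10 + vsize (rg r) + bit_size h)"
  unfolding denotes_def
proof (intro allI impI)
  fix m assume "state M rg h m"
  then have "rep m h (m r) (rg r)" using assms by (simp add: state_def)
  then show "rep m h (expr_val m (reg r)) (rg r) \<and> expr_cost m (reg r) \<le> 10 + vsize (rg r) + bit_size h"
    using rep_bit_size[of m h "m r" "rg r"] bit_size_reg[OF assms] by simp
qed

lemma denotes_Left:
  assumes "r \<in> regs" "rg r = Node u v"
  shows "denotes M rg h (Mem (reg r)) u (20 + vsize u + 3 * bit_size h)"
  unfolding denotes_def
proof (intro allI impI)
  fix m assume "state M rg h m"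
  then have rep: "rep m h (m r) (Node u v)" using assms by (auto simp: state_def)
  then have *: "rep m h (m (m r)) u" "bit_size (m r) \<le> bit_size h" by (auto intro: bit_size_mono)
  then show "rep m h (expr_val m (Mem (reg r))) u \<and> expr_cost m (Mem (reg r)) \<le> 20 + vsize u + 3 * bit_size h"
    using rep_bit_size[OF *(1)] bit_size_reg[OF assms(1)] by simp
qed

lemma denotes_Right:
  assumes "r \<in> regs" "rg r = Node u v"
  shows "denotes M rg h (cdr r) v (20 + vsize v + 4 * bit_size h)"
  unfolding denotes_def
proof (intro allI impI)
  fix m assume "state M rg h m"
  then have rep: "rep m h (m r) (Node u v)" using assms by (auto simp: state_def)
  then have *: "rep m h (m (m r - 1)) v" "bit_size (m r) \<le> bit_size h" "bit_size (m r - 1) \<le> bit_size h"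
    by (auto intro: bit_size_mono)
  then show "rep m h (expr_val m (cdr r)) v \<and> expr_cost m (cdr r) \<le> 20 + vsize v + 4 * bit_size h"
    using rep_bit_size[OF *(1)] bit_size_reg[OF assms(1)] by simp
qed

lemma denotes_Input:
  assumes "r \<in> regs" "rg r = Atom x" "0 \<le> x"
  shows "denotes M rg h (Mem (reg r)) (Atom (M x)) (10 + 2 * bit_size x + bit_size (M x))"
  unfolding denotes_def
proof (intro allI impI)
  fix m assume st: "state M rg h m"
  then have rep: "rep m h (m r) (Atom x)" using assms by (metis state_def)
  have "m x = M x" using st assms(3) by (simp add: state_def)
  then show "rep m h (expr_val m (Mem (reg r))) (Atom (M x)) \<and>
      expr_cost m (Mem (reg r)) \<le> 10 + 2 * bit_size x + bit_size (M x)"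
    using rep bit_size_reg[OF assms(1)] by simp
qed

lemma denotes_Prim:
  assumes "rg (-6) = Atom x" "rg (-7) = Atom y"
  shows "denotes M rg h (Bin f (reg (-6)) (reg (-7))) (Atom (op_val f x y)) (20 + bit_size x + bit_size y + op_cost f x y)"
  unfolding denotes_def
proof (intro allI impI)
  fix m assume st: "state M rg h m"
  have "m (-6) = x" "m (-7) = y"
    using st assms by (auto simp: state_def regs_def)
  then show "rep m h (expr_val m (Bin f (reg (-6)) (reg (-7)))) (Atom (op_val f x y)) \<and>
      expr_cost m (Bin f (reg (-6)) (reg (-7))) \<le> 20 + bit_size x + bit_size y + op_cost f x y"
    using bit_size_reg[of "-6"] bit_size_reg[of "-7"] by (simp add: regs_def)
qed

lemma runs_pop:
  assumes "rg (-2) = Node u v" "x \<in> regs - {-2}"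
  shows "runs M rg h (pop x) (60 + 2 * vsize u + 2 * vsize v + 9 * bit_size h) (rg(x := u, -2 := v)) h"
proof -
  have 1: "denotes M rg h (Mem (reg (-2))) u (20 + vsize u + 3 * bit_size h)"
    by (rule denotes_Left[of _ _ _ v]) (use assms in \<open>auto simp: regs_def\<close>)
  have 2: "denotes M (rg(x := u)) h (cdr (-2)) v (20 + vsize v + 4 * bit_size h)"
    by (rule denotes_Right[of _ _ u]) (use assms in \<open>auto simp: regs_def\<close>)
  show ?thesis
    unfolding pop_def
    by (rule runs_weaken[OF runs_Seq[OF runs_mov[OF 1] runs_mov[OF 2]]]) (use assms in \<open>auto simp: regs_def\<close>)
qed


lemma task_code_nth:
  assumes "t \<in> set ts"
  obtains i where "i < length ts" "ts ! i = t" "task_code ts t = int i"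
proof -
  obtain j where "j < length ts \<and> ts ! j = t"
    using assms by (auto simp: in_set_conv_nth)
  then have "(LEAST i. i < length ts \<and> ts ! i = t) < length ts \<and> ts ! (LEAST i. i < length ts \<and> ts ! i = t) = t"
    by (rule LeastI)
  then show ?thesis using that[of "LEAST i. i < length ts \<and> ts ! i = t"] by (simp add: task_code_def)
qed

lemma runs_push_task:
  assumes "t \<in> set ts" "vsize (rg (-1)) = 1" "h' = h - 2"
  shows "runs M rg h (push_task ts t) (160 + 2 * length ts + 15 * bit_size h')
           (rg(-1 := Node (Atom (task_code ts t)) (rg (-1)))) h'"
proof -
  obtain i where "i < length ts" "task_code ts t = int i"
    using assms(1) by (rule task_code_nth)
  then have "bit_size (task_code ts t) \<le> length ts"
    using bit_size_of_nat[of i] by simp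
  then show ?thesis
    unfolding push_task_def
    using assms by (intro runs_weaken[OF runs_push[OF denotes_Num]]) auto
qed

section \<open>Dispatch and the main loop\<close>

lemma exec_switch:
  assumes "k < length bs" "m (-5) = int (i + k)" "exec (bs ! k) m T m'"
  shows "\<exists>T'. T' \<le> T + length bs * (40 + 6 * (i + length bs)) \<and> exec (switch i bs) m T' m'"
  using assms
proof (induction bs arbitrary: i k)
  case (Cons b bs)
  let ?e = "Bin Sub (reg (-5)) (Num (int i))"
  have sz: "bit_size (int (i + k)) \<le> i + length (b # bs)" "bit_size (int i) \<le> i + 1" "bit_size (int k) \<le> length (b # bs)"
    using bit_size_of_nat[of "i + k"] bit_size_of_nat[of i] bit_size_of_nat[of k] Cons.prems(1) by simp_all
  have val: "expr_val m ?e = int k" using Cons.prems(2) by simp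
  have cost: "expr_cost m ?e + bit_size (expr_val m ?e) \<le> 40 + 6 * (i + length (b # bs))"
    unfolding val using sz Cons.prems(2) bit_size_consts by simp
  show ?case
  proof (cases k)
    case 0
    then have "exec (switch i (b # bs)) m (expr_cost m ?e + bit_size (expr_val m ?e) + T) m'"
      unfolding switch.simps by (intro exec_Cond_false) (use Cons.prems val in auto)
    then show ?thesis using cost by (intro exI[of _ "expr_cost m ?e + bit_size (expr_val m ?e) + T"]) auto
  next
    case (Suc l)
    then obtain T' where T': "T' \<le> T + length bs * (40 + 6 * (Suc i + length bs))" "exec (switch (Suc i) bs) m T' m'"
      using Cons.IH[of l "Suc i"] Cons.prems by auto
    have "exec (switch i (b # bs)) m (expr_cost m ?e + bit_size (expr_val m ?e) + T') m'"
      unfolding switch.simps by (intro exec_Cond_true) (use T' val Suc in auto)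
    then show ?thesis
      using cost T'(1) by (intro exI[of _ "expr_cost m ?e + bit_size (expr_val m ?e) + T'"]) (auto simp: algebra_simps)
  qed
qed simp

text \<open>\<open>exec\<close> relates a loop only to its final state. Partial runs, which can be
  composed, are therefore described separately; the failing last test is added in
  \<open>iterates_Loop\<close>.\<close>

inductive iterates :: "task list => memory => nat => memory => bool" for ts where
  iterates_refl: "iterates ts m 0 m"
| iterates_step: "m (-1) \<noteq> 0 ==> exec (machine_body ts) m T m1 ==> iterates ts m1 U m2 ==>
    iterates ts m (expr_cost m (reg (-1)) + bit_size (m (-1)) + T + U) m2"

lemma iterates_trans: "iterates ts m T m1 ==> iterates ts m1 U m2 ==> iterates ts m (T + U) m2"
proof (induction rule: iterates.induct)
  case (iterates_step m T m1 V m')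
  show ?case
    using iterates.iterates_step[OF iterates_step.hyps(1,2) iterates_step.IH[OF iterates_step.prems]]
    by (simp add: algebra_simps)
qed simp

lemma iterates_Loop:
  "iterates ts m T m' ==> m' (-1) = 0 ==>
    (\<exists>U. U \<le> T + 20 \<and> exec (Loop (reg (-1)) (machine_body ts)) m U m')"
proof (induction rule: iterates.induct)
  case (iterates_refl m)
  have "exec (Loop (reg (-1)) (machine_body ts)) m (expr_cost m (reg (-1)) + bit_size (expr_val m (reg (-1)))) m"
    by (rule exec_Loop_false) (use iterates_refl in simp)
  then show ?case using iterates_refl by (intro exI conjI) auto
next
  case (iterates_step m T m1 U m2)
  then obtain V where V: "V \<le> U + 20" "exec (Loop (reg (-1)) (machine_body ts)) m1 V m2"
    by blast
  have "exec (Loop (reg (-1)) (machine_body ts)) m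
    (expr_cost m (reg (-1)) + bit_size (expr_val m (reg (-1))) + T + V) m2"
    by (rule exec_Loop_true[OF _ iterates_step.hyps(2) V(2)]) (use iterates_step in simp)
  then show ?case using V(1) by (intro exI conjI) auto
qed

definition steps_to :: "task list => memory => (int => val) => int => nat => (int => val) => int => bool" where
  "steps_to ts M rg h B rg' h' \<longleftrightarrow>
    (\<forall>m. state M rg h m \<longrightarrow> (\<exists>T m'. T \<le> B \<and> iterates ts m T m' \<and> state M rg' h' m'))"

lemma steps_to_weaken: "steps_to ts M rg h B rg' h' ==> B \<le> B' ==> steps_to ts M rg h B' rg' h'"
  unfolding steps_to_def by (meson le_trans)

lemma steps_to_trans:
  assumes "steps_to ts M rg h A rg1 h1" "steps_to ts M rg1 h1 B rg2 h2"
  shows "steps_to ts M rg h (A + B) rg2 h2"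
  using assms unfolding steps_to_def by (meson iterates_trans add_mono)

text \<open>A constant of the program: the quadratic term pays for the switch, the rest for fetching
  the task and for one block.\<close>

definition overhead :: "task list => nat" where
  "overhead ts = 4000 + 30 * length ts + length ts * (40 + 6 * length ts)"

text \<open>One turn of the loop. Fetching, dispatch and block are merged into a single product, so
  that the costs of consecutive tasks add up in the number \<open>nd\<close> of charged
  units.\<close>

lemma steps_to_block:
  assumes t: "t \<in> set ts" and C: "rg (-1) = Node (Atom (task_code ts t)) C" "vsize C = 1"
    and h: "h \<le> -10" "h' \<le> h" and nd: "1 \<le> nd"
    and block: "runs M (rg(-1 := C)) h (block ts t) B rg' h'"
    and B: "B \<le> 1000 * nd + 1000 * bit_size h' + 20 * length ts"
  shows "steps_to ts M rg h (overhead ts * nd * bit_size h') rg' h'"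
  unfolding steps_to_def
proof (intro allI impI)
  fix m assume st: "state M rg h m"
  obtain i where i: "i < length ts" "ts ! i = t" "task_code ts t = int i"
    using t by (rule task_code_nth)
  let ?p = "m (-1)"
  have rp: "rep m h ?p (Node (Atom (int i)) C)" and h4: "m (-4) = h"
    using st C i unfolding state_def regs_def by force+
  then have p: "m ?p = int i" "?p \<noteq> 0" "bit_size ?p \<le> bit_size h" "bit_size (?p - 1) \<le> bit_size h"
    "rep m h (m (?p - 1)) C" "?p \<le> -10"
    by (auto intro: bit_size_mono)
  define m1 where "m1 = m(-5 := int i)"
  define m2 where "m2 = m1(-1 := m (?p - 1))"
  have bi: "bit_size (int i) \<le> length ts"
    using bit_size_of_nat[of i] i(1) by simp
  have bc: "bit_size (m (?p - 1)) \<le> 1 + bit_size h"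
    using rep_bit_size[OF p(5)] C(2) by simp
  define T1 where "T1 = bit_size (-5) + expr_cost m (Mem (reg (-1))) + bit_size (-5) + bit_size (int i)"
  define T2 where "T2 = bit_size (-1) + expr_cost m1 (cdr (-1)) + bit_size (-1) + bit_size (m (?p - 1))"
  have e1: "exec (mov (-5) (Mem (reg (-1)))) m T1 m1"
    using exec_Assign[of "Num (-5)" "Mem (reg (-1))" m] p by (simp add: mov_def T1_def m1_def)
  have e2: "exec (mov (-1) (cdr (-1))) m1 T2 m2"
    using exec_Assign[of "Num (-1)" "cdr (-1)" m1] p by (simp add: mov_def T2_def m2_def m1_def)
  have old: "rep m2 h x u" if "rep m h x u" for x u
    using that by (rule rep_mono) (auto simp: m1_def m2_def)
  have "state M (rg(-1 := C)) h m2"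
    unfolding state_def
  proof (intro conjI ballI allI impI)
    fix q assume q: "q \<in> regs"
    show "rep m2 h (m2 q) ((rg(-1 := C)) q)"
    proof (cases "q = -1")
      case True
      then show ?thesis using old[OF p(5)] by (simp add: m2_def)
    next
      case False
      then have "m2 q = m q" using q by (auto simp: m1_def m2_def regs_def)
      then show ?thesis using False old st q by (simp add: state_def)
    qed
  qed (use st in \<open>auto simp: state_def m1_def m2_def\<close>)
  then obtain T3 m3 where T3: "T3 \<le> B" "exec (block ts t) m2 T3 m3" "state M rg' h' m3"
    using block unfolding runs_def by blast
  have "m2 (-5) = int (0 + i)" by (simp add: m1_def m2_def)
  then obtain T4 where T4: "T4 \<le> T3 + length ts * (40 + 6 * length ts)" "exec (switch 0 (map (block ts) ts)) m2 T4 m3"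
    using exec_switch[of i "map (block ts) ts" m2 0 T3 m3] i T3 by auto
  have ex: "exec (machine_body ts) m (T1 + (T2 + T4)) m3"
    unfolding machine_body_def by (rule exec_Seq[OF e1 exec_Seq[OF e2 T4(2)]])
  define T where "T = expr_cost m (reg (-1)) + bit_size (m (-1)) + (T1 + (T2 + T4)) + 0"
  have it: "iterates ts m T m3"
    unfolding T_def by (rule iterates_step[OF _ ex iterates_refl]) (use p in simp)
  define L where "L = bit_size h'"
  have L: "bit_size h \<le> L" "1 \<le> L"
    using h by (auto simp: L_def intro: bit_size_mono)
  have "T1 + T2 + expr_cost m (reg (-1)) + bit_size (m (-1)) \<le> 100 + 3 * length ts + 20 * L"
    using L p bi bc bit_size_consts unfolding T1_def T2_def by (simp add: m1_def)
  then have "T \<le> 1000 * nd + 1020 * L + 100 + 23 * length ts + length ts * (40 + 6 * length ts)"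
    using T4(1) T3(1) B unfolding T_def L_def by simp
  also have "\<dots> \<le> overhead ts * nd * L"
  proof -
    have "1 \<le> nd * L" "nd \<le> nd * L" "L \<le> nd * L" using nd L by simp_all
    then have "length ts \<le> length ts * (nd * L)"
      "length ts * (40 + 6 * length ts) \<le> length ts * (40 + 6 * length ts) * (nd * L)"
      by simp_all
    moreover have "length ts \<le> length ts * (40 + 6 * length ts)" by simp
    ultimately show ?thesis
      using \<open>1 \<le> nd * L\<close> \<open>nd \<le> nd * L\<close> \<open>L \<le> nd * L\<close>
      unfolding overhead_def add_mult_distrib mult.assoc by linarith
  qed
  finally show "\<exists>T m'. T \<le> overhead ts * nd * bit_size h' \<and> iterates ts m T m' \<and> state M rg' h' m'"
    using it T3(3) unfolding L_def by blast
qed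

lemma runs_push_task2:
  assumes "t1 \<in> set ts" "t2 \<in> set ts" "vsize C = 1" "h' = h - 4" "h \<le> -10"
  shows "runs M (rg(-1 := C)) h (Seq (push_task ts t1) (push_task ts t2)) (320 + 4 * length ts + 30 * bit_size h')
     (rg(-1 := Node (Atom (task_code ts t2)) (Node (Atom (task_code ts t1)) C))) h'"
proof -
  have 1: "runs M (rg(-1 := C)) h (push_task ts t1) (160 + 2 * length ts + 15 * bit_size (h - 2))
     (rg(-1 := Node (Atom (task_code ts t1)) C)) (h - 2)"
    using runs_push_task[OF assms(1), of "rg(-1 := C)" "h - 2" h M] assms(3) by simp
  have 2: "runs M (rg(-1 := Node (Atom (task_code ts t1)) C)) (h - 2) (push_task ts t2)
     (160 + 2 * length ts + 15 * bit_size h') (rg(-1 := Node (Atom (task_code ts t2)) (Node (Atom (task_code ts t1)) C))) h'"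
    using runs_push_task[OF assms(2), of "rg(-1 := Node (Atom (task_code ts t1)) C)" h' "h - 2" M] assms(4) by simp
  have "bit_size (h - 2) \<le> bit_size h'"
    using assms by (intro bit_size_mono) simp
  then show ?thesis
    by (intro runs_weaken[OF runs_Seq[OF 1 2]]) linarith
qed

lemma runs_push_task3:
  assumes "t1 \<in> set ts" "t2 \<in> set ts" "t3 \<in> set ts" "vsize C = 1" "h' = h - 6" "h \<le> -10"
  shows "runs M (rg(-1 := C)) h (Seq (push_task ts t1) (Seq (push_task ts t2) (push_task ts t3)))
     (480 + 6 * length ts + 45 * bit_size h')
     (rg(-1 := Node (Atom (task_code ts t3)) (Node (Atom (task_code ts t2)) (Node (Atom (task_code ts t1)) C)))) h'"
proof -
  have 1: "runs M (rg(-1 := C)) h (push_task ts t1) (160 + 2 * length ts + 15 * bit_size (h - 2))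
     (rg(-1 := Node (Atom (task_code ts t1)) C)) (h - 2)"
    using runs_push_task[OF assms(1), of "rg(-1 := C)" "h - 2" h M] assms(4) by simp
  have 2: "runs M (rg(-1 := Node (Atom (task_code ts t1)) C)) (h - 2) (Seq (push_task ts t2) (push_task ts t3))
     (320 + 4 * length ts + 30 * bit_size h')
     (rg(-1 := Node (Atom (task_code ts t3)) (Node (Atom (task_code ts t2)) (Node (Atom (task_code ts t1)) C)))) h'"
    using assms by (intro runs_push_task2) auto
  have "bit_size (h - 2) \<le> bit_size h'"
    using assms by (intro bit_size_mono) simp
  then show ?thesis
    by (intro runs_weaken[OF runs_Seq[OF 1 2]]) linarith
qed

lemma runs_pop_push:
  assumes "rg (-2) = Node u D" "vsize D = 1" "h' = h - 2" "h \<le> -10"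
    and e: "denotes M (rg(-6 := u, -2 := D)) h e v B"
  shows "runs M rg h (Seq (pop (-6)) (push (-2) e)) (300 + B + 2 * vsize u + vsize v + 30 * bit_size h')
    (rg(-6 := u, -2 := Node v D)) h'"
proof -
  have 1: "runs M rg h (pop (-6)) (60 + 2 * vsize u + 2 * vsize D + 9 * bit_size h) (rg(-6 := u, -2 := D)) h"
    using assms(1) by (intro runs_pop) (auto simp: regs_def)
  have 2: "runs M (rg(-6 := u, -2 := D)) h (push (-2) e) (B + 150 + vsize v + 2 * vsize D + 15 * bit_size h')
     (rg(-6 := u, -2 := Node v D)) h'"
    using runs_push[OF e, of "-2" h'] assms by simp
  have "bit_size h \<le> bit_size h'" using assms by (intro bit_size_mono) simp
  then show ?thesis
    by (intro runs_weaken[OF runs_Seq[OF 1 2]]) (use assms(2) in simp)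
qed

text \<open>Each charged unit uses at most 20 heap cells. Hence addresses are linear in the cost and
  have logarithmic length, which is why compilation loses only a logarithmic factor.\<close>

definition simulates :: "task list => memory => (int => val) => int => nat => (int => val) => int => bool" where
  "simulates ts M rg h n rg' h' \<longleftrightarrow> h \<le> -10 \<and> h' \<le> h \<and> h - 20 * int n \<le> h' \<and>
     steps_to ts M rg h (overhead ts * n * bit_size h') rg' h'"

lemma simulates_trans:
  assumes "simulates ts M rg h m rg1 h1" "simulates ts M rg1 h1 n rg2 h2"
  shows "simulates ts M rg h (m + n) rg2 h2"
proof -
  have "steps_to ts M rg h (overhead ts * m * bit_size h1 + overhead ts * n * bit_size h2) rg2 h2"
    using assms unfolding simulates_def by (intro steps_to_trans) auto
  moreover have "bit_size h1 \<le> bit_size h2"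
    using assms unfolding simulates_def by (intro bit_size_mono) auto
  then have "overhead ts * m * bit_size h1 \<le> overhead ts * m * bit_size h2"
    by simp
  ultimately have "steps_to ts M rg h (overhead ts * (m + n) * bit_size h2) rg2 h2"
    by (elim steps_to_weaken) (simp add: algebra_simps)
  then show ?thesis
    using assms unfolding simulates_def by auto
qed

lemma simulates_mono:
  assumes "simulates ts M rg h m rg1 h1" "m \<le> n"
  shows "simulates ts M rg h n rg1 h1"
  using assms unfolding simulates_def by (auto elim!: steps_to_weaken)

lemma simulates_block:
  assumes "runs M (rg(-1 := C)) h c B rg1 h'" "block ts t = c" "rg1 = rg'"
    and "t \<in> set ts" "rg (-1) = Node (Atom (task_code ts t)) C" "vsize C = 1"
    and "h \<le> -10" "h' \<le> h" "h - 20 \<le> h'" "1 \<le> nd"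
    and "B \<le> 1000 * nd + 1000 * bit_size h' + 20 * length ts"
  shows "simulates ts M rg h nd rg' h'"
  using assms steps_to_block[OF assms(4-8,10) assms(1)[folded assms(2), unfolded assms(3)] assms(11)]
  unfolding simulates_def by auto

lemma TEval_in_tasks: "TEval s e \<in> set (tasks s e)"
  by (cases e) auto

lemma simulates_eval2:
  assumes ts: "TEval s e \<in> set ts" "t1 \<in> set ts" "t2 \<in> set ts"
    and b: "block ts (TEval s e) = Seq (push_task ts t1) (push_task ts t2)"
    and r: "rg (-1) = Node (Atom (task_code ts (TEval s e))) C" "vsize C = 1" and h: "h \<le> -10"
  shows "simulates ts M rg h 1 (rg(-1 := Node (Atom (task_code ts t2)) (Node (Atom (task_code ts t1)) C))) (h - 4)"
  by (rule simulates_block[OF runs_push_task2 b]) (use assms in auto)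

lemma simulates_eval3:
  assumes ts: "TEval s e \<in> set ts" "t1 \<in> set ts" "t2 \<in> set ts" "t3 \<in> set ts"
    and b: "block ts (TEval s e) = Seq (push_task ts t1) (Seq (push_task ts t2) (push_task ts t3))"
    and r: "rg (-1) = Node (Atom (task_code ts (TEval s e))) C" "vsize C = 1" and h: "h \<le> -10"
  shows "simulates ts M rg h 1
    (rg(-1 := Node (Atom (task_code ts t3)) (Node (Atom (task_code ts t2)) (Node (Atom (task_code ts t1)) C)))) (h - 6)"
  by (rule simulates_block[OF runs_push_task3 b]) (use assms in auto)

lemma simulates_pop_push:
  assumes b: "block ts t = Seq (pop (-6)) (push (-2) e)"
    and r: "rg (-2) = Node u D" "vsize D = 1" "rg (-1) = Node (Atom (task_code ts t)) C" "vsize C = 1"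
    and h: "h \<le> -10" and t: "t \<in> set ts"
    and e: "denotes M (rg(-1 := C, -6 := u, -2 := D)) h e v B"
    and nd: "B + 2 * vsize u + vsize v \<le> 500 * nd + 500 * bit_size h" "1 \<le> nd"
  shows "simulates ts M rg h nd (rg(-1 := C, -6 := u, -2 := Node v D)) (h - 2)"
proof (rule simulates_block[OF runs_pop_push[OF _ r(2) refl h e] b])
  have "bit_size h \<le> bit_size (h - 2)" using h by (intro bit_size_mono) simp
  then show "300 + B + 2 * vsize u + vsize v + 30 * bit_size (h - 2) \<le> 1000 * nd + 1000 * bit_size (h - 2) + 20 * length ts"
    using nd by simp
qed (use assms in auto)

lemma bit_size_le_op_cost: "bit_size x \<le> op_cost f x y" "bit_size y \<le> op_cost f x y"
  by (cases f; simp add: Suc_leI)+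

lemma simulates_prim:
  assumes r: "rg (-2) = Node (Atom y) (Node (Atom x) D)" "vsize D = 1" "rg (-1) = Node (Atom (task_code ts (TPrim f))) C" "vsize C = 1"
    and h: "h \<le> -10" and t: "TPrim f \<in> set ts"
  shows "simulates ts M rg h (op_cost f x y + bit_size (op_val f x y))
    (rg(-1 := C, -7 := Atom y, -6 := Atom x, -2 := Node (Atom (op_val f x y)) D)) (h - 2)"
proof -
  let ?r = "rg(-1 := C)" and ?e = "Bin f (reg (-6)) (reg (-7))"
  have 1: "runs M ?r h (pop (-7)) (60 + 2 * vsize (Atom y) + 2 * vsize (Node (Atom x) D) + 9 * bit_size h)
     (?r(-7 := Atom y, -2 := Node (Atom x) D)) h"
    using r by (intro runs_pop) (auto simp: regs_def)
  have 2: "runs M (?r(-7 := Atom y, -2 := Node (Atom x) D)) h (Seq (pop (-6)) (push (-2) ?e))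
     (300 + (20 + bit_size x + bit_size y + op_cost f x y) + 2 * vsize (Atom x) + vsize (Atom (op_val f x y)) + 30 * bit_size (h - 2))
     (?r(-7 := Atom y, -2 := Node (Atom x) D, -6 := Atom x, -2 := Node (Atom (op_val f x y)) D)) (h - 2)"
    by (rule runs_pop_push) (use r h in \<open>auto intro!: denotes_Prim\<close>)
  have eq: "?r(-7 := Atom y, -2 := Node (Atom x) D, -6 := Atom x, -2 := Node (Atom (op_val f x y)) D)
     = rg(-1 := C, -7 := Atom y, -6 := Atom x, -2 := Node (Atom (op_val f x y)) D)"
    by (simp add: fun_upd_twist)
  have "bit_size h \<le> bit_size (h - 2)" using h by (intro bit_size_mono) simp
  then show ?thesis
    using bit_size_le_op_cost(1)[of x f y] bit_size_le_op_cost(2)[of y f x] bit_size_pos(3)[of x] bit_size_pos(3)[of "h - 2"]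
    by (intro simulates_block[OF runs_Seq[OF 1 2] block.simps(3) eq]) (use assms in \<open>auto simp del: bit_size_pos vsize_pos\<close>)
qed

lemma simulates_join:
  assumes r: "rg (-2) = Node v (Node u D)" "vsize D = 1" "rg (-1) = Node (Atom (task_code ts TJoin)) C" "vsize C = 1"
    and h: "h \<le> -10" and t: "TJoin \<in> set ts"
  shows "simulates ts M rg h (vsize u + vsize v)
    (rg(-1 := C, -7 := Node u v, -6 := u, -2 := Node (Node u v) D)) (h - 4)"
proof -
  let ?r = "rg(-1 := C)"
  let ?r1 = "?r(-7 := v, -2 := Node u D)"
  let ?r2 = "?r1(-6 := u, -2 := D)"
  let ?r3 = "?r2(-7 := Node u v)"
  let ?r4 = "?r3(-2 := Node (Node u v) D)"
  have 1: "runs M ?r h (pop (-7)) (60 + 2 * vsize v + 2 * vsize (Node u D) + 9 * bit_size h) ?r1 h"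
    using r by (intro runs_pop) (auto simp: regs_def)
  have 2: "runs M ?r1 h (pop (-6)) (60 + 2 * vsize u + 2 * vsize D + 9 * bit_size h) ?r2 h"
    by (intro runs_pop) (auto simp: regs_def)
  have d3: "denotes M ?r2 h (reg (-6)) u (10 + vsize u + bit_size h)"
    using denotes_reg[of "-6" M ?r2 h] by (simp add: regs_def)
  have 3: "runs M ?r2 h (push (-7) (reg (-6))) (10 + vsize u + bit_size h + 150 + vsize u + 2 * vsize v + 15 * bit_size (h - 2)) ?r3 (h - 2)"
    using runs_push[OF d3, of "-7" "h - 2"] by simp
  have d4: "denotes M ?r3 (h - 2) (reg (-7)) (Node u v) (10 + 1 + bit_size (h - 2))"
    using denotes_reg[of "-7" M ?r3 "h - 2"] by (simp add: regs_def)
  have 4: "runs M ?r3 (h - 2) (push (-2) (reg (-7))) (10 + 1 + bit_size (h - 2) + 150 + 1 + 2 * vsize D + 15 * bit_size (h - 4)) ?r4 (h - 4)"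
    using runs_push[OF d4, of "-2" "h - 4"] by simp
  have eq: "?r4 = rg(-1 := C, -7 := Node u v, -6 := u, -2 := Node (Node u v) D)"
    by (simp add: fun_upd_twist)
  have "bit_size h \<le> bit_size (h - 4)" "bit_size (h - 2) \<le> bit_size (h - 4)"
    using h by (auto intro: bit_size_mono)
  then show ?thesis
    using vsize_pos(2)[of u] vsize_pos(2)[of v] bit_size_pos(3)[of "h - 4"]
    by (intro simulates_block[OF runs_Seq[OF 1 runs_Seq[OF 2 runs_Seq[OF 3 4]]] block.simps(4) eq])
      (use assms in \<open>auto simp del: bit_size_pos vsize_pos\<close>)
qed

lemma simulates_test:
  assumes r: "rg (-2) = Node (Atom x) D" "vsize D = 1" "rg (-1) = Node (Atom (task_code ts (TTest s a b))) C" "vsize C = 1"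
    and h: "h \<le> -10" and t: "TTest s a b \<in> set ts" "TEval s a \<in> set ts" "TEval s b \<in> set ts"
  shows "simulates ts M rg h (bit_size x)
    (rg(-1 := Node (Atom (task_code ts (TEval s (if x \<noteq> 0 then a else b)))) C, -6 := Atom x, -2 := D)) (h - 2)"
proof -
  let ?r = "rg(-1 := C)"
  let ?r1 = "?r(-6 := Atom x, -2 := D)"
  let ?t = "TEval s (if x \<noteq> 0 then a else b)"
  let ?r2 = "?r1(-1 := Node (Atom (task_code ts ?t)) C)"
  have 1: "runs M ?r h (pop (-6)) (60 + 2 * vsize (Atom x) + 2 * vsize D + 9 * bit_size h) ?r1 h"
    using r by (intro runs_pop) (auto simp: regs_def)
  have p: "runs M ?r1 h (push_task ts ?t) (160 + 2 * length ts + 15 * bit_size (h - 2)) ?r2 (h - 2)"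
    using runs_push_task[of ?t ts ?r1 "h - 2" h M] assms by auto
  have 2: "runs M ?r1 h (Cond (reg (-6)) (push_task ts (TEval s a)) (push_task ts (TEval s b)))
     (10 + 2 * bit_size x + (160 + 2 * length ts + 15 * bit_size (h - 2))) ?r2 (h - 2)"
    unfolding runs_def
  proof (intro allI impI)
    fix m assume st: "state M ?r1 h m"
    have m6: "m (-6) = x" using st by (auto simp: state_def regs_def)
    obtain T m' where T: "T \<le> 160 + 2 * length ts + 15 * bit_size (h - 2)" "exec (push_task ts ?t) m T m'"
      "state M ?r2 (h - 2) m'"
      using p st unfolding runs_def by blast
    let ?T = "expr_cost m (reg (-6)) + bit_size (expr_val m (reg (-6))) + T"
    have "exec (Cond (reg (-6)) (push_task ts (TEval s a)) (push_task ts (TEval s b))) m ?T m'"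
    proof (cases "x = 0")
      case True
      show ?thesis by (rule exec_Cond_false) (use True T(2) m6 in auto)
    next
      case False
      show ?thesis by (rule exec_Cond_true) (use False T(2) m6 in auto)
    qed
    moreover have "?T \<le> 10 + 2 * bit_size x + (160 + 2 * length ts + 15 * bit_size (h - 2))"
      using T(1) m6 bit_size_reg[of "-6"] by (simp add: regs_def)
    ultimately show "\<exists>T m'. T \<le> 10 + 2 * bit_size x + (160 + 2 * length ts + 15 * bit_size (h - 2)) \<and>
       exec (Cond (reg (-6)) (push_task ts (TEval s a)) (push_task ts (TEval s b))) m T m' \<and> state M ?r2 (h - 2) m'"
      using T(3) by blast
  qed
  have eq: "?r2 = rg(-1 := Node (Atom (task_code ts ?t)) C, -6 := Atom x, -2 := D)"
    by (simp add: fun_upd_twist)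
  have "bit_size h \<le> bit_size (h - 2)" using h by (intro bit_size_mono) simp
  then show ?thesis
    using bit_size_pos(3)[of x] bit_size_pos(3)[of "h - 2"]
    by (intro simulates_block[OF runs_Seq[OF 1 2] block.simps(7) eq]) (use assms in \<open>auto simp del: bit_size_pos vsize_pos\<close>)
qed

lemma simulates_enter:
  assumes r: "rg (-2) = Node u D" "vsize D = 1" "rg (-1) = Node (Atom (task_code ts (TEnter s b))) C" "vsize C = 1"
    and E: "rg (-3) = E"
    and h: "h \<le> -10" and t: "TEnter s b \<in> set ts" "TRestore \<in> set ts" "TEval s b \<in> set ts"
  shows "simulates ts M rg h (vsize u + vsize E)
    (rg(-1 := Node (Atom (task_code ts (TEval s b))) (Node (Atom (task_code ts TRestore)) C),
       -6 := u, -3 := u, -2 := Node E D)) (h - 6)"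
proof -
  let ?r = "rg(-1 := C)"
  let ?r1 = "?r(-6 := u, -2 := D)"
  let ?r2 = "?r1(-2 := Node E D)"
  let ?r3 = "?r2(-3 := u)"
  let ?r4 = "?r3(-1 := Node (Atom (task_code ts (TEval s b))) (Node (Atom (task_code ts TRestore)) C))"
  have 1: "runs M ?r h (pop (-6)) (60 + 2 * vsize u + 2 * vsize D + 9 * bit_size h) ?r1 h"
    using r by (intro runs_pop) (auto simp: regs_def)
  have d2: "denotes M ?r1 h (reg (-3)) E (10 + vsize E + bit_size h)"
    using denotes_reg[of "-3" M ?r1 h] E by (simp add: regs_def)
  have 2: "runs M ?r1 h (push (-2) (reg (-3))) (10 + vsize E + bit_size h + 150 + vsize E + 2 * vsize D + 15 * bit_size (h - 2)) ?r2 (h - 2)"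
    using runs_push[OF d2, of "-2" "h - 2"] by simp
  have d3: "denotes M ?r2 (h - 2) (reg (-6)) u (10 + vsize u + bit_size (h - 2))"
    using denotes_reg[of "-6" M ?r2 "h - 2"] by (simp add: regs_def)
  have 3: "runs M ?r2 (h - 2) (mov (-3) (reg (-6))) (10 + vsize u + bit_size (h - 2) + 10 + vsize u + bit_size (h - 2)) ?r3 (h - 2)"
    by (rule runs_mov[OF d3]) (simp add: regs_def)
  have "runs M (?r3(-1 := C)) (h - 2) (Seq (push_task ts TRestore) (push_task ts (TEval s b)))
     (320 + 4 * length ts + 30 * bit_size (h - 6)) ?r4 (h - 6)"
    by (rule runs_push_task2) (use assms in auto)
  moreover have "?r3(-1 := C) = ?r3" by (rule ext) auto
  ultimately have 4: "runs M ?r3 (h - 2) (Seq (push_task ts TRestore) (push_task ts (TEval s b)))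
     (320 + 4 * length ts + 30 * bit_size (h - 6)) ?r4 (h - 6)"
    by simp
  have eq: "?r4 = rg(-1 := Node (Atom (task_code ts (TEval s b))) (Node (Atom (task_code ts TRestore)) C),
       -6 := u, -3 := u, -2 := Node E D)"
    by (rule ext) auto
  have "bit_size h \<le> bit_size (h - 6)" "bit_size (h - 2) \<le> bit_size (h - 6)"
    using h by (auto intro: bit_size_mono)
  then show ?thesis
    using vsize_pos(2)[of u] vsize_pos(2)[of E] bit_size_pos(3)[of "h - 6"]
    by (intro simulates_block[OF runs_Seq[OF 1 runs_Seq[OF 2 runs_Seq[OF 3 4]]] block.simps(8) eq])
      (use assms in \<open>auto simp del: bit_size_pos vsize_pos\<close>)
qed

lemma simulates_restore:
  assumes r: "rg (-2) = Node v (Node E D)" "vsize D = 1" "rg (-1) = Node (Atom (task_code ts TRestore)) C" "vsize C = 1"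
    and h: "h \<le> -10" and t: "TRestore \<in> set ts"
  shows "simulates ts M rg h (vsize v + vsize E) (rg(-1 := C, -6 := v, -3 := E, -2 := Node v D)) (h - 2)"
proof -
  let ?r = "rg(-1 := C)"
  let ?r1 = "?r(-6 := v, -2 := Node E D)"
  let ?r2 = "?r1(-3 := E, -2 := D)"
  let ?r3 = "?r2(-2 := Node v D)"
  have 1: "runs M ?r h (pop (-6)) (60 + 2 * vsize v + 2 * vsize (Node E D) + 9 * bit_size h) ?r1 h"
    using r by (intro runs_pop) (auto simp: regs_def)
  have 2: "runs M ?r1 h (pop (-3)) (60 + 2 * vsize E + 2 * vsize D + 9 * bit_size h) ?r2 h"
    by (intro runs_pop) (auto simp: regs_def)
  have d3: "denotes M ?r2 h (reg (-6)) v (10 + vsize v + bit_size h)"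
    using denotes_reg[of "-6" M ?r2 h] by (simp add: regs_def)
  have 3: "runs M ?r2 h (push (-2) (reg (-6))) (10 + vsize v + bit_size h + 150 + vsize v + 2 * vsize D + 15 * bit_size (h - 2)) ?r3 (h - 2)"
    using runs_push[OF d3, of "-2" "h - 2"] by simp
  have eq: "?r3 = rg(-1 := C, -6 := v, -3 := E, -2 := Node v D)"
    by (rule ext) auto
  have "bit_size h \<le> bit_size (h - 2)" using h by (intro bit_size_mono) simp
  then show ?thesis
    using vsize_pos(2)[of v] vsize_pos(2)[of E] bit_size_pos(3)[of "h - 2"]
    by (intro simulates_block[OF runs_Seq[OF 1 runs_Seq[OF 2 3]] block.simps(9) eq]) (use assms in \<open>auto simp del: bit_size_pos vsize_pos\<close>)
qed

text \<open>Common to the three calling constructs, which differ only in the body \<open>b\<close>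
  that runs and in the body \<open>s'\<close> that \<open>Self\<close> means inside it. The caller's
  environment waits on the result stack, below whatever the body leaves there.\<close>

lemma simulates_call:
  assumes a: "\<And>rg h. h \<le> -10 ==> rg (-1) = Node (Atom (task_code ts (TEval s a))) (Node (Atom (task_code ts (TEnter s' b))) C) ==>
      rg (-2) = D ==> rg (-3) = E ==> \<exists>rg' h'. simulates ts M rg h (10 * c) rg' h' \<and>
        rg' (-1) = Node (Atom (task_code ts (TEnter s' b))) C \<and> rg' (-2) = Node u D \<and> rg' (-3) = E"
    and b: "\<And>rg h. h \<le> -10 ==> rg (-1) = Node (Atom (task_code ts (TEval s' b))) (Node (Atom (task_code ts TRestore)) C) ==>
      rg (-2) = Node E D ==> rg (-3) = u ==> \<exists>rg' h'. simulates ts M rg h (10 * d) rg' h' \<and>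
        rg' (-1) = Node (Atom (task_code ts TRestore)) C \<and> rg' (-2) = Node v (Node E D) \<and> rg' (-3) = u"
    and ts: "TEval s e \<in> set ts" "TEval s a \<in> set ts" "TEnter s' b \<in> set ts" "TEval s' b \<in> set ts" "TRestore \<in> set ts"
    and blk: "block ts (TEval s e) = Seq (push_task ts (TEnter s' b)) (push_task ts (TEval s a))"
    and r: "rg (-1) = Node (Atom (task_code ts (TEval s e))) C" "vsize C = 1" "rg (-2) = D" "vsize D = 1" "rg (-3) = E"
    and h: "h \<le> -10"
  shows "\<exists>rg' h'. simulates ts M rg h (10 * (c + d + 1 + vsize u + vsize E + vsize v)) rg' h' \<and>
        rg' (-1) = C \<and> rg' (-2) = Node v D \<and> rg' (-3) = E"
proof -
  note 1 = simulates_eval2[where rg = rg and C = C, OF ts(1,3,2) blk r(1,2) h, where M = M]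
  obtain rg2 h2 where 2: "simulates ts M (rg(-1 := Node (Atom (task_code ts (TEval s a))) (Node (Atom (task_code ts (TEnter s' b))) C)))
      (h - 4) (10 * c) rg2 h2" "rg2 (-1) = Node (Atom (task_code ts (TEnter s' b))) C" "rg2 (-2) = Node u D" "rg2 (-3) = E"
    using a[where h = "h - 4" and rg = "rg(-1 := Node (Atom (task_code ts (TEval s a))) (Node (Atom (task_code ts (TEnter s' b))) C))"]
      r h by auto
  have h2: "h2 \<le> -10" using 2(1) by (simp add: simulates_def)
  note 3 = simulates_enter[OF 2(3) r(4) 2(2) r(2) 2(4) h2 ts(3,5,4), where M = M]
  obtain rg4 h4 where 4: "simulates ts M (rg2(- 1 := Node (Atom (task_code ts (TEval s' b))) (Node (Atom (task_code ts TRestore)) C),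
       -6 := u, -3 := u, -2 := Node E D)) (h2 - 6) (10 * d) rg4 h4"
     "rg4 (-1) = Node (Atom (task_code ts TRestore)) C" "rg4 (-2) = Node v (Node E D)"
    using b[where h = "h2 - 6" and rg = "rg2(- 1 := Node (Atom (task_code ts (TEval s' b))) (Node (Atom (task_code ts TRestore)) C),
       -6 := u, -3 := u, -2 := Node E D)"] h2 by auto
  have h4: "h4 \<le> -10" using 4(1) by (simp add: simulates_def)
  note 5 = simulates_restore[OF 4(3) r(4) 4(2) r(2) h4 ts(5), where M = M]
  note 6 = simulates_trans[OF 1 simulates_trans[OF 2(1) simulates_trans[OF 3 simulates_trans[OF 4(1) 5]]]]
  show ?thesis
    by (intro exI conjI, rule simulates_mono[OF 6]) (use r in auto)
qed

lemma simulates_unary: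
  assumes a: "\<And>rg h. h \<le> -10 ==> rg (-1) = Node (Atom (task_code ts (TEval s a))) (Node (Atom (task_code ts t)) C) ==>
      rg (-2) = D ==> rg (-3) = E ==> \<exists>rg' h'. simulates ts M rg h (10 * c) rg' h' \<and>
        rg' (-1) = Node (Atom (task_code ts t)) C \<and> rg' (-2) = Node u D \<and> rg' (-3) = E"
    and ts: "TEval s e \<in> set ts" "TEval s a \<in> set ts" "t \<in> set ts"
    and blk: "block ts (TEval s e) = Seq (push_task ts t) (push_task ts (TEval s a))"
    and blk2: "block ts t = Seq (pop (-6)) (push (-2) x)"
    and den: "\<And>rg h. rg (-6) = u ==> denotes M rg h x v (B + 20 * bit_size h)"
    and B: "B + 2 * vsize u + vsize v \<le> 480 * nd" "1 \<le> nd" "nd \<le> 9 * n"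
    and r: "rg (-1) = Node (Atom (task_code ts (TEval s e))) C" "vsize C = 1" "rg (-2) = D" "vsize D = 1" "rg (-3) = E"
    and h: "h \<le> -10"
  shows "\<exists>rg' h'. simulates ts M rg h (10 * (c + n)) rg' h' \<and> rg' (-1) = C \<and> rg' (-2) = Node v D \<and> rg' (-3) = E"
proof -
  note 1 = simulates_eval2[where rg = rg and C = C, OF ts(1,3,2) blk r(1,2) h, where M = M]
  obtain rg2 h2 where 2: "simulates ts M (rg(-1 := Node (Atom (task_code ts (TEval s a))) (Node (Atom (task_code ts t)) C)))
      (h - 4) (10 * c) rg2 h2" "rg2 (-1) = Node (Atom (task_code ts t)) C" "rg2 (-2) = Node u D" "rg2 (-3) = E"
    using a[where h = "h - 4" and rg = "rg(-1 := Node (Atom (task_code ts (TEval s a))) (Node (Atom (task_code ts t)) C))"]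
      r h by auto
  have h2: "h2 \<le> -10" using 2(1) by (simp add: simulates_def)
  have 3: "simulates ts M rg2 h2 nd (rg2(-1 := C, -6 := u, -2 := Node v D)) (h2 - 2)"
    by (rule simulates_pop_push[OF blk2 2(3) r(4) 2(2) r(2) h2 ts(3) den]) (use B in auto)
  note 4 = simulates_trans[OF 1 simulates_trans[OF 2(1) 3]]
  have le: "1 + (10 * c + nd) \<le> 10 * (c + n)" using B(2,3) by (cases n) auto
  show ?thesis
    by (intro exI conjI, rule simulates_mono[OF 4 le]) (use 2 in auto)
qed

text \<open>The factor 10 pays for the bookkeeping tasks that accompany each evaluation rule. The
  rest \<open>C\<close> of the agenda and the rest \<open>D\<close> of the stack are arbitrary, as
  subexpressions are evaluated on top of pending work.\<close>

lemma simulation: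
  assumes "eval M s E e v c" "set (tasks s e) \<subseteq> set ts" "set (tasks s s) \<subseteq> set ts"
    and "rg (-1) = Node (Atom (task_code ts (TEval s e))) C" "rg (-2) = D" "rg (-3) = E"
    and "vsize C = 1" "vsize D = 1" "h \<le> -10"
  shows "\<exists>rg' h'. simulates ts M rg h (10 * c) rg' h' \<and> rg' (-1) = C \<and> rg' (-2) = Node v D \<and> rg' (-3) = E"
  using assms
proof (induction arbitrary: rg C D h rule: eval.induct)
  case (eval_Env s E)
  have d: "denotes M (rg(-1 := C)) h (reg (-3)) E (10 + vsize E + bit_size h)"
    using denotes_reg[of "-3" M "rg(-1 := C)" h] eval_Env by (simp add: regs_def)
  have p: "runs M (rg(-1 := C)) h (push (-2) (reg (-3))) (10 + vsize E + bit_size h + 150 + vsize E + 2 * vsize D + 15 * bit_size (h - 2))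
    (rg(-1 := C, -2 := Node E D)) (h - 2)"
    using runs_push[OF d, of "-2" "h - 2"] eval_Env by simp
  have "bit_size h \<le> bit_size (h - 2)" using eval_Env by (intro bit_size_mono) simp
  then have sim: "simulates ts M rg h (10 * (1 + vsize E)) (rg(-1 := C, -2 := Node E D)) (h - 2)"
    by (intro simulates_block[OF p _ refl, of ts "TEval s Env"]) (use eval_Env in auto)
  show ?case by (intro exI conjI, rule sim) (use eval_Env in auto)
next
  case (eval_Const s E k)
  have p: "runs M (rg(-1 := C)) h (push (-2) (Num k)) (bit_size k + 150 + vsize (Atom k) + 2 * vsize D + 15 * bit_size (h - 2))
    (rg(-1 := C, -2 := Node (Atom k) D)) (h - 2)"
    using runs_push[OF denotes_Num[of M "rg(-1 := C)" h k], of "-2" "h - 2"] eval_Const by simp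
  have sim: "simulates ts M rg h (10 * (1 + bit_size k)) (rg(-1 := C, -2 := Node (Atom k) D)) (h - 2)"
    by (intro simulates_block[OF p _ refl, of ts "TEval s (Const k)"]) (use eval_Const in auto)
  show ?case by (intro exI conjI, rule sim) (use eval_Const in auto)
next
  case (eval_Input s E a x c)
  have "\<exists>rg' h'. simulates ts M rg h (10 * (c + (1 + bit_size x + bit_size (M x)))) rg' h' \<and>
      rg' (-1) = C \<and> rg' (-2) = Node (Atom (M x)) D \<and> rg' (-3) = E"
  proof (rule simulates_unary[where t = TInput and s = s and e = "Input a" and a = a and u = "Atom x" and x = "Mem (reg (-6))"
        and nd = "9 * (1 + bit_size x + bit_size (M x))" and B = "10 + 2 * bit_size x + bit_size (M x)"])
    fix rg' :: "int => val" and h' :: int assume "rg' (-6) = Atom x"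
    from denotes_Input[where rg = rg' and r = "-6" and M = M and h = h', OF _ this] eval_Input(2)
    show "denotes M rg' h' (Mem (reg (-6))) (Atom (M x)) (10 + 2 * bit_size x + bit_size (M x) + 20 * bit_size h')"
      by (auto simp: denotes_def regs_def intro: trans_le_add1)
  qed (use eval_Input TEval_in_tasks[of s a] in auto)
  then show ?case by (simp only: add.assoc)
next
  case (eval_Left s E a u v c)
  have "\<exists>rg' h'. simulates ts M rg h (10 * (c + (1 + vsize u))) rg' h' \<and>
      rg' (-1) = C \<and> rg' (-2) = Node u D \<and> rg' (-3) = E"
  proof (rule simulates_unary[where t = TLeft and s = s and e = "Left a" and a = a and u = "Node u v" and x = "Mem (reg (-6))"
        and nd = "9 * (1 + vsize u)" and B = "20 + vsize u"])
    fix rg' :: "int => val" and h' :: int assume "rg' (-6) = Node u v"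
    from denotes_Left[where rg = rg' and r = "-6" and M = M and h = h', OF _ this]
    show "denotes M rg' h' (Mem (reg (-6))) u (20 + vsize u + 20 * bit_size h')"
      by (fastforce simp: denotes_def regs_def)
  qed (use eval_Left TEval_in_tasks[of s a] in auto)
  then show ?case by (simp only: add.assoc)
next
  case (eval_Right s E a u v c)
  have "\<exists>rg' h'. simulates ts M rg h (10 * (c + (1 + vsize v))) rg' h' \<and>
      rg' (-1) = C \<and> rg' (-2) = Node v D \<and> rg' (-3) = E"
  proof (rule simulates_unary[where t = TRight and s = s and e = "Right a" and a = a and u = "Node u v" and x = "cdr (-6)"
        and nd = "9 * (1 + vsize v)" and B = "20 + vsize v"])
    fix rg' :: "int => val" and h' :: int assume "rg' (-6) = Node u v"
    from denotes_Right[where rg = rg' and r = "-6" and M = M and h = h', OF _ this]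
    show "denotes M rg' h' (cdr (-6)) v (20 + vsize v + 20 * bit_size h')"
      by (fastforce simp: denotes_def regs_def)
  qed (use eval_Right TEval_in_tasks[of s a] in auto)
  then show ?case by (simp only: add.assoc)
next
  case (eval_Prim s E a x c b y d f)
  let ?C = "Node (Atom (task_code ts (TPrim f))) C"
  have ts: "TEval s (Prim f a b) \<in> set ts" "TPrim f \<in> set ts" "TEval s b \<in> set ts" "TEval s a \<in> set ts"
    using eval_Prim.prems TEval_in_tasks[of s a] TEval_in_tasks[of s b] by auto
  define rg1 where "rg1 = rg(-1 := Node (Atom (task_code ts (TEval s a))) (Node (Atom (task_code ts (TEval s b))) ?C))"
  have p1: "rg1 (-1) = Node (Atom (task_code ts (TEval s a))) (Node (Atom (task_code ts (TEval s b))) ?C)" "rg1 (-2) = D" "rg1 (-3) = E"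
    using eval_Prim.prems by (auto simp: rg1_def)
  note 1 = simulates_eval3[where rg = rg and C = C and s = s and e = "Prim f a b", OF ts _ eval_Prim.prems(3,6,8), where M = M, simplified, folded rg1_def]
  obtain rg2 h2 where 2: "simulates ts M rg1 (h - 6) (10 * c) rg2 h2" "rg2 (-1) = Node (Atom (task_code ts (TEval s b))) ?C" "rg2 (-2) = Node (Atom x) D" "rg2 (-3) = E"
    using eval_Prim.IH(1)[OF _ eval_Prim.prems(2) p1, of "h - 6"] eval_Prim.prems by auto
  have h2: "h2 \<le> -10" using 2(1) by (simp add: simulates_def)
  obtain rg3 h3 where 3: "simulates ts M rg2 h2 (10 * d) rg3 h3" "rg3 (-1) = ?C" "rg3 (-2) = Node (Atom y) (Node (Atom x) D)" "rg3 (-3) = E"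
    using eval_Prim.IH(2)[of rg2 ?C "Node (Atom x) D" h2] eval_Prim.prems 2 h2 by auto
  have h3: "h3 \<le> -10" using 3(1) by (simp add: simulates_def)
  note 4 = simulates_prim[OF 3(3) eval_Prim.prems(7) 3(2) eval_Prim.prems(6) h3 ts(2), where M = M]
  note 5 = simulates_trans[OF 1 simulates_trans[OF 2(1) simulates_trans[OF 3(1) 4]]]
  show ?case
    by (intro exI conjI, rule simulates_mono[OF 5]) (use 3 in auto)
next
  case (eval_Join s E a u c b v d)
  let ?C = "Node (Atom (task_code ts TJoin)) C"
  have ts: "TEval s (Join a b) \<in> set ts" "TJoin \<in> set ts" "TEval s b \<in> set ts" "TEval s a \<in> set ts"
    using eval_Join.prems TEval_in_tasks[of s a] TEval_in_tasks[of s b] by auto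
  define rg1 where "rg1 = rg(-1 := Node (Atom (task_code ts (TEval s a))) (Node (Atom (task_code ts (TEval s b))) ?C))"
  have p1: "rg1 (-1) = Node (Atom (task_code ts (TEval s a))) (Node (Atom (task_code ts (TEval s b))) ?C)" "rg1 (-2) = D" "rg1 (-3) = E"
    using eval_Join.prems by (auto simp: rg1_def)
  note 1 = simulates_eval3[where rg = rg and C = C and s = s and e = "Join a b", OF ts _ eval_Join.prems(3,6,8), where M = M, simplified, folded rg1_def]
  obtain rg2 h2 where 2: "simulates ts M rg1 (h - 6) (10 * c) rg2 h2" "rg2 (-1) = Node (Atom (task_code ts (TEval s b))) ?C" "rg2 (-2) = Node u D" "rg2 (-3) = E"
    using eval_Join.IH(1)[OF _ eval_Join.prems(2) p1, of "h - 6"] eval_Join.prems by auto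
  have h2: "h2 \<le> -10" using 2(1) by (simp add: simulates_def)
  obtain rg3 h3 where 3: "simulates ts M rg2 h2 (10 * d) rg3 h3" "rg3 (-1) = ?C" "rg3 (-2) = Node v (Node u D)" "rg3 (-3) = E"
    using eval_Join.IH(2)[of rg2 ?C "Node u D" h2] eval_Join.prems 2 h2 by auto
  have h3: "h3 \<le> -10" using 3(1) by (simp add: simulates_def)
  note 4 = simulates_join[OF 3(3) eval_Join.prems(7) 3(2) eval_Join.prems(6) h3 ts(2), where M = M]
  note 5 = simulates_trans[OF 1 simulates_trans[OF 2(1) simulates_trans[OF 3(1) 4]]]
  show ?case
    by (intro exI conjI, rule simulates_mono[OF 5]) (use 3 in auto)
next
  case (eval_Test s E e x c a b v d)
  let ?C = "Node (Atom (task_code ts (TTest s a b))) C"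
  let ?e = "if x \<noteq> 0 then a else b"
  have ts: "TEval s (Test e a b) \<in> set ts" "TTest s a b \<in> set ts" "TEval s e \<in> set ts" "TEval s a \<in> set ts" "TEval s b \<in> set ts"
    using eval_Test.prems TEval_in_tasks[of s a] TEval_in_tasks[of s b] TEval_in_tasks[of s e] by auto
  define rg1 where "rg1 = rg(-1 := Node (Atom (task_code ts (TEval s e))) ?C)"
  have p1: "rg1 (-1) = Node (Atom (task_code ts (TEval s e))) ?C" "rg1 (-2) = D" "rg1 (-3) = E"
    using eval_Test.prems by (auto simp: rg1_def)
  note 1 = simulates_eval2[where rg = rg and C = C and s = s and e = "Test e a b", OF ts(1-3) _ eval_Test.prems(3,6,8), where M = M, simplified, folded rg1_def]
  obtain rg2 h2 where 2: "simulates ts M rg1 (h - 4) (10 * c) rg2 h2" "rg2 (-1) = ?C" "rg2 (-2) = Node (Atom x) D" "rg2 (-3) = E"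
    using eval_Test.IH(1)[OF _ eval_Test.prems(2) p1, of "h - 4"] eval_Test.prems by auto
  have h2: "h2 \<le> -10" using 2(1) by (simp add: simulates_def)
  define rg3 where "rg3 = rg2(-1 := Node (Atom (task_code ts (TEval s ?e))) C, -6 := Atom x, -2 := D)"
  have p3: "rg3 (-1) = Node (Atom (task_code ts (TEval s ?e))) C" "rg3 (-2) = D" "rg3 (-3) = E"
    using 2 by (auto simp: rg3_def)
  note 3 = simulates_test[OF 2(3) eval_Test.prems(7) 2(2) eval_Test.prems(6) h2 ts(2,4,5), where M = M, folded rg3_def]
  have sub: "set (tasks s ?e) \<subseteq> set ts" using eval_Test.prems(1) by auto
  obtain rg4 h4 where 4: "simulates ts M rg3 (h2 - 2) (10 * d) rg4 h4"
    "rg4 (-1) = C" "rg4 (-2) = Node v D" "rg4 (-3) = E"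
    using eval_Test.IH(2)[OF sub eval_Test.prems(2) p3, of "h2 - 2"] eval_Test.prems h2 by auto
  note 5 = simulates_trans[OF 1 simulates_trans[OF 2(1) simulates_trans[OF 3 4(1)]]]
  show ?case
    by (intro exI conjI, rule simulates_mono[OF 5]) (use 4 in auto)
next
  case (eval_Bind s E a u c b v d)
  show ?case
    by (rule simulates_call[where a = a and b = b and s' = s and s = s and e = "Bind a b"])
      (use eval_Bind TEval_in_tasks[of s a] TEval_in_tasks[of s b] in auto)
next
  case (eval_Self s E a u c v d)
  show ?case
    by (rule simulates_call[where a = a and b = s and s' = s and s = s and e = "Self a"])
      (use eval_Self TEval_in_tasks[of s a] TEval_in_tasks[of s s] in auto)
next
  case (eval_Rec s E a u c b v d)
  show ?case
    by (rule simulates_call[where a = a and b = b and s' = b and s = s and e = "Rec b a"])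
      (use eval_Rec TEval_in_tasks[of s a] TEval_in_tasks[of b b] in auto)
qed

lemma eval_vsize: "eval M s E e v c ==> vsize v \<le> c"
  by (induction rule: eval.induct) auto

theorem compile_correct:
  "\<exists>K. \<forall>M r c. eval M e (Atom 0) e (Atom r) c \<longrightarrow> (\<forall>a<0. M a = 0) \<longrightarrow>
     (\<exists>T m. exec (compile e) M T m \<and> m 0 = r \<and> T \<le> K * c * bit_size (300 * int c))"
proof -
  define ts where "ts = tasks e e"
  define K where "K = 10 * overhead ts + 1000 + 10 * length ts"
  have "\<exists>T m. exec (compile e) M T m \<and> m 0 = r \<and> T \<le> K * c * bit_size (300 * int c)"
    if ev: "eval M e (Atom 0) e (Atom r) c" and M: "\<forall>a<0. M a = 0" for M r c
  proof -
    have c: "1 \<le> c" using ev by (cases) auto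
    define r0 where "r0 = (\<lambda>_::int. Atom 0)"
    define m0 where "m0 = M(-4 := -10)"
    have e0: "exec (mov (-4) (Num (-10))) M (bit_size (-4) + bit_size (-10) + bit_size (-4) + bit_size (-10)) m0"
      using exec_Assign[of "Num (-4)" "Num (-10)" M] by (simp add: mov_def m0_def)
    have s0: "state M r0 (-10) m0"
      using M by (auto simp: state_def m0_def r0_def regs_def)
    have ts: "TEval e e \<in> set ts" using TEval_in_tasks by (simp add: ts_def)
    let ?r1 = "r0(-1 := Node (Atom (task_code ts (TEval e e))) (Atom 0))"
    have "runs M r0 (-10) (push_task ts (TEval e e)) (160 + 2 * length ts + 15 * bit_size (-12)) ?r1 (-12)"
      using runs_push_task[OF ts, of r0 "-12" "-10" M] by (simp add: r0_def)
    then obtain T1 m1 where 1: "T1 \<le> 160 + 2 * length ts + 15 * bit_size (-12)" "exec (push_task ts (TEval e e)) m0 T1 m1"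
      "state M ?r1 (-12) m1"
      using s0 unfolding runs_def by blast
    obtain rg h where sim: "simulates ts M ?r1 (-12) (10 * c) rg h" "rg (-1) = Atom 0" "rg (-2) = Node (Atom r) (Atom 0)"
      using simulation[OF ev, of ts ?r1 "Atom 0" "Atom 0" "-12"] by (auto simp: ts_def r0_def)
    then obtain T2 m2 where 2: "T2 \<le> overhead ts * (10 * c) * bit_size h" "iterates ts m1 T2 m2" "state M rg h m2"
      using 1(3) unfolding simulates_def steps_to_def by blast
    have "rep m2 h (m2 (-1)) (rg (-1))" "rep m2 h (m2 (-2)) (rg (-2))"
      using 2(3) by (auto simp: state_def regs_def)
    then have m2: "m2 (-1) = 0" "m2 (m2 (-2)) = r"
      using sim by auto
    obtain T3 where 3: "T3 \<le> T2 + 20" "exec (Loop (reg (-1)) (machine_body ts)) m1 T3 m2"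
      using iterates_Loop[OF 2(2) m2(1)] by blast
    define T4 where "T4 = bit_size 0 + expr_cost m2 (Mem (reg (-2))) + bit_size 0 + bit_size r"
    have 4: "exec (mov 0 (Mem (reg (-2)))) m2 T4 (m2(0 := r))"
      using exec_Assign[of "Num 0" "Mem (reg (-2))" m2] m2 by (simp add: mov_def T4_def)
    have "denotes M rg h (Mem (reg (-2))) (Atom r) (20 + vsize (Atom r) + 3 * bit_size h)"
      by (rule denotes_Left) (use sim in \<open>auto simp: regs_def\<close>)
    then have d4: "expr_cost m2 (Mem (reg (-2))) \<le> 20 + bit_size r + 3 * bit_size h"
      using 2(3) unfolding denotes_def by auto
    \<comment> \<open>The heap pointer starts at -12 and drops by at most
      \<open>20 * (10 * c)\<close>, so it is not below \<open>- 300 * c\<close>.\<close>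
    define L where "L = bit_size (300 * int c)"
    have L: "bit_size h \<le> L" "bit_size (-12) \<le> L"
      using sim(1) c unfolding L_def simulates_def by (auto intro!: bit_size_mono)
    have rc: "bit_size r \<le> c"
      using eval_vsize[OF ev] by simp
    let ?T = "bit_size (-4) + bit_size (-10) + bit_size (-4) + bit_size (-10) + (T1 + (T3 + T4))"
    have "exec (compile e) M ?T (m2(0 := r))"
      unfolding compile_def Let_def ts_def[symmetric]
      by (rule exec_Seq[OF e0 exec_Seq[OF 1(2) exec_Seq[OF 3(2) 4]]])
    moreover have b1: "?T \<le> 240 + 2 * length ts + 18 * L + 2 * c + overhead ts * (10 * c) * L"
    proof -
      have "overhead ts * (10 * c) * bit_size h \<le> overhead ts * (10 * c) * L" using L by simp
      with 2(1) have "T2 \<le> overhead ts * (10 * c) * L" by (rule le_trans)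
      then show ?thesis
        using 1(1) 3(1) d4 L rc bit_size_consts unfolding T4_def by simp
    qed
    moreover have b2: "240 + 2 * length ts + 18 * L + 2 * c + overhead ts * (10 * c) * L \<le> K * c * L"
    proof -
      have "1 \<le> L" by (simp add: L_def)
      then have "1 \<le> c * L" "c \<le> c * L" "L \<le> c * L" using c by simp_all
      moreover from this have "length ts \<le> length ts * (c * L)" by simp
      ultimately show ?thesis
        unfolding K_def add_mult_distrib mult.assoc by linarith
    qed
    ultimately have "exec (compile e) M ?T (m2(0 := r)) \<and> (m2(0 := r)) 0 = r \<and> ?T \<le> K * c * bit_size (300 * int c)"
      using le_trans[OF b1 b2] unfolding L_def by (simp only: fun_upd_same simp_thms)
    then show ?thesis by blast
  qed
  then show ?thesis by blast
qed

section \<open>Cost bounds for programs of the language\<close>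

fun env :: "val list => val" where
  "env [] = Atom 0"
| "env (v # vs) = Node v (env vs)"

fun tuple :: "fexp list => fexp" where
  "tuple [] = Const 0"
| "tuple (e # es) = Join e (tuple es)"

text \<open>De Bruijn indices: an environment is a list, and \<open>Let_in\<close> extends it at the
  front.\<close>

definition Var :: "nat => fexp" where "Var i = Left ((Right ^^ i) Env)"
definition Let_in :: "fexp => fexp => fexp" where "Let_in a b = Bind (Join a Env) b"
definition Call :: "fexp => fexp list => fexp" where "Call f es = Rec f (tuple es)"
definition Recur :: "fexp list => fexp" where "Recur es = Self (tuple es)"

text \<open>
  \<open>bounded M s ws e v w c\<close>: if every value in the environment \<open>ws\<close> has the size listed with it, then
  \<open>e\<close> has the value \<open>v\<close> of size at most \<open>w\<close>, computed at cost at most \<open>c\<close>.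
\<close>

definition valid :: "(val \<times> nat) list => bool" where
  "valid ws \<longleftrightarrow> (\<forall>(v, w) \<in> set ws. vsize v \<le> w)"

definition bounded :: "memory => fexp => (val \<times> nat) list => fexp => val => nat => nat => bool" where
  "bounded M s ws e v w c \<longleftrightarrow> (valid ws \<longrightarrow> vsize v \<le> w \<and> (\<exists>c'\<le>c. eval M s (env (map fst ws)) e v c'))"

definition bounded_args :: "memory => fexp => (val \<times> nat) list => fexp list => (val \<times> nat) list => nat => bool" where
  "bounded_args M s ws es \<Delta> c \<longleftrightarrow>
     (valid ws \<longrightarrow> valid \<Delta> \<and> (\<exists>c'\<le>c. eval M s (env (map fst ws)) (tuple es) (env (map fst \<Delta>)) c'))"

text \<open>The body is evaluated with itself as the function in progress, so \<open>Recur\<close>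
  inside \<open>f\<close> calls \<open>f\<close>.\<close>

definition computes :: "memory => fexp => val list => val => nat => bool" where
  "computes M f vs v c \<longleftrightarrow> (\<exists>c'\<le>c. eval M f (env vs) f v c')"

lemma valid_simps [simp]: "valid []" "valid ((v, w) # ws) \<longleftrightarrow> vsize v \<le> w \<and> valid ws"
  by (auto simp: valid_def)

lemma vsize_env [simp]: "vsize (env vs) = 1"
  by (cases vs) auto

lemma computes_mono: "computes M f vs v c ==> c \<le> d ==> computes M f vs v d"
  unfolding computes_def by (meson le_trans)

text \<open>The premise \<open>f = e\<close> unfolds the code where it is evaluated but leaves it
  folded where it is the meaning of \<open>Self\<close>, so that induction hypotheses about
  \<open>f\<close> apply.\<close>

lemma computesI:
  assumes "f = e" "bounded M f ws e v' w c" "v' = v" "map fst ws = vs" "valid ws" "c \<le> d"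
  shows "computes M f vs v d"
  using assms unfolding computes_def bounded_def by (metis le_trans)

lemma boundedI:
  assumes "valid ws ==> eval M s (env (map fst ws)) e v c'" "c' \<le> c" "valid ws ==> vsize v \<le> w"
  shows "bounded M s ws e v w c"
  using assms unfolding bounded_def by blast

lemma boundedE:
  assumes "bounded M s ws e v w c" "valid ws"
  obtains c' where "c' \<le> c" "eval M s (env (map fst ws)) e v c'" "vsize v \<le> w"
  using assms unfolding bounded_def by blast

lemma eval_le: "eval M s E e v c' ==> c' \<le> c ==> \<exists>c'\<le>c. eval M s E e v c'"
  by blast

lemma eval_Var:
  assumes "i < length ws"
  shows "eval M s (env (map fst ws)) (Var i) (fst (ws ! i)) (vsize (fst (ws ! i)) + 2 * i + 3)"
proof -
  have "eval M s (env (map fst ws)) ((Right ^^ i) Env) (env (map fst (drop i ws))) (2 * i + 2)"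
    using assms
  proof (induction i)
    case 0
    show ?case using eval_Env[of M s "env (map fst ws)"] by simp
  next
    case (Suc i)
    then have "eval M s (env (map fst ws)) ((Right ^^ i) Env)
       (Node (fst (ws ! i)) (env (map fst (drop (Suc i) ws)))) (2 * i + 2)"
      by (simp add: Cons_nth_drop_Suc[symmetric])
    from eval_Right[OF this] show ?case by simp
  qed
  then have "eval M s (env (map fst ws)) ((Right ^^ i) Env)
       (Node (fst (ws ! i)) (env (map fst (drop (Suc i) ws)))) (2 * i + 2)"
    using assms by (simp add: Cons_nth_drop_Suc[symmetric])
  from eval_Left[OF this] show ?thesis
    by (simp add: Var_def numeral_3_eq_3 algebra_simps)
qed

lemma bounded_Var:
  assumes "i < length ws"
  shows "bounded M s ws (Var i) (fst (ws ! i)) (snd (ws ! i)) (snd (ws ! i) + 2 * i + 3)"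
proof -
  have "vsize (fst (ws ! i)) \<le> snd (ws ! i)" if "valid ws"
    using that assms nth_mem[OF assms] unfolding valid_def by (auto simp: split_beta)
  then show ?thesis
    unfolding bounded_def by (intro impI conjI eval_le[OF eval_Var[OF assms]]) auto
qed

lemma bounded_Var':
  "i < length ws ==> ws ! i = (v, w) ==> c = w + 2 * i + 3 ==> bounded M s ws (Var i) v w c"
  using bounded_Var[of i ws M s] by simp

text \<open>Spelled out for literal indices, so that resolution can match the numeral in the code
  against the shape of the environment.\<close>

lemma bounded_vars:
  "bounded M s ((v,w)#ws) (Var 0) v w (w + 3)"
  "bounded M s (g0#(v,w)#ws) (Var 1) v w (w + 5)"
  "bounded M s (g0#g1#(v,w)#ws) (Var 2) v w (w + 7)"
  "bounded M s (g0#g1#g2#(v,w)#ws) (Var 3) v w (w + 9)"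
  "bounded M s (g0#g1#g2#g3#(v,w)#ws) (Var 4) v w (w + 11)"
  "bounded M s (g0#g1#g2#g3#g4#(v,w)#ws) (Var 5) v w (w + 13)"
  "bounded M s (g0#g1#g2#g3#g4#g5#(v,w)#ws) (Var 6) v w (w + 15)"
  "bounded M s (g0#g1#g2#g3#g4#g5#g6#(v,w)#ws) (Var 7) v w (w + 17)"
  "bounded M s (g0#g1#g2#g3#g4#g5#g6#g7#(v,w)#ws) (Var 8) v w (w + 19)"
  "bounded M s (g0#g1#g2#g3#g4#g5#g6#g7#g8#(v,w)#ws) (Var 9) v w (w + 21)"
  "bounded M s (g0#g1#g2#g3#g4#g5#g6#g7#g8#g9#(v,w)#ws) (Var 10) v w (w + 23)"
  "bounded M s (g0#g1#g2#g3#g4#g5#g6#g7#g8#g9#g10#(v,w)#ws) (Var 11) v w (w + 25)"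
  by (rule bounded_Var'; simp)+

lemma bounded_Const: "\<bar>k\<bar> < 128 ==> bounded M s ws (Const k) (Atom k) 8 9"
  using bit_size_small[of k 7] by (intro boundedI[OF eval_Const]) auto

lemmas bounded_consts = bounded_Const[of 0, simplified] bounded_Const[of 1, simplified] bounded_Const[of 2, simplified]
  bounded_Const[of 3, simplified] bounded_Const[of 4, simplified] bounded_Const[of 64, simplified]

lemma bounded_Input:
  assumes "bounded M s ws a (Atom x) w c" "0 \<le> x" "bit_size (M x) \<le> W"
  shows "bounded M s ws (Input a) (Atom (M x)) W (c + 1 + w + W)"
  unfolding bounded_def
proof
  assume "valid ws"
  with assms(1) obtain c' where *: "c' \<le> c" "eval M s (env (map fst ws)) a (Atom x) c'" "vsize (Atom x) \<le> w"
    by (rule boundedE)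
  show "vsize (Atom (M x)) \<le> W \<and> (\<exists>c'\<le>c + 1 + w + W. eval M s (env (map fst ws)) (Input a) (Atom (M x)) c')"
    using *(1,3) assms(3) by (intro conjI eval_le[OF eval_Input[OF *(2) assms(2)]]) auto
qed

lemma bounded_Prim:
  assumes "bounded M s ws a (Atom x) w c" "bounded M s ws b (Atom y) u d"
    and "bit_size x \<le> w ==> bit_size y \<le> u ==> op_cost f x y \<le> k"
    and "bit_size x \<le> w ==> bit_size y \<le> u ==> bit_size (op_val f x y) \<le> l"
  shows "bounded M s ws (Prim f a b) (Atom (op_val f x y)) l (c + d + 1 + k + l)"
  unfolding bounded_def
proof
  assume val: "valid ws"
  with assms(1) obtain c' where c: "c' \<le> c" "eval M s (env (map fst ws)) a (Atom x) c'" "vsize (Atom x) \<le> w"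
    by (rule boundedE)
  from assms(2) val obtain d' where d: "d' \<le> d" "eval M s (env (map fst ws)) b (Atom y) d'" "vsize (Atom y) \<le> u"
    by (rule boundedE)
  have "op_cost f x y \<le> k" "bit_size (op_val f x y) \<le> l"
    using assms(3,4) c(3) d(3) by auto
  with eval_Prim[OF c(2) d(2), of f] c(1) d(1)
  show "vsize (Atom (op_val f x y)) \<le> l \<and> (\<exists>c'\<le>c + d + 1 + k + l. eval M s (env (map fst ws)) (Prim f a b) (Atom (op_val f x y)) c')"
    by (intro conjI exI[of _ "c' + d' + 1 + op_cost f x y + bit_size (op_val f x y)"]) auto
qed

lemma bounded_Add:
  assumes "bounded M s ws a (Atom x) w c" "bounded M s ws b (Atom y) u d"
  shows "bounded M s ws (Prim Add a b) (Atom (x + y)) (w + u) (c + d + 1 + (w + u) + (w + u))"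
  using bounded_Prim[OF assms, of Add "w + u" "w + u"] bit_size_add[of x y] by simp

lemma bounded_Sub:
  assumes "bounded M s ws a (Atom x) w c" "bounded M s ws b (Atom y) u d"
  shows "bounded M s ws (Prim Sub a b) (Atom (x - y)) (w + u) (c + d + 1 + (w + u) + (w + u))"
  using bounded_Prim[OF assms, of Sub "w + u" "w + u"] bit_size_diff[of x y] by simp

lemma bounded_Mul:
  assumes "bounded M s ws a (Atom x) w c" "bounded M s ws b (Atom y) u d"
  shows "bounded M s ws (Prim Mul a b) (Atom (x * y)) (w + u) (c + d + 1 + w * u + (w + u))"
  using bounded_Prim[OF assms, of Mul "w * u" "w + u"] bit_size_mult[of x y] mult_le_mono by simp

lemma bounded_Rem:
  assumes "bounded M s ws a (Atom x) w c" "bounded M s ws b (Atom y) u d" "0 < y"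
  shows "bounded M s ws (Prim Rem a b) (Atom (x mod y)) u (c + d + 1 + w * u + u)"
  using bounded_Prim[OF assms(1,2), of Rem "w * u" u] bit_size_mod[OF assms(3), of x] mult_le_mono by simp

lemma bounded_Quo:
  assumes "bounded M s ws a (Atom x) w c" "bounded M s ws b (Atom y) u d" "0 < y"
  shows "bounded M s ws (Prim Quo a b) (Atom (x div y)) w (c + d + 1 + w * u + w)"
proof -
  have "bit_size (x div y) \<le> bit_size x"
    using assms(3) by (intro bit_size_mono abs_div_le) simp
  then show ?thesis
    using bounded_Prim[OF assms(1,2), of Quo "w * u" w] mult_le_mono by simp
qed

lemma bounded_Shl:
  assumes "bounded M s ws a (Atom x) w c" "bounded M s ws b (Atom y) u d"
  shows "bounded M s ws (Prim Shl a b) (Atom (x * 2 ^ nat y)) (w + nat y) (c + d + 1 + (w + u + nat y) + (w + nat y))"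
  using bounded_Prim[OF assms, of Shl "w + u + nat y" "w + nat y"] bit_size_push_bit[of "nat y" x]
  by (simp add: push_bit_eq_mult)

lemma bounded_Shr:
  assumes "bounded M s ws a (Atom x) w c" "bounded M s ws b (Atom y) u d"
  shows "bounded M s ws (Prim Shr a b) (Atom (x div 2 ^ nat y)) w (c + d + 1 + (w + u) + w)"
  using bounded_Prim[OF assms, of Shr "w + u" w] bit_size_drop_bit[of "nat y" x]
  by (simp add: drop_bit_eq_div)

lemma bounded_Lt:
  assumes "bounded M s ws a (Atom x) w c" "bounded M s ws b (Atom y) u d"
  shows "bounded M s ws (Prim Lt a b) (Atom (if x < y then 1 else 0)) 2 (c + d + 1 + (w + u) + 2)"
  using bounded_Prim[OF assms, of Lt "w + u" 2] by simp

lemma bounded_Join: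
  assumes "bounded M s ws a u w c" "bounded M s ws b v k d"
  shows "bounded M s ws (Join a b) (Node u v) 1 (c + d + 1 + w + k)"
  unfolding bounded_def
proof
  assume val: "valid ws"
  with assms(1) obtain c' where c: "c' \<le> c" "eval M s (env (map fst ws)) a u c'" "vsize u \<le> w"
    by (rule boundedE)
  from assms(2) val obtain d' where d: "d' \<le> d" "eval M s (env (map fst ws)) b v d'" "vsize v \<le> k"
    by (rule boundedE)
  from eval_Join[OF c(2) d(2)] c d
  show "vsize (Node u v) \<le> 1 \<and> (\<exists>c'\<le>c + d + 1 + w + k. eval M s (env (map fst ws)) (Join a b) (Node u v) c')"
    by (intro conjI exI[of _ "c' + d' + 1 + vsize u + vsize v"]) auto
qed

lemma bounded_Left:
  assumes "bounded M s ws a (Node u v) w c" "vsize u \<le> k"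
  shows "bounded M s ws (Left a) u k (c + 1 + k)"
  unfolding bounded_def
proof
  assume "valid ws"
  with assms(1) obtain c' where c: "c' \<le> c" "eval M s (env (map fst ws)) a (Node u v) c'"
    by (rule boundedE)
  from eval_Left[OF c(2)] c(1) assms(2)
  show "vsize u \<le> k \<and> (\<exists>c'\<le>c + 1 + k. eval M s (env (map fst ws)) (Left a) u c')"
    by (intro conjI exI[of _ "c' + 1 + vsize u"]) auto
qed

lemma bounded_Right:
  assumes "bounded M s ws a (Node u v) w c" "vsize v \<le> k"
  shows "bounded M s ws (Right a) v k (c + 1 + k)"
  unfolding bounded_def
proof
  assume "valid ws"
  with assms(1) obtain c' where c: "c' \<le> c" "eval M s (env (map fst ws)) a (Node u v) c'"
    by (rule boundedE)
  from eval_Right[OF c(2)] c(1) assms(2)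
  show "vsize v \<le> k \<and> (\<exists>c'\<le>c + 1 + k. eval M s (env (map fst ws)) (Right a) v c')"
    by (intro conjI exI[of _ "c' + 1 + vsize v"]) auto
qed

lemma bounded_Test:
  assumes "bounded M s ws e (Atom x) w c" "bounded M s ws (if x \<noteq> 0 then a else b) v k d"
  shows "bounded M s ws (Test e a b) v k (c + d + 1 + w)"
  unfolding bounded_def
proof
  assume val: "valid ws"
  with assms(1) obtain c' where c: "c' \<le> c" "eval M s (env (map fst ws)) e (Atom x) c'" "vsize (Atom x) \<le> w"
    by (rule boundedE)
  from assms(2) val obtain d' where d: "d' \<le> d" "eval M s (env (map fst ws)) (if x \<noteq> 0 then a else b) v d'" "vsize v \<le> k"
    by (rule boundedE)
  from eval_Test[OF c(2) d(2)] c d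
  show "vsize v \<le> k \<and> (\<exists>c'\<le>c + d + 1 + w. eval M s (env (map fst ws)) (Test e a b) v c')"
    by (intro conjI exI[of _ "c' + d' + 1 + bit_size x"]) auto
qed

lemma bounded_Test_then:
  "bounded M s ws e (Atom x) w c ==> x \<noteq> 0 ==> bounded M s ws a v k d ==> bounded M s ws (Test e a b) v k (c + d + 1 + w)"
  by (rule bounded_Test) auto

lemma bounded_Test_else:
  "bounded M s ws e (Atom x) w c ==> x = 0 ==> bounded M s ws b v k d ==> bounded M s ws (Test e a b) v k (c + d + 1 + w)"
  by (rule bounded_Test) auto

lemma bounded_Let:
  assumes "bounded M s ws a u w c" "bounded M s ((u, w) # ws) b v k d"
  shows "bounded M s ws (Let_in a b) v k (c + d + w + k + 7)"
  unfolding bounded_def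
proof
  assume val: "valid ws"
  with assms(1) obtain c' where c: "c' \<le> c" "eval M s (env (map fst ws)) a u c'" "vsize u \<le> w"
    by (rule boundedE)
  have "valid ((u, w) # ws)" using val c(3) by simp
  with assms(2) obtain d' where d: "d' \<le> d" "eval M s (env (map fst ((u, w) # ws))) b v d'" "vsize v \<le> k"
    by (rule boundedE)
  have "eval M s (env (map fst ws)) (Join a Env) (env (map fst ((u, w) # ws))) (c' + 2 + 1 + vsize u + 1)"
    using eval_Join[OF c(2) eval_Env] by simp
  note e = eval_Bind[OF this d(2)]
  show "vsize v \<le> k \<and> (\<exists>c'\<le>c + d + w + k + 7. eval M s (env (map fst ws)) (Let_in a b) v c')"
    unfolding Let_in_def using c d by (intro conjI eval_le[OF e]) auto
qed

lemma bounded_args_Nil: "bounded_args M s ws [] [] 2"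
  unfolding bounded_args_def by (intro impI conjI eval_le) (auto intro: eval_Const)

lemma bounded_args_Cons:
  assumes "bounded M s ws e v w c" "bounded_args M s ws es \<Delta> d"
  shows "bounded_args M s ws (e # es) ((v, w) # \<Delta>) (c + d + w + 2)"
  unfolding bounded_args_def
proof
  assume val: "valid ws"
  with assms(1) obtain c' where c: "c' \<le> c" "eval M s (env (map fst ws)) e v c'" "vsize v \<le> w"
    by (rule boundedE)
  from assms(2) val obtain d' where d: "d' \<le> d" "eval M s (env (map fst ws)) (tuple es) (env (map fst \<Delta>)) d'" "valid \<Delta>"
    unfolding bounded_args_def by blast
  from eval_Join[OF c(2) d(2)] c d
  show "valid ((v, w) # \<Delta>) \<and> (\<exists>c'\<le>c + d + w + 2. eval M s (env (map fst ws)) (tuple (e # es)) (env (map fst ((v, w) # \<Delta>))) c')"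
    by (intro conjI exI[of _ "c' + d' + 1 + vsize v + vsize (env (map fst \<Delta>))"]) auto
qed

lemma bounded_Call:
  assumes "computes M f vs v d" "vsize v \<le> k" "bounded_args M s ws es \<Delta> c" "map fst \<Delta> = vs"
  shows "bounded M s ws (Call f es) v k (c + d + k + 3)"
  unfolding bounded_def
proof
  assume val: "valid ws"
  with assms(3) obtain c' where c: "c' \<le> c" "eval M s (env (map fst ws)) (tuple es) (env vs) c'"
    unfolding bounded_args_def assms(4)[symmetric] by blast
  from assms(1) obtain d' where d: "d' \<le> d" "eval M f (env vs) f v d'"
    unfolding computes_def by blast
  show "vsize v \<le> k \<and> (\<exists>c'\<le>c + d + k + 3. eval M s (env (map fst ws)) (Call f es) v c')"
    unfolding Call_def using c d assms(2) by (intro conjI eval_le[OF eval_Rec[OF c(2) d(2)]]) auto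
qed

lemma bounded_Recur:
  assumes "computes M s vs v d" "vsize v \<le> k" "bounded_args M s ws es \<Delta> c" "map fst \<Delta> = vs"
  shows "bounded M s ws (Recur es) v k (c + d + k + 3)"
  unfolding bounded_def
proof
  assume val: "valid ws"
  with assms(3) obtain c' where c: "c' \<le> c" "eval M s (env (map fst ws)) (tuple es) (env vs) c'"
    unfolding bounded_args_def assms(4)[symmetric] by blast
  from assms(1) obtain d' where d: "d' \<le> d" "eval M s (env vs) s v d'"
    unfolding computes_def by blast
  show "vsize v \<le> k \<and> (\<exists>c'\<le>c + d + k + 3. eval M s (env (map fst ws)) (Recur es) v c')"
    unfolding Recur_def using c d assms(2) by (intro conjI eval_le[OF eval_Self[OF c(2) d(2)]]) auto
qed

text \<open>One rule per construct. Resolution along the syntax of a program synthesizes value, size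
  and cost in schematic variables; what remains is to identify the value and to compare the cost
  with the claimed bound.\<close>

lemmas bnds = bounded_vars bounded_consts bounded_Add bounded_Sub bounded_Mul bounded_Rem bounded_Quo
  bounded_Shl bounded_Shr bounded_Lt bounded_Join bounded_Left bounded_Right bounded_Let bounded_args_Nil bounded_args_Cons

section \<open>Arithmetic modulo a Fermat number\<close>

definition fold_code :: fexp where
  "fold_code = Let_in (Prim Shr (Var 1) (Var 0)) (Prim Sub (Prim Sub (Var 2) (Prim Shl (Var 0) (Var 1))) (Var 0))"

text \<open>Modulo \<open>2 ^ N + 1\<close> the power \<open>2 ^ N\<close> is -1, so the high part
  is subtracted from the low part.\<close>

definition fold_mod :: "nat => int => int" where
  "fold_mod N x = x mod 2 ^ N - x div 2 ^ N"

lemma computes_fold: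
  assumes "bit_size x \<le> W" "N < W"
  shows "computes M fold_code [Atom (int N), Atom x] (Atom (fold_mod N x)) (100 * W)"
  by (rule computesI[OF fold_code_def, where ws = "[(Atom (int N), W), (Atom x, W)]"], (rule bnds)+)
    (use assms bit_size_of_nat[of N] in \<open>auto simp: fold_mod_def minus_div_mult_eq_mod\<close>)


lemma fold_mod_dvd: "(2 ^ N + 1) dvd (x - fold_mod N x)"
proof -
  have "x - fold_mod N x = (x div 2 ^ N) * (2 ^ N + 1)"
    using div_mult_mod_eq[of x "2 ^ N"] unfolding fold_mod_def by (simp add: algebra_simps)
  then show ?thesis by simp
qed

lemma div_power_bounds:
  fixes x :: int
  assumes "\<bar>x\<bar> \<le> 2 ^ (N + k)"
  shows "- (2 ^ k) \<le> x div 2 ^ N" "x div 2 ^ N \<le> 2 ^ k"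
proof -
  have x: "x \<le> 2 ^ k * 2 ^ N" "- (2 ^ k) * 2 ^ N \<le> x"
    using assms by (auto simp: power_add mult.commute)
  have c: "c * 2 ^ N div 2 ^ N = c" for c :: int by simp
  show "- (2 ^ k) \<le> x div 2 ^ N" "x div 2 ^ N \<le> 2 ^ k"
    using zdiv_mono1[OF x(1), of "2 ^ N"] zdiv_mono1[OF x(2), of "2 ^ N"] unfolding c by simp_all
qed

lemma fold_mod_bounds:
  assumes "\<bar>x\<bar> \<le> 2 ^ (N + k)"
  shows "- (2 ^ k) \<le> fold_mod N x" "fold_mod N x < 2 ^ N + 2 ^ k"
proof -
  have "0 \<le> x mod 2 ^ N" "x mod 2 ^ N < 2 ^ N" by simp_all
  with div_power_bounds[OF assms] show "- (2 ^ k) \<le> fold_mod N x" "fold_mod N x < 2 ^ N + 2 ^ k"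
    unfolding fold_mod_def by linarith+
qed

text \<open>Four rounds, as the absolute value shrinks from \<open>2 ^ (3 * N)\<close> to
  \<open>2 ^ (2 * N + 1)\<close> to \<open>2 ^ (N + 2)\<close>, then the value falls between -4 and
  \<open>2 ^ N + 4\<close>, and finally between -1 and \<open>2 ^ N\<close>. The residue of -1 keeps
  two representatives, which does no harm.\<close>

definition fermat_red :: "nat => int => int" where
  "fermat_red N x = fold_mod N (fold_mod N (fold_mod N (fold_mod N x)))"

lemma fold_mod_size1: "\<bar>x\<bar> \<le> 2 ^ (3 * N) ==> 2 \<le> N ==> \<bar>fold_mod N x\<bar> \<le> 2 ^ (2 * N + 1)"
proof -
  assume *: "\<bar>x\<bar> \<le> 2 ^ (3 * N)" "2 \<le> N"
  have "\<bar>x\<bar> \<le> 2 ^ (N + 2 * N)" using * by (simp add: algebra_simps)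
  note fold_mod_bounds[OF this]
  moreover have "(2::int) ^ N \<le> 2 ^ (2 * N)" by (rule power_increasing) auto
  moreover have "(2::int) ^ (2 * N + 1) = 2 * 2 ^ (2 * N)" by simp
  ultimately show ?thesis by linarith
qed

lemma fold_mod_size2: "\<bar>x\<bar> \<le> 2 ^ (2 * N + 1) ==> 2 \<le> N ==> \<bar>fold_mod N x\<bar> \<le> 2 ^ (N + 2)"
proof -
  assume *: "\<bar>x\<bar> \<le> 2 ^ (2 * N + 1)" "2 \<le> N"
  have e: "2 * N + 1 = N + (N + 1)" by simp
  have "\<bar>x\<bar> \<le> 2 ^ (N + (N + 1))" using *(1) unfolding e .
  note fold_mod_bounds[OF this]
  moreover have "(2::int) ^ (N + 2) = 4 * 2 ^ N" "(2::int) ^ (N + 1) = 2 * 2 ^ N" by (simp_all add: power_add)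
  ultimately show ?thesis by linarith
qed

lemma fold_mod_size3: "\<bar>x\<bar> \<le> 2 ^ (N + 2) ==> 2 \<le> N ==> -4 \<le> fold_mod N x \<and> fold_mod N x < 2 ^ N + 4"
  using fold_mod_bounds[of x N 2] by simp

text \<open>The quotient by \<open>2 ^ N\<close> can only be -1, 0 or 1 here, because
  \<open>2 ^ N\<close> is at least 4.\<close>

lemma fold_mod_size4:
  assumes "-4 \<le> x" "x < 2 ^ N + 4" "2 \<le> N"
  shows "-1 \<le> fold_mod N x \<and> fold_mod N x \<le> 2 ^ N"
proof -
  have N4: "4 \<le> (2::int) ^ N"
    using power_increasing[OF assms(3), of "2::int"] by simp
  consider "x < 0" | "0 \<le> x" "x < 2 ^ N" | "2 ^ N \<le> x" by linarith
  then show ?thesis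
  proof cases
    case 1
    have "x div 2 ^ N = -1" by (rule int_div_pos_eq[of x "2^N" "-1" "x + 2^N"]) (use 1 N4 assms in auto)
    moreover have "x mod 2 ^ N = x + 2 ^ N"
      using calculation div_mult_mod_eq[of x "2 ^ N"] by simp
    ultimately show ?thesis using 1 N4 assms unfolding fold_mod_def by simp
  next
    case 2
    then show ?thesis unfolding fold_mod_def by simp
  next
    case 3
    have "x div 2 ^ N = 1" by (rule int_div_pos_eq[of x "2^N" 1 "x - 2^N"]) (use 3 N4 assms in auto)
    moreover have "x mod 2 ^ N = x - 2 ^ N"
      using calculation div_mult_mod_eq[of x "2 ^ N"] by simp
    ultimately show ?thesis using 3 N4 assms unfolding fold_mod_def by simp
  qed
qed

lemma fermat_red_range:
  assumes "\<bar>x\<bar> \<le> 2 ^ (3 * N)" "2 \<le> N"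
  shows "-1 \<le> fermat_red N x" "fermat_red N x \<le> 2 ^ N"
  using fold_mod_size4[of "fold_mod N (fold_mod N (fold_mod N x))" N] assms
    fold_mod_size3[OF fold_mod_size2[OF fold_mod_size1[OF assms] assms(2)] assms(2)]
  unfolding fermat_red_def by auto

lemma fermat_red_dvd: "(2 ^ N + 1) dvd (x - fermat_red N x)"
proof -
  let ?f = "fold_mod N"
  have "x - fermat_red N x = (x - ?f x) + (?f x - ?f (?f x)) + (?f (?f x) - ?f (?f (?f x))) + (?f (?f (?f x)) - ?f (?f (?f (?f x))))"
    by (simp add: fermat_red_def)
  then show ?thesis by (simp only: dvd_add fold_mod_dvd)
qed

lemma bit_size_le_power: "\<bar>x\<bar> \<le> 2 ^ k ==> bit_size x \<le> k + 2"
proof -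
  assume "\<bar>x\<bar> \<le> 2 ^ k"
  also have "(2::int) ^ k < 2 ^ (k + 1)" by simp
  finally show ?thesis using bit_size_small[of x "k + 1"] by simp
qed

definition red_code :: fexp where
  "red_code = Call fold_code [Var 0, Call fold_code [Var 0, Call fold_code [Var 0, Call fold_code [Var 0, Var 1]]]]"

lemma computes_red:
  assumes x: "\<bar>x\<bar> \<le> 2 ^ (3 * N)" and N: "2 \<le> N"
  shows "computes M red_code [Atom (int N), Atom x] (Atom (fermat_red N x)) (5000 * N)"
proof -
  define W where "W = 3 * N + 2"
  let ?f = "fold_mod N"
  note s1 = fold_mod_size1[OF x N]
  note s2 = fold_mod_size2[OF s1 N]
  have s3: "\<bar>?f (?f (?f x))\<bar> \<le> 2 ^ (N + 3)"
  proof -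
    have "(4::int) \<le> 2 ^ N" using power_increasing[OF N, of "2::int"] by simp
    moreover have "(2::int) ^ (N + 3) = 8 * 2 ^ N" by (simp add: power_add)
    ultimately show ?thesis using fold_mod_size3[OF s2 N] by linarith
  qed
  have s4: "\<bar>?f (?f (?f (?f x)))\<bar> \<le> 2 ^ N"
    using fermat_red_range[OF x N] one_le_power[of "2::int" N] unfolding fermat_red_def by linarith
  have b: "bit_size x \<le> W" "bit_size (?f x) \<le> W" "bit_size (?f (?f x)) \<le> W" "bit_size (?f (?f (?f x))) \<le> W"
    "bit_size (?f (?f (?f (?f x)))) \<le> W"
    using bit_size_le_power[OF x] bit_size_le_power[OF s1] bit_size_le_power[OF s2] bit_size_le_power[OF s3]
      bit_size_le_power[OF s4] N by (auto simp: W_def)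
  have NW: "N < W" by (simp add: W_def)
  have v: "vsize (Atom (?f x)) \<le> W" "vsize (Atom (?f (?f x))) \<le> W" "vsize (Atom (?f (?f (?f x)))) \<le> W"
    "vsize (Atom (?f (?f (?f (?f x))))) \<le> W"
    using b by simp_all
  note c = computes_fold[OF b(1) NW, of M] computes_fold[OF b(2) NW, of M] computes_fold[OF b(3) NW, of M]
    computes_fold[OF b(4) NW, of M]
  show ?thesis
    apply (rule computesI[OF red_code_def, where ws = "[(Atom (int N), W), (Atom x, W)]"])
    apply (rule bounded_Call[OF c(4) v(4)], (rule bnds)+)
    apply (rule bounded_Call[OF c(3) v(3)], (rule bnds)+)
    apply (rule bounded_Call[OF c(2) v(2)], (rule bnds)+)
    apply (rule bounded_Call[OF c(1) v(1)], (rule bnds | (simp; fail))+)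
    using b NW N bit_size_of_nat[of N] by (auto simp: fermat_red_def W_def)
qed


section \<open>Perfect binary trees\<close>

text \<open>Arrays are stored with their two halves as subtrees, the shape in which all
  divide-and-conquer programs take them apart.\<close>

fun tree :: "nat => (nat => int) => val" where
  "tree 0 a = Atom (a 0)"
| "tree (Suc h) a = Node (tree h a) (tree h (\<lambda>i. a (2 ^ h + i)))"

lemma tree_cong: "(\<And>i. i < 2 ^ h ==> a i = b i) ==> tree h a = tree h b"
proof (induction h arbitrary: a b)
  case (Suc h)
  have "tree h a = tree h b" by (rule Suc.IH) (use Suc.prems in auto)
  moreover have "tree h (\<lambda>i. a (2 ^ h + i)) = tree h (\<lambda>i. b (2 ^ h + i))" by (rule Suc.IH) (use Suc.prems in auto)
  ultimately show ?case by simp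
qed simp

lemma vsize_tree: "(\<And>i. i < 2 ^ h ==> bit_size (a i) \<le> W) ==> 0 < W ==> vsize (tree h a) \<le> W"
  by (cases h) auto

definition join :: "nat => (nat => int) => (nat => int) => nat => int" where
  "join h a b = (\<lambda>i. if i < 2 ^ h then a i else b (i - 2 ^ h))"

lemma join_simps [simp]: "i < 2 ^ h ==> join h a b i = a i" "join h a b (2 ^ h + i) = b i"
  by (simp_all add: join_def)

lemma tree_join [simp]: "tree h (join h a b) = tree h a"
  by (rule tree_cong) simp

lemma all_join: "(\<And>i. i < 2 ^ h ==> Q (a i)) ==> (\<And>i. i < 2 ^ h ==> Q (b i)) ==> i < 2 ^ Suc h ==> Q (join h a b i)"
  unfolding join_def by auto

text \<open>Solves the recurrence of a recursion into both halves that does work linear in the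
  number of leaves on every level.\<close>

definition tree_cost :: "nat => nat => nat" where
  "tree_cost K h = (h + 1) * 2 ^ h * K"

lemma tree_cost_0: "tree_cost K 0 = K"
  by (simp add: tree_cost_def)

lemma tree_cost_Suc: "tree_cost K (Suc h) = 2 * tree_cost K h + 2 * (2 ^ h * K)"
  by (simp add: tree_cost_def algebra_simps)

section \<open>Splitting integers into digits\<close>

lemma exp_Suc_double: "(w::nat) * 2 ^ Suc h = w * 2 ^ h + w * 2 ^ h"
  by simp

text \<open>The quotient is not reduced: the leading digit carries the sign and may reach
  \<open>2 ^ w\<close> in absolute value. This admits the extreme representatives -1 and
  \<open>2 ^ (w * 2 ^ h)\<close> without a special case.\<close>

fun digits :: "nat => nat => int => nat => int" where
  "digits 0 w x = (\<lambda>_. x)"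
| "digits (Suc h) w x = join h (digits h w (x mod 2 ^ (w * 2 ^ h))) (digits h w (x div 2 ^ (w * 2 ^ h)))"

definition split_code :: fexp where
  "split_code = Test (Var 0)
     (Let_in (Prim Shl (Var 1) (Prim Sub (Var 0) (Const 1)))
     (Let_in (Prim Shr (Var 3) (Var 0))
       (Join (Recur [Prim Sub (Var 2) (Const 1), Var 3, Prim Sub (Var 4) (Prim Shl (Var 0) (Var 1))])
             (Recur [Prim Sub (Var 2) (Const 1), Var 3, Var 0]))))
     (Var 2)"

lemma digits_size:
  assumes "\<bar>x\<bar> \<le> 2 ^ (w * 2 ^ h)" "i < 2 ^ h"
  shows "\<bar>digits h w x i\<bar> \<le> 2 ^ w"
  using assms
proof (induction h arbitrary: x i)
  case (Suc h)
  let ?s = "w * 2 ^ h"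
  have "\<bar>x\<bar> \<le> 2 ^ (?s + ?s)" using Suc.prems(1) by (simp only: exp_Suc_double)
  from div_power_bounds[OF this] have d: "\<bar>x div 2 ^ ?s\<bar> \<le> 2 ^ ?s" by simp
  have "0 \<le> x mod 2 ^ ?s" "x mod 2 ^ ?s < 2 ^ ?s" by simp_all
  then have m: "\<bar>x mod 2 ^ ?s\<bar> \<le> 2 ^ ?s" by linarith
  show ?case
    unfolding digits.simps by (rule all_join[where Q = "\<lambda>y. \<bar>y\<bar> \<le> 2 ^ w", OF Suc.IH[OF m] Suc.IH[OF d] Suc.prems(2)])
qed simp

lemma computes_split:
  assumes "\<bar>x\<bar> \<le> 2 ^ (w * 2 ^ h)"
  shows "computes M split_code [Atom (int h), Atom (int w), Atom x] (tree h (digits h w x)) (tree_cost (2000 * (w + 1)) h)"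
  using assms
proof (induction h arbitrary: x)
  case 0
  then have x: "bit_size x \<le> w + 2" by (intro bit_size_le_power) simp
  show ?case
    apply (rule computesI[OF split_code_def, where ws = "[(Atom (int 0), 1), (Atom (int w), w + 2), (Atom x, w + 2)]"])
    apply (rule bounded_Test_else, (rule bnds)+, simp, (rule bnds)+)
    using x bit_size_of_nat[of w] by (auto simp: tree_cost_0)
next
  case (Suc h)
  let ?s = "w * 2 ^ h"
  have "\<bar>x\<bar> \<le> 2 ^ (?s + ?s)" using Suc.prems(1) by (simp only: exp_Suc_double)
  from div_power_bounds[OF this] have d: "\<bar>x div 2 ^ ?s\<bar> \<le> 2 ^ ?s" by simp
  have "0 \<le> x mod 2 ^ ?s" "x mod 2 ^ ?s < 2 ^ ?s" by simp_all
  then have m: "\<bar>x mod 2 ^ ?s\<bar> \<le> 2 ^ ?s" by linarith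
  have vs: "vsize (tree h (digits h w y)) \<le> w + 2" if "\<bar>y\<bar> \<le> 2 ^ ?s" for y
    using digits_size[OF that] by (intro vsize_tree bit_size_le_power) auto
  have wx: "bit_size x \<le> 2 * ?s + 2" using bit_size_le_power[OF Suc.prems] by simp
  have h: "h \<le> 2 ^ h" using less_exp[of h] by simp
  have nat: "nat (int w * 2 ^ h) = w * 2 ^ h" by (simp add: nat_mult_distrib nat_power_eq)
  let ?ws = "[(Atom (int (Suc h)), h + 2), (Atom (int w), w + 1), (Atom x, 2 * ?s + 2)]"
  have w1: "w \<le> w * 2 ^ h" "1 \<le> (2::nat) ^ h" by simp_all
  have cost: "2 ^ h * (2000 * (w + 1)) = 2000 * (w * 2 ^ h) + 2000 * 2 ^ h"
    by (simp add: algebra_simps)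
  show ?case
    apply (rule computesI[OF split_code_def, where ws = ?ws])
         apply (rule bounded_Test_then)
           apply (rule bnds)+
          apply simp
         apply (rule bnds)+
          apply (rule bounded_Recur[OF Suc.IH[OF m] vs[OF m]])
           apply (rule bnds)+
          apply (simp add: nat minus_div_mult_eq_mod)
         apply (rule bounded_Recur[OF Suc.IH[OF d] vs[OF d]])
          apply (rule bnds)+
         apply (simp add: nat)
    subgoal by simp
    subgoal by simp
    subgoal using bit_size_of_nat[of "Suc h"] bit_size_of_nat[of w] wx by simp
    subgoal apply (simp add: nat) unfolding tree_cost_Suc using cost[simplified] h w1 by linarith
    done
qed


section \<open>Packing residues into an integer\<close>

definition center :: "nat => int => int" where
  "center N x = (if 2 ^ (N - 1) < x then x - 2 ^ N - 1 else x)"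

text \<open>Evaluation at \<open>2 ^ w\<close> of the polynomial whose coefficients are the centred
  residues. These may exceed \<open>w\<close> bits, so the halves overlap and are added rather than
  concatenated.\<close>

fun pack :: "nat => nat => nat => (nat => int) => int" where
  "pack N 0 w a = center N (a 0)"
| "pack N (Suc h) w a = pack N h w a + pack N h w (\<lambda>i. a (2 ^ h + i)) * 2 ^ (w * 2 ^ h)"

definition pack_code :: fexp where
  "pack_code = Test (Var 1)
     (Prim Add (Recur [Var 0, Prim Sub (Var 1) (Const 1), Var 2, Left (Var 3)])
        (Prim Shl (Recur [Var 0, Prim Sub (Var 1) (Const 1), Var 2, Right (Var 3)])
           (Prim Shl (Var 2) (Prim Sub (Var 1) (Const 1)))))
     (Test (Prim Lt (Prim Shl (Const 1) (Prim Sub (Var 0) (Const 1))) (Var 3))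
        (Prim Sub (Prim Sub (Var 3) (Prim Shl (Const 1) (Var 0))) (Const 1))
        (Var 3))"

lemma center_size: "\<bar>x\<bar> \<le> 2 ^ N ==> \<bar>center N x\<bar> \<le> 2 ^ N"
proof -
  assume "\<bar>x\<bar> \<le> 2 ^ N"
  moreover have "(1::int) \<le> 2 ^ (N - 1)" by simp
  ultimately show ?thesis unfolding center_def by (split if_split) linarith
qed

text \<open>Subtracting 1 from the power makes the induction close:
  \<open>(Q - 1) + (Q - 1) * Q = Q * Q - 1\<close>.\<close>

lemma pack_size:
  assumes "\<And>i. i < 2 ^ h ==> \<bar>a i\<bar> \<le> 2 ^ N" "1 \<le> w"
  shows "\<bar>pack N h w a\<bar> \<le> 2 ^ N * (2 ^ (w * 2 ^ h) - 1)"
  using assms(1)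
proof (induction h arbitrary: a)
  case 0
  have "\<bar>center N (a 0)\<bar> \<le> 2 ^ N" using 0 by (intro center_size) simp
  also have "(2::int) ^ N * 1 \<le> 2 ^ N * (2 ^ (w * 2 ^ 0) - 1)"
  proof (rule mult_left_mono)
    have "(2::int) ^ 1 \<le> 2 ^ w" using assms(2) by (rule power_increasing) simp
    then show "(1::int) \<le> 2 ^ (w * 2 ^ 0) - 1" by simp
  qed simp
  finally show ?case by simp
next
  case (Suc h)
  let ?Q = "(2::int) ^ (w * 2 ^ h)"
  have 1: "\<bar>pack N h w a\<bar> \<le> 2 ^ N * (?Q - 1)" by (rule Suc.IH) (use Suc.prems in auto)
  have 2: "\<bar>pack N h w (\<lambda>i. a (2 ^ h + i))\<bar> \<le> 2 ^ N * (?Q - 1)" by (rule Suc.IH) (use Suc.prems in auto)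
  have "\<bar>pack N (Suc h) w a\<bar> \<le> \<bar>pack N h w a\<bar> + \<bar>pack N h w (\<lambda>i. a (2 ^ h + i)) * ?Q\<bar>"
    by simp
  also have "\<dots> \<le> 2 ^ N * (?Q - 1) + 2 ^ N * (?Q - 1) * ?Q"
    using 1 2 by (intro add_mono) (auto simp: abs_mult)
  also have "\<dots> = 2 ^ N * (?Q * ?Q - 1)" by (simp add: algebra_simps)
  also have "?Q * ?Q = 2 ^ (w * 2 ^ Suc h)" by (simp only: exp_Suc_double power_add)
  finally show ?case .
qed

lemma bit_size_pack:
  assumes "\<And>i. i < 2 ^ h ==> \<bar>a i\<bar> \<le> 2 ^ N" "1 \<le> w"
  shows "bit_size (pack N h w a) \<le> N + w * 2 ^ h + 2"
proof (rule bit_size_le_power)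
  have "\<bar>pack N h w a\<bar> \<le> 2 ^ N * (2 ^ (w * 2 ^ h) - 1)" by (rule pack_size[OF assms])
  also have "\<dots> \<le> 2 ^ (N + w * 2 ^ h)" by (simp add: power_add algebra_simps)
  finally show "\<bar>pack N h w a\<bar> \<le> 2 ^ (N + w * 2 ^ h)" .
qed

lemma computes_pack:
  assumes "\<And>i. i < 2 ^ h ==> \<bar>a i\<bar> \<le> 2 ^ N" "1 \<le> w" "1 \<le> N"
  shows "computes M pack_code [Atom (int N), Atom (int h), Atom (int w), tree h a] (Atom (pack N h w a))
    (tree_cost (2000 * (N + w)) h)"
  using assms(1)
proof (induction h arbitrary: a)
  case 0
  have a: "bit_size (a 0) \<le> N + 2" using 0 by (intro bit_size_le_power) simp
  have n1: "nat (int N - 1) = N - 1" by simp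
  show ?case
  proof (cases "2 ^ (N - 1) < a 0")
    case True
    show ?thesis
      apply (rule computesI[OF pack_code_def, where ws = "[(Atom (int N), N + 1), (Atom (int 0), 1), (Atom (int w), w + 1), (Atom (a 0), N + 2)]"])
      apply (rule bounded_Test_else, (rule bnds | (simp; fail))+)
      apply (rule bounded_Test_then, (rule bnds)+)
      apply (use True n1 in simp)
      apply (rule bnds)+
      using True a assms(2,3) bit_size_of_nat[of w] bit_size_of_nat[of N] by (auto simp: center_def tree_cost_0)
  next
    case False
    show ?thesis
      apply (rule computesI[OF pack_code_def, where ws = "[(Atom (int N), N + 1), (Atom (int 0), 1), (Atom (int w), w + 1), (Atom (a 0), N + 2)]"])
      apply (rule bounded_Test_else, (rule bnds | (simp; fail))+)
      apply (rule bounded_Test_else, (rule bnds)+)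
      apply (use False n1 in simp)
      apply (rule bnds)+
      using False a assms(2,3) bit_size_of_nat[of w] bit_size_of_nat[of N] by (auto simp: center_def tree_cost_0)
  qed
next
  case (Suc h)
  let ?b = "\<lambda>i. a (2 ^ h + i)" and ?s = "w * 2 ^ h"
  have pa: "\<And>i. i < 2 ^ h ==> \<bar>a i\<bar> \<le> 2 ^ N" "\<And>i. i < 2 ^ h ==> \<bar>?b i\<bar> \<le> 2 ^ N" using Suc.prems by auto
  have v: "vsize (Atom (pack N h w a)) \<le> N + ?s + 2" "vsize (Atom (pack N h w ?b)) \<le> N + ?s + 2"
    using bit_size_pack[OF pa(1) assms(2)] bit_size_pack[OF pa(2) assms(2)] by simp_all
  have t: "vsize (tree h a) \<le> N + 2" "vsize (tree h ?b) \<le> N + 2"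
    by (rule vsize_tree[OF bit_size_le_power[OF pa(1)]] vsize_tree[OF bit_size_le_power[OF pa(2)]]; simp)+
  have h: "h < 2 ^ h" by (rule less_exp)
  have nat: "nat (int w * 2 ^ h) = ?s" by (simp add: nat_mult_distrib nat_power_eq)
  have cost: "2 ^ h * (2000 * (N + w)) = 2000 * (w * 2 ^ h) + 2000 * (N * 2 ^ h)"
    by (simp add: algebra_simps)
  have Nh: "N + h \<le> N * 2 ^ h" "1 \<le> N * 2 ^ h" "w \<le> w * 2 ^ h"
  proof -
    have "h + 1 \<le> 2 ^ h" using h by linarith
    then have "N * (h + 1) \<le> N * 2 ^ h" by (rule mult_le_mono2)
    moreover have "1 * h \<le> N * h" using assms(3) by (rule mult_le_mono1)
    ultimately show "N + h \<le> N * 2 ^ h" by (simp only: distrib_left)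
  qed (use assms(3) in auto)
  let ?ws = "[(Atom (int N), N + 1), (Atom (int (Suc h)), h + 2), (Atom (int w), w + 1), (tree (Suc h) a, 1)]"
  show ?case
    apply (rule computesI[OF pack_code_def, where ws = ?ws])
    apply (rule bounded_Test_then, (rule bnds | (simp; fail))+)
    apply (rule bounded_Recur[OF Suc.IH[OF pa(1)] v(1)], assumption)
    apply (unfold tree.simps)
    apply (rule bnds t | (simp; fail))+
    apply (rule bounded_Recur[OF Suc.IH[OF pa(2)] v(2)], assumption)
    apply (rule bnds t | (simp; fail))+
    subgoal by (simp add: nat)
    subgoal by simp
    subgoal using bit_size_of_nat[of "Suc h"] bit_size_of_nat[of w] bit_size_of_nat[of N] by simp
    subgoal apply (simp add: nat) unfolding tree_cost_Suc using cost[simplified] Nh by linarith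
    done
qed


section \<open>Sums of shifted residues\<close>

definition butterfly :: "nat => nat => nat => int => int => int" where
  "butterfly N e f x y = fermat_red N (fermat_red N (x * 2 ^ e) + fermat_red N (y * 2 ^ f))"

definition butterfly_code :: fexp where
  "butterfly_code = Test (Var 1)
     (Join (Recur [Var 0, Prim Sub (Var 1) (Const 1), Var 2, Var 3, Left (Var 4), Left (Var 5)])
           (Recur [Var 0, Prim Sub (Var 1) (Const 1), Var 2, Var 3, Right (Var 4), Right (Var 5)]))
     (Call red_code [Var 0, Prim Add (Call red_code [Var 0, Prim Shl (Var 4) (Var 2)])
                                     (Call red_code [Var 0, Prim Shl (Var 5) (Var 3)])])"

lemma shifted_range:
  fixes x :: int
  assumes "\<bar>x\<bar> \<le> 2 ^ N" "e \<le> 2 * N"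
  shows "\<bar>x * 2 ^ e\<bar> \<le> 2 ^ (3 * N)"
proof -
  have "\<bar>x * 2 ^ e\<bar> \<le> 2 ^ N * 2 ^ (2 * N)"
    unfolding abs_mult using assms by (intro mult_mono) (auto intro: power_increasing)
  then show ?thesis by (simp add: power_add[symmetric])
qed

lemma abs_fermat_red: "\<bar>x\<bar> \<le> 2 ^ (3 * N) ==> 2 \<le> N ==> \<bar>fermat_red N x\<bar> \<le> 2 ^ N"
  using fermat_red_range[of x N] one_le_power[of "2::int" N] by linarith

lemma sum_range:
  fixes x :: int
  assumes "\<bar>x\<bar> \<le> 2 ^ N" "\<bar>y\<bar> \<le> 2 ^ N" "2 \<le> N"
  shows "\<bar>x + y\<bar> \<le> 2 ^ (3 * N)"
proof -
  have "(2::int) ^ (N + 1) \<le> 2 ^ (3 * N)" using assms(3) by (intro power_increasing) auto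
  moreover have "(2::int) ^ (N + 1) = 2 * 2 ^ N" by simp
  ultimately show ?thesis using assms(1,2) by linarith
qed

lemma butterfly_inner_range:
  assumes "\<bar>x\<bar> \<le> 2 ^ N" "\<bar>y\<bar> \<le> 2 ^ N" "e \<le> 2 * N" "f \<le> 2 * N" "2 \<le> N"
  shows "\<bar>fermat_red N (x * 2 ^ e) + fermat_red N (y * 2 ^ f)\<bar> \<le> 2 ^ (3 * N)"
  using assms by (intro sum_range abs_fermat_red shifted_range)

lemma butterfly_range:
  assumes "\<bar>x\<bar> \<le> 2 ^ N" "\<bar>y\<bar> \<le> 2 ^ N" "e \<le> 2 * N" "f \<le> 2 * N" "2 \<le> N"
  shows "-1 \<le> butterfly N e f x y" "butterfly N e f x y \<le> 2 ^ N" "\<bar>butterfly N e f x y\<bar> \<le> 2 ^ N"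
  unfolding butterfly_def
  using fermat_red_range[OF butterfly_inner_range[OF assms] assms(5)] abs_fermat_red[OF butterfly_inner_range[OF assms] assms(5)]
  by auto

lemma butterfly_dvd: "(2 ^ N + 1) dvd (x * 2 ^ e + y * 2 ^ f - butterfly N e f x y)"
proof -
  let ?r = "fermat_red N"
  have "x * 2 ^ e + y * 2 ^ f - butterfly N e f x y = (x * 2 ^ e - ?r (x * 2 ^ e)) + (y * 2 ^ f - ?r (y * 2 ^ f))
     + (?r (x * 2 ^ e) + ?r (y * 2 ^ f) - ?r (?r (x * 2 ^ e) + ?r (y * 2 ^ f)))"
    by (simp add: butterfly_def)
  then show ?thesis by (simp only: dvd_add fermat_red_dvd)
qed

lemma vsize_tree_range: "(\<And>i. i < 2 ^ h ==> \<bar>a i\<bar> \<le> 2 ^ N) ==> vsize (tree h a) \<le> N + 2"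
  by (rule vsize_tree[OF bit_size_le_power]) auto

text \<open>Solves the recurrence with constant work \<open>K\<close> per node: a tree of height
  \<open>h\<close> has \<open>2 * 2 ^ h - 1\<close> nodes.\<close>

definition tree_cost' :: "nat => nat => nat" where
  "tree_cost' K h = (2 * 2 ^ h - 1) * K"

lemma tree_cost'_0: "tree_cost' K 0 = K"
  by (simp add: tree_cost'_def)

lemma tree_cost'_Suc: "tree_cost' K (Suc h) = 2 * tree_cost' K h + K"
proof -
  obtain m where "(2::nat) ^ h = Suc m" by (metis not0_implies_Suc power_not_zero zero_neq_numeral)
  then show ?thesis by (simp add: tree_cost'_def algebra_simps)
qed

lemma tree_cost'_le: "tree_cost' K h \<le> 2 * 2 ^ h * K"
  by (simp add: tree_cost'_def)

lemma computes_butterfly: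
  assumes "2 \<le> N" "e \<le> 2 * N" "f \<le> 2 * N"
    and "h \<le> N" "\<And>i. i < 2 ^ h ==> \<bar>a i\<bar> \<le> 2 ^ N" "\<And>i. i < 2 ^ h ==> \<bar>b i\<bar> \<le> 2 ^ N"
  shows "computes M butterfly_code [Atom (int N), Atom (int h), Atom (int e), Atom (int f), tree h a, tree h b]
    (tree h (\<lambda>i. butterfly N e f (a i) (b i))) (tree_cost' (20000 * N) h)"
  using assms(4-)
proof (induction h arbitrary: a b)
  case 0
  have ab: "\<bar>a 0\<bar> \<le> 2 ^ N" "\<bar>b 0\<bar> \<le> 2 ^ N" using 0 by auto
  note r1 = shifted_range[OF ab(1) assms(2)] and r2 = shifted_range[OF ab(2) assms(3)]
  note r3 = butterfly_inner_range[OF ab assms(2,3,1)]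
  note c1 = computes_red[OF r1 assms(1), of M] and c2 = computes_red[OF r2 assms(1), of M] and c3 = computes_red[OF r3 assms(1), of M]
  have v: "vsize (Atom (fermat_red N x)) \<le> N + 2" if "\<bar>x\<bar> \<le> 2 ^ (3 * N)" for x
    using bit_size_le_power[OF abs_fermat_red[OF that assms(1)]] by simp
  let ?ws = "[(Atom (int N), N + 1), (Atom (int 0), 1), (Atom (int e), 2 * N + 1), (Atom (int f), 2 * N + 1), (tree 0 a, N + 2), (tree 0 b, N + 2)]"
  show ?case
    apply (rule computesI[OF butterfly_code_def, where ws = ?ws])
    apply (rule bounded_Test_else, (rule bnds | (simp; fail))+)
    apply (rule bounded_Call[OF c3 v[OF r3]], (rule bnds)+)
    apply (rule bounded_Call[OF c1 v[OF r1]], unfold tree.simps, (rule bnds | (simp; fail))+)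
    apply (rule bounded_Call[OF c2 v[OF r2]], (rule bnds | (simp; fail))+)
    subgoal by (simp add: butterfly_def)
    subgoal by simp
    subgoal using ab bit_size_le_power[OF ab(1)] bit_size_le_power[OF ab(2)] assms bit_size_of_nat[of N] bit_size_of_nat[of e] bit_size_of_nat[of f]
      by auto
    subgoal using assms by (simp add: tree_cost'_0)
    done
next
  case (Suc h)
  let ?a = "\<lambda>i. a (2 ^ h + i)" and ?b = "\<lambda>i. b (2 ^ h + i)"
  have p1: "h \<le> N" "\<And>i. i < 2 ^ h ==> \<bar>a i\<bar> \<le> 2 ^ N" "\<And>i. i < 2 ^ h ==> \<bar>b i\<bar> \<le> 2 ^ N" using Suc.prems by auto
  have p2: "h \<le> N" "\<And>i. i < 2 ^ h ==> \<bar>?a i\<bar> \<le> 2 ^ N" "\<And>i. i < 2 ^ h ==> \<bar>?b i\<bar> \<le> 2 ^ N" using Suc.prems by auto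
  have t: "vsize (tree h a) \<le> N + 2" "vsize (tree h b) \<le> N + 2" "vsize (tree h ?a) \<le> N + 2" "vsize (tree h ?b) \<le> N + 2"
    by (rule vsize_tree_range; use p1 p2 in simp)+
  have v: "vsize (tree h (\<lambda>i. butterfly N e f (a i) (b i))) \<le> N + 2" "vsize (tree h (\<lambda>i. butterfly N e f (?a i) (?b i))) \<le> N + 2"
    by (rule vsize_tree_range, rule butterfly_range; use p1 p2 assms in simp)+
  let ?ws = "[(Atom (int N), N + 1), (Atom (int (Suc h)), N + 1), (Atom (int e), 2 * N + 1), (Atom (int f), 2 * N + 1), (tree (Suc h) a, 1), (tree (Suc h) b, 1)]"
  show ?case
    apply (rule computesI[OF butterfly_code_def, where ws = ?ws])
    apply (rule bounded_Test_then, (rule bnds | (simp; fail))+)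
    apply (unfold tree.simps)
    apply (rule bounded_Recur[OF Suc.IH[OF p1] v(1)], assumption, assumption)
    apply (rule bnds t | (simp; fail))+
    apply (rule bounded_Recur[OF Suc.IH[OF p2] v(2)], assumption, assumption)
    apply (rule bnds t | (simp; fail))+
    subgoal using Suc.prems assms bit_size_of_nat[of N] bit_size_of_nat[of e] bit_size_of_nat[of f] bit_size_of_nat[of "Suc h"]
      by auto
    subgoal using assms by (simp add: tree_cost'_Suc)
    done
qed


section \<open>The fast Fourier transform modulo a Fermat number\<close>

text \<open>
  \<open>fft N h e a\<close> are the residues of \<open>\<Sum>i<2^h. a i * x^i\<close> modulo the linear factors of \<open>x^(2^h) - 2^e\<close>,
  found by splitting \<open>x^(2m) - c^2\<close> into \<open>x^m - c\<close> and \<open>x^m + c\<close>; note that \<open>-1 = 2^N\<close>.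
\<close>

fun fft :: "nat => nat => nat => (nat => int) => nat => int" where
  "fft N 0 e a = a"
| "fft N (Suc h) e a = (let g = e div 2 in
     join h (fft N h g (\<lambda>i. butterfly N 0 g (a i) (a (2 ^ h + i))))
            (fft N h (g + N) (\<lambda>i. butterfly N 0 (g + N) (a i) (a (2 ^ h + i)))))"

text \<open>Because \<open>2 ^ (2 * N) = 1\<close>, the inverse of 2 is
  \<open>2 ^ (2 * N - 1)\<close> and that of \<open>2 * 2 ^ g\<close> is
  \<open>2 ^ (2 * N - 1 - g)\<close>. Lowering an exponent by \<open>N\<close> changes the sign, so
  the two butterflies are \<open>(u + v) / 2\<close> and
  \<open>(u - v) / (2 * 2 ^ g)\<close>.\<close>

fun ifft :: "nat => nat => nat => (nat => int) => nat => int" where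
  "ifft N 0 e a = a"
| "ifft N (Suc h) e a = (let g = e div 2; u = ifft N h g a; v = ifft N h (g + N) (\<lambda>i. a (2 ^ h + i)) in
     join h (\<lambda>i. butterfly N (2 * N - 1) (2 * N - 1) (u i) (v i))
            (\<lambda>i. butterfly N (2 * N - 1 - g) (N - 1 - g) (u i) (v i)))"

definition fft_code :: fexp where
  "fft_code = Test (Var 1)
     (Let_in (Prim Shr (Var 2) (Const 1))
     (Let_in (Prim Add (Var 0) (Var 1))
       (Join (Recur [Var 2, Prim Sub (Var 3) (Const 1), Var 1,
                Call butterfly_code [Var 2, Prim Sub (Var 3) (Const 1), Const 0, Var 1, Left (Var 5), Right (Var 5)]])
             (Recur [Var 2, Prim Sub (Var 3) (Const 1), Var 0,
                Call butterfly_code [Var 2, Prim Sub (Var 3) (Const 1), Const 0, Var 0, Left (Var 5), Right (Var 5)]]))))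
     (Var 3)"

definition ifft_code :: fexp where
  "ifft_code = Test (Var 1)
     (Let_in (Prim Shr (Var 2) (Const 1))
     (Let_in (Recur [Var 1, Prim Sub (Var 2) (Const 1), Var 0, Left (Var 4)])
     (Let_in (Recur [Var 2, Prim Sub (Var 3) (Const 1), Prim Add (Var 1) (Var 2), Right (Var 5)])
     (Let_in (Prim Sub (Prim Shl (Var 3) (Const 1)) (Const 1))
       (Join (Call butterfly_code [Var 4, Prim Sub (Var 5) (Const 1), Var 0, Var 0, Var 2, Var 1])
             (Call butterfly_code [Var 4, Prim Sub (Var 5) (Const 1), Prim Sub (Var 0) (Var 3),
                Prim Sub (Prim Sub (Var 4) (Const 1)) (Var 3), Var 2, Var 1]))))))
     (Var 3)"

lemma fft_range:
  assumes "2 \<le> N" "e < 2 * N" "\<And>i. i < 2 ^ h ==> \<bar>a i\<bar> \<le> 2 ^ N" "i < 2 ^ h"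
  shows "\<bar>fft N h e a i\<bar> \<le> 2 ^ N"
  using assms(2-)
proof (induction h arbitrary: e a i)
  case (Suc h)
  have g: "e div 2 < 2 * N" "e div 2 + N < 2 * N" using Suc.prems(1) by auto
  have b: "\<bar>butterfly N 0 (e div 2) (a i) (a (2 ^ h + i))\<bar> \<le> 2 ^ N" "\<bar>butterfly N 0 (e div 2 + N) (a i) (a (2 ^ h + i))\<bar> \<le> 2 ^ N"
    if "i < 2 ^ h" for i
    by (rule butterfly_range; use that Suc.prems g assms(1) in simp)+
  show ?case
    unfolding fft.simps Let_def
    by (rule all_join[where Q = "\<lambda>y. \<bar>y\<bar> \<le> 2 ^ N", OF Suc.IH[OF g(1) b(1)] Suc.IH[OF g(2) b(2)] Suc.prems(3)])
qed simp

text \<open>The interval from -1 to \<open>2 ^ N\<close> is sharper than the bound in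
  \<open>fft_range\<close>; \<open>center_eq\<close> needs it to identify a number from its
  residue.\<close>

lemma ifft_range:
  assumes "2 \<le> N" "e < 2 * N" "\<And>i. i < 2 ^ h ==> -1 \<le> a i \<and> a i \<le> 2 ^ N" "i < 2 ^ h"
  shows "-1 \<le> ifft N h e a i \<and> ifft N h e a i \<le> 2 ^ N"
  using assms(2-)
proof (induction h arbitrary: e a i)
  case (Suc h)
  have g: "e div 2 < 2 * N" "e div 2 + N < 2 * N" using Suc.prems(1) by auto
  have uv: "\<bar>ifft N h (e div 2) a i\<bar> \<le> 2 ^ N" "\<bar>ifft N h (e div 2 + N) (\<lambda>i. a (2 ^ h + i)) i\<bar> \<le> 2 ^ N" if "i < 2 ^ h" for i
  proof -
    have "-1 \<le> ifft N h (e div 2) a i \<and> ifft N h (e div 2) a i \<le> 2 ^ N"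
      by (rule Suc.IH[OF g(1)]) (use that Suc.prems(2) in auto)
    moreover have "-1 \<le> ifft N h (e div 2 + N) (\<lambda>i. a (2 ^ h + i)) i \<and> ifft N h (e div 2 + N) (\<lambda>i. a (2 ^ h + i)) i \<le> 2 ^ N"
      by (rule Suc.IH[OF g(2)]) (use that Suc.prems(2) in auto)
    ultimately show "\<bar>ifft N h (e div 2) a i\<bar> \<le> 2 ^ N" "\<bar>ifft N h (e div 2 + N) (\<lambda>i. a (2 ^ h + i)) i\<bar> \<le> 2 ^ N"
      using one_le_power[of "2::int" N] by linarith+
  qed
  let ?g = "e div 2" and ?u = "ifft N h (e div 2) a" and ?v = "ifft N h (e div 2 + N) (\<lambda>i. a (2 ^ h + i))"
  have 1: "-1 \<le> butterfly N (2 * N - 1) (2 * N - 1) (?u i) (?v i) \<and> butterfly N (2 * N - 1) (2 * N - 1) (?u i) (?v i) \<le> 2 ^ N"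
    if "i < 2 ^ h" for i
    using butterfly_range(1,2)[OF uv[OF that], of "2 * N - 1" "2 * N - 1"] assms(1) by simp
  have 2: "-1 \<le> butterfly N (2 * N - 1 - ?g) (N - 1 - ?g) (?u i) (?v i) \<and> butterfly N (2 * N - 1 - ?g) (N - 1 - ?g) (?u i) (?v i) \<le> 2 ^ N"
    if "i < 2 ^ h" for i
    using butterfly_range(1,2)[OF uv[OF that], of "2 * N - 1 - ?g" "N - 1 - ?g"] assms(1) by simp
  show ?case
    unfolding ifft.simps Let_def
    by (rule all_join[where Q = "\<lambda>y. -1 \<le> y \<and> y \<le> 2 ^ N", OF 1 2 Suc.prems(3)])
qed simp

lemma computes_fft:
  assumes "2 \<le> N" "e < 2 * N" "h \<le> N" "\<And>i. i < 2 ^ h ==> \<bar>a i\<bar> \<le> 2 ^ N"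
  shows "computes M fft_code [Atom (int N), Atom (int h), Atom (int e), tree h a] (tree h (fft N h e a)) (tree_cost (50000 * N) h)"
  using assms(2-)
proof (induction h arbitrary: e a)
  case 0
  have a: "bit_size (a 0) \<le> N + 2" using 0 by (intro bit_size_le_power) simp
  show ?case
    apply (rule computesI[OF fft_code_def, where ws = "[(Atom (int N), N + 1), (Atom (int 0), 1), (Atom (int e), 2 * N + 1), (tree 0 a, N + 2)]"])
    apply (rule bounded_Test_else, (rule bnds | (simp; fail))+)
    using a 0(1) assms(1) bit_size_of_nat[of N] bit_size_of_nat[of e] by (auto simp: tree_cost_0)
next
  case (Suc h)
  let ?b = "\<lambda>i. a (2 ^ h + i)" and ?g = "e div 2" and ?f = "e div 2 + N"
  have g: "?g < 2 * N" "?f < 2 * N" "?g \<le> 2 * N" "?f \<le> 2 * N" "h \<le> N" using Suc.prems by auto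
  have a: "\<And>i. i < 2 ^ h ==> \<bar>a i\<bar> \<le> 2 ^ N" "\<And>i. i < 2 ^ h ==> \<bar>?b i\<bar> \<le> 2 ^ N" using Suc.prems by auto
  have t: "vsize (tree h a) \<le> N + 2" "vsize (tree h ?b) \<le> N + 2"
    by (rule vsize_tree_range; use a in simp)+
  let ?u = "\<lambda>i. butterfly N 0 ?g (a i) (?b i)" and ?v = "\<lambda>i. butterfly N 0 ?f (a i) (?b i)"
  have b: "\<And>i. i < 2 ^ h ==> \<bar>?u i\<bar> \<le> 2 ^ N" "\<And>i. i < 2 ^ h ==> \<bar>?v i\<bar> \<le> 2 ^ N"
    by (rule butterfly_range; use a g assms(1) in simp)+
  have tb: "vsize (tree h ?u) \<le> N + 2" "vsize (tree h ?v) \<le> N + 2"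
    by (rule vsize_tree_range; use b in simp)+
  have tf: "vsize (tree h (fft N h ?g ?u)) \<le> N + 2" "vsize (tree h (fft N h ?f ?v)) \<le> N + 2"
    by (rule vsize_tree_range, rule fft_range[OF assms(1)]; use b g in simp)+
  have c1: "computes M butterfly_code [Atom (int N), Atom (int h), Atom (int 0), Atom (int ?g), tree h a, tree h ?b] (tree h ?u) (tree_cost' (20000 * N) h)"
    and c2: "computes M butterfly_code [Atom (int N), Atom (int h), Atom (int 0), Atom (int ?f), tree h a, tree h ?b] (tree h ?v) (tree_cost' (20000 * N) h)"
    by (rule computes_butterfly; use a g assms(1) in simp)+
  let ?ws = "[(Atom (int N), N + 1), (Atom (int (Suc h)), N + 1), (Atom (int e), 2 * N + 1), (tree (Suc h) a, 1)]"
  have cost: "N \<le> 2 ^ h * N" "2 ^ h * (50000 * N) = 50000 * (2 ^ h * N)" by simp_all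
  have cb: "tree_cost' (20000 * N) h \<le> 40000 * (2 ^ h * N)" using tree_cost'_le[of "20000 * N" h] by simp
  show ?case
    apply (rule computesI[OF fft_code_def, where ws = ?ws])
    apply (rule bounded_Test_then, (rule bnds | (simp; fail))+)
    apply (unfold tree.simps)
    apply (rule bounded_Recur[OF Suc.IH[OF g(1,5) b(1)] tf(1)], assumption)
    apply (rule bnds)+
    apply (rule bounded_Call[OF c1 tb(1)])
    apply (rule bnds t | (simp add: zdiv_int; fail))+
    apply (rule bounded_Recur[OF Suc.IH[OF g(2,5) b(2)] tf(2)], assumption)
    apply (rule bnds)+
    apply (rule bounded_Call[OF c2 tb(2)])
    apply (rule bnds t | (simp add: zdiv_int; fail))+
    subgoal by (simp add: Let_def)
    subgoal by simp
    subgoal using Suc.prems assms bit_size_of_nat[of N] bit_size_of_nat[of e] bit_size_of_nat[of "Suc h"] by auto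
    subgoal apply simp unfolding tree_cost_Suc using cost cb assms(1) by linarith
    done
qed


lemma computes_ifft:
  assumes "2 \<le> N" "e < 2 * N" "h \<le> N" "\<And>i. i < 2 ^ h ==> -1 \<le> a i \<and> a i \<le> 2 ^ N"
  shows "computes M ifft_code [Atom (int N), Atom (int h), Atom (int e), tree h a] (tree h (ifft N h e a)) (tree_cost (50000 * N) h)"
  using assms(2-)
proof (induction h arbitrary: e a)
  case 0
  have "-1 \<le> a 0 \<and> a 0 \<le> 2 ^ N" using 0(3) by simp
  then have "\<bar>a 0\<bar> \<le> 2 ^ N" using one_le_power[of "2::int" N] by linarith
  then have a: "bit_size (a 0) \<le> N + 2" by (rule bit_size_le_power)
  show ?case
    apply (rule computesI[OF ifft_code_def, where ws = "[(Atom (int N), N + 1), (Atom (int 0), 1), (Atom (int e), 2 * N + 1), (tree 0 a, N + 2)]"])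
    apply (rule bounded_Test_else, (rule bnds | (simp; fail))+)
    using a 0(1) assms(1) bit_size_of_nat[of N] bit_size_of_nat[of e] by (auto simp: tree_cost_0)
next
  case (Suc h)
  let ?b = "\<lambda>i. a (2 ^ h + i)" and ?g = "e div 2" and ?f = "e div 2 + N"
  have g: "?g < 2 * N" "?f < 2 * N" "?g < N" "h \<le> N" using Suc.prems by auto
  have one: "1 \<le> (2::int) ^ N" by simp
  have a: "\<And>i. i < 2 ^ h ==> -1 \<le> a i \<and> a i \<le> 2 ^ N" "\<And>i. i < 2 ^ h ==> -1 \<le> ?b i \<and> ?b i \<le> 2 ^ N"
    using Suc.prems by auto
  have r: "\<bar>x\<bar> \<le> 2 ^ N" if "-1 \<le> x \<and> x \<le> 2 ^ N" for x :: int using that one by linarith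
  let ?u = "ifft N h ?g a" and ?v = "ifft N h ?f ?b"
  have uv: "\<And>i. i < 2 ^ h ==> \<bar>?u i\<bar> \<le> 2 ^ N" "\<And>i. i < 2 ^ h ==> \<bar>?v i\<bar> \<le> 2 ^ N"
    using a by (intro r ifft_range[OF assms(1) g(1)] ifft_range[OF assms(1) g(2)]; simp)+
  have ta: "vsize (tree h a) \<le> N + 2" "vsize (tree h ?b) \<le> N + 2"
    by (rule vsize_tree_range, rule r, rule a, assumption)+
  have tu: "vsize (tree h ?u) \<le> N + 2" "vsize (tree h ?v) \<le> N + 2"
    by (rule vsize_tree_range; use uv in simp)+
  let ?p = "\<lambda>i. butterfly N (2 * N - 1) (2 * N - 1) (?u i) (?v i)"
  let ?q = "\<lambda>i. butterfly N (2 * N - 1 - ?g) (N - 1 - ?g) (?u i) (?v i)"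
  have tp: "vsize (tree h ?p) \<le> N + 2" "vsize (tree h ?q) \<le> N + 2"
    by (rule vsize_tree_range, rule butterfly_range; use uv assms(1) in simp)+
  note t = ta tu tp
  have c1: "computes M butterfly_code [Atom (int N), Atom (int h), Atom (int (2 * N - 1)), Atom (int (2 * N - 1)), tree h ?u, tree h ?v]
      (tree h ?p) (tree_cost' (20000 * N) h)"
    and c2: "computes M butterfly_code [Atom (int N), Atom (int h), Atom (int (2 * N - 1 - ?g)), Atom (int (N - 1 - ?g)), tree h ?u, tree h ?v]
      (tree h ?q) (tree_cost' (20000 * N) h)"
    by (rule computes_butterfly; use uv g assms(1) in simp)+
  have n: "int (2 * N - 1) = 2 * int N - 1" "int (2 * N - 1 - ?g) = 2 * int N - 1 - int e div 2" "int (N - 1 - ?g) = int N - 1 - int e div 2"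
    using g by (auto simp: of_nat_diff zdiv_int)
  let ?ws = "[(Atom (int N), N + 1), (Atom (int (Suc h)), N + 1), (Atom (int e), 2 * N + 1), (tree (Suc h) a, 1)]"
  have cost: "N \<le> 2 ^ h * N" "2 ^ h * (50000 * N) = 50000 * (2 ^ h * N)" by simp_all
  have cb: "tree_cost' (20000 * N) h \<le> 40000 * (2 ^ h * N)" using tree_cost'_le[of "20000 * N" h] by simp
  show ?case
    apply (rule computesI[OF ifft_code_def, where ws = ?ws])
    apply (rule bounded_Test_then, (rule bnds | (simp; fail))+)
    apply (unfold tree.simps)
    apply (rule bounded_Recur[OF Suc.IH[OF g(1,4) a(1)] tu(1)], assumption)
    apply (rule bnds t | (simp add: zdiv_int; fail))+
    apply (rule bounded_Recur[OF Suc.IH[OF g(2,4) a(2)] tu(2)], assumption)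
    apply (rule bnds t | (simp add: zdiv_int; fail))+
    apply (rule bounded_Call[OF c1[unfolded n] tp(1)])
    apply (rule bnds t | (simp add: n zdiv_int; fail))+
    apply (rule bounded_Call[OF c2[unfolded n] tp(2)])
    apply (rule bnds t | (simp add: n zdiv_int; fail))+
    subgoal by (simp add: Let_def)
    subgoal by simp
    subgoal using Suc.prems assms bit_size_of_nat[of N] bit_size_of_nat[of e] bit_size_of_nat[of "Suc h"] by auto
    subgoal apply simp unfolding tree_cost_Suc using cost cb assms(1) by linarith
    done
qed

section \<open>Correctness of the transform in terms of ideals\<close>

fun poly_of :: "nat => (nat => int) => int poly" where
  "poly_of 0 a = [:a 0:]"
| "poly_of (Suc h) a = poly_of h a + monom 1 (2 ^ h) * poly_of h (\<lambda>i. a (2 ^ h + i))"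

lemma coeff_poly_of: "coeff (poly_of h a) i = (if i < 2 ^ h then a i else 0)"
proof (induction h arbitrary: a i)
  case 0
  show ?case by (cases i) auto
next
  case (Suc h)
  show ?case by (auto simp: Suc.IH coeff_monom_mult)
qed

lemma poly_of_dvd:
  assumes "\<And>i. i < 2 ^ h ==> q dvd (s * x i + t * y i - z i)"
  shows "[:q:] dvd ([:s:] * poly_of h x + [:t:] * poly_of h y - poly_of h z)"
  unfolding const_poly_dvd_iff using assms by (simp add: coeff_poly_of)

text \<open>Membership in the ideal generated by \<open>F\<close> and \<open>Q\<close>. Congruences
  modulo \<open>x^m - c\<close> and a Fermat number are kept in this form to avoid quotient
  rings.\<close>

definition in_ideal :: "int poly => int poly => int poly => bool" where
  "in_ideal F Q Z \<longleftrightarrow> (\<exists>X Y. Z = X * F + Q * Y)"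

lemma in_ideal_product:
  assumes "in_ideal F Q (A - A')" "in_ideal F Q (B - B')" "in_ideal F Q (U - A' * B')"
  shows "in_ideal F Q (U - A * B)"
proof -
  obtain X1 Y1 X2 Y2 X3 Y3 where
    "A - A' = X1 * F + Q * Y1" "B - B' = X2 * F + Q * Y2" "U - A' * B' = X3 * F + Q * Y3"
    using assms unfolding in_ideal_def by blast
  then have eqs: "A = A' + (X1 * F + Q * Y1)" "B = B' + (X2 * F + Q * Y2)" "U = A' * B' + (X3 * F + Q * Y3)"
    by (simp_all add: algebra_simps)
  have "U - A * B = (X3 - A' * X2 - X1 * B) * F + Q * (Y3 - A' * Y2 - Y1 * B)"
    unfolding eqs(1,3) by (simp add: eqs(2) algebra_simps)
  then show ?thesis unfolding in_ideal_def by blast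
qed

text \<open>Modulo \<open>x^m - c\<close> the upper half of the coefficients may be multiplied by
  \<open>c\<close> and added to the lower half.\<close>

lemma split_in_ideal:
  fixes c :: int
  assumes "\<And>i. i < 2 ^ h ==> q dvd (a i + c * b i - z i)"
  shows "in_ideal (monom 1 (2 ^ h) - [:c:]) [:q:] (poly_of h a + monom 1 (2 ^ h) * poly_of h b - poly_of h z)"
proof -
  have "[:q:] dvd ([:1:] * poly_of h a + [:c:] * poly_of h b - poly_of h z)"
    using assms by (intro poly_of_dvd) simp
  then obtain Y where Y: "[:1:] * poly_of h a + [:c:] * poly_of h b - poly_of h z = [:q:] * Y" by (rule dvdE)
  have "poly_of h a + monom 1 (2 ^ h) * poly_of h b - poly_of h z
     = poly_of h b * (monom 1 (2 ^ h) - [:c:]) + ([:1:] * poly_of h a + [:c:] * poly_of h b - poly_of h z)"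
    by (simp add: algebra_simps)
  then show ?thesis unfolding Y in_ideal_def by blast
qed

text \<open>Chinese remaindering for \<open>x * x - c * c\<close>. As \<open>k\<close> is an inverse
  of \<open>2 * c\<close> and \<open>k'\<close> its negative, \<open>L + x * R\<close> is
  \<open>k * ((x + c) * U - (x - c) * V)\<close> modulo \<open>Q\<close>. Inserting \<open>E\<close>
  for \<open>U\<close> and \<open>V\<close> gives \<open>2 * k * c * E\<close>, which is
  \<open>E\<close>, and the deviations of \<open>U\<close> and \<open>V\<close> from
  \<open>E\<close> become multiples of \<open>x * x - c * c\<close>.\<close>

lemma ideal_combine:
  fixes x :: "int poly"
  assumes U: "in_ideal (x - c) Q (U - E)" and V: "in_ideal (x + c) Q (V - E)"
    and L: "Q dvd (s * U + s * V - L)" and R: "Q dvd (k * U + k' * V - R)"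
    and k: "Q dvd (k + k')" and s: "s = k * c" "Q dvd (2 * s - 1)"
  shows "in_ideal (x * x - c * c) Q (L + x * R - E)"
proof -
  obtain X1 Y1 where U: "U = E + X1 * (x - c) + Q * Y1"
    using U unfolding in_ideal_def by (auto simp: algebra_simps)
  obtain X2 Y2 where V: "V = E + X2 * (x + c) + Q * Y2"
    using V unfolding in_ideal_def by (auto simp: algebra_simps)
  obtain l where l: "s * U + s * V - L = Q * l" using L by (rule dvdE)
  obtain r where r: "k * U + k' * V - R = Q * r" using R by (rule dvdE)
  obtain z where z: "k + k' = Q * z" using k by (rule dvdE)
  obtain y where y: "2 * s - 1 = Q * y" using s(2) by (rule dvdE)
  have L': "L = s * U + s * V - Q * l" using l by (simp add: algebra_simps)
  have k': "k' = Q * z - k" using z by (simp add: algebra_simps)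
  have "R = k * U + k' * V - Q * r" using r by (simp add: algebra_simps)
  then have R': "R = k * U + (Q * z - k) * V - Q * r" unfolding k' .
  have "2 * s - Q * y = 1" using y by (simp add: algebra_simps)
  then have E: "E = (2 * s - Q * y) * E" by simp
  have "L + x * R - E = s * (U + V) + x * k * (U - V) + Q * (x * z * V - l - x * r) - E"
    unfolding L' R' by (simp add: algebra_simps)
  also have "\<dots> = s * (U + V) + x * k * (U - V) + Q * (x * z * V - l - x * r) - (2 * s - Q * y) * E"
    using E by simp
  also have "\<dots> = (k * X1 - k * X2) * (x * x - c * c) + Q * (x * z * V - l - x * r + y * E + (s + x * k) * Y1 + (s - x * k) * Y2)"
    unfolding U V s(1) by (simp add: algebra_simps)
  finally show ?thesis unfolding in_ideal_def by blast
qed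

lemma linear_factor_sign:
  fixes x :: "int poly"
  assumes "V = X * (x - c') + Q * Y" "c' = Q * c - c"
  shows "V = X * (x + c) + Q * (Y - X * c)"
  unfolding assms by (simp add: algebra_simps)

text \<open>Divisibility of \<open>e\<close> by \<open>2 ^ h\<close> makes every halving of the
  exponent exact, and divisibility of \<open>N\<close> hands this on to the branch with exponent
  \<open>g + N\<close>. For \<open>e = N\<close> the first generator becomes
  \<open>x^(2^h) + 1\<close> modulo the Fermat number.\<close>

theorem ifft_fft_product:
  assumes "2 \<le> N" "e < 2 * N" "2 ^ h dvd e" "2 ^ h dvd N"
    and "\<And>i. i < 2 ^ h ==> (2 ^ N + 1) dvd (fft N h e a i * fft N h e b i - c i)"
  shows "in_ideal (monom 1 (2 ^ h) - [:2 ^ e:]) [:2 ^ N + 1:] (poly_of h (ifft N h e c) - poly_of h a * poly_of h b)"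
  using assms(2-)
proof (induction h arbitrary: e a b c)
  case 0
  have "(2 ^ N + 1) dvd (c 0 - a 0 * b 0)"
    using 0(4)[of 0] by (simp add: dvd_diff_commute)
  then obtain y where y: "c 0 - a 0 * b 0 = (2 ^ N + 1) * y" by (rule dvdE)
  have "poly_of 0 (ifft N 0 e c) - poly_of 0 a * poly_of 0 b = 0 * (monom 1 (2 ^ 0) - [:2 ^ e:]) + [:2 ^ N + 1:] * [:y:]"
    using y by (simp add: algebra_simps)
  then show ?case unfolding in_ideal_def by blast
next
  case (Suc h)
  define g where "g = e div 2"
  have e: "e = 2 * g" using Suc.prems(2) unfolding g_def by (auto elim: dvdE)
  have gN: "g < N" "g < 2 * N" "g + N < 2 * N" using Suc.prems(1) e by auto
  have dN: "2 ^ h dvd N" using Suc.prems(3) by (meson dvd_trans le_imp_power_dvd lessI less_imp_le)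
  have dg: "2 ^ h dvd g" using Suc.prems(2) e by auto
  have dgN: "2 ^ h dvd g + N" using dN dg by simp
  define q :: int where "q = 2 ^ N + 1"
  let ?x = "monom 1 (2 ^ h) :: int poly"
  define A where "A = poly_of (Suc h) a"
  define B where "B = poly_of (Suc h) b"
  define al where "al = (\<lambda>i. butterfly N 0 g (a i) (a (2 ^ h + i)))"
  define ar where "ar = (\<lambda>i. butterfly N 0 (g + N) (a i) (a (2 ^ h + i)))"
  define bl where "bl = (\<lambda>i. butterfly N 0 g (b i) (b (2 ^ h + i)))"
  define br where "br = (\<lambda>i. butterfly N 0 (g + N) (b i) (b (2 ^ h + i)))"
  define u where "u = ifft N h g c"
  define v where "v = ifft N h (g + N) (\<lambda>i. c (2 ^ h + i))"
  have fft_eqs: "fft N (Suc h) e a = join h (fft N h g al) (fft N h (g + N) ar)"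
    "fft N (Suc h) e b = join h (fft N h g bl) (fft N h (g + N) br)"
    by (simp_all add: Let_def g_def al_def ar_def bl_def br_def)
  have "in_ideal (?x - [:2 ^ g:]) [:q:] (poly_of h u - poly_of h al * poly_of h bl)"
    unfolding u_def q_def
  proof (rule Suc.IH[OF gN(2) dg dN])
    fix i :: nat assume "i < 2 ^ h"
    then show "(2 ^ N + 1) dvd (fft N h g al i * fft N h g bl i - c i)"
      using Suc.prems(4)[of i] unfolding fft_eqs by simp
  qed
  moreover have "in_ideal (?x - [:2 ^ g:]) [:q:] (A - poly_of h al)" "in_ideal (?x - [:2 ^ g:]) [:q:] (B - poly_of h bl)"
    unfolding A_def B_def poly_of.simps al_def bl_def q_def
    using butterfly_dvd[of N _ 0 _ g] by (auto intro!: split_in_ideal simp: mult.commute[of "2 ^ g"])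
  ultimately have U: "in_ideal (?x - [:2 ^ g:]) [:q:] (poly_of h u - A * B)"
    using in_ideal_product by blast
  have "in_ideal (?x - [:2 ^ (g + N):]) [:q:] (poly_of h v - poly_of h ar * poly_of h br)"
    unfolding v_def q_def
  proof (rule Suc.IH[OF gN(3) dgN dN])
    fix i :: nat assume "i < 2 ^ h"
    then show "(2 ^ N + 1) dvd (fft N h (g + N) ar i * fft N h (g + N) br i - c (2 ^ h + i))"
      using Suc.prems(4)[of "2 ^ h + i"] unfolding fft_eqs by simp
  qed
  moreover have "in_ideal (?x - [:2 ^ (g + N):]) [:q:] (A - poly_of h ar)" "in_ideal (?x - [:2 ^ (g + N):]) [:q:] (B - poly_of h br)"
    unfolding A_def B_def poly_of.simps ar_def br_def q_def
    using butterfly_dvd[of N _ 0 _ "g + N"] by (auto intro!: split_in_ideal simp: mult.commute[of "2 ^ (g + N)"])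
  ultimately have "in_ideal (?x - [:2 ^ (g + N):]) [:q:] (poly_of h v - A * B)"
    using in_ideal_product by blast
  then obtain X Y where XY: "poly_of h v - A * B = X * (?x - [:2 ^ (g + N):]) + [:q:] * Y"
    unfolding in_ideal_def by blast
  \<comment> \<open>Modulo \<open>q\<close> the power \<open>2 ^ (g + N)\<close> is
    \<open>- 2 ^ g\<close>, so the right branch works modulo \<open>x + 2 ^ g\<close>.\<close>
  have "[:2 ^ (g + N):] = [:q:] * [:2 ^ g:] - [:2 ^ g:]"
    by (simp add: q_def power_add algebra_simps)
  from linear_factor_sign[OF XY this]
  have "poly_of h v - A * B = X * (?x + [:2 ^ g:]) + [:q:] * (Y - X * [:2 ^ g:])" .
  then have V: "in_ideal (?x + [:2 ^ g:]) [:q:] (poly_of h v - A * B)"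
    unfolding in_ideal_def by blast
  define L where "L = (\<lambda>i. butterfly N (2 * N - 1) (2 * N - 1) (u i) (v i))"
  define R where "R = (\<lambda>i. butterfly N (2 * N - 1 - g) (N - 1 - g) (u i) (v i))"
  have W: "poly_of (Suc h) (ifft N (Suc h) e c) = poly_of h L + ?x * poly_of h R"
  proof -
    have "ifft N (Suc h) e c = join h L R"
      by (simp add: Let_def g_def L_def R_def u_def v_def)
    moreover have "poly_of h (join h L R) = poly_of h L" "poly_of h (\<lambda>i. join h L R (2 ^ h + i)) = poly_of h R"
      by (auto intro!: poly_eqI simp: coeff_poly_of)
    ultimately show ?thesis by simp
  qed
  let ?s = "2 ^ (2 * N - 1) :: int" and ?k = "2 ^ (2 * N - 1 - g) :: int" and ?k' = "2 ^ (N - 1 - g) :: int"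
  have "in_ideal (?x * ?x - [:2 ^ g:] * [:2 ^ g:]) [:q:] (poly_of h L + ?x * poly_of h R - A * B)"
  proof (rule ideal_combine[OF U V, of "[:?s:]" _ "[:?k:]" "[:?k':]"])
    show "[:q:] dvd ([:?s:] * poly_of h u + [:?s:] * poly_of h v - poly_of h L)"
      unfolding L_def q_def using butterfly_dvd[of N _ "2 * N - 1" _ "2 * N - 1"]
      by (intro poly_of_dvd) (simp add: mult.commute)
    show "[:q:] dvd ([:?k:] * poly_of h u + [:?k':] * poly_of h v - poly_of h R)"
      unfolding R_def q_def using butterfly_dvd[of N _ "2 * N - 1 - g" _ "N - 1 - g"]
      by (intro poly_of_dvd) (simp add: mult.commute)
    have "2 * N - 1 - g = N + (N - 1 - g)" using gN by simp
    then have "?k + ?k' = q * ?k'" by (simp add: power_add q_def algebra_simps)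
    then show "[:q:] dvd ([:?k:] + [:?k':])" by simp
    have "2 * N - 1 = (2 * N - 1 - g) + g" using gN by simp
    then have "?s = ?k * 2 ^ g" by (metis power_add)
    then show "[:?s:] = [:?k:] * [:2 ^ g:]" by simp
    have "2 * ?s = 2 ^ N * 2 ^ N"
      using assms(1) by (simp add: power_add[symmetric] power_Suc[symmetric] del: power_Suc)
    then have "2 * ?s - 1 = q * (2 ^ N - 1)" by (simp add: q_def algebra_simps)
    then have "q dvd 2 * ?s - 1" by simp
    moreover have "[:?s:] + [:?s:] - [:1:] = [:?s + ?s - 1:]" by (simp only: add_pCons diff_pCons add.left_neutral diff_self)
    then have "2 * [:?s:] - 1 = [:2 * ?s - 1:]" by (simp only: mult_2 pCons_one)
    ultimately show "[:q:] dvd (2 * [:?s:] - 1)" unfolding const_poly_dvd_iff by (auto simp: coeff_pCons split: nat.split)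
  qed
  moreover have "?x * ?x = monom 1 (2 ^ Suc h)" by (simp add: mult_monom mult_2)
  moreover have "[:2 ^ g:] * [:2 ^ g:] = [:2 ^ e :: int:]" using e by (simp add: mult_2 power_add)
  ultimately show ?case unfolding W A_def B_def q_def by simp
qed


text \<open>\<open>x^k + 1\<close> is monic and \<open>D\<close> has degree below \<open>k\<close>.
  Comparing the coefficients from \<open>k\<close> on shows, from the top downwards, that
  \<open>q\<close> divides every coefficient of the cofactor \<open>X\<close>.\<close>

lemma ideal_coeff_dvd:
  fixes D :: "int poly"
  assumes "D = X * (monom 1 k + 1) + [:q:] * Y" "\<And>i. k \<le> i ==> coeff D i = 0" "0 < k"
  shows "q dvd coeff D i"
proof -
  have cD: "coeff D i = (if i < k then 0 else coeff X (i - k)) + coeff X i + q * coeff Y i" for i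
    unfolding assms(1) by (simp add: distrib_left mult.commute[of X] coeff_monom_mult)
  have X: "q dvd coeff X n" for n
  proof (induction "Suc (degree X) - n" arbitrary: n rule: less_induct)
    case less
    show ?case
    proof (cases "n \<le> degree X")
      case True
      have "q dvd coeff X (n + k)"
        by (rule less) (use True assms(3) in simp)
      moreover have "0 = coeff X n + coeff X (n + k) + q * coeff Y (n + k)"
        using cD[of "n + k"] assms(2)[of "n + k"] by simp
      then have "coeff X n = - (coeff X (n + k) + q * coeff Y (n + k))" by simp
      ultimately show ?thesis by simp
    qed (simp add: Polynomial.coeff_eq_0)
  qed
  show ?thesis unfolding cD using X by simp
qed

section \<open>From convolutions to products of integers\<close>

lemma coeff_mult_bound:
  assumes "\<And>i. i < k ==> \<bar>coeff A i\<bar> \<le> m" "\<And>i. k \<le> i ==> coeff A i = 0"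
    and "\<And>i. \<bar>coeff B i\<bar> \<le> (m::int)"
  shows "\<bar>coeff (A * B) n\<bar> \<le> int k * (m * m)"
proof -
  have m: "0 \<le> m" using assms(3)[of 0] by simp
  have "\<bar>coeff (A * B) n\<bar> \<le> (\<Sum>i\<le>n. \<bar>coeff A i * coeff B (n - i)\<bar>)"
    unfolding coeff_mult by (rule sum_abs)
  also have "\<dots> \<le> (\<Sum>i\<le>n. if i < k then m * m else 0)"
  proof (rule sum_mono)
    fix i
    show "\<bar>coeff A i * coeff B (n - i)\<bar> \<le> (if i < k then m * m else 0)"
    proof (cases "i < k")
      case True
      then show ?thesis unfolding abs_mult using assms(1,3) m by (auto intro: mult_mono)
    qed (use assms(2) in simp)
  qed
  also have "\<dots> = (\<Sum>i\<in>{..n} \<inter> {..<k}. m * m)"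
    by (subst sum.inter_restrict) auto
  also have "\<dots> = int (card ({..n} \<inter> {..<k})) * (m * m)" by simp
  also have "\<dots> \<le> int k * (m * m)"
  proof (rule mult_right_mono)
    show "int (card ({..n} \<inter> {..<k})) \<le> int k"
      using card_mono[of "{..<k}" "{..n} \<inter> {..<k}"] by auto
  qed (use m in simp)
  finally show ?thesis .
qed

lemma pack_poly: "pack N h w a = poly (poly_of h (\<lambda>i. center N (a i))) (2 ^ w)"
  by (induction h arbitrary: a) (auto simp: poly_monom power_mult mult.commute)

lemma poly_digits: "poly (poly_of h (digits h w x)) (2 ^ w) = x"
proof (induction h arbitrary: x)
  case (Suc h)
  have "poly_of h (join h a b) = poly_of h a" "poly_of h (\<lambda>i. join h a b (2 ^ h + i)) = poly_of h b" for a b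
    by (auto intro!: poly_eqI simp: coeff_poly_of)
  then show ?case
    by (simp add: Suc.IH poly_monom power_mult[symmetric] mod_mult_div_eq)
qed simp

text \<open>After centring, the two numbers are congruent and less than the modulus apart.\<close>

lemma center_eq:
  assumes "-1 \<le> r" "r \<le> 2 ^ N" "\<bar>z\<bar> \<le> 2 ^ (N - 1)" "(2 ^ N + 1) dvd (r - z)" "1 \<le> N"
  shows "center N r = z"
proof -
  have N: "(2::int) ^ N = 2 * 2 ^ (N - 1)" using assms(5) by (cases N) auto
  have one: "1 \<le> (2::int) ^ (N - 1)" by simp
  have "(2 ^ N + 1) dvd (center N r - z)"
  proof (cases "2 ^ (N - 1) < r")
    case True
    have "r - 2 ^ N - 1 - z = (r - z) - (2 ^ N + 1)" by simp
    then show ?thesis using assms(4) True unfolding center_def by (simp only: if_True) (rule dvd_diff, auto)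
  qed (use assms(4) in \<open>simp add: center_def\<close>)
  moreover have "\<bar>center N r - z\<bar> < 2 ^ N + 1"
    using assms(1-3) N one unfolding center_def by (split if_split) linarith
  ultimately have "center N r - z = 0"
    by (meson dvd_imp_le_int not_less zdvd_not_zless abs_ge_zero dvd_abs_iff le_less_trans zero_less_abs_iff)
  then show ?thesis by simp
qed

text \<open>A coefficient of the product of the digit polynomials has about \<open>h + 2 * w\<close>
  bits, and wrapping subtracts two of them; the first hypothesis lets centred residues recover these
  integers exactly. Evaluation at \<open>2 ^ w\<close> turns \<open>x^(2^h) + 1\<close> into
  \<open>2 ^ (w * 2 ^ h) + 1\<close>.\<close>

theorem pack_product:
  assumes h: "h + 2 * w + 1 \<le> N - 1" and N: "2 \<le> N" "2 ^ h dvd N"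
    and x: "\<bar>x\<bar> \<le> 2 ^ (w * 2 ^ h)" and y: "\<bar>y\<bar> \<le> 2 ^ (w * 2 ^ h)"
    and c: "\<And>i. i < 2 ^ h ==> -1 \<le> c i \<and> c i \<le> 2 ^ N"
    and d: "\<And>i. i < 2 ^ h ==> (2 ^ N + 1) dvd (fft N h N (digits h w x) i * fft N h N (digits h w y) i - c i)"
  shows "(2 ^ (w * 2 ^ h) + 1) dvd (x * y - pack N h w (ifft N h N c))"
proof -
  let ?k = "2 ^ h :: nat"
  define A where "A = poly_of h (digits h w x)"
  define B where "B = poly_of h (digits h w y)"
  define P where "P = A * B"
  define T where "T = poly_of h (\<lambda>s. coeff P (?k + s))"
  \<comment> \<open>The negacyclic convolution: degree \<open>2 ^ h + s\<close> wraps around to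
    \<open>s\<close> with a minus sign.\<close>
  define z where "z = (\<lambda>s. coeff P s - coeff P (?k + s))"
  define r where "r = ifft N h N c"
  have zero: "coeff A i = 0" "coeff B i = 0" if "?k \<le> i" for i
    using that by (auto simp: A_def B_def coeff_poly_of)
  have P0: "coeff P i = 0" if "2 * ?k \<le> i" for i
    unfolding P_def coeff_mult
  proof (rule sum.neutral, rule ballI)
    fix j assume "j \<in> {..i}"
    then show "coeff A j * coeff B (i - j) = 0"
      using zero(1)[of j] zero(2)[of "i - j"] that by (cases "?k \<le> j") auto
  qed
  have PZ: "P - poly_of h z = (monom 1 ?k + 1) * T"
  proof (rule poly_eqI)
    fix i
    show "coeff (P - poly_of h z) i = coeff ((monom 1 ?k + 1) * T) i"
      using P0[of i] by (auto simp: distrib_right coeff_monom_mult T_def coeff_poly_of z_def not_less)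
  qed
  define Q where "Q = [:2 ^ N + 1 :: int:]"
  have N1: "monom 1 ?k - [:2 ^ N:] = (monom 1 ?k + 1) - Q"
  proof -
    have "[:2 ^ N + 1 :: int:] = [:2 ^ N:] + [:1:]" by (simp only: add_pCons add.left_neutral)
    then show ?thesis unfolding Q_def pCons_one by simp
  qed
  have "in_ideal (monom 1 ?k - [:2 ^ N:]) [:2 ^ N + 1:] (poly_of h r - P)"
    unfolding r_def P_def A_def B_def by (rule ifft_fft_product) (use N d in auto)
  then obtain X Y where "poly_of h r - P = X * (monom 1 ?k - [:2 ^ N:]) + Q * Y"
    unfolding in_ideal_def Q_def by blast
  then have "poly_of h r - poly_of h z = (X + T) * (monom 1 ?k + 1) + Q * (Y - X)"
    using PZ unfolding N1 by (simp add: algebra_simps)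
  then have "poly_of h r - poly_of h z = (X + T) * (monom 1 ?k + 1) + [:2 ^ N + 1:] * (Y - X)"
    by (simp only: Q_def)
  then have "(2 ^ N + 1) dvd coeff (poly_of h r - poly_of h z) i" for i
    by (rule ideal_coeff_dvd) (auto simp: coeff_poly_of)
  from this have dvd: "(2 ^ N + 1) dvd (r i - z i)" if "i < ?k" for i
    using that by (metis coeff_poly_of coeff_diff)
  have cA: "\<bar>coeff A i\<bar> \<le> 2 ^ w" "\<bar>coeff B i\<bar> \<le> 2 ^ w" for i
    using digits_size[OF x] digits_size[OF y] by (auto simp: A_def B_def coeff_poly_of)
  have Pb: "\<bar>coeff P i\<bar> \<le> 2 ^ (h + 2 * w)" for i
  proof -
    have "\<bar>coeff P i\<bar> \<le> int ?k * (2 ^ w * 2 ^ w)"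
      unfolding P_def by (rule coeff_mult_bound) (use cA zero in auto)
    then show ?thesis by (simp add: power_add mult_2)
  qed
  have zb: "\<bar>z i\<bar> \<le> 2 ^ (N - 1)" for i
  proof -
    have "\<bar>z i\<bar> \<le> 2 ^ (h + 2 * w) + 2 ^ (h + 2 * w)"
      unfolding z_def using Pb[of i] Pb[of "?k + i"] by linarith
    also have "\<dots> = 2 ^ (h + 2 * w + 1)" by simp
    also have "\<dots> \<le> 2 ^ (N - 1)" by (rule power_increasing[OF h]) simp
    finally show ?thesis .
  qed
  have "center N (r i) = z i" if "i < ?k" for i
    using ifft_range[OF N(1) _ c that, of N] N(1) dvd[OF that] zb[of i] unfolding r_def by (intro center_eq) auto
  then have "poly_of h (\<lambda>i. center N (r i)) = poly_of h z"
    by (intro poly_eqI) (simp add: coeff_poly_of)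
  then have "pack N h w r = poly (poly_of h z) (2 ^ w)" by (simp add: pack_poly)
  also have "poly_of h z = P - (monom 1 ?k + 1) * T" using PZ by (simp add: algebra_simps)
  finally have "x * y - pack N h w r = (2 ^ (w * 2 ^ h) + 1) * poly T (2 ^ w)"
    by (simp add: P_def A_def B_def poly_digits poly_monom power_mult)
  then show ?thesis by (simp add: r_def)
qed


section \<open>Fast multiplication of integers\<close>

text \<open>
  Multiplication modulo \<open>2^(2^j) + 1\<close>, following Schoenhage and Strassen: the factors are cut into
  \<open>2^i\<close> digits of \<open>w = 2^(j-i)\<close> bits, whose negacyclic convolution is computed modulo \<open>2^(4*w) + 1\<close>.
  The pointwise products are found by a recursive call on trees.
\<close>

definition mul_code :: fexp where
  "mul_code = Test (Var 0)
     (Join (Recur [Prim Sub (Var 0) (Const 1), Var 1, Left (Var 2), Left (Var 3)])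
           (Recur [Prim Sub (Var 0) (Const 1), Var 1, Right (Var 2), Right (Var 3)]))
     (Test (Prim Lt (Var 1) (Const 64))
       (Call red_code [Prim Shl (Const 1) (Var 1), Prim Mul (Var 2) (Var 3)])
       (Let_in (Prim Add (Prim Shr (Var 1) (Const 1)) (Const 1))
       (Let_in (Prim Shl (Const 1) (Prim Sub (Var 2) (Var 0)))
       (Let_in (Prim Shl (Var 0) (Const 2))
         (Call red_code [Prim Shl (Const 1) (Var 4),
            Call pack_code [Var 0, Var 2, Var 1,
              Call ifft_code [Var 0, Var 2, Var 0,
                Recur [Var 2, Prim Add (Prim Sub (Var 4) (Var 2)) (Const 2),
                  Call fft_code [Var 0, Var 2, Var 0, Call split_code [Var 2, Var 1, Var 5]],
                  Call fft_code [Var 0, Var 2, Var 0, Call split_code [Var 2, Var 1, Var 6]]]]]])))))"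

text \<open>The exponent 4 fits the recurrence: \<open>2 ^ i\<close> products of length
  \<open>2 ^ k\<close> with \<open>2 ^ i * 2 ^ k = 4 * 2 ^ j\<close>, doubled by the tree, amount to
  a factor 8, while passing from \<open>j\<close> to \<open>k\<close>, about \<open>j / 2\<close>,
  gains nearly 16.\<close>

definition mul_cost :: "nat => nat" where
  "mul_cost j = 2 ^ 80 * (2 ^ j * j ^ 4)"

definition fermat_product :: "nat => nat => (nat => int) => (nat => int) => (nat => int) => bool" where
  "fermat_product d N a b c \<longleftrightarrow> (\<forall>i<2^d. -1 \<le> c i \<and> c i \<le> 2 ^ N \<and> (2 ^ N + 1) dvd (a i * b i - c i))"

text \<open>Since 8 is only half of 16, there is slack for the rounding in
  \<open>2 * k <= j + 3\<close> and for the transforms, which cost only \<open>2 ^ j * j\<close>.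
  From \<open>j = 64\<close> on the rounding is small enough.\<close>

lemma mul_cost_step:
  assumes "64 \<le> j" "2 * k \<le> j + 3"
  shows "8 * 2 ^ 80 * (2 ^ j * k ^ 4) + 2 ^ 70 * (2 ^ j * j) \<le> mul_cost j"
proof -
  have "64 * (j + 3) \<le> 67 * j" using assms(1) by simp
  then have "(64 * (j + 3)) ^ 4 \<le> (67 * j) ^ 4" by (rule power_mono) simp
  then have *: "64 ^ 4 * (j + 3) ^ 4 \<le> 67 ^ 4 * j ^ 4" by (simp only: power_mult_distrib)
  have "(2 * k) ^ 4 \<le> (j + 3) ^ 4" using assms(2) by (rule power_mono) simp
  then have "16 * k ^ 4 \<le> (j + 3) ^ 4" by (simp add: power_mult_distrib)
  then have "32 * k ^ 4 \<le> 3 * j ^ 4" using * by simp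
  then have "2 ^ j * (32 * k ^ 4) \<le> 2 ^ j * (3 * j ^ 4)" by (rule mult_le_mono2)
  then have 1: "32 * (2 ^ j * k ^ 4) \<le> 3 * (2 ^ j * j ^ 4)" by (simp only: mult.left_commute)
  have "j ^ 1 \<le> j ^ 4" using assms(1) by (intro power_increasing) auto
  then have 2: "2 ^ j * j \<le> 2 ^ j * j ^ 4" by simp
  have e: "(2::nat) ^ 80 = 1208925819614629174706176" "(2::nat) ^ 70 = 1180591620717411303424" by simp_all
  show ?thesis unfolding mul_cost_def e using 1 2 by linarith
qed

lemma abs_le_powerI: "-1 \<le> x \<and> x \<le> 2 ^ N ==> \<bar>x::int\<bar> \<le> 2 ^ N"
  using one_le_power[of "2::int" N] by linarith

text \<open>\<open>Self\<close> offers a single recursive function, so one body serves trees of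
  operands as well as single numbers. The behaviour on numbers is a hypothesis, as it is supplied by
  the induction in \<open>computes_mul_leaf\<close>.\<close>

lemma computes_mul_tree:
  assumes leaf: "\<And>x y. \<bar>x\<bar> \<le> 2 ^ N ==> \<bar>y\<bar> \<le> 2 ^ N ==>
      \<exists>z. -1 \<le> z \<and> z \<le> 2 ^ N \<and> (2 ^ N + 1) dvd (x * y - z) \<and>
        computes M mul_code [Atom (int 0), Atom (int j), Atom x, Atom y] (Atom z) K"
    and N: "N = 2 ^ j" "1000 * N \<le> K" "1 \<le> N"
    and "d \<le> N" "\<And>i. i < 2 ^ d ==> \<bar>a i\<bar> \<le> 2 ^ N" "\<And>i. i < 2 ^ d ==> \<bar>b i\<bar> \<le> 2 ^ N"
  shows "\<exists>c. fermat_product d N a b c \<and>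
    computes M mul_code [Atom (int d), Atom (int j), tree d a, tree d b] (tree d c) (tree_cost' K d)"
  using assms(5-)
proof (induction d arbitrary: a b)
  case 0
  then obtain z where "-1 \<le> z \<and> z \<le> 2 ^ N \<and> (2 ^ N + 1) dvd (a 0 * b 0 - z) \<and>
        computes M mul_code [Atom (int 0), Atom (int j), Atom (a 0), Atom (b 0)] (Atom z) K"
    using leaf[of "a 0" "b 0"] by auto
  then show ?case
    by (intro exI[of _ "\<lambda>_. z"]) (auto simp: fermat_product_def tree_cost'_0)
next
  case (Suc d)
  let ?a = "\<lambda>i. a (2 ^ d + i)" and ?b = "\<lambda>i. b (2 ^ d + i)"
  have p: "d \<le> N" "\<And>i. i < 2 ^ d ==> \<bar>a i\<bar> \<le> 2 ^ N" "\<And>i. i < 2 ^ d ==> \<bar>b i\<bar> \<le> 2 ^ N"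
    "\<And>i. i < 2 ^ d ==> \<bar>?a i\<bar> \<le> 2 ^ N" "\<And>i. i < 2 ^ d ==> \<bar>?b i\<bar> \<le> 2 ^ N"
    using Suc.prems by auto
  obtain c1 where c1: "fermat_product d N a b c1"
    "computes M mul_code [Atom (int d), Atom (int j), tree d a, tree d b] (tree d c1) (tree_cost' K d)"
    using Suc.IH[of a b] p by blast
  obtain c2 where c2: "fermat_product d N ?a ?b c2"
    "computes M mul_code [Atom (int d), Atom (int j), tree d ?a, tree d ?b] (tree d c2) (tree_cost' K d)"
    using Suc.IH[of ?a ?b] p by blast
  have t: "vsize (tree d a) \<le> N + 2" "vsize (tree d b) \<le> N + 2" "vsize (tree d ?a) \<le> N + 2" "vsize (tree d ?b) \<le> N + 2"
    by (rule vsize_tree_range; use p in simp)+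
  have v: "vsize (tree d c1) \<le> N + 2" "vsize (tree d c2) \<le> N + 2"
    by (rule vsize_tree_range, rule abs_le_powerI, use c1(1) c2(1) in \<open>simp add: fermat_product_def\<close>)+
  have j: "j \<le> N" using less_exp[of j] N(1) by simp
  let ?ws = "[(Atom (int (Suc d)), N + 1), (Atom (int j), N + 1), (tree (Suc d) a, 1), (tree (Suc d) b, 1)]"
  have "computes M mul_code [Atom (int (Suc d)), Atom (int j), tree (Suc d) a, tree (Suc d) b] (tree (Suc d) (join d c1 c2)) (tree_cost' K (Suc d))"
    apply (rule computesI[OF mul_code_def, where ws = ?ws])
    apply (rule bounded_Test_then, (rule bnds | (simp; fail))+)
    apply (unfold tree.simps)
    apply (rule bounded_Recur[OF c1(2) v(1)])
    apply (rule bnds t | (simp; fail))+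
    apply (rule bounded_Recur[OF c2(2) v(2)])
    apply (rule bnds t | (simp; fail))+
    subgoal using Suc.prems(1) j bit_size_of_nat[of j] bit_size_of_nat[of "Suc d"] by auto
    subgoal apply simp unfolding tree_cost'_Suc using N by linarith
    done
  moreover have "fermat_product (Suc d) N a b (join d c1 c2)"
    using c1(1) c2(1) unfolding fermat_product_def
    apply (auto simp: join_def)
    by (metis add_less_cancel_left le_add_diff_inverse mult_2 not_less)+
  ultimately show ?case by blast
qed


lemma add_2_le_power: "2 \<le> n ==> n + 2 \<le> (2::nat) ^ n"
  by (induction n rule: dec_induct) auto

lemma computes_mul_leaf:
  assumes "1 \<le> j" "\<bar>x\<bar> \<le> 2 ^ 2 ^ j" "\<bar>y\<bar> \<le> 2 ^ 2 ^ j"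
  shows "\<exists>z. -1 \<le> z \<and> z \<le> 2 ^ 2 ^ j \<and> (2 ^ 2 ^ j + 1) dvd (x * y - z) \<and>
    computes M mul_code [Atom (int 0), Atom (int j), Atom x, Atom y] (Atom z) (mul_cost j)"
  using assms
proof (induction j arbitrary: x y rule: less_induct)
  case (less j)
  define n where "n = (2::nat) ^ j"
  have n: "j < n" "2 \<le> n"
    using less_exp[of j] power_increasing[OF less.prems(1), of "2::nat"] by (auto simp: n_def)
  have xy: "\<bar>x\<bar> \<le> 2 ^ n" "\<bar>y\<bar> \<le> 2 ^ n" using less.prems by (auto simp: n_def)
  have bxy: "bit_size x \<le> n + 2" "bit_size y \<le> n + 2" using bit_size_le_power[OF xy(1)] bit_size_le_power[OF xy(2)] by auto
  let ?ws = "[(Atom (int 0), 1), (Atom (int j), j + 1), (Atom x, n + 2), (Atom y, n + 2)]"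
  have pn: "(2::int) ^ j = int n" by (simp add: n_def)
  have valid: "valid ?ws" using bxy bit_size_of_nat[of j] by simp
  show ?case
  proof (cases "j < 64")
    case True
    have xyr: "\<bar>x * y\<bar> \<le> 2 ^ (3 * n)"
    proof -
      have "\<bar>x * y\<bar> \<le> 2 ^ n * 2 ^ n" unfolding abs_mult using xy by (intro mult_mono) auto
      also have "\<dots> \<le> 2 ^ (3 * n)" unfolding power_add[symmetric] by (rule power_increasing) auto
      finally show ?thesis .
    qed
    let ?z = "fermat_red n (x * y)"
    have z: "-1 \<le> ?z" "?z \<le> 2 ^ n" "(2 ^ n + 1) dvd (x * y - ?z)"
      using fermat_red_range[OF xyr n(2)] fermat_red_dvd by auto
    have v: "vsize (Atom ?z) \<le> n + 2" using bit_size_le_power[OF abs_fermat_red[OF xyr n(2)]] by simp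
    \<comment> \<open>Below the threshold the schoolbook cost is linear up to a constant, because
      one factor is at most about \<open>2 ^ 64\<close>.\<close>
    have n64: "n \<le> 2 ^ 64" unfolding n_def using True by (intro power_increasing) auto
    have "(n + 2) * (n + 2) \<le> (2 ^ 64 + 2) * (2 * n)"
      using n64 n(2) by (intro mult_mono) auto
    then have nn: "(n + 2) * (n + 2) \<le> 2 ^ 66 * n" by simp
    have mc: "2 ^ 80 * n \<le> mul_cost j" using less.prems(1) by (simp add: mul_cost_def n_def)
    have "computes M mul_code [Atom (int 0), Atom (int j), Atom x, Atom y] (Atom ?z) (mul_cost j)"
      apply (rule computesI[OF mul_code_def, where ws = ?ws])
      apply (rule bounded_Test_else, (rule bnds | (simp; fail))+)
      apply (rule bounded_Test_then, (rule bnds | (simp add: True; fail))+)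
      apply (rule bounded_Call[OF computes_red[OF xyr n(2)] v])
      apply (rule bnds)+
      subgoal using pn by simp
      subgoal by simp
      subgoal by simp
      subgoal by (rule valid)
      subgoal apply simp using mc nn n by simp
      done
    then show ?thesis using z unfolding n_def by blast
  next
    case False
    then have j: "64 \<le> j" by simp
    \<comment> \<open>Number and length of the digits are balanced, rounded so that
      \<open>i <= k\<close>; then \<open>2 ^ i\<close> divides \<open>m = 2 ^ k\<close>, as the
      transform requires. The 2 in \<open>k\<close> gives \<open>m = 4 * w\<close>, room for
      coefficients of about \<open>2 * w + i\<close> bits.\<close>
    define i where "i = j div 2 + 1"
    define k where "k = j - i + 2"
    define w where "w = (2::nat) ^ (j - i)"
    define m where "m = (2::nat) ^ k"
    have i: "i \<le> j" "i \<le> k" "2 * k \<le> j + 3" "k < j" "1 \<le> k" "30 \<le> j - i" using j by (auto simp: i_def k_def)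
    have wi: "w * 2 ^ i = n" unfolding w_def n_def using i by (simp add: power_add[symmetric])
    have m: "m = 4 * w" by (simp add: m_def k_def w_def power_add)
    have w30: "2 ^ 30 \<le> w" unfolding w_def using i by (intro power_increasing) auto
    have iw: "i \<le> w"
    proof -
      have "i \<le> (j - i) + 2" using i by (simp add: k_def)
      also have "\<dots> \<le> 2 ^ (j - i)" using i(6) by (intro add_2_le_power) simp
      finally show ?thesis by (simp add: w_def)
    qed
    have m2: "2 \<le> m" "m < 2 * m" "i \<le> m" "1 \<le> w" "1 \<le> m" using m w30 iw by auto
    have mn: "m \<le> n"
    proof -
      have "(2::nat) ^ 2 \<le> 2 ^ i" using j by (intro power_increasing) (auto simp: i_def)
      then show ?thesis unfolding m wi[symmetric] by simp
    qed
    have x: "\<bar>x\<bar> \<le> 2 ^ (w * 2 ^ i)" "\<bar>y\<bar> \<le> 2 ^ (w * 2 ^ i)" using xy by (simp_all add: wi)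
    have wm: "(2::int) ^ w \<le> 2 ^ m" using m by (intro power_increasing) auto
    have dm: "\<bar>digits i w x s\<bar> \<le> 2 ^ m" "\<bar>digits i w y s\<bar> \<le> 2 ^ m" if "s < 2 ^ i" for s
      using digits_size[OF x(1) that] digits_size[OF x(2) that] wm by linarith+
    define fx where "fx = fft m i m (digits i w x)"
    define fy where "fy = fft m i m (digits i w y)"
    have fm: "\<bar>fx s\<bar> \<le> 2 ^ m" "\<bar>fy s\<bar> \<le> 2 ^ m" if "s < 2 ^ i" for s
      unfolding fx_def fy_def using m2 dm that by (auto intro!: fft_range)
    have k1000: "1000 * m \<le> mul_cost k"
    proof -
      have "1 \<le> k ^ 4" using i(5) by simp
      then have "m * 1 \<le> m * k ^ 4" by (rule mult_le_mono2)
      then show ?thesis by (simp add: mul_cost_def m_def)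
    qed
    obtain c where c: "fermat_product i m fx fy c"
      "computes M mul_code [Atom (int i), Atom (int k), tree i fx, tree i fy] (tree i c) (tree_cost' (mul_cost k) i)"
      using computes_mul_tree[where N = m and j = k and K = "mul_cost k" and d = i and a = fx and b = fy and M = M]
        less.IH[OF i(4,5)] m2 k1000 fm unfolding m_def by blast
    have cr: "-1 \<le> c s \<and> c s \<le> 2 ^ m" if "s < 2 ^ i" for s using c(1) that by (simp add: fermat_product_def)
    define r where "r = ifft m i m c"
    have rr: "\<bar>r s\<bar> \<le> 2 ^ m" if "s < 2 ^ i" for s
      unfolding r_def by (rule abs_le_powerI, rule ifft_range) (use m2 cr that in auto)
    define p where "p = pack m i w r"
    have prod: "(2 ^ n + 1) dvd (x * y - p)"
      unfolding p_def r_def wi[symmetric]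
    proof (rule pack_product)
      show "i + 2 * w + 1 \<le> m - 1" using m iw w30 by simp
      show "2 ^ i dvd m" unfolding m_def using i(2) by (rule le_imp_power_dvd)
    qed (use m2 x cr c(1) in \<open>auto simp: fermat_product_def fx_def fy_def\<close>)
    have pb: "\<bar>p\<bar> \<le> 2 ^ (m + n)"
    proof -
      have "\<bar>p\<bar> \<le> 2 ^ m * (2 ^ (w * 2 ^ i) - 1)" unfolding p_def by (rule pack_size) (use rr m2 in auto)
      also have "\<dots> \<le> 2 ^ m * 2 ^ n" by (simp add: wi)
      finally show ?thesis by (simp add: power_add)
    qed
    have pr: "\<bar>p\<bar> \<le> 2 ^ (3 * n)"
      by (rule order_trans[OF pb], rule power_increasing) (use mn in auto)
    let ?z = "fermat_red n p"
    have z: "-1 \<le> ?z" "?z \<le> 2 ^ n"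
      using fermat_red_range[OF pr n(2)] by auto
    have "x * y - ?z = (x * y - p) + (p - ?z)" by simp
    then have zd: "(2 ^ n + 1) dvd (x * y - ?z)"
      using prod fermat_red_dvd[of n p] by (metis dvd_add)
    have v: "vsize (Atom ?z) \<le> n + 2" "vsize (Atom p) \<le> m + n + 2"
      using bit_size_le_power[OF abs_fermat_red[OF pr n(2)]] bit_size_le_power[OF pb] by simp_all
    have t: "vsize (tree i (digits i w x)) \<le> m + 2" "vsize (tree i (digits i w y)) \<le> m + 2"
      "vsize (tree i fx) \<le> m + 2" "vsize (tree i fy) \<le> m + 2" "vsize (tree i r) \<le> m + 2"
      by (rule vsize_tree_range; use dm fm rr in simp)+
    have tc: "vsize (tree i c) \<le> m + 2" by (rule vsize_tree_range, rule abs_le_powerI, rule cr)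
    have cfx: "computes M fft_code [Atom (int m), Atom (int i), Atom (int m), tree i (digits i w x)] (tree i fx) (tree_cost (50000 * m) i)"
      and cfy: "computes M fft_code [Atom (int m), Atom (int i), Atom (int m), tree i (digits i w y)] (tree i fy) (tree_cost (50000 * m) i)"
      unfolding fx_def fy_def by (rule computes_fft; use m2 dm in simp)+
    have ci: "computes M ifft_code [Atom (int m), Atom (int i), Atom (int m), tree i c] (tree i r) (tree_cost (50000 * m) i)"
      unfolding r_def by (rule computes_ifft) (use m2 cr in auto)
    have cp: "computes M pack_code [Atom (int m), Atom (int i), Atom (int w), tree i r] (Atom p) (tree_cost (2000 * (m + w)) i)"
      unfolding p_def by (rule computes_pack) (use m2 rr in auto)
    have ei: "int j div 2 + 1 = int i" "1 + int j div 2 = int i" by (simp_all add: i_def zdiv_int)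
    have ew: "nat (int j - int i) = j - i" "(2::int) ^ (j - i) = int w" "int w * 4 = int m" "int j - int i + 2 = int k"
      using i by (auto simp: w_def m k_def)
    define Z where "Z = 2 ^ j * j"
    have nZ: "n \<le> Z" "j \<le> Z" "m \<le> Z" "w \<le> Z" "1 \<le> Z"
      using n mn m less.prems(1) wi unfolding Z_def n_def[symmetric] by (auto intro: le_trans[of _ n])
    have tZ: "tree_cost (q * w) i \<le> q * Z" for q
    proof -
      have "tree_cost (q * w) i = q * (n * (i + 1))" by (simp add: tree_cost_def wi[symmetric] algebra_simps)
      also have "\<dots> \<le> q * (n * j)" using j by (intro mult_le_mono2) (simp add: i_def)
      finally show ?thesis by (simp add: Z_def n_def)
    qed
    have mono: "tree_cost a i \<le> tree_cost b i" if "a \<le> b" for a b using that by (simp add: tree_cost_def)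
    have tz: "tree_cost (50000 * m) i \<le> 200000 * Z" "tree_cost (2000 * (m + w)) i \<le> 10000 * Z" "tree_cost (2000 * (w + 1)) i \<le> 4000 * Z"
      using tZ[of 200000] tZ[of 10000] tZ[of 4000] mono[of "2000 * (w + 1)" "4000 * w"] m2 by (simp_all add: m)
    have "2 ^ i * 2 ^ k = 4 * (2::nat) ^ j" using i by (simp add: power_add[symmetric] k_def)
    moreover have "2 * 2 ^ i * mul_cost k = 2 * 2 ^ 80 * ((2 ^ i * 2 ^ k) * k ^ 4)"
      unfolding mul_cost_def by (simp only: mult_ac)
    ultimately have "2 * 2 ^ i * mul_cost k = 2 * 2 ^ 80 * ((4 * 2 ^ j) * k ^ 4)" by simp
    also have "\<dots> = 8 * 2 ^ 80 * (2 ^ j * k ^ 4)" by simp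
    finally have eq: "2 * 2 ^ i * mul_cost k = 8 * 2 ^ 80 * (2 ^ j * k ^ 4)" .
    have tr: "tree_cost' (mul_cost k) i \<le> 8 * 2 ^ 80 * (2 ^ j * k ^ 4)"
      using tree_cost'_le[of "mul_cost k" i] unfolding eq .
    note step = mul_cost_step[OF j i(3), folded Z_def]
    note S = ei ew pn
    have "computes M mul_code [Atom (int 0), Atom (int j), Atom x, Atom y] (Atom ?z) (mul_cost j)"
      apply (rule computesI[OF mul_code_def, where ws = ?ws])
      apply (rule bounded_Test_else, (rule bnds | (simp; fail))+)
      apply (rule bounded_Test_else, (rule bnds | (simp add: False; fail))+)
      apply (rule bounded_Call[OF computes_red[OF pr n(2)] v(1)])
      apply (rule bnds)+
      apply (rule bounded_Call[OF cp v(2)])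
      apply (rule bnds)+
      apply (rule bounded_Call[OF ci t(5)])
      apply (rule bnds)+
      apply (rule bounded_Recur[OF c(2) tc])
      apply (rule bnds)+
      apply (rule bounded_Call[OF cfx t(3)])
      apply (rule bnds)+
      apply (rule bounded_Call[OF computes_split[OF x(1)] t(1)])
      apply (rule bnds | (simp add: S; fail))+
      apply (rule bounded_Call[OF cfy t(4)])
      apply (rule bnds)+
      apply (rule bounded_Call[OF computes_split[OF x(2)] t(2)])
      apply (rule bnds | (simp add: S; fail))+
      subgoal by (rule valid)
      subgoal apply (simp add: S) using step tr tz nZ n by simp
      done
    then show ?thesis using z zd unfolding n_def by blast
  qed
qed


theorem computes_mul:
  assumes "1 \<le> j" "0 \<le> x" "x \<le> 2 ^ 2 ^ j" "0 \<le> y" "y \<le> 2 ^ 2 ^ j" "x * y < 2 ^ 2 ^ j"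
  shows "computes M mul_code [Atom 0, Atom (int j), Atom x, Atom y] (Atom (x * y)) (mul_cost j)"
proof -
  obtain z where z: "-1 \<le> z" "z \<le> 2 ^ 2 ^ j" "(2 ^ 2 ^ j + 1) dvd (x * y - z)"
    "computes M mul_code [Atom (int 0), Atom (int j), Atom x, Atom y] (Atom z) (mul_cost j)"
    using computes_mul_leaf[OF assms(1), of x y M] assms by auto
  have "0 \<le> x * y" using assms by simp
  \<comment> \<open>The product and its residue differ by less than the modulus, so congruence is
    equality.\<close>
  then have "\<bar>x * y - z\<bar> < 2 ^ 2 ^ j + 1" using z(1,2) assms(6) by linarith
  then have "x * y - z = 0"
    using z(3) dvd_imp_le_int[of "x * y - z" "2 ^ 2 ^ j + 1"] by linarith
  then show ?thesis using z(4) by simp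
qed

section \<open>Polynomials modulo a prime\<close>

definition map_mod_code :: fexp where
  "map_mod_code = Test (Var 0)
     (Join (Recur [Prim Sub (Var 0) (Const 1), Var 1, Left (Var 2)])
           (Recur [Prim Sub (Var 0) (Const 1), Var 1, Right (Var 2)]))
     (Prim Rem (Var 2) (Var 1))"

lemma computes_map_mod:
  assumes "0 < p" "bit_size p \<le> W" "h < W" "\<And>i. i < 2 ^ h ==> bit_size (a i) \<le> W"
  shows "computes M map_mod_code [Atom (int h), Atom p, tree h a] (tree h (\<lambda>i. a i mod p)) (tree_cost' (200 * (W * W)) h)"
  using assms(3-)
proof (induction h arbitrary: a)
  case 0
  have W: "W \<le> W * W" "1 \<le> W * W" using 0(1) by auto
  show ?case
    apply (rule computesI[OF map_mod_code_def, where ws = "[(Atom (int 0), 1), (Atom p, W), (tree 0 a, W)]"])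
    apply (rule bounded_Test_else, (rule bnds | (simp; fail))+)
    apply (unfold tree.simps)
    apply (rule bnds)+
    subgoal by (rule assms)
    subgoal by simp
    subgoal by simp
    subgoal using assms 0 by simp
    subgoal apply (simp add: tree_cost'_0) using W by linarith
    done
next
  case (Suc h)
  let ?b = "\<lambda>i. a (2 ^ h + i)"
  have p: "h < W" "\<And>i. i < 2 ^ h ==> bit_size (a i) \<le> W" "\<And>i. i < 2 ^ h ==> bit_size (?b i) \<le> W" using Suc.prems by auto
  have W0: "0 < W" using p by simp
  have W: "W \<le> W * W" "1 \<le> W * W" using W0 by auto
  have t: "vsize (tree h a) \<le> W" "vsize (tree h ?b) \<le> W"
    by (rule vsize_tree[OF _ W0]; use p in simp)+
  have bm: "bit_size (x mod p) \<le> W" for x using bit_size_mod[OF assms(1), of x] assms(2) by simp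
  have v: "vsize (tree h (\<lambda>i. a i mod p)) \<le> W" "vsize (tree h (\<lambda>i. ?b i mod p)) \<le> W"
    by (rule vsize_tree[OF _ W0]; rule bm)+
  show ?case
    apply (rule computesI[OF map_mod_code_def, where ws = "[(Atom (int (Suc h)), W + 1), (Atom p, W), (tree (Suc h) a, 1)]"])
    apply (rule bounded_Test_then, (rule bnds | (simp; fail))+)
    apply (unfold tree.simps)
    apply (rule bounded_Recur[OF Suc.IH[OF p(1,2)] v(1)], assumption)
    apply (rule bnds t | (simp; fail))+
    apply (rule bounded_Recur[OF Suc.IH[OF p(1,3)] v(2)], assumption)
    apply (rule bnds t | (simp; fail))+
    subgoal using assms(2) Suc.prems(1) bit_size_of_nat[of "Suc h"] by simp
    subgoal apply simp unfolding tree_cost'_Suc using W by linarith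
    done
qed

section \<open>Kronecker substitution\<close>

lemma poly_of_bounds:
  assumes "\<And>i. i < 2 ^ h ==> 0 \<le> a i \<and> a i < 2 ^ w"
  shows "0 \<le> poly (poly_of h a) (2 ^ w) \<and> poly (poly_of h a) (2 ^ w) < 2 ^ (w * 2 ^ h)"
  using assms
proof (induction h arbitrary: a)
  case (Suc h)
  let ?Q = "(2::int) ^ (w * 2 ^ h)"
  let ?x = "poly (poly_of h a) (2 ^ w)" and ?y = "poly (poly_of h (\<lambda>i. a (2 ^ h + i))) (2 ^ w)"
  have x: "0 \<le> ?x \<and> ?x < ?Q" by (rule Suc.IH) (use Suc.prems in auto)
  have y: "0 \<le> ?y \<and> ?y < ?Q" by (rule Suc.IH) (use Suc.prems in auto)
  have eq: "poly (poly_of (Suc h) a) (2 ^ w) = ?x + ?Q * ?y"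
    by (simp add: poly_monom power_mult[symmetric])
  have "?Q * ?y \<le> ?Q * (?Q - 1)" using y by (intro mult_left_mono) auto
  then have "?x + ?Q * ?y < ?Q * ?Q" using x by (simp add: algebra_simps)
  moreover have "?Q * ?Q = 2 ^ (w * 2 ^ Suc h)" by (simp only: exp_Suc_double power_add)
  ultimately show ?case using x y unfolding eq by simp
qed simp

text \<open>Coefficients that are nonnegative and below the base cause no carries, so splitting
  inverts evaluation.\<close>

lemma digits_poly_of:
  assumes "\<And>i. i < 2 ^ h ==> 0 \<le> a i \<and> a i < 2 ^ w" "i < 2 ^ h"
  shows "digits h w (poly (poly_of h a) (2 ^ w)) i = a i"
  using assms
proof (induction h arbitrary: a i)
  case (Suc h)
  let ?Q = "(2::int) ^ (w * 2 ^ h)"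
  let ?b = "\<lambda>i. a (2 ^ h + i)"
  let ?x = "poly (poly_of h a) (2 ^ w)" and ?y = "poly (poly_of h ?b) (2 ^ w)"
  have x: "0 \<le> ?x \<and> ?x < ?Q" by (rule poly_of_bounds) (use Suc.prems in auto)
  have eq: "poly (poly_of (Suc h) a) (2 ^ w) = ?x + ?Q * ?y"
    by (simp add: poly_monom power_mult[symmetric])
  have dm: "(?x + ?Q * ?y) mod ?Q = ?x" "(?x + ?Q * ?y) div ?Q = ?y" using x by simp_all
  have 1: "digits h w ?x i = a i" if "i < 2 ^ h" for i by (rule Suc.IH) (use that Suc.prems(1) in auto)
  have 2: "digits h w ?y i = ?b i" if "i < 2 ^ h" for i by (rule Suc.IH[of ?b]) (use that Suc.prems(1) in auto)
  show ?case
  proof (cases "i < 2 ^ h")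
    case True
    then show ?thesis unfolding digits.simps eq dm by (simp add: join_def 1)
  next
    case False
    then have "i - 2 ^ h < 2 ^ h" using Suc.prems(2) by auto
    from 2[OF this] show ?thesis unfolding digits.simps eq dm using False by (simp add: join_def)
  qed
qed simp

text \<open>The product-sum \<open>a * b + c * d\<close> modulo \<open>p\<close>, by Kronecker substitution with \<open>2^q\<close> bits per coefficient.\<close>

definition dot_code :: fexp where
  "dot_code =
     Let_in (Prim Shl (Const 1) (Var 1))
     (Let_in (Prim Add (Prim Add (Var 1) (Var 2)) (Const 1))
     (Call map_mod_code [Prim Add (Var 2) (Const 1), Var 4,
        Call split_code [Prim Add (Var 2) (Const 1), Var 1,
          Prim Add
           (Call mul_code [Const 0, Var 0, Call pack_code [Var 1, Var 2, Var 1, Var 5], Call pack_code [Var 1, Var 2, Var 1, Var 6]])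
           (Call mul_code [Const 0, Var 0, Call pack_code [Var 1, Var 2, Var 1, Var 7], Call pack_code [Var 1, Var 2, Var 1, Var 8]])]]))"

definition dot :: "int => nat => (nat => int) => (nat => int) => (nat => int) => (nat => int) => nat => int" where
  "dot p h a b c d i = coeff (poly_of h a * poly_of h b + poly_of h c * poly_of h d) i mod p"

definition residues :: "int => nat => (nat => int) => bool" where
  "residues p h a \<longleftrightarrow> (\<forall>i<2 ^ h. 0 \<le> a i \<and> a i < p)"

lemma coeff_product_residues:
  assumes "residues p h a" "residues p h b"
  shows "0 \<le> coeff (poly_of h a * poly_of h b) i" "coeff (poly_of h a * poly_of h b) i \<le> 2 ^ h * (p * p)"
    "2 ^ Suc h \<le> i ==> coeff (poly_of h a * poly_of h b) i = 0"
proof -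
  have a: "0 \<le> coeff (poly_of h a) i" "0 \<le> coeff (poly_of h b) i" for i
    using assms by (auto simp: coeff_poly_of residues_def)
  show n: "0 \<le> coeff (poly_of h a * poly_of h b) i"
    unfolding coeff_mult using a by (intro sum_nonneg mult_nonneg_nonneg)
  have p: "0 \<le> p" using assms(1) unfolding residues_def by (metis le_less_trans less_imp_le zero_less_numeral zero_less_power)
  have "\<bar>coeff (poly_of h a * poly_of h b) i\<bar> \<le> int (2 ^ h) * (p * p)"
    by (rule coeff_mult_bound) (use assms p in \<open>auto simp: coeff_poly_of residues_def less_imp_le\<close>)
  then show "coeff (poly_of h a * poly_of h b) i \<le> 2 ^ h * (p * p)" using n by simp
  assume i: "2 ^ Suc h \<le> i"
  show "coeff (poly_of h a * poly_of h b) i = 0"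
    unfolding coeff_mult
  proof (rule sum.neutral, rule ballI)
    fix j assume "j \<in> {..i}"
    then show "coeff (poly_of h a) j * coeff (poly_of h b) (i - j) = 0"
      using i by (auto simp: coeff_poly_of)
  qed
qed

text \<open>Multiplying numbers of \<open>w * 2 ^ h\<close> bits costs about
  \<open>w * 2 ^ h\<close> times the fourth power of \<open>q + h + 1 <= 2 * w\<close>, hence
  \<open>w ^ 5\<close> per coefficient. This is crude in \<open>w\<close>, but \<open>w\<close> will
  be logarithmic in the input.\<close>

definition dot_cost :: "nat => nat" where
  "dot_cost w = 2 ^ 92 * w ^ 5"

text \<open>The bound on \<open>p * p\<close> keeps every coefficient of the sum of the two products
  below \<open>2 ^ w\<close>, so neighbouring slots do not interfere. The multiplication has twice
  \<open>w * 2 ^ h\<close> bits available and therefore returns the exact integers.\<close>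

lemma computes_dot:
  assumes r: "residues p h a" "residues p h b" "residues p h c" "residues p h d"
    and p: "0 < p" and w: "w = 2 ^ q" "2 * 2 ^ h * (p * p) < 2 ^ w" "h < w" "2 \<le> w"
  shows "computes M dot_code [Atom (int h), Atom (int q), Atom p, tree h a, tree h b, tree h c, tree h d]
     (tree (Suc h) (dot p h a b c d)) (2 ^ h * dot_cost w)"
proof -
  define P where "P = poly_of h a * poly_of h b + poly_of h c * poly_of h d"
  have P: "0 \<le> coeff P i" "coeff P i < 2 ^ w" "2 ^ Suc h \<le> i ==> coeff P i = 0" for i
    using coeff_product_residues[OF r(1,2), of i] coeff_product_residues[OF r(3,4), of i] w(2) by (auto simp: P_def)
  have Pof: "P = poly_of (Suc h) (coeff P)"
    by (rule poly_eqI) (use P(3) in \<open>auto simp: coeff_poly_of simp del: poly_of.simps\<close>)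
  define X where "X = (\<lambda>e. poly (poly_of h e) (2 ^ w))"
  have pw: "2 * p \<le> 2 ^ w"
  proof -
    have "1 * (1 * p) \<le> 2 ^ h * (p * p)" using p by (intro mult_mono) auto
    then show ?thesis using w(2) by simp
  qed
  have ww: "(2::int) ^ w = 2 * 2 ^ (w - 1)" using w(4) by (cases w) auto
  have e: "residues p h e ==> i < 2 ^ h ==> 0 \<le> e i \<and> e i < 2 ^ (w - 1) \<and> e i < 2 ^ w" for e i
  proof -
    assume "residues p h e" "i < 2 ^ h"
    then have "0 \<le> e i" "e i < p" by (auto simp: residues_def)
    then show ?thesis using pw p ww by simp
  qed
  have Xb: "0 \<le> X e" "X e < 2 ^ (w * 2 ^ h)" if "residues p h e" for e
    using poly_of_bounds[of h e w] e[OF that] by (auto simp: X_def)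
  \<comment> \<open>Residues are below \<open>2 ^ (w - 1)\<close>, so the centring inside
    \<open>pack\<close> leaves them alone.\<close>
  have Xp: "pack w h w e = X e" if "residues p h e" for e
  proof -
    have "poly_of h (\<lambda>i. center w (e i)) = poly_of h e"
    proof (rule poly_eqI)
      fix i
      have "center w (e i) = e i" if "i < 2 ^ h"
        using e[OF \<open>residues p h e\<close> that] by (simp add: center_def)
      then show "coeff (poly_of h (\<lambda>i. center w (e i))) i = coeff (poly_of h e) i"
        by (simp add: coeff_poly_of)
    qed
    then show ?thesis by (simp add: pack_poly X_def)
  qed
  have XP: "X a * X b + X c * X d = poly P (2 ^ w)" by (simp add: X_def P_def)
  have pP: "0 \<le> poly P (2 ^ w) \<and> poly P (2 ^ w) < 2 ^ (w * 2 ^ Suc h)"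
    by (subst (1 2) Pof, rule poly_of_bounds) (use P in auto)
  define j where "j = q + h + 1"
  have j: "1 \<le> j" "2 ^ j = w * 2 ^ Suc h" by (simp_all add: j_def w power_add)
  have j': "2 ^ 2 ^ j = (2::int) ^ (w * 2 ^ Suc h)" by (simp add: j(2))
  have XQ: "(2::int) ^ (w * 2 ^ h) \<le> 2 ^ 2 ^ j" unfolding j' by (rule power_increasing) auto
  have Xle: "X e \<le> 2 ^ 2 ^ j" if "residues p h e" for e
    using Xb(2)[OF that] XQ by linarith
  have XX: "X e * X f < 2 ^ 2 ^ j" if "residues p h e" "residues p h f" for e f
  proof -
    have "X e * X f < 2 ^ (w * 2 ^ h) * 2 ^ (w * 2 ^ h)"
      using Xb[OF that(1)] Xb[OF that(2)] by (intro mult_strict_mono) auto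
    also have "\<dots> = 2 ^ 2 ^ j" unfolding j' exp_Suc_double power_add ..
    finally show ?thesis .
  qed
  have cm: "computes M mul_code [Atom 0, Atom (int j), Atom (X e), Atom (X f)] (Atom (X e * X f)) (mul_cost j)"
    if "residues p h e" "residues p h f" for e f
    by (rule computes_mul[OF j(1) Xb(1)[OF that(1)] Xle[OF that(1)] Xb(1)[OF that(2)] Xle[OF that(2)] XX[OF that]])
  have er: "\<bar>e i\<bar> \<le> 2 ^ w" if "residues p h e" "i < 2 ^ h" for e i using e[OF that] by simp
  have cp: "computes M pack_code [Atom (int w), Atom (int h), Atom (int w), tree h e] (Atom (X e)) (tree_cost (2000 * (w + w)) h)"
    if "residues p h e" for e
    unfolding Xp[OF that, symmetric] by (rule computes_pack) (use er[OF that] w(4) in auto)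
  have pP': "\<bar>poly P (2 ^ w)\<bar> \<le> 2 ^ (w * 2 ^ Suc h)" using pP by simp
  define D where "D = digits (Suc h) w (poly P (2 ^ w))"
  have D: "D i = coeff P i" if "i < 2 ^ Suc h" for i
    unfolding D_def by (subst Pof, rule digits_poly_of) (use P that in auto)
  have DW: "bit_size (D i) \<le> w + 2" if "i < 2 ^ Suc h" for i
    using P(1,2)[of i] D[OF that] by (intro bit_size_le_power) simp
  have pW: "bit_size p \<le> w + 2" using pw p by (intro bit_size_le_power) simp
  have cs: "computes M split_code [Atom (int (Suc h)), Atom (int w), Atom (poly P (2 ^ w))] (tree (Suc h) D) (tree_cost (2000 * (w + 1)) (Suc h))"
    unfolding D_def by (rule computes_split[OF pP'])
  have cmm: "computes M map_mod_code [Atom (int (Suc h)), Atom p, tree (Suc h) D] (tree (Suc h) (\<lambda>i. D i mod p)) (tree_cost' (200 * ((w + 2) * (w + 2))) (Suc h))"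
    by (rule computes_map_mod[OF p pW]) (use w DW in auto)
  have "tree (Suc h) (\<lambda>i. D i mod p) = tree (Suc h) (dot p h a b c d)"
    by (rule tree_cong) (use D in \<open>simp add: dot_def P_def\<close>)
  note cmm = cmm[unfolded this]
  have bX: "bit_size (X e) \<le> w * 2 ^ h + 2" if "residues p h e" for e
    using Xb[OF that] by (intro bit_size_le_power) simp
  have bXX: "bit_size (X e * X f) \<le> w * 2 ^ Suc h + 2" if "residues p h e" "residues p h f" for e f
    using XX[OF that] Xb(1)[OF that(1)] Xb(1)[OF that(2)] unfolding j' by (intro bit_size_le_power) simp
  have vX: "vsize (Atom (X e)) \<le> w * 2 ^ h + 2" if "residues p h e" for e using bX[OF that] by simp
  have vXX: "vsize (Atom (X e * X f)) \<le> w * 2 ^ Suc h + 2" if "residues p h e" "residues p h f" for e f using bXX[OF that] by simp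
  have vD: "vsize (tree (Suc h) D) \<le> w + 2" by (rule vsize_tree[OF DW]) auto
  have vr: "vsize (tree (Suc h) (dot p h a b c d)) \<le> w + 2"
  proof (rule vsize_tree)
    show "bit_size (dot p h a b c d i) \<le> w + 2" for i
      unfolding dot_def using bit_size_mod[OF p] pW le_trans by blast
  qed simp
  have vt: "vsize (tree h e) \<le> w + 2" if "residues p h e" for e by (rule vsize_tree_range[OF er[OF that]])
  let ?ws = "[(Atom (int h), w + 1), (Atom (int q), w + 1), (Atom p, w + 2), (tree h a, w + 2), (tree h b, w + 2), (tree h c, w + 2), (tree h d, w + 2)]"
  have qw: "q < w" using less_exp[of q] w(1) by simp
  have ji: "int j = int q + int h + 1" "int w = 2 ^ q" by (simp_all add: j_def w(1))
  define H where "H = 2 ^ h * w ^ 5"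
  have w5: "w \<le> w ^ 5" "w * w \<le> w ^ 5" "1 \<le> w ^ 5"
    using w(4) self_le_power[of w 5] power_increasing[of 2 5 w] by (auto simp: power2_eq_square)
  have h0: "2 ^ h * w \<le> H" "2 ^ h * (w * w) \<le> H" "1 \<le> H" "w \<le> H" "2 ^ h \<le> H"
    using w5 unfolding H_def by (auto intro: mult_le_mono le_trans[OF _ mult_le_mono2[OF w5(3)]] le_trans[OF w5(1)])
  have hw: "w * 2 ^ h \<le> H" using h0(1) by (simp add: mult.commute)
  have dc: "2 ^ h * dot_cost w = 2 ^ 92 * H" by (simp add: dot_cost_def H_def)
  have mc: "mul_cost j \<le> 2 ^ 86 * H"
  proof -
    have "j ^ 4 \<le> (2 * w) ^ 4" using qw w(3) by (intro power_mono) (auto simp: j_def)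
    then have "w * 2 ^ Suc h * j ^ 4 \<le> w * 2 ^ Suc h * (2 * w) ^ 4" by (rule mult_le_mono2)
    also have "\<dots> = 32 * H" by (simp add: H_def power_mult_distrib algebra_simps eval_nat_numeral)
    finally show ?thesis unfolding mul_cost_def j(2) by simp
  qed
  have tc: "tree_cost (2000 * (w + w)) h \<le> 4000 * H" "tree_cost (2000 * (w + 1)) (Suc h) \<le> 16000 * H"
    "tree_cost' (200 * ((w + 2) * (w + 2))) (Suc h) \<le> 4000 * H"
  proof -
    have "2 ^ h * ((h + 1) * w) \<le> 2 ^ h * (w * w)" using w(3) by (intro mult_le_mono2 mult_le_mono1) simp
    then have a: "2 ^ h * ((h + 1) * w) \<le> H" using h0(2) by (rule le_trans)
    have "tree_cost (2000 * (w + w)) h = 4000 * (2 ^ h * ((h + 1) * w))" by (simp add: tree_cost_def algebra_simps)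
    then show "tree_cost (2000 * (w + w)) h \<le> 4000 * H" using a by simp
    have "tree_cost (2000 * (w + 1)) (Suc h) \<le> (h + 2) * (2 * 2 ^ h) * (2000 * (2 * w))"
      unfolding tree_cost_def using w(4) by (intro mult_le_mono) auto
    also have "\<dots> = 8000 * (2 ^ h * ((h + 1) * w)) + 8000 * (2 ^ h * w)" by (simp add: algebra_simps)
    also have "\<dots> \<le> 16000 * H" using a h0(1) by simp
    finally show "tree_cost (2000 * (w + 1)) (Suc h) \<le> 16000 * H" .
    have "(w + 2) * (w + 2) \<le> (2 * w) * (2 * w)" using w(4) by (intro mult_le_mono) auto
    then have "2 * 2 ^ Suc h * (200 * ((w + 2) * (w + 2))) \<le> 2 * 2 ^ Suc h * (200 * ((2 * w) * (2 * w)))" by simp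
    also have "\<dots> = 3200 * (2 ^ h * (w * w))" by (simp add: algebra_simps)
    finally have f: "2 * 2 ^ Suc h * (200 * ((w + 2) * (w + 2))) \<le> 3200 * (2 ^ h * (w * w))" .
    show "tree_cost' (200 * ((w + 2) * (w + 2))) (Suc h) \<le> 4000 * H"
      using le_trans[OF tree_cost'_le f] h0(2) by linarith
  qed
  show ?thesis
    apply (rule computesI[OF dot_code_def, where ws = ?ws])
    apply (rule bnds)+
    apply (rule bounded_Call[OF cmm vr])
    apply (rule bnds)+
    apply (rule bounded_Call[OF cs[folded XP] vD])
    apply (rule bnds)+
    apply (rule bounded_Call[OF cm[OF r(1,2)] vXX[OF r(1,2)]])
    apply (rule bnds)+
    apply (rule bounded_Call[OF cp[OF r(1)] vX[OF r(1)]])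
    apply (rule bnds | (simp add: ji; fail))+
    apply (rule bounded_Call[OF cp[OF r(2)] vX[OF r(2)]])
    apply (rule bnds | (simp add: ji; fail))+
    apply (rule bounded_Call[OF cm[OF r(3,4)] vXX[OF r(3,4)]])
    apply (rule bnds)+
    apply (rule bounded_Call[OF cp[OF r(3)] vX[OF r(3)]])
    apply (rule bnds | (simp add: ji; fail))+
    apply (rule bounded_Call[OF cp[OF r(4)] vX[OF r(4)]])
    apply (rule bnds | (simp add: ji; fail))+
    subgoal using vt[OF r(1)] vt[OF r(2)] vt[OF r(3)] vt[OF r(4)] pW w(3) qw bit_size_of_nat[of h] bit_size_of_nat[of q] by simp
    subgoal apply (simp add: ji dc) using mc[simplified] tc[simplified] h0 hw qw w(3) by linarith
    done
qed

section \<open>Division steps\<close>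

text \<open>
  The division steps of Bernstein and Yang on power series modulo \<open>p\<close>; they are carried out here on
  integer polynomials, since no division by elements of the field occurs.
\<close>

definition divstep :: "int => int \<times> int poly \<times> int poly => int \<times> int poly \<times> int poly" where
  "divstep p = (\<lambda>(\<delta>, f, g). let a = coeff f 0; b = coeff g 0 in
     if 0 < \<delta> \<and> \<not> p dvd b
     then (1 - \<delta>, g, poly_shift 1 (smult b f - smult a g))
     else (1 + \<delta>, f, poly_shift 1 (smult a g - smult b f)))"

definition agree :: "int => nat => int poly => int poly => bool" where
  "agree p n f g \<longleftrightarrow> (\<forall>i<n. p dvd (coeff f i - coeff g i))"

text \<open>\<open>n\<close> steps act as a polynomial matrix followed by division by
  \<open>x ^ n\<close>, and the matrix depends only on the first \<open>n\<close> coefficients of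
  the two series. The latter is built in by quantifying over all \<open>f\<close> and
  \<open>g\<close> that agree with \<open>F\<close> and \<open>G\<close> to this order.\<close>

definition transition :: "int => nat => int => int poly => int poly => int =>
    int poly => int poly => int poly => int poly => bool" where
  "transition p n \<delta> F G \<delta>' U11 U12 U21 U22 \<longleftrightarrow>
    (\<forall>f g. agree p n f F \<and> agree p n g G \<longrightarrow>
      (\<exists>f' g'. (divstep p ^^ n) (\<delta>, f, g) = (\<delta>', f', g') \<and>
         [:p:] dvd (monom 1 n * f' - (U11 * f + U12 * g)) \<and>
         [:p:] dvd (monom 1 n * g' - (U21 * f + U22 * g))))"

lemma agree_mult: "agree p n f g ==> agree p n (U * f) (U * g)"
  unfolding agree_def coeff_mult
  by (auto simp: sum_subtractf[symmetric] right_diff_distrib[symmetric] intro!: dvd_sum dvd_mult)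

lemma agree_add: "agree p n f g ==> agree p n f' g' ==> agree p n (f + f') (g + g')"
  unfolding agree_def by (metis add_diff_add coeff_add dvd_add)

lemma agree_mono: "agree p n f g ==> m \<le> n ==> agree p m f g"
  by (auto simp: agree_def)

lemma transition_weaken:
  assumes "transition p n \<delta> F G \<delta>' U11 U12 U21 U22" "agree p n F F'" "agree p n G G'"
  shows "transition p n \<delta> F' G' \<delta>' U11 U12 U21 U22"
proof -
  have "agree p n f F" if "agree p n f F'" "agree p n F F'" for f F F'
  proof -
    have "p dvd (coeff f i - coeff F' i) - (coeff F i - coeff F' i)" if "i < n" for i
      using that \<open>agree p n f F'\<close> \<open>agree p n F F'\<close> unfolding agree_def by (metis dvd_diff)
    then show ?thesis by (simp add: agree_def)
  qed
  then show ?thesis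
    using assms unfolding transition_def by blast
qed

text \<open>The second half of the steps sees the first \<open>n\<close> coefficients of the series
  reached so far. These are the coefficients \<open>n\<close> to \<open>2 * n - 1\<close> of the
  first matrix applied to \<open>F\<close> and \<open>G\<close>, which is why the composed statement
  asks for agreement to order \<open>2 * n\<close>.\<close>

lemma transition_step:
  assumes 1: "transition p n \<delta> F G \<delta>1 U11 U12 U21 U22"
    and 2: "transition p n \<delta>1 F1 G1 \<delta>2 V11 V12 V21 V22"
    and F1: "\<And>i. i < n ==> p dvd (coeff (U11 * F + U12 * G) (n + i) - coeff F1 i)"
    and G1: "\<And>i. i < n ==> p dvd (coeff (U21 * F + U22 * G) (n + i) - coeff G1 i)"
    and W: "[:p:] dvd (V11 * U11 + V12 * U21 - W11)" "[:p:] dvd (V11 * U12 + V12 * U22 - W12)"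
      "[:p:] dvd (V21 * U11 + V22 * U21 - W21)" "[:p:] dvd (V21 * U12 + V22 * U22 - W22)"
  shows "transition p (2 * n) \<delta> F G \<delta>2 W11 W12 W21 W22"
  unfolding transition_def
proof (intro allI impI)
  fix f g
  assume fg: "agree p (2 * n) f F \<and> agree p (2 * n) g G"
  let ?x = "monom 1 n :: int poly"
  have "agree p n f F" "agree p n g G" using fg agree_mono[of p "2 * n" _ _ n] by auto
  then obtain f1 g1 where fg1: "(divstep p ^^ n) (\<delta>, f, g) = (\<delta>1, f1, g1)"
    "[:p:] dvd (?x * f1 - (U11 * f + U12 * g))" "[:p:] dvd (?x * g1 - (U21 * f + U22 * g))"
    using 1 unfolding transition_def by blast
  have coeff: "p dvd (coeff f1 i - coeff F1 i)"
    if "[:p:] dvd (?x * f1 - (U * f + U' * g))" "i < n"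
      "p dvd (coeff (U * F + U' * G) (n + i) - coeff F1 i)" for f1 F1 U U' i
  proof -
    have "p dvd (coeff (?x * f1) (n + i) - coeff (U * f + U' * g) (n + i))"
      using that(1) unfolding const_poly_dvd_iff by (metis coeff_diff)
    moreover have "coeff (?x * f1) (n + i) = coeff f1 i" by (simp add: coeff_monom_mult)
    moreover have "agree p (2 * n) (U * f + U' * g) (U * F + U' * G)"
      using fg by (intro agree_add agree_mult) auto
    then have "p dvd (coeff (U * f + U' * g) (n + i) - coeff (U * F + U' * G) (n + i))"
      using that(2) unfolding agree_def by simp
    ultimately have "p dvd (coeff f1 i - coeff (U * f + U' * g) (n + i) +
       (coeff (U * f + U' * g) (n + i) - coeff (U * F + U' * G) (n + i)) +
       (coeff (U * F + U' * G) (n + i) - coeff F1 i))"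
      using that(3) by (intro dvd_add) auto
    then show ?thesis by simp
  qed
  have "agree p n f1 F1" "agree p n g1 G1"
    unfolding agree_def using coeff[OF fg1(2) _ F1] coeff[OF fg1(3) _ G1] by auto
  then obtain f2 g2 where fg2: "(divstep p ^^ n) (\<delta>1, f1, g1) = (\<delta>2, f2, g2)"
    "[:p:] dvd (?x * f2 - (V11 * f1 + V12 * g1))" "[:p:] dvd (?x * g2 - (V21 * f1 + V22 * g1))"
    using 2 unfolding transition_def by blast
  have comp: "[:p:] dvd (?x * ?x * f2 - (W * f + W' * g))"
    if "[:p:] dvd (?x * f2 - (V * f1 + V' * g1))" "[:p:] dvd (V * U11 + V' * U21 - W)" "[:p:] dvd (V * U12 + V' * U22 - W')"
    for f2 V V' W W'
  proof -
    have "?x * ?x * f2 - (W * f + W' * g) = ?x * (?x * f2 - (V * f1 + V' * g1))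
       + V * (?x * f1 - (U11 * f + U12 * g)) + V' * (?x * g1 - (U21 * f + U22 * g))
       + (V * U11 + V' * U21 - W) * f + (V * U12 + V' * U22 - W') * g"
      by (simp add: algebra_simps)
    then show ?thesis using that fg1(2,3) by (simp only: dvd_add dvd_mult dvd_mult2)
  qed
  have xx: "?x * ?x = monom 1 (2 * n)" by (simp add: mult_monom mult_2)
  have "(divstep p ^^ (2 * n)) (\<delta>, f, g) = (\<delta>2, f2, g2)"
    using fg1(1) fg2(1) by (simp add: mult_2 funpow_add)
  then show "\<exists>f' g'. (divstep p ^^ (2 * n)) (\<delta>, f, g) = (\<delta>2, f', g') \<and>
     [:p:] dvd (monom 1 (2 * n) * f' - (W11 * f + W12 * g)) \<and>
     [:p:] dvd (monom 1 (2 * n) * g' - (W21 * f + W22 * g))"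
    using comp[OF fg2(2) W(1,2)] comp[OF fg2(3) W(3,4)] unfolding xx by blast
qed

lemma monom_poly_shift: "coeff Z 0 = 0 ==> monom 1 1 * poly_shift 1 Z = (Z :: int poly)"
proof (rule poly_eqI)
  fix n
  assume "coeff Z 0 = 0"
  then show "coeff (monom 1 1 * poly_shift 1 Z) n = coeff Z n"
    by (cases n) (auto simp: coeff_monom_mult coeff_poly_shift)
qed

text \<open>The sign is absorbed into the representative \<open>(- a) mod p\<close>, so that all
  entries of the matrix are residues.\<close>

lemma transition_swap:
  assumes "0 < \<delta>" "\<not> p dvd b"
  shows "transition p 1 \<delta> [:a:] [:b:] (1 - \<delta>) 0 (monom 1 1) [:b:] [:(- a) mod p:]"
  unfolding transition_def
proof (intro allI impI)
  fix f g assume "agree p 1 f [:a:] \<and> agree p 1 g [:b:]"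
  then have ab: "p dvd (coeff f 0 - a)" "p dvd (coeff g 0 - b)" by (auto simp: agree_def)
  let ?f = "coeff f 0" and ?g = "coeff g 0"
  let ?Z = "smult ?g f - smult ?f g"
  have "\<not> p dvd ?g"
    using assms(2) ab(2) dvd_diff[of p ?g "?g - b"] by auto
  then have ds: "(divstep p ^^ 1) (\<delta>, f, g) = (1 - \<delta>, g, poly_shift 1 ?Z)"
    using assms(1) by (simp add: divstep_def Let_def)
  have x: "monom 1 1 * poly_shift 1 ?Z = ?Z" by (rule monom_poly_shift) simp
  have am: "p dvd (- ?f - (- a) mod p)"
  proof -
    have "- ?f - (- a) mod p = - (?f - a) + (- a - (- a) mod p)" by simp
    moreover have "p dvd (- a - (- a) mod p)" by (simp add: minus_mod_eq_mult_div)
    ultimately show ?thesis using ab(1) by (simp only: dvd_add dvd_minus_iff)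
  qed
  have "?Z - ([:b:] * f + [:(- a) mod p:] * g) = [:?g - b:] * f + [:- ?f - (- a) mod p:] * g"
    by (simp add: algebra_simps smult_diff_left)
  moreover have "[:p:] dvd [:?g - b:]" "[:p:] dvd [:- ?f - (- a) mod p:]"
    using ab(2) am by (auto simp: const_poly_dvd_iff coeff_pCons split: nat.split)
  ultimately have "[:p:] dvd (?Z - ([:b:] * f + [:(- a) mod p:] * g))"
    by (simp only: dvd_add dvd_mult2)
  then show "\<exists>f' g'. (divstep p ^^ 1) (\<delta>, f, g) = (1 - \<delta>, f', g') \<and>
     [:p:] dvd (monom 1 1 * f' - (0 * f + monom 1 1 * g)) \<and>
     [:p:] dvd (monom 1 1 * g' - ([:b:] * f + [:(- a) mod p:] * g))"
    unfolding ds by (intro exI[of _ g] exI[of _ "poly_shift 1 ?Z"]) (simp only: x, simp)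
qed

lemma transition_no_swap:
  assumes "\<not> (0 < \<delta> \<and> \<not> p dvd b)"
  shows "transition p 1 \<delta> [:a:] [:b:] (1 + \<delta>) (monom 1 1) 0 [:(- b) mod p:] [:a:]"
  unfolding transition_def
proof (intro allI impI)
  fix f g assume "agree p 1 f [:a:] \<and> agree p 1 g [:b:]"
  then have ab: "p dvd (coeff f 0 - a)" "p dvd (coeff g 0 - b)" by (auto simp: agree_def)
  let ?f = "coeff f 0" and ?g = "coeff g 0"
  let ?Z = "smult ?f g - smult ?g f"
  have "p dvd ?g \<longleftrightarrow> p dvd b"
    using ab(2) dvd_diff[of p ?g "?g - b"] dvd_add[of p "?g - b" b] by auto
  then have ds: "(divstep p ^^ 1) (\<delta>, f, g) = (1 + \<delta>, f, poly_shift 1 ?Z)"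
    using assms(1) by (auto simp: divstep_def Let_def)
  have x: "monom 1 1 * poly_shift 1 ?Z = ?Z" by (rule monom_poly_shift) simp
  have am: "p dvd (- ?g - (- b) mod p)"
  proof -
    have "- ?g - (- b) mod p = - (?g - b) + (- b - (- b) mod p)" by simp
    moreover have "p dvd (- b - (- b) mod p)" by (simp add: minus_mod_eq_mult_div)
    ultimately show ?thesis using ab(2) by (simp only: dvd_add dvd_minus_iff)
  qed
  have "?Z - ([:(- b) mod p:] * f + [:a:] * g) = [:- ?g - (- b) mod p:] * f + [:?f - a:] * g"
    by (simp add: algebra_simps smult_diff_left)
  moreover have "[:p:] dvd [:?f - a:]" "[:p:] dvd [:- ?g - (- b) mod p:]"
    using ab(1) am by (auto simp: const_poly_dvd_iff coeff_pCons split: nat.split)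
  ultimately have "[:p:] dvd (?Z - ([:(- b) mod p:] * f + [:a:] * g))"
    by (simp only: dvd_add dvd_mult2)
  then show "\<exists>f' g'. (divstep p ^^ 1) (\<delta>, f, g) = (1 + \<delta>, f', g') \<and>
     [:p:] dvd (monom 1 1 * f' - (monom 1 1 * f + 0 * g)) \<and>
     [:p:] dvd (monom 1 1 * g' - ([:(- b) mod p:] * f + [:a:] * g))"
    unfolding ds by (intro exI[of _ f] exI[of _ "poly_shift 1 ?Z"]) (simp only: x, simp)
qed

section \<open>Divide and conquer on the number of steps\<close>

definition jump_code :: fexp where
  "jump_code = Test (Var 0)
     (Let_in (Recur [Prim Sub (Var 0) (Const 1), Var 1, Var 2, Var 3, Left (Var 4), Left (Var 5)])
     (Let_in (Right (Left (Call dot_code [Var 1, Var 2, Var 3, Left (Left (Right (Var 0))), Var 5, Right (Left (Right (Var 0))), Var 6])))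
     (Let_in (Right (Left (Call dot_code [Var 2, Var 3, Var 4, Left (Right (Right (Var 1))), Var 6, Right (Right (Right (Var 1))), Var 7])))
     (Let_in (Recur [Prim Sub (Var 3) (Const 1), Var 4, Var 5, Left (Var 2), Var 1, Var 0])
     (Join (Left (Var 0))
       (Join
         (Join (Call dot_code [Var 4, Var 5, Var 6, Left (Left (Right (Var 0))), Left (Left (Right (Var 3))),
                  Right (Left (Right (Var 0))), Left (Right (Right (Var 3)))])
               (Call dot_code [Var 4, Var 5, Var 6, Left (Left (Right (Var 0))), Right (Left (Right (Var 3))),
                  Right (Left (Right (Var 0))), Right (Right (Right (Var 3)))]))
         (Join (Call dot_code [Var 4, Var 5, Var 6, Left (Right (Right (Var 0))), Left (Left (Right (Var 3))),
                  Right (Right (Right (Var 0))), Left (Right (Right (Var 3)))])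
               (Call dot_code [Var 4, Var 5, Var 6, Left (Right (Right (Var 0))), Right (Left (Right (Var 3))),
                  Right (Right (Right (Var 0))), Right (Right (Right (Var 3)))]))))))))
     (Test (Prim Mul (Prim Lt (Const 0) (Var 3)) (Var 5))
       (Join (Prim Sub (Const 1) (Var 3))
         (Join (Join (Join (Const 0) (Const 0)) (Join (Const 0) (Const 1)))
               (Join (Join (Var 5) (Const 0)) (Join (Prim Rem (Prim Sub (Const 0) (Var 4)) (Var 2)) (Const 0)))))
       (Join (Prim Add (Const 1) (Var 3))
         (Join (Join (Join (Const 0) (Const 1)) (Join (Const 0) (Const 0)))
               (Join (Join (Prim Rem (Prim Sub (Const 0) (Var 5)) (Var 2)) (Const 0)) (Join (Var 4) (Const 0))))))"

text \<open>The counter, followed by the two rows of the matrix. After \<open>2 ^ h\<close> steps an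
  entry can have degree \<open>2 ^ h\<close>, one more than a tree of height \<open>h\<close> can
  hold; hence the entries are stored with height \<open>Suc h\<close>.\<close>

definition jump_val :: "nat => int => (nat => int) => (nat => int) => (nat => int) => (nat => int) => val" where
  "jump_val h \<delta> a b c d = Node (Atom \<delta>) (Node (Node (tree h a) (tree h b)) (Node (tree h c) (tree h d)))"

definition pair :: "int => int => nat => int" where
  "pair x y i = (if i = 0 then x else if i = 1 then y else 0)"

lemma tree_pair: "tree (Suc 0) (pair x y) = Node (Atom x) (Atom y)"
  by (simp add: pair_def)

lemma poly_of_pair: "poly_of (Suc 0) (pair x y) = [:x, y:]"
  by (rule poly_eqI) (simp add: coeff_poly_of pair_def coeff_pCons split: nat.split del: poly_of.simps)

lemma residues_pair: "0 \<le> x ==> x < p ==> 0 \<le> y ==> y < p ==> residues p (Suc 0) (pair x y)"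
  by (simp add: residues_def pair_def)

lemma residues_dot: "0 < p ==> residues p h' (dot p h a b c d)"
  by (simp add: residues_def dot_def)

lemma dot_agree:
  assumes "residues p h a" "residues p h b" "residues p h c" "residues p h d"
  shows "[:p:] dvd (poly_of h a * poly_of h b + poly_of h c * poly_of h d - poly_of (Suc h) (dot p h a b c d))"
  unfolding const_poly_dvd_iff
proof
  fix i
  let ?P = "poly_of h a * poly_of h b + poly_of h c * poly_of h d"
  have "2 ^ Suc h \<le> i ==> coeff ?P i = 0"
    using coeff_product_residues(3)[OF assms(1,2), of i] coeff_product_residues(3)[OF assms(3,4), of i] by simp
  then show "p dvd coeff (?P - poly_of (Suc h) (dot p h a b c d)) i"
    by (auto simp: coeff_poly_of dot_def minus_mod_eq_mult_div simp del: poly_of.simps)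
qed

text \<open>\<open>G\<close> is already reduced, so the program tests \<open>G\<close> itself
  instead of its divisibility by \<open>p\<close>.\<close>

lemma computes_jump_leaf:
  assumes p: "1 < p" and F: "0 \<le> F" "F < p" and G: "0 \<le> G" "G < p"
    and w: "w = 2 ^ q" "p \<le> 2 ^ w" "2 \<le> w" and \<delta>: "\<bar>\<delta>\<bar> \<le> 2 ^ w"
  shows "\<exists>\<delta>' a b c d. \<bar>\<delta>'\<bar> \<le> \<bar>\<delta>\<bar> + 1 \<and>
     residues p 1 a \<and> residues p 1 b \<and> residues p 1 c \<and> residues p 1 d \<and>
     transition p 1 \<delta> [:F:] [:G:] \<delta>' (poly_of 1 a) (poly_of 1 b) (poly_of 1 c) (poly_of 1 d) \<and>
     computes M jump_code [Atom 0, Atom (int q), Atom p, Atom \<delta>, Atom F, Atom G] (jump_val 1 \<delta>' a b c d) (dot_cost w)"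
proof -
  let ?ws = "[(Atom 0, 1), (Atom (int q), w + 1), (Atom p, w + 2), (Atom \<delta>, w + 2), (Atom F, w + 2), (Atom G, w + 2)]"
  have s: "bit_size p \<le> w + 2" "bit_size \<delta> \<le> w + 2" "bit_size F \<le> w + 2" "bit_size G \<le> w + 2"
    by (rule bit_size_le_power; use p F G w(2) \<delta> in linarith)+
  have qw: "bit_size (int q) \<le> w + 1" using less_exp[of q] w(1) bit_size_of_nat[of q] by linarith
  have p0: "0 < p" using p by simp
  have w5: "w \<le> w ^ 5" "w * w \<le> w ^ 5" "1 \<le> w ^ 5"
    using w(3) self_le_power[of w 5] power_increasing[of 2 5 w] by (auto simp: power2_eq_square)
  have x: "[:0, 1:] = (monom 1 1 :: int poly)" "pCons 0 1 = (monom 1 1 :: int poly)"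
    by (simp_all add: monom_Suc monom_0 pCons_one)
  show ?thesis
  proof (cases "0 < \<delta> \<and> G \<noteq> 0")
    case True
    have "\<not> p dvd G" using True G by (auto dest: zdvd_imp_le)
    then have t: "transition p 1 \<delta> [:F:] [:G:] (1 - \<delta>) 0 (monom 1 1) [:G:] [:(- F) mod p:]"
      using True by (intro transition_swap) auto
    have c: "computes M jump_code [Atom 0, Atom (int q), Atom p, Atom \<delta>, Atom F, Atom G]
      (jump_val 1 (1 - \<delta>) (pair 0 0) (pair 0 1) (pair G 0) (pair ((- F) mod p) 0)) (dot_cost w)"
      apply (rule computesI[OF jump_code_def, where ws = ?ws])
      apply (rule bounded_Test_else, (rule bnds | (simp; fail))+)
      apply (rule bounded_Test_then, (rule bnds)+)
      subgoal using True by simp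
      apply (rule bnds p0)+
      subgoal by (simp add: jump_val_def tree_pair pair_def)
      subgoal by simp
      subgoal using s qw by simp
      subgoal apply (simp add: dot_cost_def) using w5 w(3) add_mult_distrib[of 10 w w] by linarith
      done
    show ?thesis
      by (rule exI[of _ "1 - \<delta>"], rule exI[of _ "pair 0 0"], rule exI[of _ "pair 0 1"], rule exI[of _ "pair G 0"], rule exI[of _ "pair ((- F) mod p) 0"])
        (use t c p G True in \<open>auto simp: poly_of_pair x residues_pair simp del: poly_of.simps\<close>)
  next
    case False
    have "\<not> (0 < \<delta> \<and> \<not> p dvd G)" using False by auto
    then have t: "transition p 1 \<delta> [:F:] [:G:] (1 + \<delta>) (monom 1 1) 0 [:(- G) mod p:] [:F:]"
      by (intro transition_no_swap) auto
    have c: "computes M jump_code [Atom 0, Atom (int q), Atom p, Atom \<delta>, Atom F, Atom G]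
      (jump_val 1 (1 + \<delta>) (pair 0 1) (pair 0 0) (pair ((- G) mod p) 0) (pair F 0)) (dot_cost w)"
      apply (rule computesI[OF jump_code_def, where ws = ?ws])
      apply (rule bounded_Test_else, (rule bnds | (simp; fail))+)
      apply (rule bounded_Test_else, (rule bnds)+)
      subgoal using False by auto
      apply (rule bnds p0)+
      subgoal by (simp add: jump_val_def tree_pair pair_def)
      subgoal by simp
      subgoal using s qw by simp
      subgoal apply (simp add: dot_cost_def) using w5 w(3) add_mult_distrib[of 10 w w] by linarith
      done
    show ?thesis
      by (rule exI[of _ "1 + \<delta>"], rule exI[of _ "pair 0 1"], rule exI[of _ "pair 0 0"], rule exI[of _ "pair ((- G) mod p) 0"], rule exI[of _ "pair F 0"])
        (use t c p F in \<open>auto simp: poly_of_pair x residues_pair simp del: poly_of.simps\<close>)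
  qed
qed

text \<open>Besides the transition, the induction carries that the counter changes by at most one
  per step, since its length enters the cost.\<close>

lemma computes_jump:
  assumes p: "1 < p" and w: "w = 2 ^ q" "2 \<le> w"
    and "2 * 2 ^ h * (p * p) < 2 ^ w" "h < w" "\<bar>\<delta>\<bar> + 2 ^ h \<le> 2 ^ w" "residues p h F" "residues p h G"
  shows "\<exists>\<delta>' a b c d. \<bar>\<delta>'\<bar> \<le> \<bar>\<delta>\<bar> + 2 ^ h \<and>
     residues p (Suc h) a \<and> residues p (Suc h) b \<and> residues p (Suc h) c \<and> residues p (Suc h) d \<and>
     transition p (2 ^ h) \<delta> (poly_of h F) (poly_of h G) \<delta>' (poly_of (Suc h) a) (poly_of (Suc h) b) (poly_of (Suc h) c) (poly_of (Suc h) d) \<and>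
     computes M jump_code [Atom (int h), Atom (int q), Atom p, Atom \<delta>, tree h F, tree h G] (jump_val (Suc h) \<delta>' a b c d)
       (tree_cost (8 * dot_cost w) h)"
  using assms(4-)
proof (induction h arbitrary: \<delta> F G)
  case 0
  have "1 * p \<le> p * p" using p by (intro mult_right_mono) auto
  moreover have "2 * (p * p) < 2 ^ w" "0 < p * p" using 0(1) p by auto
  ultimately have p2: "p \<le> 2 ^ w" by linarith
  have FG: "0 \<le> F 0" "F 0 < p" "0 \<le> G 0" "G 0 < p" "\<bar>\<delta>\<bar> \<le> 2 ^ w" using 0 by (auto simp: residues_def)
  have c: "computes M jump_code vs v (tree_cost (8 * dot_cost w) 0)" if "computes M jump_code vs v (dot_cost w)" for vs v
    by (rule computes_mono[OF that]) (simp add: tree_cost_0)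
  obtain \<delta>' a b c d where x: "\<bar>\<delta>'\<bar> \<le> \<bar>\<delta>\<bar> + 1"
     "residues p 1 a" "residues p 1 b" "residues p 1 c" "residues p 1 d"
     "transition p 1 \<delta> [:F 0:] [:G 0:] \<delta>' (poly_of 1 a) (poly_of 1 b) (poly_of 1 c) (poly_of 1 d)"
     "computes M jump_code [Atom 0, Atom (int q), Atom p, Atom \<delta>, Atom (F 0), Atom (G 0)] (jump_val 1 \<delta>' a b c d) (dot_cost w)"
    using computes_jump_leaf[OF p FG(1-4) w(1) p2 w(2) FG(5), of M] by blast
  show ?case
    by (rule exI[of _ \<delta>'], rule exI[of _ a], rule exI[of _ b], rule exI[of _ c], rule exI[of _ d])
      (use x(1-6) c[OF x(7)] in \<open>simp add: One_nat_def del: poly_of.simps(2)\<close>)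
next
  case (Suc h)
  let ?F = "\<lambda>i. F (2 ^ h + i)" and ?G = "\<lambda>i. G (2 ^ h + i)"
  have h: "2 * 2 ^ h * (p * p) < 2 ^ w" "h < w" "\<bar>\<delta>\<bar> + 2 ^ h \<le> 2 ^ w" "residues p h F" "residues p h G"
    subgoal
    proof -
      have "2 * 2 ^ h * (p * p) \<le> 2 * 2 ^ Suc h * (p * p)" by (intro mult_right_mono) auto
      then show ?thesis using Suc.prems(1) by linarith
    qed
    subgoal using Suc.prems(2) by simp
    subgoal
    proof -
      have "(2::int) ^ h \<le> 2 ^ Suc h" by simp
      then show ?thesis using Suc.prems(3) by linarith
    qed
    subgoal using Suc.prems(4) by (simp add: residues_def)
    subgoal using Suc.prems(5) by (simp add: residues_def)
    done
  from Suc.IH[OF h] obtain \<delta>1 a b c d where 1: "\<bar>\<delta>1\<bar> \<le> \<bar>\<delta>\<bar> + 2 ^ h"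
    "residues p (Suc h) a" "residues p (Suc h) b" "residues p (Suc h) c" "residues p (Suc h) d"
    "transition p (2 ^ h) \<delta> (poly_of h F) (poly_of h G) \<delta>1 (poly_of (Suc h) a) (poly_of (Suc h) b) (poly_of (Suc h) c) (poly_of (Suc h) d)"
    "computes M jump_code [Atom (int h), Atom (int q), Atom p, Atom \<delta>, tree h F, tree h G] (jump_val (Suc h) \<delta>1 a b c d)
       (tree_cost (8 * dot_cost w) h)" by blast
  \<comment> \<open>The first matrix applied to the input, divided by \<open>x ^ (2 ^ h)\<close> and
    cut to the \<open>2 ^ h\<close> coefficients that the second half of the steps depends
    on.\<close>
  define F1 where "F1 = (\<lambda>i. dot p (Suc h) a F b G (2 ^ h + i))"
  define G1 where "G1 = (\<lambda>i. dot p (Suc h) c F d G (2 ^ h + i))"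
  have p0: "0 < p" using p by simp
  have r1: "residues p h F1" "residues p h G1"
    unfolding residues_def F1_def G1_def dot_def using p0 by auto
  have \<delta>1: "\<bar>\<delta>1\<bar> + 2 ^ h \<le> 2 ^ w" using 1(1) Suc.prems(3) by simp
  from Suc.IH[OF h(1,2) \<delta>1 r1] obtain \<delta>2 a' b' c' d' where 2: "\<bar>\<delta>2\<bar> \<le> \<bar>\<delta>1\<bar> + 2 ^ h"
    "residues p (Suc h) a'" "residues p (Suc h) b'" "residues p (Suc h) c'" "residues p (Suc h) d'"
    "transition p (2 ^ h) \<delta>1 (poly_of h F1) (poly_of h G1) \<delta>2 (poly_of (Suc h) a') (poly_of (Suc h) b') (poly_of (Suc h) c') (poly_of (Suc h) d')"
    "computes M jump_code [Atom (int h), Atom (int q), Atom p, Atom \<delta>1, tree h F1, tree h G1] (jump_val (Suc h) \<delta>2 a' b' c' d')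
       (tree_cost (8 * dot_cost w) h)" by blast
  note res = Suc.prems(4,5) 1(2-5) 2(2-5)
  define W11 where "W11 = dot p (Suc h) a' a b' c"
  define W12 where "W12 = dot p (Suc h) a' b b' d"
  define W21 where "W21 = dot p (Suc h) c' a d' c"
  define W22 where "W22 = dot p (Suc h) c' b d' d"
  have rW: "residues p (Suc (Suc h)) W11" "residues p (Suc (Suc h)) W12" "residues p (Suc (Suc h)) W21" "residues p (Suc (Suc h)) W22"
    unfolding W11_def W12_def W21_def W22_def using residues_dot[OF p0] by auto
  have mid: "p dvd (coeff (poly_of (Suc h) u * poly_of (Suc h) F + poly_of (Suc h) v * poly_of (Suc h) G) (2 ^ h + i)
      - coeff (poly_of h (\<lambda>i. dot p (Suc h) u F v G (2 ^ h + i))) i)" if "i < 2 ^ h" for i u v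
    using that by (simp add: coeff_poly_of dot_def minus_mod_eq_mult_div del: poly_of.simps)
  have ag: "agree p (2 ^ h) (poly_of h E) (poly_of (Suc h) E)" for E
    by (simp add: agree_def coeff_poly_of del: poly_of.simps)
  have t1: "transition p (2 ^ h) \<delta> (poly_of (Suc h) F) (poly_of (Suc h) G) \<delta>1 (poly_of (Suc h) a) (poly_of (Suc h) b) (poly_of (Suc h) c) (poly_of (Suc h) d)"
    by (rule transition_weaken[OF 1(6) ag ag])
  have t: "transition p (2 ^ Suc h) \<delta> (poly_of (Suc h) F) (poly_of (Suc h) G) \<delta>2
     (poly_of (Suc (Suc h)) W11) (poly_of (Suc (Suc h)) W12) (poly_of (Suc (Suc h)) W21) (poly_of (Suc (Suc h)) W22)"
    unfolding power_Suc
    apply (rule transition_step[OF t1 2(6)])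
    unfolding F1_def G1_def W11_def W12_def W21_def W22_def
    by (simp only: mid, simp only: mid, (rule dot_agree; rule res)+)
  have ex: "Suc h < w" "2 * 2 ^ Suc h * (p * p) < 2 ^ w" using Suc.prems by auto
  have cd: "computes M dot_code [Atom (int (Suc h)), Atom (int q), Atom p, tree (Suc h) a, tree (Suc h) b, tree (Suc h) c, tree (Suc h) d]
     (tree (Suc (Suc h)) (dot p (Suc h) a b c d)) (2 ^ Suc h * dot_cost w)"
    if "residues p (Suc h) a" "residues p (Suc h) b" "residues p (Suc h) c" "residues p (Suc h) d" for a b c d
    using computes_dot[OF that p0 w(1) ex(2,1) w(2)] .
  have "1 * p \<le> p * p" using p by (intro mult_right_mono) auto
  also have "\<dots> \<le> 2 * 2 ^ Suc h * (p * p)"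
  proof -
    have "1 * (p * p) \<le> 2 * 2 ^ Suc h * (p * p)"
      by (rule mult_right_mono) (use one_le_power[of "2::int" "Suc h"] in linarith, simp)
    then show ?thesis by simp
  qed
  finally have p2: "p \<le> 2 ^ w" using ex(2) by simp
  have vt: "vsize (tree h' e) \<le> w + 2" if "residues p h' e" for h' e
    by (rule vsize_tree_range) (use that p2 in \<open>auto simp: residues_def\<close>)
  have vs: "vsize (Atom \<delta>1) \<le> w + 2" "vsize (Atom \<delta>2) \<le> w + 2" "vsize (Atom \<delta>) \<le> w + 2" "bit_size p \<le> w + 2"
    unfolding vsize.simps
    by (rule bit_size_le_power; use 1(1) 2(1) Suc.prems(3) p2 p0 power_Suc[of "2::int" h] zero_less_power[of "2::int" h] in linarith)+
  have vh: "bit_size (int (Suc h)) \<le> w + 1" "bit_size (int q) \<le> w + 1"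
    using less_exp[of q] w(1) bit_size_of_nat[of q] bit_size_of_nat[of "Suc h"] ex(1) by linarith+
  have vd: "vsize (tree h' (dot p h a b c d)) \<le> w + 2" for h' h a b c d
    by (rule vt[OF residues_dot[OF p0]])
  have vd': "vsize (tree h' (\<lambda>i. dot p h a b c d (2 ^ k + i))) \<le> w + 2" for h' h a b c d k
    by (rule vt) (use p0 in \<open>simp add: residues_def dot_def\<close>)
  have vj: "vsize (jump_val h \<delta> a b c d) \<le> 1" for h \<delta> a b c d by (simp add: jump_val_def)
  note r1' = vt[OF res(3)] vt[OF res(4)] vt[OF res(5)] vt[OF res(6)] vt[OF res(7)] vt[OF res(8)] vt[OF res(9)] vt[OF res(10)]
  have FG: "tree h (\<lambda>i. dot p (Suc h) a F b G (2 ^ h + i)) = tree h F1" "tree h (\<lambda>i. dot p (Suc h) c F d G (2 ^ h + i)) = tree h G1"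
    by (simp_all add: F1_def G1_def)
  have vh': "vsize (tree h ?F) \<le> w + 2" "vsize (tree h ?G) \<le> w + 2" "vsize (tree h F) \<le> w + 2" "vsize (tree h G) \<le> w + 2"
    subgoal by (rule vt) (use Suc.prems(4) in \<open>simp add: residues_def\<close>)
    subgoal by (rule vt) (use Suc.prems(5) in \<open>simp add: residues_def\<close>)
    subgoal by (rule vt[OF h(4)])
    subgoal by (rule vt[OF h(5)])
    done
  have n1: "vsize (Node x y) \<le> 1" for x y by simp
  define D where "D = 2 ^ h * dot_cost w"
  have D: "2 ^ Suc h * dot_cost w = 2 * D" "2 ^ h * (8 * dot_cost w) = 8 * D" "1000 * w \<le> D"
  proof -
    have "w \<le> w ^ 5" using w(2) by (intro self_le_power) auto
    then have "1 * (2 ^ 92 * w) \<le> 2 ^ h * (2 ^ 92 * w ^ 5)" by (intro mult_le_mono) auto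
    then show "1000 * w \<le> D" unfolding D_def dot_cost_def by simp
  qed (simp_all add: D_def)
  have c: "computes M jump_code [Atom (int (Suc h)), Atom (int q), Atom p, Atom \<delta>, tree (Suc h) F, tree (Suc h) G]
       (jump_val (Suc (Suc h)) \<delta>2 W11 W12 W21 W22) (tree_cost (8 * dot_cost w) (Suc h))"
  proof -
    have e1: "computes M dot_code [Atom (int (Suc h)), Atom (int q), Atom p, tree (Suc h) a, tree (Suc h) F, tree (Suc h) b, tree (Suc h) G]
       (Node (Node (tree h (dot p (Suc h) a F b G)) (tree h F1)) (tree (Suc h) (\<lambda>i. dot p (Suc h) a F b G (2 ^ Suc h + i)))) (2 * D)"
      using cd[OF res(3,1,4,2)] unfolding D(1) F1_def by simp
    have e2: "computes M dot_code [Atom (int (Suc h)), Atom (int q), Atom p, tree (Suc h) c, tree (Suc h) F, tree (Suc h) d, tree (Suc h) G]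
       (Node (Node (tree h (dot p (Suc h) c F d G)) (tree h G1)) (tree (Suc h) (\<lambda>i. dot p (Suc h) c F d G (2 ^ Suc h + i)))) (2 * D)"
      using cd[OF res(5,1,6,2)] unfolding D(1) G1_def by simp
    note vF1 = vt[OF r1(1)] vt[OF r1(2)]
    note u = r1' n1 vF1 vs(1-3) vh'
    note vD = vd[of "Suc (Suc h)" "Suc h"]
    show ?thesis
      unfolding jump_val_def
      apply (rule computesI[OF jump_code_def, where ws = "[(Atom (int (Suc h)), w + 1), (Atom (int q), w + 1), (Atom p, w + 2), (Atom \<delta>, w + 2),
         (Node (tree h F) (tree h ?F), 1), (Node (tree h G) (tree h ?G), 1)]"])
      apply (rule bounded_Test_then, (rule bnds | (simp; fail))+)
      apply (rule bounded_Recur[OF 1(7)[unfolded jump_val_def] n1])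
      apply (rule bnds u | (simp; fail))+
      apply (rule bounded_Call[OF e1 n1])
      apply (rule bnds u | (simp; fail))+
      apply (rule bounded_Call[OF e2 n1])
      apply (rule bnds u | (simp; fail))+
      apply (rule bounded_Recur[OF 2(7)[unfolded jump_val_def] n1])
      apply (rule bnds u | (simp; fail))+
      apply (rule bounded_Call[OF cd[OF res(7,3,8,5)] vD])
      apply (rule bnds u | (simp; fail))+
      apply (rule bounded_Call[OF cd[OF res(7,4,8,6)] vD])
      apply (rule bnds u | (simp; fail))+
      apply (rule bounded_Call[OF cd[OF res(9,3,10,5)] vD])
      apply (rule bnds u | (simp; fail))+
      apply (rule bounded_Call[OF cd[OF res(9,4,10,6)] vD])
      apply (rule bnds u | (simp; fail))+
      subgoal by (simp only: W11_def W12_def W21_def W22_def)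
      subgoal by simp
      subgoal using vh vs by simp
      subgoal apply (simp del: power_Suc) unfolding tree_cost_Suc D(1,2) using D(3) D(1)[unfolded mult.commute[of "2 ^ Suc h"]] w(2) by linarith
      done
  qed
  have "\<bar>\<delta>2\<bar> \<le> \<bar>\<delta>\<bar> + 2 ^ Suc h" using 1(1) 2(1) by simp
  then show ?case using rW t c by blast
qed

section \<open>Greatest common divisors modulo a prime\<close>

text \<open>Divisibility over the prime field, expressed by integer lifts;
  \<open>divides_reduce_mod\<close> relates it to the polynomial ring of the theorem.\<close>

definition divides_mod :: "int => int poly => int poly => bool" where
  "divides_mod p h F \<longleftrightarrow> (\<exists>k. [:p:] dvd (F - h * k))"

lemma divides_mod_cong: "divides_mod p h F ==> [:p:] dvd (F - G) ==> divides_mod p h G"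
  unfolding divides_mod_def
proof (elim exE)
  fix k assume "[:p:] dvd (F - h * k)" "[:p:] dvd (F - G)"
  then have "[:p:] dvd (F - h * k) - (F - G)" by (rule dvd_diff)
  also have "(F - h * k) - (F - G) = G - h * k" by simp
  finally show "\<exists>k. [:p:] dvd (G - h * k)" by blast
qed

lemma divides_mod_diff: "divides_mod p h F ==> divides_mod p h G ==> divides_mod p h (F - G)"
  unfolding divides_mod_def
proof (elim exE)
  fix k l assume "[:p:] dvd (F - h * k)" "[:p:] dvd (G - h * l)"
  then have "[:p:] dvd (F - h * k) - (G - h * l)" by (rule dvd_diff)
  also have "(F - h * k) - (G - h * l) = F - G - h * (k - l)" by (simp add: algebra_simps)
  finally show "\<exists>k. [:p:] dvd (F - G - h * k)" by blast
qed

lemma divides_mod_mult: "divides_mod p h F ==> divides_mod p h (K * F)"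
  unfolding divides_mod_def
proof (elim exE)
  fix k assume "[:p:] dvd (F - h * k)"
  then have "[:p:] dvd K * (F - h * k)" by (rule dvd_mult)
  also have "K * (F - h * k) = K * F - h * (K * k)" by (simp add: algebra_simps)
  finally show "\<exists>k. [:p:] dvd (K * F - h * k)" by blast
qed

lemma divides_mod_refl: "divides_mod p h h"
  unfolding divides_mod_def by (rule exI[of _ 1]) simp

lemma divides_mod_trans: "divides_mod p h F ==> divides_mod p F G ==> divides_mod p h G"
proof -
  assume 1: "divides_mod p h F" and "divides_mod p F G"
  then obtain k where k: "[:p:] dvd (G - F * k)" by (auto simp: divides_mod_def)
  have "[:p:] dvd (k * F - G)" using k by (metis dvd_minus_iff minus_diff_eq mult.commute)
  then show ?thesis using divides_mod_mult[OF 1] divides_mod_cong by blast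
qed

lemma divides_mod_add: "divides_mod p h F ==> divides_mod p h G ==> divides_mod p h (F + G)"
  using divides_mod_diff[of p h F "- G"] divides_mod_mult[of p h G "-1"] by simp

lemma prime_inverse_mod:
  fixes p :: int assumes "prime p" "\<not> p dvd a"
  obtains c where "p dvd (c * a - 1)"
proof -
  have "coprime p a" using assms prime_imp_coprime by blast
  then obtain x y where "x * p + y * a = 1" using bezout_int[of p a] by auto
  then have "y * a - 1 = - x * p" by simp
  then show thesis using that by (metis dvd_triv_right)
qed

text \<open>Units modulo \<open>p\<close> can be cancelled; this is what allows the division steps
  to do without inverses.\<close>

lemma divides_mod_smult:
  assumes "prime p" "\<not> p dvd a"
  shows "divides_mod p h (smult a F) \<longleftrightarrow> divides_mod p h F"
proof
  assume d: "divides_mod p h (smult a F)"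
  obtain c where c: "p dvd (c * a - 1)" by (rule prime_inverse_mod[OF assms])
  have "[:p:] dvd [:c:] * smult a F - F"
    unfolding const_poly_dvd_iff
  proof
    fix n
    have "coeff ([:c:] * smult a F - F) n = (c * a - 1) * coeff F n"
      by (simp add: algebra_simps)
    then show "p dvd coeff ([:c:] * smult a F - F) n" using c by simp
  qed
  then show "divides_mod p h F" by (rule divides_mod_cong[OF divides_mod_mult[OF d]])
next
  assume "divides_mod p h F"
  from divides_mod_mult[OF this, of "[:a:]"] show "divides_mod p h (smult a F)" by simp
qed

section \<open>Reversed polynomials and the Euclidean invariant\<close>

definition coeff_int :: "int poly => int => int" where
  "coeff_int F k = (if k < 0 then 0 else coeff F (nat k))"

text \<open>\<open>f\<close> is \<open>x^A * F(1/x)\<close> modulo \<open>p\<close>. As coefficients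
  are extended by 0 to negative indices, the one congruence for all integers \<open>j\<close> also
  says that \<open>F\<close> has degree at most \<open>A\<close> modulo \<open>p\<close>, and for
  negative \<open>A\<close> that both vanish.\<close>

definition reflects :: "int => int => int poly => int poly => bool" where
  "reflects p A f F \<longleftrightarrow> (\<forall>j. p dvd (coeff_int f j - coeff_int F (A - j)))"

lemma coeff_int_shift:
  "coeff Z 0 = 0 ==> coeff_int (poly_shift 1 Z) j = coeff_int Z (j + 1)"
  by (auto simp: coeff_int_def coeff_poly_shift nat_add_distrib)

lemma coeff_int_diff: "coeff_int (F - G) k = coeff_int F k - coeff_int G k"
  and coeff_int_smult: "coeff_int (smult a F) k = a * coeff_int F k"
  by (auto simp: coeff_int_def)

lemma coeff_int_monom_mult: "coeff_int (monom b n * F) k = b * coeff_int F (k - int n)"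
  by (auto simp: coeff_int_def coeff_monom_mult nat_diff_distrib)

text \<open>Cancelling the constant terms of the reversed polynomials and shifting means cancelling
  the terms of formal degree \<open>A\<close> and \<open>B\<close> in \<open>F\<close> and
  \<open>G\<close>: a step of Euclid's algorithm.\<close>

lemma reflects_step:
  assumes "reflects p A f F" "reflects p B g G" "A \<le> B" and ab: "a = coeff f 0" "b = coeff g 0"
  shows "reflects p (B - 1) (poly_shift 1 (smult a g - smult b f))
     (smult a G - monom b (nat (B - A)) * F)"
  unfolding reflects_def
proof
  fix j
  have s: "coeff_int (poly_shift 1 (smult a g - smult b f)) j = a * coeff_int g (j + 1) - b * coeff_int f (j + 1)"
    by (subst coeff_int_shift) (simp_all add: ab coeff_int_diff coeff_int_smult)
  have r: "coeff_int (smult a G - monom b (nat (B - A)) * F) (B - 1 - j)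
     = a * coeff_int G (B - (j + 1)) - b * coeff_int F (A - (j + 1))"
    using assms(3) by (simp add: coeff_int_diff coeff_int_smult coeff_int_monom_mult) (simp add: algebra_simps)
  have "p dvd a * (coeff_int g (j + 1) - coeff_int G (B - (j + 1))) - b * (coeff_int f (j + 1) - coeff_int F (A - (j + 1)))"
    using assms(1,2) unfolding reflects_def by (simp add: dvd_diff)
  then show "p dvd (coeff_int (poly_shift 1 (smult a g - smult b f)) j -
      coeff_int (smult a G - monom b (nat (B - A)) * F) (B - 1 - j))"
    unfolding s r by (simp add: algebra_simps)
qed

text \<open>If the coefficient of \<open>G\<close> at its formal degree vanishes already, the formal
  degree may drop whatever \<open>A\<close> is.\<close>

lemma reflects_step_zero:
  assumes "reflects p B g G" "p dvd b" and ab: "a = coeff f 0" "b = coeff g 0"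
  shows "reflects p (B - 1) (poly_shift 1 (smult a g - smult b f)) (smult a G)"
  unfolding reflects_def
proof
  fix j
  have s: "coeff_int (poly_shift 1 (smult a g - smult b f)) j = a * coeff_int g (j + 1) - b * coeff_int f (j + 1)"
    by (subst coeff_int_shift) (simp_all add: ab coeff_int_diff coeff_int_smult)
  have "p dvd a * (coeff_int g (j + 1) - coeff_int G (B - (j + 1))) - b * coeff_int f (j + 1)"
    using assms(1,2) unfolding reflects_def by (simp add: dvd_diff)
  then show "p dvd (coeff_int (poly_shift 1 (smult a g - smult b f)) j - coeff_int (smult a G) (B - 1 - j))"
    unfolding s coeff_int_smult by (simp add: algebra_simps)
qed

text \<open>\<open>F\<close> and \<open>G\<close> are the current remainders with formal degrees
  \<open>A\<close> and \<open>B\<close>, of sum \<open>m\<close> and difference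
  \<open>\<delta>\<close>; their common divisors are those of \<open>R\<close> and \<open>S\<close>.
  The degree \<open>A\<close> is exact because \<open>f\<close> has a unit as constant term, while
  that of \<open>G\<close> may be smaller than \<open>B\<close>.\<close>

definition euclid :: "int => int poly => int poly => int => int \<times> int poly \<times> int poly => bool" where
  "euclid p R S m = (\<lambda>(\<delta>, f, g). \<not> p dvd coeff f 0 \<and> (\<exists>A B F G. 2 * A = m + \<delta> \<and> 2 * B = m - \<delta> \<and>
     reflects p A f F \<and> reflects p B g G \<and>
     (\<forall>h. divides_mod p h R \<and> divides_mod p h S \<longleftrightarrow> divides_mod p h F \<and> divides_mod p h G)))"

lemma euclidI:
  assumes "reflects p A f F" "reflects p B g G"
    "\<And>h. divides_mod p h R \<and> divides_mod p h S \<longleftrightarrow> divides_mod p h F \<and> divides_mod p h G"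
    "\<not> p dvd coeff f 0" "2 * A = m + \<delta>" "2 * B = m - \<delta>"
  shows "euclid p R S m (\<delta>, f, g)"
  unfolding euclid_def prod.case using assms by blast

lemma common_divisors_step:
  assumes "prime p" "\<not> p dvd a"
  shows "divides_mod p h F \<and> divides_mod p h (smult a G - M * F) \<longleftrightarrow> divides_mod p h F \<and> divides_mod p h G"
  using divides_mod_smult[OF assms, of h G] divides_mod_mult[of p h F M]
    divides_mod_add[of p h "smult a G - M * F" "M * F"] divides_mod_diff[of p h "smult a G" "M * F"]
  by auto

text \<open>\<open>\<delta> > 0\<close> means \<open>A > B\<close>, so a \<open>G\<close> with
  nonzero top coefficient must become the divisor (swap). A vanishing top coefficient only lowers
  \<open>B\<close>, and for \<open>A <= B\<close> the remainder \<open>F\<close> is used to reduce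
  \<open>G\<close>. In each case the sum of the formal degrees falls by one.\<close>

lemma euclid_divstep:
  assumes p: "prime p" and e: "euclid p R S m z"
  shows "euclid p R S (m - 1) (divstep p z)"
proof -
  obtain \<delta> f g where z: "z = (\<delta>, f, g)" by (metis prod_cases3)
  define a b where "a = coeff f 0" and "b = coeff g 0"
  from e obtain A B F G where *: "\<not> p dvd a" "2 * A = m + \<delta>" "2 * B = m - \<delta>" "reflects p A f F" "reflects p B g G"
     "\<And>h. divides_mod p h R \<and> divides_mod p h S \<longleftrightarrow> divides_mod p h F \<and> divides_mod p h G"
    unfolding euclid_def z a_def by auto
  consider "0 < \<delta>" "\<not> p dvd b" | "\<not> (0 < \<delta> \<and> \<not> p dvd b)" "p dvd b" | "\<not> (0 < \<delta> \<and> \<not> p dvd b)" "\<delta> \<le> 0" by linarith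
  then show ?thesis
  proof cases
    case 1
    have r: "reflects p (A - 1) (poly_shift 1 (smult b f - smult a g)) (smult b F - monom a (nat (A - B)) * G)"
      by (rule reflects_step[OF *(5,4) _ b_def a_def]) (use * 1 in simp)
    have c: "divides_mod p h R \<and> divides_mod p h S \<longleftrightarrow>
       divides_mod p h G \<and> divides_mod p h (smult b F - monom a (nat (A - B)) * G)" for h
      using *(6)[of h] common_divisors_step[OF p 1(2), of h G F] by auto
    have ds: "divstep p z = (1 - \<delta>, g, poly_shift 1 (smult b f - smult a g))"
      using 1 by (simp add: divstep_def z a_def b_def Let_def)
    show ?thesis
      unfolding ds by (rule euclidI[OF *(5) r c 1(2)[unfolded b_def]]) (use *(2,3) in simp_all)
  next
    case 2
    have r: "reflects p (B - 1) (poly_shift 1 (smult a g - smult b f)) (smult a G)"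
      by (rule reflects_step_zero[OF *(5) 2(2) a_def b_def])
    have c: "divides_mod p h R \<and> divides_mod p h S \<longleftrightarrow> divides_mod p h F \<and> divides_mod p h (smult a G)" for h
      using *(6)[of h] divides_mod_smult[OF p *(1)] by auto
    have ds: "divstep p z = (1 + \<delta>, f, poly_shift 1 (smult a g - smult b f))"
      using 2(1) by (auto simp: divstep_def z a_def b_def Let_def)
    show ?thesis
      unfolding ds by (rule euclidI[OF *(4) r c *(1)[unfolded a_def]]) (use *(2,3) in simp_all)
  next
    case 3
    have r: "reflects p (B - 1) (poly_shift 1 (smult a g - smult b f)) (smult a G - monom b (nat (B - A)) * F)"
      by (rule reflects_step[OF *(4,5) _ a_def b_def]) (use * 3 in simp)
    have c: "divides_mod p h R \<and> divides_mod p h S \<longleftrightarrow>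
       divides_mod p h F \<and> divides_mod p h (smult a G - monom b (nat (B - A)) * F)" for h
      using *(6)[of h] common_divisors_step[OF p *(1), of h F G] by auto
    have ds: "divstep p z = (1 + \<delta>, f, poly_shift 1 (smult a g - smult b f))"
      using 3(1) by (auto simp: divstep_def z a_def b_def Let_def)
    show ?thesis
      unfolding ds by (rule euclidI[OF *(4) r c *(1)[unfolded a_def]]) (use *(2,3) in simp_all)
  qed
qed

lemma euclid_funpow:
  "prime p ==> euclid p R S m z ==> euclid p R S (m - int k) ((divstep p ^^ k) z)"
proof (induction k)
  case (Suc k)
  then show ?case using euclid_divstep[of p R S "m - int k"] by (simp add: algebra_simps)
qed simp

definition gcd_mod :: "int => int poly => int poly => int poly => nat => bool" where
  "gcd_mod p R S F D \<longleftrightarrow> divides_mod p F R \<and> divides_mod p F S \<and>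
     (\<forall>h. divides_mod p h R \<longrightarrow> divides_mod p h S \<longrightarrow> divides_mod p h F) \<and>
     \<not> p dvd coeff F D \<and> (\<forall>i>D. p dvd coeff F i)"

text \<open>The unit constant term of \<open>f\<close> forces \<open>A >= 0\<close>, so a negative
  sum makes \<open>B\<close> negative. Then \<open>G\<close> vanishes modulo \<open>p\<close>, and
  \<open>F\<close> is the gcd, of exact degree \<open>A\<close>.\<close>

lemma euclid_gcd:
  assumes "euclid p R S m (\<delta>, f, g)" "m < 0"
  shows "\<exists>F D. gcd_mod p R S F D \<and> 2 * int D = m + \<delta>"
proof -
  from assms obtain A B F G where *: "\<not> p dvd coeff f 0" "2 * A = m + \<delta>" "2 * B = m - \<delta>" "reflects p A f F" "reflects p B g G"
     "\<And>h. divides_mod p h R \<and> divides_mod p h S \<longleftrightarrow> divides_mod p h F \<and> divides_mod p h G"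
    unfolding euclid_def by auto
  have f0: "p dvd (coeff f 0 - coeff_int F A)"
    using *(4)[unfolded reflects_def, rule_format, of 0] by (simp add: coeff_int_def)
  have A: "\<not> p dvd coeff_int F A" using f0 *(1) dvd_add[OF f0, of "coeff_int F A"] by auto
  have A0: "0 \<le> A" using A by (auto simp: coeff_int_def split: if_splits)
  have B: "B < 0" using *(2,3) assms(2) A0 by linarith
  have "p dvd coeff G k" for k
    using *(5)[unfolded reflects_def, rule_format, of "B - int k"] B by (simp add: coeff_int_def)
  then have "[:p:] dvd G" by (simp add: const_poly_dvd_iff)
  then have G: "divides_mod p h G" for h unfolding divides_mod_def by (intro exI[of _ 0]) simp
  have hi: "p dvd coeff F i" if "nat A < i" for i
  proof -
    have "A < int i" using that by simp
    then show ?thesis using *(4)[unfolded reflects_def, rule_format, of "A - int i"] by (simp add: coeff_int_def)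
  qed
  have "gcd_mod p R S F (nat A)"
    unfolding gcd_mod_def using *(6) G divides_mod_refl[of p F] A A0 hi by (auto simp: coeff_int_def)
  moreover have "2 * int (nat A) = m + \<delta>" using A0 *(2) by simp
  ultimately show ?thesis by blast
qed

text \<open>The second polynomial enters with formal degree \<open>n - 1\<close> even if its degree
  modulo \<open>p\<close> is smaller, as happens to the derivative when \<open>p\<close> divides
  \<open>n\<close>.\<close>

lemma euclid_init:
  assumes "\<And>i. i \<le> n ==> p dvd (coeff F i - coeff f (n - i))"
    "\<And>i. n < i ==> p dvd coeff F i"
    "\<And>i. i < n ==> p dvd (coeff G i - coeff g (n - 1 - i))"
    "\<And>i. n \<le> i ==> p dvd coeff G i"
    and d: "degree f \<le> n" "degree g \<le> n - 1" "1 \<le> n" "\<not> p dvd coeff f n"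
  shows "euclid p f g (2 * int n - 1) (1, F, G)"
proof -
  have F: "reflects p (int n) F f"
    unfolding reflects_def
  proof
    fix j show "p dvd (coeff_int F j - coeff_int f (int n - j))"
      using assms(1)[of "nat j"] assms(2)[of "nat j"] d(1)
      by (auto simp: coeff_int_def nat_diff_distrib coeff_eq_0)
  qed
  have G: "reflects p (int n - 1) G g"
    unfolding reflects_def
  proof
    fix j show "p dvd (coeff_int G j - coeff_int g (int n - 1 - j))"
    proof (cases "j < 0")
      case True
      then have "coeff g (nat (int n - 1 - j)) = 0" using d(2,3) by (intro coeff_eq_0) linarith
      then show ?thesis using True by (simp add: coeff_int_def)
    next
      case False
      have "nat (int n - 1 - j) = n - 1 - nat j" using False by simp
      then show ?thesis using False assms(3)[of "nat j"] assms(4)[of "nat j"] by (auto simp: coeff_int_def)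
    qed
  qed
  have "\<not> p dvd coeff F 0" using assms(1)[of 0] d(4) dvd_diff[of p "coeff F 0" "coeff F 0 - coeff f n"] by auto
  then show ?thesis by (intro euclidI[OF F G]) auto
qed

text \<open>For a test whose outcome is not fixed while the program is evaluated symbolically; both
  branches are charged.\<close>

lemma bounded_Test_if:
  assumes "bounded M s ws e (Atom x) w c" "bounded M s ws a u k d" "bounded M s ws b v k' d'"
  shows "bounded M s ws (Test e a b) (if x \<noteq> 0 then u else v) (k + k') (c + (d + d') + 1 + w)"
proof (rule bounded_Test[OF assms(1)])
  show "bounded M s ws (if x \<noteq> 0 then a else b) (if x \<noteq> 0 then u else v) (k + k') (d + d')"
    using assms(2,3) unfolding bounded_def by (auto intro: trans_le_add1 trans_le_add2)
qed

section \<open>Testing a single prime\<close>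

definition left_code :: fexp where
  "left_code = Test (Var 0) (Recur [Prim Sub (Var 0) (Const 1), Left (Var 1)]) (Var 1)"

lemma computes_left:
  assumes "h < W" "\<And>i. i < 2 ^ h ==> bit_size (a i) \<le> W"
  shows "computes M left_code [Atom (int h), tree h a] (Atom (a 0)) ((h + 1) * (100 * W))"
  using assms
proof (induction h)
  case 0
  show ?case
    apply (rule computesI[OF left_code_def, where ws = "[(Atom (int 0), 1), (tree 0 a, W)]"])
    apply (rule bounded_Test_else, (rule bnds | (simp; fail))+)
    using 0 by auto
next
  case (Suc h)
  have t: "vsize (tree h a) \<le> W" by (rule vsize_tree) (use Suc.prems in auto)
  have a: "vsize (Atom (a 0)) \<le> W" using Suc.prems by simp
  have IH: "computes M left_code [Atom (int h), tree h a] (Atom (a 0)) ((h + 1) * (100 * W))"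
    using Suc by simp
  show ?case
    apply (rule computesI[OF left_code_def, where ws = "[(Atom (int (Suc h)), W + 1), (tree (Suc h) a, 1)]"])
    apply (rule bounded_Test_then, (rule bnds | (simp; fail))+)
    apply (unfold tree.simps)
    apply (rule bounded_Recur[OF IH a])
    apply (rule bnds t | (simp; fail))+
    using Suc.prems bit_size_of_nat[of "Suc h"] by auto
qed

text \<open>In reversed order entry \<open>i\<close> belongs to \<open>x^(n - i)\<close>, which the
  derivative multiplies by \<open>n - i\<close>. The second argument is this factor for the first
  leaf of the subtree.\<close>

definition deriv_code :: fexp where
  "deriv_code = Test (Var 0)
     (Join (Recur [Prim Sub (Var 0) (Const 1), Var 1, Var 2, Left (Var 3)])
           (Recur [Prim Sub (Var 0) (Const 1), Prim Sub (Var 1) (Prim Shl (Const 1) (Prim Sub (Var 0) (Const 1))), Var 2, Right (Var 3)]))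
     (Prim Rem (Prim Mul (Var 1) (Var 3)) (Var 2))"

lemma computes_deriv:
  assumes "0 < p" "p \<le> 2 ^ W" "2 \<le> W" "h < W" "\<bar>c\<bar> + 2 ^ h \<le> 2 ^ W" "\<And>i. i < 2 ^ h ==> \<bar>a i\<bar> \<le> 2 ^ W"
  shows "computes M deriv_code [Atom (int h), Atom c, Atom p, tree h a] (tree h (\<lambda>i. ((c - int i) * a i) mod p)) (tree_cost' (400 * (W * W)) h)"
  using assms(4-)
proof (induction h arbitrary: a c)
  case 0
  have s: "bit_size p \<le> W + 2" "bit_size c \<le> W + 2" "bit_size (a 0) \<le> W + 2"
    by (rule bit_size_le_power; use assms 0 in simp)+
  have W: "2 * W \<le> W * W" using assms(3) by simp
  show ?case
    apply (rule computesI[OF deriv_code_def, where ws = "[(Atom (int 0), 1), (Atom c, W + 2), (Atom p, W + 2), (Atom (a 0), W + 2)]"])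
    apply (rule bounded_Test_else, (rule bnds | (simp add: assms(1); fail))+)
    subgoal using s by simp
    subgoal
    proof -
      have "W * (W * 397) = 397 * (W * W)" by simp
      then show ?thesis apply (simp add: tree_cost'_0 algebra_simps) using W assms(3) by linarith
    qed
    done
next
  case (Suc h)
  let ?a = "\<lambda>i. a (2 ^ h + i)" and ?c = "c - 2 ^ h"
  have pre: "h < W" "\<bar>c\<bar> + 2 ^ h \<le> 2 ^ W" "\<bar>?c\<bar> + 2 ^ h \<le> 2 ^ W"
    using Suc.prems(1,2) power_Suc[of "2::int" h] zero_less_power[of "2::int" h] by linarith+
  have a: "\<And>i. i < 2 ^ h ==> \<bar>a i\<bar> \<le> 2 ^ W" "\<And>i. i < 2 ^ h ==> \<bar>?a i\<bar> \<le> 2 ^ W" using Suc.prems by auto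
  let ?b = "\<lambda>i. ((c - int i) * a i) mod p" and ?b' = "\<lambda>i. ((?c - int i) * ?a i) mod p"
  have t: "vsize (tree h a) \<le> W + 2" "vsize (tree h ?a) \<le> W + 2"
    by (rule vsize_tree_range; use a in simp)+
  have sp: "bit_size p \<le> W + 2" "bit_size c \<le> W + 2"
    by (rule bit_size_le_power; use assms(1,2) pre(2) zero_less_power[of "2::int" h] in linarith)+
  have mp: "0 \<le> x mod p" "x mod p \<le> 2 ^ W" for x using assms(1,2) pos_mod_bound[of p x] by (simp, linarith)
  have tb: "vsize (tree h ?b) \<le> W + 2" "vsize (tree h ?b') \<le> W + 2"
    by (rule vsize_tree_range; use mp in simp)+
  have W: "2 * W \<le> W * W" using assms(3) by simp
  show ?case
    apply (rule computesI[OF deriv_code_def, where ws = "[(Atom (int (Suc h)), W + 1), (Atom c, W + 2), (Atom p, W + 2), (tree (Suc h) a, 1)]"])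
    apply (rule bounded_Test_then, (rule bnds | (simp; fail))+)
    apply (unfold tree.simps)
    apply (rule bounded_Recur[OF Suc.IH[OF pre(1,2) a(1)] tb(1)], assumption)
    apply (rule bnds t | (simp; fail))+
    apply (rule bounded_Recur[OF Suc.IH[OF pre(1,3) a(2)] tb(2)], assumption)
    apply (rule bnds t | (simp; fail))+
    subgoal by (simp add: algebra_simps)
    subgoal by simp
    subgoal using sp Suc.prems(1) bit_size_of_nat[of "Suc h"] by simp
    subgoal apply (simp add: tree_cost'_Suc) using W assms(3) Suc.prems(1) by linarith
    done
qed

text \<open>The outer test skips the padding value 1. By \<open>divstep_gcd\<close> the degree
  \<open>D\<close> satisfies \<open>2 * D = 2 * n - 1 - 2 ^ d + \<delta>\<close>, and the comparison
  is \<open>2 * D < 2 * t\<close> solved for \<open>\<delta>\<close>.\<close>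

definition leaf_code :: fexp where
  "leaf_code = Test (Prim Lt (Const 1) (Var 5))
     (Let_in (Call map_mod_code [Var 1, Var 5, Var 4])
       (Test (Call left_code [Var 2, Var 0])
         (Test (Prim Lt (Left (Call jump_code [Var 2, Var 1, Var 6, Const 1, Var 0, Call deriv_code [Var 2, Var 3, Var 6, Var 0]]))
                  (Prim Sub (Prim Add (Prim Add (Var 4) (Var 4)) (Prim Shl (Const 1) (Var 2))) (Prim Sub (Prim Add (Var 3) (Var 3)) (Const 1))))
           (Var 6) (Const 0))
         (Const 0)))
     (Const 0)"

definition good :: "int => int poly => nat => bool" where
  "good p f t \<longleftrightarrow> prime p \<and> \<not> p dvd lead_coeff f \<and> (\<exists>F D. gcd_mod p f (pderiv f) F D \<and> D < t)"

definition bad :: "int => int poly => nat => bool" where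
  "bad p f t \<longleftrightarrow> p dvd lead_coeff f \<or> (\<exists>F D. gcd_mod p f (pderiv f) F D \<and> t \<le> D)"

definition reversal :: "int poly => nat => int" where
  "reversal f i = (if i \<le> degree f then coeff f (degree f - i) else 0)"

lemma gcd_mod_smult:
  assumes "prime p" "\<not> p dvd c" "gcd_mod p (smult c R) (smult c S) F D"
  shows "gcd_mod p R S F D"
  using assms unfolding gcd_mod_def by (simp add: divides_mod_smult)

text \<open>The sum of the formal degrees starts at \<open>2 * n - 1\<close>, so
  \<open>2 ^ d >= 2 * n\<close> steps make it negative. The input agrees with the reversed
  polynomial only up to the unit \<open>c\<close>, which scales both polynomials and does not affect
  the gcd.\<close>

lemma divstep_gcd:
  assumes p: "prime p" and n: "1 \<le> degree f" "2 * degree f \<le> 2 ^ d"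
    and c: "\<not> p dvd c" "\<And>i. i < 2 ^ d ==> p dvd (x i - c * reversal f i)"
    and lc: "\<not> p dvd lead_coeff f"
    and F: "F = (\<lambda>i. x i mod p)" and G: "G = (\<lambda>i. ((int (degree f) - int i) * F i) mod p)"
    and ds: "(divstep p ^^ (2 ^ d)) (1, poly_of d F, poly_of d G) = (\<delta>, f', g')"
  shows "\<exists>H D. gcd_mod p f (pderiv f) H D \<and> 2 * int D = 2 * int (degree f) - 1 - 2 ^ d + \<delta>"
proof -
  let ?n = "degree f"
  have xF: "p dvd (F i - c * reversal f i)" if "i < 2 ^ d" for i
  proof -
    have "p dvd x i - F i" by (simp add: F minus_mod_eq_mult_div)
    from dvd_diff[OF c(2)[OF that] this] show ?thesis by simp
  qed
  have xG: "p dvd (G i - c * ((int ?n - int i) * reversal f i))" if "i < 2 ^ d" for i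
  proof -
    have "p dvd (int ?n - int i) * F i - G i" by (simp add: G minus_mod_eq_mult_div)
    from dvd_diff[OF dvd_mult[OF xF[OF that], of "int ?n - int i"] this] show ?thesis by (simp add: algebra_simps)
  qed
  have n2: "?n < 2 ^ d" using n by linarith
  have e: "euclid p (smult c f) (smult c (pderiv f)) (2 * int ?n - 1) (1, poly_of d F, poly_of d G)"
  proof (rule euclid_init)
    fix i
    show "p dvd coeff (poly_of d F) i - coeff (smult c f) (?n - i)" if "i \<le> ?n"
      using xF[of i] that n2 by (simp add: coeff_poly_of reversal_def)
    show "p dvd coeff (poly_of d F) i" if "?n < i"
      using xF[of i] that by (auto simp: coeff_poly_of reversal_def)
    show "p dvd coeff (poly_of d G) i" if "?n \<le> i"
      using xG[of i] that by (cases "i = ?n") (auto simp: coeff_poly_of reversal_def)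
    show "p dvd coeff (poly_of d G) i - coeff (smult c (pderiv f)) (?n - 1 - i)" if "i < ?n"
    proof -
      have "Suc (?n - 1 - i) = ?n - i" "int (?n - i) = int ?n - int i" using that by auto
      then show ?thesis using xG[of i] that n2 by (simp add: coeff_poly_of reversal_def coeff_pderiv of_nat_diff del: of_nat_Suc)
    qed
  qed (use n lc c p in \<open>auto simp: degree_pderiv prime_dvd_mult_iff\<close>)
  from euclid_funpow[OF p e, of "2 ^ d"] ds
  have "euclid p (smult c f) (smult c (pderiv f)) (2 * int ?n - 1 - 2 ^ d) (\<delta>, f', g')" by simp
  moreover have "int (2 * ?n) \<le> int (2 ^ d)" using n(2) of_nat_le_iff by blast
  then have "2 * int ?n \<le> 2 ^ d" by simp
  then have "2 * int ?n - 1 - 2 ^ d < 0" by linarith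
  ultimately obtain H D where "gcd_mod p (smult c f) (smult c (pderiv f)) H D" "2 * int D = 2 * int ?n - 1 - 2 ^ d + \<delta>"
    using euclid_gcd by blast
  then show ?thesis using gcd_mod_smult[OF p c(1)] by blast
qed

lemma computes_leaf_trivial:
  "computes M leaf_code [Atom (int q), Atom (int d), Atom (int n), Atom (int t), tree d x, Atom 1] (Atom 0) 100"
  apply (rule computesI[OF leaf_code_def, where ws = "[(Atom (int q), bit_size (int q)), (Atom (int d), bit_size (int d)), (Atom (int n), bit_size (int n)), (Atom (int t), bit_size (int t)), (tree d x, vsize (tree d x)), (Atom 1, 2)]"])
  apply (rule bounded_Test_else, (rule bnds | (simp; fail))+)
  done

lemma computes_leaf:
  assumes p: "prime p" and n: "1 \<le> degree f" "2 * degree f \<le> 2 ^ d"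
    and t: "t \<le> degree f"
    and c: "\<not> p dvd c" "\<And>i. i < 2 ^ d ==> p dvd (x i - c * reversal f i)"
    and w: "w = 2 ^ q" "2 \<le> w" "2 * 2 ^ d * (p * p) < 2 ^ w" "d < w"
    and x: "\<And>i. i < 2 ^ d ==> \<bar>x i\<bar> \<le> 2 ^ w"
  shows "\<exists>r. computes M leaf_code [Atom (int q), Atom (int d), Atom (int (degree f)), Atom (int t), tree d x, Atom p] (Atom r)
      (tree_cost (9 * dot_cost w) d) \<and> (r = p \<and> good p f t \<or> r = 0 \<and> bad p f t)"
proof -
  let ?n = "degree f"
  have p1: "1 < p" using p prime_gt_1_int by blast
  have p0: "0 < p" using p1 by simp
  define F where "F = (\<lambda>i. x i mod p)"
  define G where "G = (\<lambda>i. ((int ?n - int i) * F i) mod p)"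
  have rF: "residues p d F" and rG: "residues p d G" using p0 by (auto simp: F_def G_def residues_def)
  have "1 * p \<le> p * p" using p1 by (intro mult_right_mono) auto
  moreover have "1 * (p * p) \<le> 2 * 2 ^ d * (p * p)"
  proof (rule mult_right_mono)
    show "1 \<le> 2 * (2::int) ^ d" using zero_less_power[of "2::int" d] by linarith
  qed simp
  ultimately have p2: "p \<le> 2 ^ w" using w(3) by linarith
  have ps: "bit_size p \<le> w + 2" by (rule bit_size_le_power) (use p0 p2 in simp)
  have d2: "(2::int) ^ d * 2 \<le> 2 ^ w" using power_increasing[of "Suc d" w "2::int"] w(4) by simp
  have "int (2 * ?n) \<le> int (2 ^ d)" using n(2) of_nat_le_iff by blast
  then have n2: "2 * int ?n \<le> 2 ^ d" by simp
  have dd: "\<bar>1\<bar> + 2 ^ d \<le> (2::int) ^ w" using d2 zero_less_power[of "2::int" d] by linarith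
  obtain \<delta> a b c' d' where J: "\<bar>\<delta>\<bar> \<le> \<bar>1\<bar> + 2 ^ d"
    "transition p (2 ^ d) 1 (poly_of d F) (poly_of d G) \<delta> (poly_of (Suc d) a) (poly_of (Suc d) b) (poly_of (Suc d) c') (poly_of (Suc d) d')"
    "computes M jump_code [Atom (int d), Atom (int q), Atom p, Atom 1, tree d F, tree d G] (jump_val (Suc d) \<delta> a b c' d')
       (tree_cost (8 * dot_cost w) d)"
    using computes_jump[OF p1 w(1-4) dd rF rG, of M] by blast
  have "agree p (2 ^ d) E E" for E by (simp add: agree_def)
  then obtain f' g' where ds: "(divstep p ^^ (2 ^ d)) (1, poly_of d F, poly_of d G) = (\<delta>, f', g')"
    using J(2) unfolding transition_def by blast
  have bx: "bit_size (x i) \<le> w + 2" if "i < 2 ^ d" for i by (rule bit_size_le_power[OF x[OF that]])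
  have cm: "computes M map_mod_code [Atom (int d), Atom p, tree d x] (tree d F) (tree_cost' (200 * ((w + 2) * (w + 2))) d)"
    unfolding F_def by (rule computes_map_mod[OF p0 ps]) (use w bx in auto)
  have Fi: "\<bar>F i\<bar> \<le> 2 ^ w" "bit_size (F i) \<le> w + 2" for i
  proof -
    have "0 \<le> F i" "F i < p" using p0 by (auto simp: F_def)
    then show "\<bar>F i\<bar> \<le> 2 ^ w" using p2 by simp
    then show "bit_size (F i) \<le> w + 2" by (rule bit_size_le_power)
  qed
  have cl: "computes M left_code [Atom (int d), tree d F] (Atom (F 0)) ((d + 1) * (100 * (w + 2)))"
    by (rule computes_left) (use w Fi in auto)
  have nn: "\<bar>int ?n\<bar> + 2 ^ d \<le> 2 ^ w" using d2 n2 by linarith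
  have cd: "computes M deriv_code [Atom (int d), Atom (int ?n), Atom p, tree d F] (tree d G) (tree_cost' (400 * (w * w)) d)"
    unfolding G_def by (rule computes_deriv) (use p0 p2 w nn Fi in auto)
  have vF: "vsize (tree d F) \<le> w + 2" by (rule vsize_tree_range) (rule Fi)
  have Gi: "\<bar>G i\<bar> \<le> 2 ^ w" for i
  proof -
    have "0 \<le> G i" "G i < p" using p0 by (auto simp: G_def)
    then show "\<bar>G i\<bar> \<le> 2 ^ w" using p2 by simp
  qed
  have vG: "vsize (tree d G) \<le> w + 2" by (rule vsize_tree_range) (rule Gi)
  have vF0: "vsize (Atom (F 0)) \<le> w + 2" using Fi by simp
  have vx: "vsize (tree d x) \<le> w + 2" by (rule vsize_tree_range) (rule x)
  have n1: "vsize (Node y z) \<le> 1" for y z by simp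
  have v\<delta>: "vsize (Atom \<delta>) \<le> w + 2" unfolding vsize.simps by (rule bit_size_le_power) (use J(1) dd in linarith)
  have qw: "q < w" using w(1) by simp
  have small: "bit_size (int q) \<le> w + 1" "bit_size (int d) \<le> w + 1" "bit_size (int ?n) \<le> w + 2" "bit_size (int t) \<le> w + 2"
    subgoal using bit_size_of_nat[of q] qw by linarith
    subgoal using bit_size_of_nat[of d] w(4) by linarith
    subgoal by (rule bit_size_le_power) (use nn zero_less_power[of "2::int" d] in linarith)
    subgoal by (rule bit_size_le_power) (use t nn zero_less_power[of "2::int" d] in linarith)
    done
  let ?ws = "[(Atom (int q), w + 1), (Atom (int d), w + 1), (Atom (int ?n), w + 2), (Atom (int t), w + 2), (tree d x, w + 2), (Atom p, w + 2)]"
  define H where "H = 2 ^ d * w ^ 5"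
  have H: "2 ^ d * dot_cost w = 2 ^ 92 * H" by (simp add: dot_cost_def H_def)
  have "tree_cost (8 * dot_cost w) d + 2 ^ 92 * H \<le> tree_cost (9 * dot_cost w) d"
    unfolding H[symmetric] tree_cost_def by (simp add: algebra_simps)
  moreover have "10000 * H \<le> 2 ^ 92 * H" by simp
  ultimately have cost9: "tree_cost (8 * dot_cost w) d + 10000 * H \<le> tree_cost (9 * dot_cost w) d" by linarith
  have w5: "w \<le> w ^ 5" "w * w \<le> w ^ 5"
    using w(2) self_le_power[of w 5] power_increasing[of 2 5 w] by (auto simp: power2_eq_square)
  have h0: "w * w \<le> H" "w \<le> H" "2 ^ d * (w * w) \<le> H"
    unfolding H_def using w5 mult_le_mono[of 1 "2 ^ d" "w * w" "w ^ 5"] mult_le_mono[of 1 "2 ^ d" "w" "w ^ 5"] by auto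
  have small_costs: "tree_cost' (200 * ((w + 2) * (w + 2))) d \<le> 2000 * H" "tree_cost' (400 * (w * w)) d \<le> 2000 * H" "(d + 1) * (100 * (w + 2)) \<le> 2000 * H"
  proof -
    have "(w + 2) * (w + 2) \<le> (2 * w) * (2 * w)" using w(2) by (intro mult_le_mono) auto
    then have "2 * 2 ^ d * (200 * ((w + 2) * (w + 2))) \<le> 2 * 2 ^ d * (200 * ((2 * w) * (2 * w)))" by simp
    also have "\<dots> = 1600 * (2 ^ d * (w * w))" by (simp add: algebra_simps)
    finally show "tree_cost' (200 * ((w + 2) * (w + 2))) d \<le> 2000 * H"
      using tree_cost'_le[of "200 * ((w + 2) * (w + 2))" d] h0(3) by linarith
    have "2 * 2 ^ d * (400 * (w * w)) = 800 * (2 ^ d * (w * w))" by (simp add: algebra_simps)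
    then show "tree_cost' (400 * (w * w)) d \<le> 2000 * H"
      using tree_cost'_le[of "400 * (w * w)" d] h0(3) by linarith
    have "(d + 1) * (100 * (w + 2)) \<le> w * (100 * (2 * w))" using w(2,4) by (intro mult_le_mono) auto
    also have "\<dots> = 200 * (w * w)" by simp
    finally show "(d + 1) * (100 * (w + 2)) \<le> 2000 * H" using h0(1) by linarith
  qed
  show ?thesis
  proof (cases "p dvd lead_coeff f")
    case True
    have "p dvd x 0" using c(2)[of 0] True by (simp add: reversal_def dvd_diff_left_iff[of p "c * lead_coeff f"])
    then have F0: "F 0 = 0" by (simp add: F_def dvd_eq_mod_eq_0)
    have "computes M leaf_code [Atom (int q), Atom (int d), Atom (int ?n), Atom (int t), tree d x, Atom p] (Atom 0) (tree_cost (9 * dot_cost w) d)"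
      apply (rule computesI[OF leaf_code_def, where ws = ?ws])
      apply (rule bounded_Test_then, (rule bnds)+)
      subgoal using p1 by simp
      apply (rule bounded_Let)
      apply (rule bounded_Call[OF cm vF])
      apply (rule bnds | (simp; fail))+
      apply (rule bounded_Test_else)
      apply (rule bounded_Call[OF cl vF0])
      apply (rule bnds | (simp add: F0; fail))+
      subgoal using small ps vx by simp
      subgoal apply simp using small_costs[simplified] cost9 h0 w(2) by linarith
      done
    then show ?thesis using True unfolding bad_def by blast
  next
    case False
    have "\<not> p dvd c * lead_coeff f" using False c(1) p by (simp add: prime_dvd_mult_iff)
    then have "\<not> p dvd x 0" using c(2)[of 0] dvd_diff[of p "x 0" "x 0 - c * lead_coeff f"] by (auto simp: reversal_def)
    then have F0: "F 0 \<noteq> 0" by (simp add: F_def dvd_eq_mod_eq_0)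
    obtain K D where KD: "gcd_mod p f (pderiv f) K D" "2 * int D = 2 * int ?n - 1 - 2 ^ d + \<delta>"
      using divstep_gcd[OF p n c False F_def G_def ds] by blast
    let ?r = "if D < t then p else 0"
    have test: "D < t \<longleftrightarrow> \<delta> < (int t + int t + 1 * 2 ^ nat (int d)) - (int ?n + int ?n - 1)" using KD(2) by auto
    have "computes M leaf_code [Atom (int q), Atom (int d), Atom (int ?n), Atom (int t), tree d x, Atom p] (Atom ?r) (tree_cost (9 * dot_cost w) d)"
      apply (rule computesI[OF leaf_code_def, where ws = ?ws])
      apply (rule bounded_Test_then, (rule bnds)+)
      subgoal using p1 by simp
      apply (rule bounded_Let)
      apply (rule bounded_Call[OF cm vF])
      apply (rule bnds | (simp; fail))+
      apply (rule bounded_Test_then)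
      apply (rule bounded_Call[OF cl vF0])
      apply (rule bnds | (simp; fail))+
      apply (rule F0)
      apply (rule bounded_Test_if)
      apply (rule bounded_Lt)
      apply (rule bounded_Left[OF _ v\<delta>])
      apply (rule bounded_Call[OF J(3)[unfolded jump_val_def] n1])
      apply (rule bnds | (simp; fail))+
      apply (rule bounded_Call[OF cd vG])
      apply (rule bnds | (simp; fail))+
      subgoal using test by simp
      subgoal by simp
      subgoal using small ps vx by simp
      subgoal apply simp using small_costs[simplified] cost9 h0 w(2,4) by linarith
      done
    moreover have "?r = p \<and> good p f t \<or> ?r = 0 \<and> bad p f t"
    proof (cases "D < t")
      case True
      then show ?thesis using False p KD(1) unfolding good_def by auto
    next
      case nD: False
      then have "t \<le> D" by simp
      then have "bad p f t" unfolding bad_def using KD(1) by blast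
      then show ?thesis using nD by simp
    qed
    ultimately show ?thesis by blast
  qed
qed

section \<open>Simultaneous reduction modulo many primes\<close>

text \<open>A remainder by a power of two through shifts, because \<open>Rem\<close> is charged the
  product of the lengths.\<close>

definition low_code :: fexp where
  "low_code = Prim Sub (Var 1) (Prim Shl (Prim Shr (Var 1) (Var 0)) (Var 0))"

lemma computes_low:
  assumes "bit_size x \<le> w"
  shows "computes M low_code [Atom (int s), Atom x] (Atom (x mod 2 ^ s)) (20 * (w + s) + 100)"
  apply (rule computesI[OF low_code_def, where ws = "[(Atom (int s), s + 1), (Atom x, w)]"])
  apply (rule bnds)+
  subgoal by (simp add: minus_div_mult_eq_mod)
  subgoal by simp
  subgoal using assms bit_size_of_nat[of s] by simp
  subgoal by simp
  done

lemma bit_size_mod_power: "bit_size (x mod 2 ^ s) \<le> s + 2"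
proof (rule bit_size_le_power)
  have "0 \<le> x mod 2 ^ s" "x mod 2 ^ s < 2 ^ s" by simp_all
  then show "\<bar>x mod 2 ^ s\<bar> \<le> 2 ^ s" by linarith
qed

section \<open>Products of moduli\<close>

fun tree_prod :: "nat => (nat => int) => int" where
  "tree_prod 0 m = m 0"
| "tree_prod (Suc h) m = tree_prod h m * tree_prod h (\<lambda>i. m (2 ^ h + i))"

lemma tree_prod_bounds:
  assumes "\<And>i. i < 2 ^ h ==> 1 \<le> m i \<and> m i < 2 ^ 2 ^ \<kappa>"
  shows "1 \<le> tree_prod h m \<and> tree_prod h m < 2 ^ 2 ^ (\<kappa> + h)"
  using assms
proof (induction h arbitrary: m)
  case (Suc h)
  let ?x = "tree_prod h m" and ?y = "tree_prod h (\<lambda>i. m (2 ^ h + i))"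
  have x: "1 \<le> ?x \<and> ?x < 2 ^ 2 ^ (\<kappa> + h)" by (rule Suc.IH) (use Suc.prems in auto)
  have y: "1 \<le> ?y \<and> ?y < 2 ^ 2 ^ (\<kappa> + h)" by (rule Suc.IH) (use Suc.prems in auto)
  have "?x * ?y < 2 ^ 2 ^ (\<kappa> + h) * 2 ^ 2 ^ (\<kappa> + h)" using x y by (intro mult_strict_mono) auto
  also have "\<dots> = 2 ^ 2 ^ (\<kappa> + Suc h)" by (simp add: power_add[symmetric] mult_2)
  finally have "?x * ?y < 2 ^ 2 ^ (\<kappa> + Suc h)" .
  moreover have "1 * 1 \<le> ?x * ?y" using x y by (intro mult_mono) auto
  ultimately show ?case by simp
qed simp

lemma tree_prod_odd: "(\<And>i. i < 2 ^ h ==> odd (m i)) ==> odd (tree_prod h m)"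
  by (induction h arbitrary: m) auto

lemma tree_prod_dvd: "i < 2 ^ h ==> m i dvd tree_prod h m"
proof (induction h arbitrary: m i)
  case (Suc h)
  show ?case
  proof (cases "i < 2 ^ h")
    case True
    then show ?thesis using Suc.IH[of i m] by simp
  next
    case False
    then have "i - 2 ^ h < 2 ^ h" "2 ^ h + (i - 2 ^ h) = i" using Suc.prems by auto
    then show ?thesis using Suc.IH[of "i - 2 ^ h" "\<lambda>i. m (2 ^ h + i)"] by simp
  qed
qed simp

definition prod_code :: fexp where
  "prod_code = Test (Var 0)
     (Call mul_code [Const 0, Prim Add (Var 0) (Var 1),
        Recur [Prim Sub (Var 0) (Const 1), Var 1, Left (Var 2)], Recur [Prim Sub (Var 0) (Const 1), Var 1, Right (Var 2)]])
     (Var 2)"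

lemma computes_prod:
  assumes "\<And>i. i < 2 ^ h ==> 1 \<le> m i \<and> m i < 2 ^ 2 ^ \<kappa>" "\<kappa> + h \<le> W"
  shows "computes M prod_code [Atom (int h), Atom (int \<kappa>), tree h m] (Atom (tree_prod h m)) (tree_cost (2 ^ 82 * (2 ^ \<kappa> * (W + 1) ^ 4)) h)"
  using assms
proof (induction h arbitrary: m)
  case 0
  have s: "bit_size (m 0) \<le> 2 ^ \<kappa> + 2" by (rule bit_size_le_power) (use 0 in simp)
  have W4: "W + 1 \<le> (W + 1) ^ 4" "1 \<le> (W + 1) ^ 4" by (simp_all add: self_le_power)
  define K where "K = 2 ^ \<kappa> * (W + 1) ^ 4"
  have c: "W + 1 \<le> K" "2 ^ \<kappa> \<le> K"
    unfolding K_def using mult_le_mono[of 1 "2 ^ \<kappa>" "W + 1" "(W + 1) ^ 4"] W4 by auto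
  show ?case
    apply (rule computesI[OF prod_code_def, where ws = "[(Atom (int 0), 1), (Atom (int \<kappa>), W + 1), (Atom (m 0), 2 ^ \<kappa> + 2)]"])
    apply (rule bounded_Test_else, (rule bnds | (simp; fail))+)
    subgoal using s 0(2) bit_size_of_nat[of \<kappa>] by simp
    subgoal unfolding tree_cost_0 K_def[symmetric] using c by simp
    done
next
  case (Suc h)
  let ?m = "\<lambda>i. m (2 ^ h + i)"
  have m: "\<And>i. i < 2 ^ h ==> 1 \<le> m i \<and> m i < 2 ^ 2 ^ \<kappa>" "\<And>i. i < 2 ^ h ==> 1 \<le> ?m i \<and> ?m i < 2 ^ 2 ^ \<kappa>" "\<kappa> + h \<le> W"
    using Suc.prems by auto
  have m0: "\<bar>m i\<bar> \<le> 2 ^ 2 ^ \<kappa>" if "i < 2 ^ Suc h" for i using Suc.prems(1)[OF that] by linarith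
  let ?x = "tree_prod h m" and ?y = "tree_prod h ?m" and ?j = "\<kappa> + Suc h"
  have le: "(2::int) ^ 2 ^ (\<kappa> + h) \<le> 2 ^ 2 ^ ?j" by (intro power_increasing) auto
  have "1 \<le> ?x \<and> ?x < 2 ^ 2 ^ (\<kappa> + h)" by (rule tree_prod_bounds[OF m(1)])
  moreover have "1 \<le> ?y \<and> ?y < 2 ^ 2 ^ (\<kappa> + h)" by (rule tree_prod_bounds[OF m(2)])
  moreover have "1 \<le> tree_prod (Suc h) m \<and> tree_prod (Suc h) m < 2 ^ 2 ^ ?j" by (rule tree_prod_bounds[OF Suc.prems(1)])
  ultimately have b: "0 \<le> ?x" "?x \<le> 2 ^ 2 ^ ?j" "0 \<le> ?y" "?y \<le> 2 ^ 2 ^ ?j" "0 \<le> ?x * ?y" "?x * ?y < 2 ^ 2 ^ ?j"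
    "\<bar>?x\<bar> \<le> 2 ^ 2 ^ ?j" "\<bar>?y\<bar> \<le> 2 ^ 2 ^ ?j" "\<bar>?x * ?y\<bar> \<le> 2 ^ 2 ^ ?j"
    unfolding tree_prod.simps using le by linarith+
  have cm: "computes M mul_code [Atom 0, Atom (int ?j), Atom ?x, Atom ?y] (Atom (?x * ?y)) (mul_cost ?j)"
    by (rule computes_mul[OF _ b(1-4,6)]) simp
  have v: "vsize (Atom ?x) \<le> 2 ^ ?j + 2" "vsize (Atom ?y) \<le> 2 ^ ?j + 2" "vsize (Atom (?x * ?y)) \<le> 2 ^ ?j + 2"
    unfolding vsize.simps by (rule bit_size_le_power, rule b)+
  have t: "vsize (tree h m) \<le> 2 ^ \<kappa> + 2" "vsize (tree h ?m) \<le> 2 ^ \<kappa> + 2"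
    by (rule vsize_tree_range; use m0 in simp)+
  define K where "K = 2 ^ \<kappa> * (W + 1) ^ 4"
  have W4: "W + 1 \<le> (W + 1) ^ 4" "1 \<le> (W + 1) ^ 4" by (simp_all add: self_le_power)
  have c: "W + 1 \<le> K" "2 ^ \<kappa> \<le> K" "2 ^ ?j \<le> 2 * (2 ^ h * K)" "mul_cost ?j \<le> 2 ^ 81 * (2 ^ h * K)" "K \<le> 2 ^ h * K"
  proof -
    have "?j ^ 4 \<le> (W + 1) ^ 4" using Suc.prems(2) by (intro power_mono) auto
    then have "2 ^ ?j * ?j ^ 4 \<le> 2 ^ ?j * (W + 1) ^ 4" by (rule mult_le_mono2)
    also have "\<dots> = 2 * (2 ^ h * K)" by (simp add: K_def power_add)
    finally show "mul_cost ?j \<le> 2 ^ 81 * (2 ^ h * K)" unfolding mul_cost_def by simp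
    have "2 ^ ?j * 1 \<le> 2 ^ ?j * (W + 1) ^ 4" using W4(2) by (rule mult_le_mono2)
    also have "\<dots> = 2 * (2 ^ h * K)" by (simp add: K_def power_add)
    finally show "2 ^ ?j \<le> 2 * (2 ^ h * K)" by simp
    show "W + 1 \<le> K" "2 ^ \<kappa> \<le> K" unfolding K_def using mult_le_mono[of 1 "2 ^ \<kappa>" "W + 1" "(W + 1) ^ 4"] W4 by auto
  qed simp
  define C where "C = 2 ^ 82 * (2 ^ \<kappa> * (W + 1) ^ 4)"
  have K: "2 ^ h * C = 2 ^ 82 * (2 ^ h * K)" by (simp add: K_def C_def)
  have K': "3000 * (2 ^ h * K) + mul_cost ?j \<le> 2 * (2 ^ h * C)"
  proof -
    have "3000 * X + Y \<le> 2 * (2 ^ 82 * X)" if "Y \<le> 2 ^ 81 * X" for X Y :: nat using that by simp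
    then show ?thesis unfolding K using c(4) by blast
  qed
  note IH = Suc.IH[folded C_def]
  show ?case
    unfolding C_def[symmetric]
    apply (rule computesI[OF prod_code_def, where ws = "[(Atom (int (Suc h)), W + 1), (Atom (int \<kappa>), W + 1), (tree (Suc h) m, 1)]"])
    apply (rule bounded_Test_then, (rule bnds | (simp; fail))+)
    apply (rule bounded_Call[OF cm v(3)])
    apply (unfold tree.simps)
    apply (rule bnds)+
    apply (rule bounded_Recur[OF IH[OF m(1,3)] v(1)], assumption)
    apply (rule bnds t | (simp; fail))+
    apply (rule bounded_Recur[OF IH[OF m(2,3)] v(2)], assumption)
    apply (rule bnds t | (simp; fail))+
    subgoal using Suc.prems(2) bit_size_of_nat[of \<kappa>] bit_size_of_nat[of "Suc h"] by simp
    subgoal apply (simp del: power_Suc) unfolding tree_cost_Suc using c[simplified] c(5) K'[simplified] power_Suc[of "2::nat" "\<kappa> + h"] by linarith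
    done
qed

section \<open>Inverses modulo powers of two\<close>

definition inv_code :: fexp where
  "inv_code = Test (Var 0)
     (Let_in (Recur [Prim Sub (Var 0) (Const 1), Call low_code [Prim Shl (Const 1) (Prim Sub (Var 0) (Const 1)), Var 1]])
     (Call low_code [Prim Shl (Const 1) (Var 1),
        Call mul_code [Const 0, Prim Add (Var 1) (Const 1), Var 0,
          Call low_code [Prim Shl (Const 1) (Var 1), Prim Sub (Const 2) (Call mul_code [Const 0, Prim Add (Var 1) (Const 1), Var 2, Var 0])]]]))
     (Const 1)"

text \<open>Newton iteration, starting from the inverse 1 of an odd number modulo 2. The recursive
  call receives \<open>m\<close> reduced to half the length, so the last step dominates the
  cost.\<close>

fun inverse_mod :: "nat => int => int" where
  "inverse_mod 0 m = 1"
| "inverse_mod (Suc j) m = (let y = inverse_mod j (m mod 2 ^ 2 ^ j) in (y * ((2 - m * y) mod 2 ^ 2 ^ Suc j)) mod 2 ^ 2 ^ Suc j)"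

lemma inverse_mod_range: "0 \<le> inverse_mod j m \<and> inverse_mod j m < 2 ^ 2 ^ j"
  by (cases j) (simp_all add: Let_def)

text \<open>From \<open>1 - m * (y * (2 - m * y)) = (1 - m * y)^2\<close> the number of correct bits
  doubles.\<close>

lemma inverse_mod_correct: "odd m ==> 2 ^ 2 ^ j dvd (m * inverse_mod j m - 1)"
proof (induction j arbitrary: m)
  case (Suc j)
  let ?a = "2 ^ 2 ^ j :: int" and ?y = "inverse_mod j (m mod 2 ^ 2 ^ j)"
  have a: "2 ^ 2 ^ Suc j = ?a * ?a" by (simp add: power_add[symmetric] mult_2)
  have "2 dvd ?a" by simp
  then have "odd (m mod ?a)" using Suc.prems by (simp add: dvd_mod_iff)
  from Suc.IH[OF this] have "?a dvd (m mod ?a) * ?y - 1" .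
  moreover have "?a dvd (m - m mod ?a)" by (simp add: minus_mod_eq_mult_div)
  then have "?a dvd (m - m mod ?a) * ?y" by (rule dvd_mult2)
  ultimately have "?a dvd (m - m mod ?a) * ?y + ((m mod ?a) * ?y - 1)" by (simp only: dvd_add)
  also have "(m - m mod ?a) * ?y + ((m mod ?a) * ?y - 1) = m * ?y - 1" by (simp add: left_diff_distrib)
  finally have e: "?a dvd m * ?y - 1" .
  have "?a * ?a dvd (m * ?y - 1) * (m * ?y - 1)" by (rule mult_dvd_mono[OF e e])
  then have 1: "?a * ?a dvd m * (?y * (2 - m * ?y)) - 1"
    using dvd_minus_iff[of "?a * ?a" "m * (?y * (2 - m * ?y)) - 1"] by (simp add: algebra_simps)
  let ?z = "(?y * ((2 - m * ?y) mod (?a * ?a))) mod (?a * ?a)"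
  have "?z = (?y * (2 - m * ?y)) mod (?a * ?a)" by (simp add: mod_simps)
  then have "?a * ?a dvd ?y * (2 - m * ?y) - ?z" by (simp add: minus_mod_eq_mult_div)
  then have "?a * ?a dvd m * (?y * (2 - m * ?y) - ?z)" by (rule dvd_mult)
  from dvd_diff[OF 1 this] have "?a * ?a dvd m * ?z - 1" by (simp add: algebra_simps)
  then show ?case unfolding inverse_mod.simps Let_def a .
qed simp

lemma computes_inv:
  assumes "0 \<le> m" "m < 2 ^ 2 ^ j" "odd m"
  shows "computes M inv_code [Atom (int j), Atom m] (Atom (inverse_mod j m)) (2 ^ 84 * (2 ^ j * (j + 2) ^ 4))"
  using assms
proof (induction j arbitrary: m)
  case 0
  have "m = 0 \<or> m = 1" using 0(1,2) by auto
  then have m: "m = 1" using 0(3) by auto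
  show ?case
    apply (rule computesI[OF inv_code_def, where ws = "[(Atom (int 0), 1), (Atom m, 2)]"])
    apply (rule bounded_Test_else, (rule bnds | (simp; fail))+)
    subgoal using m by simp
    subgoal by (simp add: numeral_2_eq_2[symmetric])
    done
next
  case (Suc j)
  let ?a = "2 ^ 2 ^ j :: int" and ?s = "2 ^ j :: nat" and ?y = "inverse_mod j (m mod 2 ^ 2 ^ j)"
  let ?b = "2 ^ 2 ^ Suc j :: int"
  have ab: "?b = ?a * ?a" by (simp add: power_add[symmetric] mult_2)
  have y: "0 \<le> ?y" "?y < ?a" using inverse_mod_range by auto
  have "odd (m mod ?a)" using Suc.prems(3) by (simp add: dvd_mod_iff)
  then have IH: "computes M inv_code [Atom (int j), Atom (m mod ?a)] (Atom ?y) (2 ^ 84 * (2 ^ j * (j + 2) ^ 4))"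
    by (intro Suc.IH) auto
  \<comment> \<open>Intermediate products stay below the square of the modulus, which is the
    capacity of a multiplication with exponent \<open>j + 2\<close>.\<close>
  have c: "2 ^ 2 ^ (j + 2) = ?b * ?b" by (simp add: power_add[symmetric] mult_2)
  have a1: "1 \<le> ?a" "1 \<le> ?b" "?a \<le> ?b" by (simp_all add: power_increasing)
  have bb: "?b \<le> ?b * ?b" using mult_mono[of 1 ?b ?b ?b] a1 by simp
  have yb: "?y < ?b" using y a1 by linarith
  have p1: "m * ?y < ?b * ?b" by (intro mult_strict_mono) (use Suc.prems y yb a1 in auto)
  have m1: "computes M mul_code [Atom 0, Atom (int (j + 2)), Atom m, Atom ?y] (Atom (m * ?y)) (mul_cost (j + 2))"
    by (rule computes_mul; (unfold c)?) (use Suc.prems y a1 bb p1 in linarith)+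
  let ?u = "(2 - m * ?y) mod ?b"
  have u: "0 \<le> ?u" "?u < ?b" by simp_all
  have p2: "?y * ?u < ?b * ?b" by (intro mult_strict_mono) (use u y yb a1 in auto)
  have m2: "computes M mul_code [Atom 0, Atom (int (j + 2)), Atom ?y, Atom ?u] (Atom (?y * ?u)) (mul_cost (j + 2))"
    by (rule computes_mul; (unfold c)?) (use u y a1 bb p2 in linarith)+
  have e4: "2 ^ (j + 2) = 4 * ?s" "2 ^ Suc j = 2 * ?s" by simp_all
  have s1: "bit_size m \<le> 2 * ?s + 2" using bit_size_le_power[of m "2 ^ Suc j"] Suc.prems by (simp only: e4) (simp?)
  have "m * ?y \<le> 2 ^ 2 ^ (j + 2)" unfolding c using p1 by simp
  then have s2: "bit_size (m * ?y) \<le> 4 * ?s + 2"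
    using bit_size_le_power[of "m * ?y" "2 ^ (j + 2)"] Suc.prems(1) y(1) by (simp only: e4) (simp?)
  have "?y * ?u \<le> 2 ^ 2 ^ (j + 2)" unfolding c using p2 by simp
  then have s3: "bit_size (?y * ?u) \<le> 4 * ?s + 2"
    using bit_size_le_power[of "?y * ?u" "2 ^ (j + 2)"] u(1) y(1) by (simp only: e4) (simp?)
  have s4: "bit_size (2 - m * ?y) \<le> 4 * ?s + 10"
    using bit_size_diff[of 2 "m * ?y"] s2 bit_size_small[of 2 7] by simp
  have l1: "computes M low_code [Atom (int (2 ^ j)), Atom m] (Atom (m mod ?a)) (20 * ((2 * ?s + 2) + 2 ^ j) + 100)"
    by (rule computes_low[OF s1])
  have l2: "computes M low_code [Atom (int (2 ^ Suc j)), Atom (2 - m * ?y)] (Atom ?u) (20 * ((4 * ?s + 10) + 2 ^ Suc j) + 100)"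
    by (rule computes_low[OF s4])
  have l3: "computes M low_code [Atom (int (2 ^ Suc j)), Atom (?y * ?u)] (Atom ((?y * ?u) mod ?b)) (20 * ((4 * ?s + 2) + 2 ^ Suc j) + 100)"
    by (rule computes_low[OF s3])
  have v: "vsize (Atom (m mod ?a)) \<le> ?s + 2" "vsize (Atom ?u) \<le> 2 ^ Suc j + 2" "vsize (Atom ((?y * ?u) mod ?b)) \<le> 2 ^ Suc j + 2"
    unfolding vsize.simps by (rule bit_size_mod_power)+
  have vy: "vsize (Atom ?y) \<le> ?s + 2" unfolding vsize.simps by (rule bit_size_le_power) (use y in simp)
  have vm: "vsize (Atom (m * ?y)) \<le> 4 * ?s + 2" "vsize (Atom (?y * ?u)) \<le> 4 * ?s + 2" using s2 s3 by simp_all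
  define H where "H = ?s * (j + 3) ^ 4"
  have "1 \<le> (j + 3) ^ 4" by simp
  then have H1: "?s \<le> H" unfolding H_def by simp
  have j1: "j + 3 \<le> 3 * ?s" "1 \<le> ?s" using less_exp[of j] by linarith+
  have "(j + 2) ^ 4 \<le> (j + 3) ^ 4" by (intro power_mono) auto
  then have H2: "?s * (j + 2) ^ 4 \<le> H" unfolding H_def by (rule mult_le_mono2)
  have mc: "mul_cost (j + 2) \<le> 2 ^ 82 * H" unfolding mul_cost_def e4 using H2 by simp
  have H3: "2 ^ 84 * (2 ^ Suc j * (Suc j + 2) ^ 4) = 2 ^ 85 * H" by (simp add: H_def numeral_3_eq_3)
  have "2 ^ 84 * (2 ^ j * (j + 2) ^ 4) + 2 * mul_cost (j + 2) + 2000 * H \<le> 2 ^ 85 * H" using H2 mc by simp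
  note cost = this[unfolded H3[symmetric]]
  show ?case
    apply (rule computesI[OF inv_code_def, where ws = "[(Atom (int (Suc j)), j + 2), (Atom m, 2 * ?s + 2)]"])
    apply (rule bounded_Test_then, (rule bnds | (simp; fail))+)
    apply (rule bounded_Recur[OF IH vy])
    apply (rule bnds)+
    apply (rule bounded_Call[OF l1 v(1)])
    apply (rule bnds | (simp; fail))+
    apply (rule bounded_Call[OF l3 v(3)])
    apply (rule bnds)+
    apply (rule bounded_Call[OF m2 vm(2)])
    apply (rule bnds)+
    apply (rule bounded_Call[OF l2 v(2)])
    apply (rule bnds)+
    apply (rule bounded_Call[OF m1 vm(1)])
    apply (rule bnds | (simp add: nat_add_distrib; fail))+
    subgoal by (simp add: Let_def)
    subgoal by simp
    subgoal using s1 bit_size_of_nat[of "Suc j"] by simp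
    subgoal using cost H1 j1 by simp
    done
qed

text \<open>Montgomery's reduction: a multiple of \<open>m\<close> that clears the low
  \<open>2 ^ j\<close> bits is added, and the shift then yields \<open>x / 2 ^ (2 ^ j)\<close>
  modulo \<open>m\<close>.\<close>

definition redc :: "nat => int => int => int" where
  "redc j m x = (x + (- (x mod 2 ^ 2 ^ j * inverse_mod j m)) mod 2 ^ 2 ^ j * m) div 2 ^ 2 ^ j"

lemma redc_correct:
  assumes "odd m"
  shows "2 ^ 2 ^ j * redc j m x = x + (- (x mod 2 ^ 2 ^ j * inverse_mod j m)) mod 2 ^ 2 ^ j * m"
proof -
  let ?b = "2 ^ 2 ^ j :: int" and ?y = "inverse_mod j m"
  let ?q = "(- (x mod ?b * ?y)) mod ?b"
  have "?q = (- (x * ?y)) mod ?b" by (metis mod_minus_cong mod_mult_left_eq)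
  then have "?b dvd - (x * ?y) - ?q" by (simp add: minus_mod_eq_mult_div)
  then have 1: "?b dvd (- (x * ?y) - ?q) * m" by (rule dvd_mult2)
  have "?b dvd x * (m * ?y - 1)" by (rule dvd_mult[OF inverse_mod_correct[OF assms]])
  from dvd_add[OF 1 this] have "?b dvd - (x + ?q * m)" by (simp add: algebra_simps)
  then have "?b dvd x + ?q * m" by (simp only: dvd_minus_iff)
  then show ?thesis unfolding redc_def by (rule dvd_mult_div_cancel)
qed

text \<open>The result lies between -1 and \<open>m\<close>: the added multiple is at most
  \<open>2 ^ (2 ^ j) - 1\<close> times \<open>m\<close>, and after the shift \<open>x\<close>
  contributes at most 1 in absolute value. So signed arguments much longer than \<open>m\<close>
  shrink to its length in one step.\<close>

lemma redc_range:
  assumes m: "odd m" "1 \<le> m" "m < 2 ^ s" and x: "\<bar>x\<bar> \<le> 2 ^ 2 ^ j"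
  shows "\<bar>redc j m x\<bar> \<le> 2 ^ s"
proof -
  let ?b = "2 ^ 2 ^ j :: int"
  define q where "q = (- (x mod ?b * inverse_mod j m)) mod ?b"
  have q: "0 \<le> q" "q \<le> ?b - 1" by (simp_all add: q_def)
  have e: "?b * redc j m x = x + q * m" unfolding q_def by (rule redc_correct[OF m(1)])
  have "q * m \<le> (?b - 1) * m" using q m by (intro mult_right_mono) auto
  then have u: "?b * redc j m x < ?b * (m + 1)" using e x m by (simp add: algebra_simps)
  have "0 \<le> q * m" using q m by simp
  then have "- ?b \<le> ?b * redc j m x" using e x by simp
  then have "?b * (- 1) \<le> ?b * redc j m x" by simp
  then have "- 1 \<le> redc j m x" by (rule mult_left_le_imp_le) simp
  moreover have "redc j m x < m + 1" using u by (rule mult_left_less_imp_less) simp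
  ultimately show ?thesis using m by simp
qed

definition redc_code :: fexp where
  "redc_code = Test (Var 0)
     (Join (Recur [Prim Sub (Var 0) (Const 1), Var 1, Var 2, Var 3, Left (Var 4)])
           (Recur [Prim Sub (Var 0) (Const 1), Var 1, Var 2, Var 3, Right (Var 4)]))
     (Prim Shr (Prim Add (Var 4) (Call mul_code [Const 0, Prim Add (Var 1) (Const 1),
        Call low_code [Prim Shl (Const 1) (Var 1), Prim Sub (Const 0)
          (Call mul_code [Const 0, Prim Add (Var 1) (Const 1), Call low_code [Prim Shl (Const 1) (Var 1), Var 4], Var 3])],
        Var 2])) (Prim Shl (Const 1) (Var 1)))"

definition redc_cost :: "nat => nat" where
  "redc_cost j = 2 ^ 83 * (2 ^ j * (j + 1) ^ 4)"

lemma computes_redc: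
  assumes m: "odd m" "1 \<le> m" "m < 2 ^ 2 ^ j" and "\<And>i. i < 2 ^ d ==> \<bar>x i\<bar> \<le> 2 ^ 2 ^ j" "d \<le> 2 ^ j"
  shows "computes M redc_code [Atom (int d), Atom (int j), Atom m, Atom (inverse_mod j m), tree d x] (tree d (\<lambda>i. redc j m (x i)))
    (tree_cost' (redc_cost j) d)"
  using assms(4,5)
proof (induction d arbitrary: x)
  case 0
  let ?b = "2 ^ 2 ^ j :: int" and ?y = "inverse_mod j m" and ?s = "2 ^ j :: nat"
  let ?l = "x 0 mod ?b"
  let ?q = "(0 - ?l * ?y) mod ?b"
  have b1: "1 \<le> ?b" by simp
  have c: "2 ^ 2 ^ (j + 1) = ?b * ?b" by (simp add: power_add[symmetric] mult_2)
  have bb: "?b \<le> ?b * ?b" using mult_mono[of 1 ?b ?b ?b] b1 by simp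
  have y: "0 \<le> ?y" "?y < ?b" using inverse_mod_range by auto
  have l: "0 \<le> ?l" "?l < ?b" "0 \<le> ?q" "?q < ?b" by simp_all
  have x: "\<bar>x 0\<bar> \<le> ?b" using 0 by simp
  have p: "?l * ?y < ?b * ?b" "?q * m < ?b * ?b" by (intro mult_strict_mono; use l y m b1 in simp)+
  have m1: "computes M mul_code [Atom 0, Atom (int (j + 1)), Atom ?l, Atom ?y] (Atom (?l * ?y)) (mul_cost (j + 1))"
    by (rule computes_mul; (unfold c)?) (use l y bb p in linarith)+
  have m2: "computes M mul_code [Atom 0, Atom (int (j + 1)), Atom ?q, Atom m] (Atom (?q * m)) (mul_cost (j + 1))"
    by (rule computes_mul; (unfold c)?) (use l m bb p in linarith)+
  have s0: "bit_size (x 0) \<le> ?s + 2" "bit_size m \<le> ?s + 2" "bit_size ?y \<le> ?s + 2"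
    by (rule bit_size_le_power; use x m y in simp)+
  have e2: "2 ^ (j + 1) = 2 * ?s" by simp
  have "?l * ?y \<le> 2 ^ 2 ^ (j + 1)" "?q * m \<le> 2 ^ 2 ^ (j + 1)" unfolding c using p by simp_all
  then have s1: "bit_size (?l * ?y) \<le> 2 * ?s + 2" "bit_size (?q * m) \<le> 2 * ?s + 2"
    using bit_size_le_power[of "?l * ?y" "2 ^ (j + 1)"] bit_size_le_power[of "?q * m" "2 ^ (j + 1)"] l y m by (simp_all only: e2) simp_all
  have s2: "bit_size (0 - ?l * ?y) \<le> 2 * ?s + 10"
    using bit_size_diff[of 0 "?l * ?y"] s1 bit_size_small[of 0 7] by simp
  have l1: "computes M low_code [Atom (int (2 ^ j)), Atom (x 0)] (Atom ?l) (20 * ((?s + 2) + 2 ^ j) + 100)"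
    by (rule computes_low[OF s0(1)])
  have l2: "computes M low_code [Atom (int (2 ^ j)), Atom (0 - ?l * ?y)] (Atom ?q) (20 * ((2 * ?s + 10) + 2 ^ j) + 100)"
    by (rule computes_low[OF s2])
  have v: "vsize (Atom ?l) \<le> ?s + 2" "vsize (Atom ?q) \<le> ?s + 2"
    unfolding vsize.simps by (rule bit_size_mod_power)+
  have vm: "vsize (Atom (?l * ?y)) \<le> 2 * ?s + 2" "vsize (Atom (?q * m)) \<le> 2 * ?s + 2" using s1 by simp_all
  define H where "H = ?s * (j + 1) ^ 4"
  have "1 \<le> (j + 1) ^ 4" by simp
  then have H1: "?s \<le> H" unfolding H_def by simp
  have j1: "j + 1 \<le> ?s" "1 \<le> ?s" using less_exp[of j] by (auto simp: Suc_le_eq)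
  have mc: "mul_cost (j + 1) = 2 ^ 81 * H" unfolding mul_cost_def e2 H_def by simp
  have "2 * mul_cost (j + 1) + 2000 * H \<le> 2 ^ 83 * H" unfolding mc by simp
  then have cost: "2 * mul_cost (j + 1) + 2000 * H \<le> redc_cost j" unfolding H_def redc_cost_def .
  show ?case
    apply (rule computesI[OF redc_code_def, where ws = "[(Atom (int 0), 1), (Atom (int j), j + 1), (Atom m, ?s + 2), (Atom ?y, ?s + 2), (Atom (x 0), ?s + 2)]"])
    apply (rule bounded_Test_else, (rule bnds | (simp; fail))+)
    apply (rule bounded_Call[OF m2 vm(2)])
    apply (rule bnds)+
    apply (rule bounded_Call[OF l2 v(2)])
    apply (rule bnds)+
    apply (rule bounded_Call[OF m1 vm(1)])
    apply (rule bnds)+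
    apply (rule bounded_Call[OF l1 v(1)])
    apply (rule bnds | (simp; fail))+
    subgoal by (simp add: redc_def nat_power_eq)
    subgoal by simp
    subgoal using s0 bit_size_of_nat[of j] by simp
    subgoal unfolding tree_cost'_0 using cost H1 j1 by simp
    done
next
  case (Suc d)
  let ?b = "\<lambda>i. x (2 ^ d + i)" and ?s = "2 ^ j :: nat"
  have x: "\<And>i. i < 2 ^ d ==> \<bar>x i\<bar> \<le> 2 ^ 2 ^ j" "\<And>i. i < 2 ^ d ==> \<bar>?b i\<bar> \<le> 2 ^ 2 ^ j" and d: "d \<le> 2 ^ j" using Suc.prems by auto
  have t: "vsize (tree d x) \<le> ?s + 2" "vsize (tree d ?b) \<le> ?s + 2"
    by (rule vsize_tree_range; use x in simp)+
  have r: "vsize (tree d (\<lambda>i. redc j m (x i))) \<le> ?s + 2" "vsize (tree d (\<lambda>i. redc j m (?b i))) \<le> ?s + 2"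
    by (rule vsize_tree_range, rule redc_range[OF m]; use x in simp)+
  have y: "bit_size (inverse_mod j m) \<le> ?s + 2" by (rule bit_size_le_power) (use inverse_mod_range[of j m] in simp)
  have bm: "bit_size m \<le> ?s + 2" by (rule bit_size_le_power) (use m in simp)
  have j1: "j + 1 \<le> ?s" "1 \<le> ?s" using less_exp[of j] by (auto simp: Suc_le_eq)
  define H where "H = ?s * (j + 1) ^ 4"
  have "?s * 1 \<le> H" unfolding H_def by (intro mult_le_mono2) simp
  then have cost: "2000 * ?s \<le> redc_cost j" unfolding redc_cost_def H_def[symmetric] by simp
  show ?case
    apply (rule computesI[OF redc_code_def, where ws = "[(Atom (int (Suc d)), ?s + 2), (Atom (int j), j + 1), (Atom m, ?s + 2), (Atom (inverse_mod j m), ?s + 2), (tree (Suc d) x, 1)]"])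
    apply (rule bounded_Test_then, (rule bnds | (simp; fail))+)
    apply (unfold tree.simps)
    apply (rule bounded_Recur[OF Suc.IH[OF x(1) d] r(1)], assumption)
    apply (rule bnds t | (simp; fail))+
    apply (rule bounded_Recur[OF Suc.IH[OF x(2) d] r(2)], assumption)
    apply (rule bnds t | (simp; fail))+
    subgoal using bm y Suc.prems(2) bit_size_of_nat[of "Suc d"] bit_size_of_nat[of j] by simp
    subgoal apply (simp add: tree_cost'_Suc) using cost j1 by linarith
    done
qed

text \<open>The product of the subtree is recomputed at every node rather than stored in the tree,
  which costs no more than another logarithmic factor.\<close>

definition descend_code :: fexp where
  "descend_code = Let_in (Call prod_code [Var 0, Var 1, Var 4])
     (Let_in (Prim Add (Prim Add (Var 1) (Var 2)) (Const 1))
     (Call redc_code [Var 4, Var 0, Var 1, Call inv_code [Var 0, Var 1], Var 5]))"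

text \<open>The numbers arrive with \<open>2 ^ (\<kappa> + h + 1)\<close> bits, which is also the
  length of the Montgomery radix, and the product of the moduli has
  \<open>2 ^ (\<kappa> + h)\<close> bits; every descent halves the length of the numbers.\<close>

lemma computes_descend:
  assumes m: "\<And>i. i < 2 ^ h ==> 1 \<le> m i \<and> m i < 2 ^ 2 ^ \<kappa>" "\<And>i. i < 2 ^ h ==> odd (m i)"
    and x: "\<And>i. i < 2 ^ d ==> \<bar>x i\<bar> \<le> 2 ^ 2 ^ (\<kappa> + h + 1)" and W: "\<kappa> + h \<le> W" and d: "d \<le> 2 ^ \<kappa>"
  shows "computes M descend_code [Atom (int h), Atom (int \<kappa>), Atom (int d), tree d x, tree h m]
     (tree d (\<lambda>i. redc (\<kappa> + h + 1) (tree_prod h m) (x i))) (2 ^ 88 * (2 ^ h * (2 ^ d * 2 ^ \<kappa> * (W + 3) ^ 5)))"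
proof -
  let ?P = "tree_prod h m" and ?j = "\<kappa> + h + 1"
  have b: "1 \<le> ?P \<and> ?P < 2 ^ 2 ^ (\<kappa> + h)" by (rule tree_prod_bounds[OF m(1)])
  have le: "(2::int) ^ 2 ^ (\<kappa> + h) \<le> 2 ^ 2 ^ ?j" by (intro power_increasing) auto
  have P: "0 \<le> ?P" "1 \<le> ?P" "?P < 2 ^ 2 ^ ?j" "odd ?P" "\<bar>?P\<bar> \<le> 2 ^ 2 ^ (\<kappa> + h)"
    subgoal using b by linarith
    subgoal using b by linarith
    subgoal using b le by linarith
    subgoal by (rule tree_prod_odd[OF m(2)])
    subgoal using b by linarith
    done
  have dj: "d \<le> 2 ^ ?j" using d power_increasing[of \<kappa> ?j "2::nat"] by simp
  note c1 = computes_prod[OF m(1) W]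
  note c2 = computes_inv[OF P(1,3,4)]
  note c3 = computes_redc[OF P(4,2,3) x dj]
  have v1: "vsize (Atom ?P) \<le> 2 ^ (\<kappa> + h) + 2" unfolding vsize.simps by (rule bit_size_le_power[OF P(5)])
  have v2: "vsize (Atom (inverse_mod ?j ?P)) \<le> 2 ^ ?j + 2"
    unfolding vsize.simps by (rule bit_size_le_power) (use inverse_mod_range[of ?j ?P] in linarith)
  have r: "\<bar>redc ?j ?P (x i)\<bar> \<le> 2 ^ 2 ^ (\<kappa> + h)" if "i < 2 ^ d" for i
    by (rule redc_range[OF P(4,2) _ x[OF that]]) (use b in simp)
  have v3: "vsize (tree d (\<lambda>i. redc ?j ?P (x i))) \<le> 2 ^ (\<kappa> + h) + 2" by (rule vsize_tree_range[OF r])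
  have v4: "vsize (tree d x) \<le> 2 ^ ?j + 2" by (rule vsize_tree_range[OF x])
  have v5: "vsize (tree h m) \<le> 2 ^ \<kappa> + 2" by (rule vsize_tree_range) (use m(1) in force)
  define H where "H = 2 ^ h * (2 ^ d * 2 ^ \<kappa> * (W + 3) ^ 5)"
  have p5: "(W + 3) ^ 5 = (W + 3) * (W + 3) ^ 4" by (simp add: eval_nat_numeral)
  have p4: "(W + 1) ^ 4 \<le> (W + 3) ^ 4" "(?j + 1) ^ 4 \<le> (W + 3) ^ 4" "(?j + 2) ^ 4 \<le> (W + 3) ^ 4" "(W + 3) ^ 4 \<le> (W + 3) ^ 5" "W + 3 \<le> (W + 3) ^ 5" "1 \<le> (W + 3) ^ 5"
    using W by (auto intro!: power_mono self_le_power power_increasing)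
  have k1: "tree_cost (2 ^ 82 * (2 ^ \<kappa> * (W + 1) ^ 4)) h \<le> 2 ^ 82 * H"
  proof -
    have "tree_cost (2 ^ 82 * (2 ^ \<kappa> * (W + 1) ^ 4)) h = 2 ^ 82 * (2 ^ h * (1 * 2 ^ \<kappa> * ((h + 1) * (W + 1) ^ 4)))"
      unfolding tree_cost_def by (simp only: mult_1 ac_simps)
    also have "\<dots> \<le> 2 ^ 82 * H"
      unfolding H_def p5 using p4(1) W by (intro mult_le_mono mult_le_mono2) auto
    finally show ?thesis .
  qed
  have k2: "2 ^ 84 * (2 ^ ?j * (?j + 2) ^ 4) \<le> 2 ^ 85 * H"
  proof -
    have "2 ^ 84 * (2 ^ ?j * (?j + 2) ^ 4) = 2 ^ 85 * (2 ^ h * (1 * 2 ^ \<kappa> * (?j + 2) ^ 4))" by (simp add: power_add)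
    also have "\<dots> \<le> 2 ^ 85 * H" unfolding H_def using le_trans[OF p4(3,4)] by (intro mult_le_mono2 mult_le_mono) auto
    finally show ?thesis .
  qed
  have k3: "tree_cost' (redc_cost ?j) d \<le> 2 ^ 85 * H"
  proof -
    have "tree_cost' (redc_cost ?j) d \<le> 2 * 2 ^ d * redc_cost ?j" by (rule tree_cost'_le)
    also have "\<dots> = 2 ^ 85 * (2 ^ h * (2 ^ d * 2 ^ \<kappa> * (?j + 1) ^ 4))" unfolding redc_cost_def by (simp add: power_add)
    also have "\<dots> \<le> 2 ^ 85 * H" unfolding H_def using le_trans[OF p4(2,4)] by (intro mult_le_mono2 mult_le_mono) auto
    finally show ?thesis .
  qed
  have k4: "2 ^ (\<kappa> + h) \<le> H" "W + 3 \<le> H" "2 ^ \<kappa> \<le> H"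
  proof -
    have "2 ^ (\<kappa> + h) = 2 ^ h * (1 * 2 ^ \<kappa> * (1::nat))" by (simp add: power_add)
    also have "\<dots> \<le> H" unfolding H_def using p4(6) by (intro mult_le_mono) auto
    finally show "2 ^ (\<kappa> + h) \<le> H" .
    have "W + 3 = 1 * (1 * 1 * (W + 3))" by simp
    also have "\<dots> \<le> H" unfolding H_def using p4(5) by (intro mult_le_mono) auto
    finally show "W + 3 \<le> H" .
    have "2 ^ \<kappa> = 1 * (1 * 2 ^ \<kappa> * (1::nat))" by simp
    also have "\<dots> \<le> H" unfolding H_def using p4(6) by (intro mult_le_mono) auto
    finally show "2 ^ \<kappa> \<le> H" .
  qed
  have "2 ^ 82 * H + 2 ^ 85 * H + 2 ^ 85 * H + 1000 * H \<le> 2 ^ 88 * H" by simp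
  then have cost: "tree_cost (2 ^ 82 * (2 ^ \<kappa> * (W + 1) ^ 4)) h + 2 ^ 84 * (2 ^ ?j * (?j + 2) ^ 4) + tree_cost' (redc_cost ?j) d + 1000 * H \<le> 2 ^ 88 * H"
    using k1 k2 k3 by linarith
  have pj: "2 ^ ?j = 2 * (2::nat) ^ (\<kappa> + h)" by simp
  have cost': "2 ^ (\<kappa> + h) \<le> H" "W + 3 \<le> H" "2 ^ \<kappa> \<le> H" by (rule k4)+
  have small: "bit_size (int h) \<le> W + 1" "bit_size (int \<kappa>) \<le> W + 1" "bit_size (int d) \<le> 2 ^ \<kappa> + 1"
    using W d bit_size_of_nat[of h] bit_size_of_nat[of \<kappa>] bit_size_of_nat[of d] by linarith+
  have jj: "int ?j = int h + int \<kappa> + 1" by simp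
  show ?thesis
    unfolding H_def[symmetric]
    apply (rule computesI[OF descend_code_def, where ws = "[(Atom (int h), W + 1), (Atom (int \<kappa>), W + 1), (Atom (int d), 2 ^ \<kappa> + 1), (tree d x, 2 ^ ?j + 2), (tree h m, 2 ^ \<kappa> + 2)]"])
    apply (rule bnds)+
    apply (rule bounded_Call[OF c1 v1], assumption)
    apply (rule bnds | (simp; fail))+
    apply (rule bounded_Call[OF c3 v3], assumption)
    apply (rule bnds)+
    apply (rule bounded_Call[OF c2 v2])
    apply (rule bnds | (simp add: jj; fail))+
    subgoal using small v4 v5 by simp
    subgoal using cost cost' unfolding pj by simp
    done
qed

section \<open>Search through the tree of primes\<close>

definition search_code :: fexp where
  "search_code = Test (Var 0)
     (Let_in (Recur [Prim Sub (Var 0) (Const 1), Var 1, Var 2, Var 3, Var 4,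
        Call descend_code [Prim Sub (Var 0) (Const 1), Var 1, Var 2, Var 5, Left (Var 6)], Left (Var 6)])
     (Test (Var 0) (Var 0)
       (Recur [Prim Sub (Var 1) (Const 1), Var 2, Var 3, Var 4, Var 5,
        Call descend_code [Prim Sub (Var 1) (Const 1), Var 2, Var 3, Var 6, Right (Var 7)], Right (Var 7)])))
     (Call leaf_code [Prim Add (Var 1) (Const 2), Var 2, Var 3, Var 4, Var 5, Var 6])"

text \<open>The first summand pays for the test at a leaf, the second for the share of one leaf in
  the reductions of a level.\<close>

definition search_cost :: "nat => nat => nat => nat" where
  "search_cost \<kappa> d W = tree_cost (9 * dot_cost (4 * 2 ^ \<kappa>)) d + 2 ^ 89 * (2 ^ d * 2 ^ \<kappa> * (W + 3) ^ 5)"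

text \<open>What survives repeated Montgomery reduction: each one divides by a power of two, a unit
  modulo an odd prime. The unit \<open>c\<close> is common to all coefficients, as they pass through
  the same reductions.\<close>

definition unit_multiple :: "int poly => nat => (nat => int) => int => bool" where
  "unit_multiple f d x p \<longleftrightarrow> (\<exists>c. \<not> p dvd c \<and> (\<forall>i<2 ^ d. p dvd (x i - c * reversal f i)))"

lemma unit_multiple_redc:
  assumes p: "prime p" "odd p" "p dvd m" and "odd m" and u: "unit_multiple f d x p"
  shows "unit_multiple f d (\<lambda>i. redc j m (x i)) p"
proof -
  obtain c where c: "\<not> p dvd c" "\<And>i. i < 2 ^ d ==> p dvd (x i - c * reversal f i)"
    using u unfolding unit_multiple_def by auto
  let ?b = "2 ^ 2 ^ j :: int"
  have "\<not> p dvd 2"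
  proof
    assume "p dvd 2"
    then have "p = 2" using zdvd_imp_le[of p 2] prime_ge_2_int[OF p(1)] by simp
    then show False using p(2) by simp
  qed
  then have "\<not> p dvd ?b" using prime_dvd_power[OF p(1)] by blast
  then obtain e where e: "p dvd (e * ?b - 1)" by (rule prime_inverse_mod[OF p(1)])
  have pe: "\<not> p dvd e"
  proof
    assume "p dvd e"
    then have "p dvd e * ?b" by simp
    from dvd_diff[OF this e] have "p dvd 1" by simp
    then show False using p(1) by (simp add: prime_int_iff zdvd1_eq)
  qed
  have "p dvd redc j m (x i) - e * c * reversal f i" if "i < 2 ^ d" for i
  proof -
    let ?r = "redc j m (x i)" and ?q = "(- (x i mod ?b * inverse_mod j m)) mod ?b"
    have r: "?b * ?r = x i + ?q * m" by (rule redc_correct[OF \<open>odd m\<close>])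
    have "p dvd ?q * m" using p(3) by simp
    from dvd_add[OF c(2)[OF that] this] have 1: "p dvd ?b * ?r - c * reversal f i" unfolding r by (simp add: algebra_simps)
    have "p dvd e * (?b * ?r - c * reversal f i) - (e * ?b - 1) * ?r" by (rule dvd_diff[OF dvd_mult[OF 1] dvd_mult2[OF e]])
    then show ?thesis by (simp add: algebra_simps)
  qed
  moreover have "\<not> p dvd e * c" using pe c(1) p(1) by (simp add: prime_dvd_mult_iff)
  ultimately show ?thesis unfolding unit_multiple_def by blast
qed

text \<open>An entry 1 stands for a number that is not an odd prime: it is neutral in the products
  and skipped at the leaf. The result 0 certifies that every prime of the subtree is bad, which at
  the root will be excluded by counting.\<close>

lemma computes_search:
  assumes n: "1 \<le> degree f" "2 * degree f \<le> 2 ^ d" and t: "t \<le> degree f"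
    and \<kappa>: "k + d \<le> 2 ^ \<kappa>"
    and "\<kappa> + h \<le> W" "\<And>i. i < 2 ^ h ==> m i = 1 \<or> prime (m i) \<and> odd (m i)" "\<And>i. i < 2 ^ h ==> m i < 2 ^ k"
    "\<And>i. i < 2 ^ d ==> \<bar>x i\<bar> \<le> 2 ^ 2 ^ (\<kappa> + h)" "\<And>i. i < 2 ^ h ==> m i \<noteq> 1 ==> unit_multiple f d x (m i)"
  shows "\<exists>r. computes M search_code [Atom (int h), Atom (int \<kappa>), Atom (int d), Atom (int (degree f)), Atom (int t), tree d x, tree h m]
      (Atom r) (tree_cost (search_cost \<kappa> d W) h) \<and>
    (if r = 0 then \<forall>i<2 ^ h. m i \<noteq> 1 \<longrightarrow> bad (m i) f t else \<exists>i<2 ^ h. m i = r \<and> good r f t)"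
  using assms(5-)
proof (induction h arbitrary: m x)
  case 0
  let ?w = "4 * 2 ^ \<kappa> :: nat" and ?n = "degree f"
  have w: "?w = 2 ^ (\<kappa> + 2)" "2 \<le> ?w" "d < ?w" using \<kappa> zero_less_power[of "2::nat" \<kappa>] by (simp add: power_add, linarith, linarith)
  have k1: "1 \<le> m 0" using 0(2)[of 0] prime_ge_1_int[of "m 0"] by auto
  have mk: "m 0 < 2 ^ k" using 0(3) by simp
  have kk: "(2::int) ^ k \<le> 2 ^ 2 ^ \<kappa>" using \<kappa> by (intro power_increasing) auto
  \<comment> \<open>\<open>k + d <= 2 ^ \<kappa>\<close> gives
    \<open>1 + d + 2 * k < 4 * 2 ^ \<kappa>\<close>; this is why the leaves work with slots of
    \<open>2 ^ (\<kappa> + 2)\<close> bits.\<close>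
  have mw: "2 * 2 ^ d * (m 0 * m 0) < 2 ^ ?w"
  proof -
    have "m 0 * m 0 \<le> 2 ^ k * 2 ^ k" using mk k1 by (intro mult_mono) auto
    then have "2 * 2 ^ d * (m 0 * m 0) \<le> 2 * 2 ^ d * (2 ^ k * 2 ^ k)" by (intro mult_left_mono) auto
    also have "\<dots> = 2 ^ (1 + d + (k + k))" by (simp add: power_add)
    also have "\<dots> < 2 ^ ?w" using \<kappa> zero_less_power[of "2::nat" \<kappa>] by (intro power_strict_increasing) linarith+
    finally show ?thesis .
  qed
  have xw: "\<bar>x i\<bar> \<le> 2 ^ ?w" if "i < 2 ^ d" for i
  proof -
    have "(2::int) ^ 2 ^ (\<kappa> + 0) \<le> 2 ^ ?w" by (intro power_increasing) auto
    then show ?thesis using 0(4)[OF that] by linarith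
  qed
  have sc: "tree_cost (9 * dot_cost ?w) d + 2000 * ?w + 2000 * (W + 3) \<le> search_cost \<kappa> d W"
  proof -
    define H where "H = 2 ^ d * 2 ^ \<kappa> * (W + 3) ^ 5"
    have p4: "W + 3 \<le> (W + 3) ^ 5" "1 \<le> (W + 3) ^ 5" by (auto intro!: self_le_power)
    have "1 * 2 ^ \<kappa> * 1 \<le> H" unfolding H_def using p4(2) by (intro mult_le_mono) auto
    moreover have "1 * 1 * (W + 3) \<le> H" unfolding H_def using p4(1) by (intro mult_le_mono) auto
    moreover have "10000 * H \<le> 2 ^ 89 * H" by simp
    ultimately show ?thesis unfolding search_cost_def H_def[symmetric] by linarith
  qed
  have nd: "2 * int ?n \<le> 2 ^ d"
  proof -
    have "int (2 * ?n) \<le> int (2 ^ d)" using n(2) of_nat_le_iff by blast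
    then show ?thesis by simp
  qed
  have d2: "(2::int) ^ d \<le> 2 ^ 2 ^ \<kappa>" using \<kappa> by (intro power_increasing) auto
  have small: "bit_size (int \<kappa>) \<le> W + 1" "bit_size (int d) \<le> 2 ^ \<kappa> + 1" "bit_size (int ?n) \<le> 2 ^ \<kappa> + 2" "bit_size (int t) \<le> 2 ^ \<kappa> + 2" "bit_size (m 0) \<le> 2 ^ \<kappa> + 2"
    subgoal using 0(1) bit_size_of_nat[of \<kappa>] by linarith
    subgoal using \<kappa> bit_size_of_nat[of d] by linarith
    subgoal by (rule bit_size_le_power) (use nd d2 in linarith)
    subgoal by (rule bit_size_le_power) (use t nd d2 in linarith)
    subgoal by (rule bit_size_le_power) (use k1 mk kk in linarith)
    done
  have vx: "vsize (tree d x) \<le> 2 ^ \<kappa> + 2" by (rule vsize_tree_range) (use 0(4) in simp)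
  have main: "computes M search_code [Atom (int 0), Atom (int \<kappa>), Atom (int d), Atom (int ?n), Atom (int t), tree d x, tree 0 m]
      (Atom r) (tree_cost (search_cost \<kappa> d W) 0)"
    if c: "computes M leaf_code [Atom (int (\<kappa> + 2)), Atom (int d), Atom (int ?n), Atom (int t), tree d x, Atom (m 0)] (Atom r) (tree_cost (9 * dot_cost ?w) d + 100)"
      and v: "vsize (Atom r) \<le> 2 ^ \<kappa> + 2" for r
    apply (rule computesI[OF search_code_def, where ws = "[(Atom (int 0), 1), (Atom (int \<kappa>), W + 1), (Atom (int d), 2 ^ \<kappa> + 1), (Atom (int ?n), 2 ^ \<kappa> + 2), (Atom (int t), 2 ^ \<kappa> + 2),
       (tree d x, 2 ^ \<kappa> + 2), (Atom (m 0), 2 ^ \<kappa> + 2)]"])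
    apply (rule bounded_Test_else, (rule bnds | (simp; fail))+)
    apply (rule bounded_Call[OF c v])
    apply (rule bnds | (simp; fail))+
    subgoal using small vx by simp
    subgoal unfolding tree_cost_0 using sc by simp
    done
  show ?case
  proof (cases "m 0 = 1")
    case True
    have "computes M leaf_code [Atom (int (\<kappa> + 2)), Atom (int d), Atom (int ?n), Atom (int t), tree d x, Atom (m 0)] (Atom 0) (tree_cost (9 * dot_cost ?w) d + 100)"
      unfolding True by (rule computes_mono[OF computes_leaf_trivial]) simp
    from main[OF this] show ?thesis using True by (intro exI[of _ 0]) auto
  next
    case False
    have p: "prime (m 0)" using 0(2)[of 0] False by auto
    obtain c where c: "\<not> m 0 dvd c" "\<And>i. i < 2 ^ d ==> m 0 dvd (x i - c * reversal f i)"
      using 0(5)[of 0] False unfolding unit_multiple_def by auto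
    obtain r where r: "computes M leaf_code [Atom (int (\<kappa> + 2)), Atom (int d), Atom (int ?n), Atom (int t), tree d x, Atom (m 0)] (Atom r) (tree_cost (9 * dot_cost ?w) d)"
      "r = m 0 \<and> good (m 0) f t \<or> r = 0 \<and> bad (m 0) f t"
      using computes_leaf[OF p n t c w(1,2) mw w(3) xw, of M] by blast
    have "vsize (Atom r) \<le> 2 ^ \<kappa> + 2" using r(2) small(5) by auto
    from main[OF computes_mono[OF r(1)] this] have "computes M search_code [Atom (int 0), Atom (int \<kappa>), Atom (int d), Atom (int ?n), Atom (int t), tree d x, tree 0 m]
      (Atom r) (tree_cost (search_cost \<kappa> d W) 0)" by simp
    then show ?thesis using r(2) k1 by (intro exI[of _ r]) auto
  qed
next
  case (Suc h)
  let ?m = "\<lambda>i. m (2 ^ h + i)" and ?n = "degree f" and ?j = "\<kappa> + h + 1"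
  have mm: "\<And>i. i < 2 ^ h ==> m i = 1 \<or> prime (m i) \<and> odd (m i)" "\<And>i. i < 2 ^ h ==> m i < 2 ^ k"
    "\<And>i. i < 2 ^ h ==> ?m i = 1 \<or> prime (?m i) \<and> odd (?m i)" "\<And>i. i < 2 ^ h ==> ?m i < 2 ^ k"
    using Suc.prems(2,3) by auto
  have kk: "(2::int) ^ k \<le> 2 ^ 2 ^ \<kappa>" using \<kappa> by (intro power_increasing) auto
  have mb: "1 \<le> m i \<and> m i < 2 ^ 2 ^ \<kappa>" "odd (m i)" if "i < 2 ^ Suc h" for i
  proof -
    have "m i < 2 ^ 2 ^ \<kappa>" using Suc.prems(3)[OF that] kk by linarith
    then show "1 \<le> m i \<and> m i < 2 ^ 2 ^ \<kappa>" "odd (m i)" using Suc.prems(2)[OF that] prime_ge_1_int[of "m i"] by auto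
  qed
  have m1: "\<And>i. i < 2 ^ h ==> 1 \<le> m i \<and> m i < 2 ^ 2 ^ \<kappa>" "\<And>i. i < 2 ^ h ==> odd (m i)"
    and m2: "\<And>i. i < 2 ^ h ==> 1 \<le> ?m i \<and> ?m i < 2 ^ 2 ^ \<kappa>" "\<And>i. i < 2 ^ h ==> odd (?m i)" using mb by auto
  have W: "\<kappa> + h \<le> W" using Suc.prems(1) by simp
  have dk: "d \<le> 2 ^ \<kappa>" using \<kappa> by simp
  have x: "\<And>i. i < 2 ^ d ==> \<bar>x i\<bar> \<le> 2 ^ 2 ^ ?j" using Suc.prems(4) by simp
  let ?x1 = "\<lambda>i. redc ?j (tree_prod h m) (x i)" and ?x2 = "\<lambda>i. redc ?j (tree_prod h ?m) (x i)"
  have range: "\<bar>redc ?j (tree_prod h m') (x i)\<bar> \<le> 2 ^ 2 ^ (\<kappa> + h)" if "i < 2 ^ d" "\<And>i. i < 2 ^ h ==> 1 \<le> m' i \<and> m' i < 2 ^ 2 ^ \<kappa>" "\<And>i. i < 2 ^ h ==> odd (m' i)" for m' i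
    by (rule redc_range[OF tree_prod_odd[OF that(3)] _ _ x[OF that(1)]]) (use tree_prod_bounds[OF that(2)] in auto)
  have x12: "\<And>i. i < 2 ^ d ==> \<bar>?x1 i\<bar> \<le> 2 ^ 2 ^ (\<kappa> + h)" "\<And>i. i < 2 ^ d ==> \<bar>?x2 i\<bar> \<le> 2 ^ 2 ^ (\<kappa> + h)"
    using range[OF _ m1] range[OF _ m2] by auto
  have u1: "unit_multiple f d ?x1 (m i)" if "i < 2 ^ h" "m i \<noteq> 1" for i
    by (rule unit_multiple_redc[OF _ _ tree_prod_dvd[OF that(1)] tree_prod_odd[OF m1(2)]]) (use mm(1)[OF that(1)] that Suc.prems(5)[of i] in auto)
  have u2: "unit_multiple f d ?x2 (?m i)" if "i < 2 ^ h" "?m i \<noteq> 1" for i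
    by (rule unit_multiple_redc[OF _ _ tree_prod_dvd[OF that(1), of ?m] tree_prod_odd[OF m2(2)]]) (use mm(3)[OF that(1)] that Suc.prems(5)[of "2 ^ h + i"] in auto)
  obtain r1 where r1: "computes M search_code [Atom (int h), Atom (int \<kappa>), Atom (int d), Atom (int ?n), Atom (int t), tree d ?x1, tree h m]
      (Atom r1) (tree_cost (search_cost \<kappa> d W) h)"
    "if r1 = 0 then \<forall>i<2 ^ h. m i \<noteq> 1 \<longrightarrow> bad (m i) f t else \<exists>i<2 ^ h. m i = r1 \<and> good r1 f t"
    using Suc.IH[of m ?x1, OF W mm(1,2) x12(1) u1] by blast
  obtain r2 where r2: "computes M search_code [Atom (int h), Atom (int \<kappa>), Atom (int d), Atom (int ?n), Atom (int t), tree d ?x2, tree h ?m]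
      (Atom r2) (tree_cost (search_cost \<kappa> d W) h)"
    "if r2 = 0 then \<forall>i<2 ^ h. ?m i \<noteq> 1 \<longrightarrow> bad (?m i) f t else \<exists>i<2 ^ h. ?m i = r2 \<and> good r2 f t"
    using Suc.IH[of ?m ?x2, OF W mm(3,4) x12(2) u2] by blast
  have vr: "vsize (Atom r1) \<le> 2 ^ \<kappa> + 2" "vsize (Atom r2) \<le> 2 ^ \<kappa> + 2"
  proof -
    have "bit_size (m i) \<le> 2 ^ \<kappa> + 2" if "i < 2 ^ Suc h" for i
      by (rule bit_size_le_power) (use mb(1)[OF that] in linarith)
    then have "bit_size (m i) \<le> 2 ^ \<kappa> + 2" "bit_size (?m i) \<le> 2 ^ \<kappa> + 2" if "i < 2 ^ h" for i using that by auto
    then show "vsize (Atom r1) \<le> 2 ^ \<kappa> + 2" "vsize (Atom r2) \<le> 2 ^ \<kappa> + 2" using r1(2) r2(2) by (auto split: if_splits)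
  qed
  note d1 = computes_descend[where m = m and x = x, OF m1 x W dk] and d2 = computes_descend[where m = ?m and x = x, OF m2 x W dk]
  have vx: "vsize (tree d ?x1) \<le> 2 ^ (\<kappa> + h) + 2" "vsize (tree d ?x2) \<le> 2 ^ (\<kappa> + h) + 2"
    subgoal by (rule vsize_tree_range) (use x12(1) in blast)
    subgoal by (rule vsize_tree_range) (use x12(2) in blast)
    done
  have tm: "vsize (tree h m) \<le> 2 ^ \<kappa> + 2" "vsize (tree h ?m) \<le> 2 ^ \<kappa> + 2"
    subgoal by (rule vsize_tree_range) (use m1 in force)
    subgoal by (rule vsize_tree_range) (use m2 in force)
    done
  have vx0: "vsize (tree d x) \<le> 2 ^ ?j + 2" by (rule vsize_tree_range[OF x])
  have pj: "2 ^ ?j = 2 * (2::nat) ^ (\<kappa> + h)" by simp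
  define E where "E = 2 ^ d * 2 ^ \<kappa> * (W + 3) ^ 5"
  define C where "C = search_cost \<kappa> d W"
  have sc: "2 ^ 88 * (2 ^ h * E) + 2000 * (2 ^ h * 2 ^ \<kappa>) + 2000 * (W + 3) \<le> 2 ^ h * C"
  proof -
    have p4: "W + 3 \<le> (W + 3) ^ 5" "1 \<le> (W + 3) ^ 5" by (auto intro!: self_le_power)
    have "1 * 2 ^ \<kappa> * 1 \<le> E" unfolding E_def using p4(2) by (intro mult_le_mono) auto
    then have 1: "2 ^ h * 2 ^ \<kappa> \<le> 2 ^ h * E" by simp
    have "1 * 1 * (W + 3) \<le> E" unfolding E_def using p4(1) by (intro mult_le_mono) auto
    then have 2: "1 * (W + 3) \<le> 2 ^ h * E" by (intro mult_le_mono) auto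
    have "2 ^ h * (2 ^ 89 * E) \<le> 2 ^ h * C" unfolding C_def search_cost_def E_def by (intro mult_le_mono2) simp
    then have 3: "2 ^ 89 * (2 ^ h * E) \<le> 2 ^ h * C" by (simp add: mult.left_commute)
    have "2 ^ 88 * X + 4000 * X \<le> 2 ^ 89 * X" for X :: nat by simp
    from this[of "2 ^ h * E"] show ?thesis using 1 2 3 by linarith
  qed
  have nd: "2 * int ?n \<le> 2 ^ d"
  proof -
    have "int (2 * ?n) \<le> int (2 ^ d)" using n(2) of_nat_le_iff by blast
    then show ?thesis by simp
  qed
  have d2': "(2::int) ^ d \<le> 2 ^ 2 ^ \<kappa>" using \<kappa> by (intro power_increasing) auto
  have small: "bit_size (int (Suc h)) \<le> W + 2" "bit_size (int \<kappa>) \<le> W + 1" "bit_size (int d) \<le> 2 ^ \<kappa> + 1" "bit_size (int ?n) \<le> 2 ^ \<kappa> + 2" "bit_size (int t) \<le> 2 ^ \<kappa> + 2"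
    subgoal using W bit_size_of_nat[of "Suc h"] by linarith
    subgoal using W bit_size_of_nat[of \<kappa>] by linarith
    subgoal using \<kappa> bit_size_of_nat[of d] by linarith
    subgoal by (rule bit_size_le_power) (use nd d2' in linarith)
    subgoal by (rule bit_size_le_power) (use t nd d2' in linarith)
    done
  let ?ws = "[(Atom (int (Suc h)), W + 2), (Atom (int \<kappa>), W + 1), (Atom (int d), 2 ^ \<kappa> + 1), (Atom (int ?n), 2 ^ \<kappa> + 2), (Atom (int t), 2 ^ \<kappa> + 2),
       (tree d x, 2 ^ ?j + 2), (Node (tree h m) (tree h ?m), 1)]"
  have p\<kappa>: "2 ^ \<kappa> \<le> 2 ^ h * (2::nat) ^ \<kappa>" "2 ^ (\<kappa> + h) = 2 ^ h * (2::nat) ^ \<kappa>" by (simp_all add: power_add)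
  have all: "(\<forall>i<2 ^ Suc h. Q (m i)) \<longleftrightarrow> (\<forall>i<2 ^ h. Q (m i)) \<and> (\<forall>i<2 ^ h. Q (?m i))" for Q
  proof (intro iffI conjI allI impI)
    fix i :: nat
    assume a: "(\<forall>i<2 ^ h. Q (m i)) \<and> (\<forall>i<2 ^ h. Q (?m i))" and i: "i < 2 ^ Suc h"
    show "Q (m i)"
    proof (cases "i < 2 ^ h")
      case False
      then have "i - 2 ^ h < 2 ^ h" "2 ^ h + (i - 2 ^ h) = i" using i by auto
      then show ?thesis using a by metis
    qed (use a in blast)
  qed auto
  show ?case
  proof (cases "r1 = 0")
    case False
    have "computes M search_code [Atom (int (Suc h)), Atom (int \<kappa>), Atom (int d), Atom (int ?n), Atom (int t), tree d x, tree (Suc h) m]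
      (Atom r1) (tree_cost (search_cost \<kappa> d W) (Suc h))"
      apply (rule computesI[OF search_code_def, where ws = ?ws])
      apply (rule bounded_Test_then, (rule bnds | (simp; fail))+)
      apply (rule bounded_Recur[OF r1(1) vr(1)])
      apply (rule bnds)+
      apply (rule bounded_Call[OF d1 vx(1)], assumption+)
      apply (rule bnds tm | (simp; fail))+
      apply (rule bounded_Test_then, rule bnds, rule False, rule bnds)
      subgoal by simp
      subgoal by simp
      subgoal using small vx0 by simp
      subgoal unfolding tree_cost_Suc C_def[symmetric] E_def[symmetric] pj p\<kappa>(2) apply simp using sc[simplified] p\<kappa>(1) mult.commute[of "(2::nat) ^ \<kappa>" "2 ^ h"] mult.commute[of E "2 ^ h"] by linarith
      done
    moreover obtain i where "i < 2 ^ h" "m i = r1" "good r1 f t" using r1(2) False by auto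
    then have "\<exists>i<2 ^ Suc h. m i = r1 \<and> good r1 f t" by (intro exI[of _ i]) simp
    ultimately show ?thesis using False by (intro exI[of _ r1]) simp
  next
    case True
    have "computes M search_code [Atom (int (Suc h)), Atom (int \<kappa>), Atom (int d), Atom (int ?n), Atom (int t), tree d x, tree (Suc h) m]
      (Atom r2) (tree_cost (search_cost \<kappa> d W) (Suc h))"
      apply (rule computesI[OF search_code_def, where ws = ?ws])
      apply (rule bounded_Test_then, (rule bnds | (simp; fail))+)
      apply (rule bounded_Recur[OF r1(1) vr(1)])
      apply (rule bnds)+
      apply (rule bounded_Call[OF d1 vx(1)], assumption+)
      apply (rule bnds tm | (simp; fail))+
      apply (rule bounded_Test_else, rule bnds, rule True)
      apply (rule bounded_Recur[OF r2(1) vr(2)])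
      apply (rule bnds)+
      apply (rule bounded_Call[OF d2 vx(2)], assumption+)
      apply (rule bnds tm | (simp; fail))+
      subgoal using small vx0 by simp
      subgoal unfolding tree_cost_Suc C_def[symmetric] E_def[symmetric] pj p\<kappa>(2) apply simp using sc[simplified] p\<kappa>(1) mult.commute[of "(2::nat) ^ \<kappa>" "2 ^ h"] mult.commute[of E "2 ^ h"] by linarith
      done
    moreover have "if r2 = 0 then \<forall>i<2 ^ Suc h. m i \<noteq> 1 \<longrightarrow> bad (m i) f t else \<exists>i<2 ^ Suc h. m i = r2 \<and> good r2 f t"
    proof (cases "r2 = 0")
      case r20: True
      then show ?thesis using r1(2) r2(2) True unfolding all[of "\<lambda>m. m \<noteq> 1 \<longrightarrow> bad m f t"] by simp
    next
      case r20: False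
      then obtain i where "i < 2 ^ h" "?m i = r2" "good r2 f t" using r2(2) by auto
      then show ?thesis using r20 by (auto intro!: exI[of _ "2 ^ h + i"])
    qed
    ultimately show ?thesis by blast
  qed
qed

section \<open>The sieve\<close>

text \<open>Trees are immutable, so writing one leaf rebuilds the path to it.\<close>

definition set_code :: fexp where
  "set_code = Test (Var 0)
     (Test (Prim Lt (Var 1) (Prim Shl (Const 1) (Prim Sub (Var 0) (Const 1))))
       (Join (Recur [Prim Sub (Var 0) (Const 1), Var 1, Left (Var 2)]) (Right (Var 2)))
       (Join (Left (Var 2)) (Recur [Prim Sub (Var 0) (Const 1), Prim Sub (Var 1) (Prim Shl (Const 1) (Prim Sub (Var 0) (Const 1))), Right (Var 2)])))
     (Const 1)"

lemma computes_set:
  assumes "e < 2 ^ h" "h \<le> W" "\<And>i. i < 2 ^ h ==> \<bar>a i\<bar> \<le> 2 ^ W"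
  shows "computes M set_code [Atom (int h), Atom (int e), tree h a] (tree h (a(e := 1))) ((h + 1) * (300 * (W + 3)))"
  using assms
proof (induction h arbitrary: e a)
  case 0
  have s: "bit_size (a 0) \<le> W + 2" by (rule bit_size_le_power) (use 0 in simp)
  show ?case
    apply (rule computesI[OF set_code_def, where ws = "[(Atom (int 0), 1), (Atom (int e), 1), (tree 0 a, W + 2)]"])
    apply (rule bounded_Test_else, (rule bnds | (simp; fail))+)
    using 0 s by auto
next
  case (Suc h)
  let ?b = "\<lambda>i. a (2 ^ h + i)"
  have a: "\<bar>a i\<bar> \<le> 2 ^ W" "\<bar>?b i\<bar> \<le> 2 ^ W" if "i < 2 ^ h" for i using Suc.prems(3)[of i] Suc.prems(3)[of "2 ^ h + i"] that by auto
  have t: "vsize (tree h a) \<le> W + 2" "vsize (tree h ?b) \<le> W + 2"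
    subgoal by (rule vsize_tree_range) (use a in blast)
    subgoal by (rule vsize_tree_range) (use a in blast)
    done
  have h: "h \<le> W" using Suc.prems(2) by simp
  have eW: "e \<le> 2 ^ W" using Suc.prems(1,2) power_increasing[of "Suc h" W "2::nat"] by linarith
  have e: "bit_size (int e) \<le> W + 2"
  proof (rule bit_size_le_power)
    have "int e \<le> int (2 ^ W)" using eW of_nat_le_iff by blast
    then show "\<bar>int e\<bar> \<le> 2 ^ W" by simp
  qed
  show ?case
  proof (cases "e < 2 ^ h")
    case True
    have r: "computes M set_code [Atom (int h), Atom (int e), tree h a] (tree h (a(e := 1))) ((h + 1) * (300 * (W + 3)))"
      by (rule Suc.IH[OF True h]) (use a in blast)
    have v: "vsize (tree h (a(e := 1))) \<le> W + 2" by (rule vsize_tree_range) (use a in simp)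
    have c: "tree h (\<lambda>i. (a(e := 1)) (2 ^ h + i)) = tree h ?b" by (rule tree_cong) (use True in simp)
    have "int e < int (2 ^ h)" using True of_nat_less_iff by blast
    then have cond: "int e < 1 * 2 ^ nat (int (Suc h) - 1)" by simp
    show ?thesis
      apply (rule computesI[OF set_code_def, where ws = "[(Atom (int (Suc h)), W + 1), (Atom (int e), W + 2), (Node (tree h a) (tree h ?b), 1)]"])
      apply (rule bounded_Test_then, (rule bnds | (simp; fail))+)
      apply (rule bounded_Test_then, (rule bnds)+)
      subgoal using cond by simp
      apply (rule bnds)
      apply (rule bounded_Recur[OF r v])
      apply (rule bnds t | (simp; fail))+
      subgoal unfolding tree.simps c ..
      subgoal by simp
      subgoal using Suc.prems(2) e bit_size_of_nat[of "Suc h"] by simp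
      subgoal using Suc.prems(2) by simp
      done
  next
    case False
    have e': "e - 2 ^ h < 2 ^ h" "2 ^ h + (e - 2 ^ h) = e" using Suc.prems(1) False by auto
    have r: "computes M set_code [Atom (int h), Atom (int (e - 2 ^ h)), tree h ?b] (tree h (?b(e - 2 ^ h := 1))) ((h + 1) * (300 * (W + 3)))"
      by (rule Suc.IH[OF e'(1) h]) (use a in blast)
    have v: "vsize (tree h (?b(e - 2 ^ h := 1))) \<le> W + 2" by (rule vsize_tree_range) (use a in simp)
    have c: "tree h (a(e := 1)) = tree h a" by (rule tree_cong) (use False in auto)
    have c': "tree h (\<lambda>i. (a(e := 1)) (2 ^ h + i)) = tree h (?b(e - 2 ^ h := 1))"
      by (rule tree_cong) (use e' in auto)
    have "2 ^ h \<le> e" using False by simp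
    then have "int (2 ^ h) \<le> int e" by (rule of_nat_mono)
    then have cond: "\<not> int e < 1 * 2 ^ nat (int (Suc h) - 1)" by simp
    have ee: "int (e - 2 ^ h) = int e - 2 ^ h" using False by (simp add: of_nat_diff)
    show ?thesis
      apply (rule computesI[OF set_code_def, where ws = "[(Atom (int (Suc h)), W + 1), (Atom (int e), W + 2), (Node (tree h a) (tree h ?b), 1)]"])
      apply (rule bounded_Test_then, (rule bnds | (simp; fail))+)
      apply (rule bounded_Test_else, (rule bnds)+)
      subgoal using cond by simp
      apply (rule bnds)
      apply (rule bnds t)+
      apply (rule bounded_Recur[OF r v])
      apply (rule bnds t | (simp add: ee; fail))+
      subgoal unfolding tree.simps c c' ..
      subgoal by simp
      subgoal using Suc.prems(2) e bit_size_of_nat[of "Suc h"] by simp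
      subgoal using Suc.prems(2) by simp
      done
  qed
qed

definition strike_code :: fexp where
  "strike_code = Test (Prim Lt (Var 1) (Prim Shl (Const 1) (Var 2)))
     (Recur [Var 0, Prim Add (Var 0) (Var 1), Var 2, Call set_code [Var 2, Var 1, Var 3]])
     (Var 3)"

definition strike :: "nat => nat => (nat => int) => nat => int" where
  "strike d e a i = (if e \<le> i \<and> d dvd (i - e) then 1 else a i)"

lemma bit_size_nat_le: "n \<le> 2 ^ w ==> bit_size (int n) \<le> w + 2"
proof (rule bit_size_le_power)
  assume "n \<le> 2 ^ w"
  then have "int n \<le> int (2 ^ w)" using of_nat_le_iff by blast
  then show "\<bar>int n\<bar> \<le> 2 ^ w" by simp
qed

text \<open>\<open>(x + d - 1) div d\<close> is the ceiling of \<open>x / d\<close>, here the number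
  of leaves that get struck out; the final failing test adds 1.\<close>

lemma computes_strike:
  assumes "1 \<le> d" "d \<le> 2 ^ k" "e \<le> 2 ^ (k + 1)" "\<And>i. i < 2 ^ k ==> \<bar>a i\<bar> \<le> 2 ^ k"
  shows "computes M strike_code [Atom (int d), Atom (int e), Atom (int k), tree k a] (tree k (strike d e a))
    (((2 ^ k - e + d - 1) div d + 1) * (1000 * (k + 3) ^ 2))"
  using assms(3,4)
proof (induction "2 ^ k - e" arbitrary: e a rule: less_induct)
  case less
  have s: "bit_size (int d) \<le> k + 3" "bit_size (int e) \<le> k + 3" "bit_size (int k) \<le> k + 1" "vsize (tree k a) \<le> k + 2"
    subgoal using bit_size_nat_le[OF assms(2)] by simp
    subgoal using bit_size_nat_le[OF less.prems(1)] by simp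
    subgoal using bit_size_of_nat[of k] by simp
    subgoal by (rule vsize_tree_range[OF less.prems(2)])
    done
  let ?ws = "[(Atom (int d), k + 3), (Atom (int e), k + 3), (Atom (int k), k + 1), (tree k a, k + 2)]"
  define Q where "Q = (k + 3) ^ 2"
  have "3 * (k + 3) \<le> Q" unfolding Q_def power2_eq_square by (rule mult_le_mono1) simp
  moreover have "300 * ((k + 1) * (k + 3)) \<le> 300 * Q" unfolding Q_def power2_eq_square by (intro mult_le_mono2 mult_le_mono1) simp
  ultimately have sq1: "3 * (k + 3) \<le> Q" "(k + 1) * (300 * (k + 3)) \<le> 300 * Q" unfolding mult.left_commute[of "k + 1"] by simp_all
  show ?case
  proof (cases "e < 2 ^ k")
    case False
    then have "2 ^ k \<le> e" by simp
    then have "int (2 ^ k) \<le> int e" by (rule of_nat_mono)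
    then have c: "\<not> int e < 1 * 2 ^ nat (int k)" by simp
    have v: "tree k (strike d e a) = tree k a" by (rule tree_cong) (use False in \<open>auto simp: strike_def\<close>)
    have "(2 ^ k - e + d - 1) div d = 0" using False assms(1) by simp
    then have cost: "((2 ^ k - e + d - 1) div d + 1) * (1000 * (k + 3) ^ 2) = 1000 * Q" by (simp add: Q_def)
    show ?thesis
      unfolding cost v
      apply (rule computesI[OF strike_code_def, where ws = ?ws])
      apply (rule bounded_Test_else, (rule bnds)+)
      subgoal using c by simp
      apply (rule bnds)
      subgoal by simp
      subgoal by simp
      subgoal using s by simp
      subgoal apply simp using sq1[simplified] by linarith
      done
  next
    case True
    then have "int e < int (2 ^ k)" using of_nat_less_iff by blast
    then have c: "int e < 1 * 2 ^ nat (int k)" by simp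
    have set: "computes M set_code [Atom (int k), Atom (int e), tree k a] (tree k (a(e := 1))) ((k + 1) * (300 * (k + 3)))"
      by (rule computes_set[OF True]) (use less.prems(2) in auto)
    have u: "\<And>i. i < 2 ^ k ==> \<bar>(a(e := 1)) i\<bar> \<le> 2 ^ k" using less.prems(2) by simp
    have vs: "vsize (tree k (a(e := 1))) \<le> k + 2" by (rule vsize_tree_range[OF u])
    have pk: "(2::nat) ^ (k + 1) = 2 * 2 ^ k" by simp
    have de: "d + e \<le> 2 ^ (k + 1)" unfolding pk using True assms(2) by linarith
    have lt: "2 ^ k - (d + e) < 2 ^ k - e" using True assms(1) by linarith
    have IH: "computes M strike_code [Atom (int d), Atom (int (d + e)), Atom (int k), tree k (a(e := 1))] (tree k (strike d (d + e) (a(e := 1))))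
      (((2 ^ k - (d + e) + d - 1) div d + 1) * (1000 * (k + 3) ^ 2))"
      by (rule less.hyps[OF lt de u])
    have val: "tree k (strike d (d + e) (a(e := 1))) = tree k (strike d e a)"
    proof (rule tree_cong)
      fix i
      have "d + e \<le> i \<and> d dvd (i - (d + e)) \<longleftrightarrow> e \<noteq> i \<and> e \<le> i \<and> d dvd (i - e)"
      proof (cases "d + e \<le> i")
        case True
        then have e: "i - e = (i - (d + e)) + d" by simp
        have "d dvd (i - e) \<longleftrightarrow> d dvd (i - (d + e))" by (subst e) simp
        then show ?thesis using True assms(1) by auto
      next
        case False
        then show ?thesis using assms(1) by (auto dest: dvd_imp_le)
      qed
      then show "strike d (d + e) (a(e := 1)) i = strike d e a i" by (auto simp: strike_def)
    qed
    have b: "\<bar>strike d e a i\<bar> \<le> 2 ^ k" if "i < 2 ^ k" for i using less.prems(2)[OF that] by (simp add: strike_def)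
    have vv: "vsize (tree k (strike d e a)) \<le> k + 2" by (rule vsize_tree_range[OF b])
    define N where "N = (2 ^ k - (d + e) + d - 1) div d + 1"
    have N: "(2 ^ k - e + d - 1) div d = N"
    proof (cases "d + e \<le> 2 ^ k")
      case True
      then have "2 ^ k - e + d - 1 = (2 ^ k - (d + e) + d - 1) + d" using assms(1) by simp
      then have "(2 ^ k - e + d - 1) div d = ((2 ^ k - (d + e) + d - 1) + d) div d" by (simp only:)
      also have "\<dots> = N" unfolding N_def using assms(1) by (subst div_add_self2) simp_all
      finally show ?thesis .
    next
      case False
      then have "2 ^ k - (d + e) + d - 1 = d - 1" "d \<le> 2 ^ k - e + d - 1" "2 ^ k - e + d - 1 < 2 * d" using True assms(1) by linarith+
      then show ?thesis using assms(1) by (auto simp: N_def div_nat_eqI)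
    qed
    have cost: "(N + 1) * (1000 * (k + 3) ^ 2) = N * (1000 * (k + 3) ^ 2) + 1000 * Q" by (simp add: Q_def algebra_simps)
    define C where "C = N * (1000 * (k + 3) ^ 2)"
    show ?thesis
      unfolding N cost C_def[symmetric]
      apply (rule computesI[OF strike_code_def, where ws = ?ws])
      apply (rule bounded_Test_then, (rule bnds)+)
      subgoal using c by simp
      apply (rule bounded_Recur[OF IH[folded N_def C_def, unfolded val] vv])
      apply (rule bnds)+
      apply (rule bounded_Call[OF set vs])
      apply (rule bnds | (simp; fail))+
      subgoal using s by simp
      subgoal apply simp using sq1[simplified] by linarith
      done
  qed
qed

text \<open>The indices from \<open>2 ^ i\<close> to \<open>2 ^ Suc i - 1\<close> contribute at most
  \<open>2 ^ i * (X div 2 ^ i)\<close>, so every dyadic block costs at most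
  \<open>X\<close>.\<close>

lemma harmonic_sum: "(\<Sum>j = 1..<2 ^ i. X div j) \<le> i * (X::nat)"
proof (induction i)
  case (Suc i)
  have "(\<Sum>j = 1..<2 ^ Suc i. X div j) = (\<Sum>j = 1..<2 ^ i. X div j) + (\<Sum>j = 2 ^ i..<2 ^ Suc i. X div j)"
    by (rule sum.atLeastLessThan_concat[symmetric]) auto
  also have "(\<Sum>j = 2 ^ i..<2 ^ Suc i. X div j) \<le> (\<Sum>j = 2 ^ i..<(2::nat) ^ Suc i. X div 2 ^ i)"
    by (rule sum_mono) (auto intro: div_le_mono2)
  also have "\<dots> = 2 ^ i * (X div 2 ^ i)" by simp
  also have "\<dots> \<le> X" by simp
  finally show ?case using Suc by simp
qed simp

definition sieve_code :: fexp where
  "sieve_code = Test (Prim Lt (Var 0) (Prim Shl (Const 1) (Var 1)))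
     (Recur [Prim Add (Var 0) (Const 1), Var 1, Call strike_code [Var 0, Prim Add (Var 0) (Var 0), Var 1, Var 2]])
     (Var 2)"

text \<open>Multiples of every \<open>d\<close> are struck out, prime or not; the harmonic sum keeps
  this quasilinear. Striking starts at \<open>2 * d\<close>, so that primes survive, and writes 1,
  the padding value of the search.\<close>

lemma computes_sieve:
  assumes "1 \<le> d" "d \<le> 2 ^ k" "\<And>i. i < 2 ^ k ==> \<bar>a i\<bar> \<le> 2 ^ k"
  shows "computes M sieve_code [Atom (int d), Atom (int k), tree k a] (tree k (\<lambda>i. if \<exists>j\<ge>d. j dvd i \<and> 2 * j \<le> i then 1 else a i))
    (((\<Sum>j = d..<2 ^ k. 2 ^ k div j + 2) + 1) * (1000 * (k + 3) ^ 2))"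
  using assms
proof (induction "2 ^ k - d" arbitrary: d a)
  case 0
  then have d: "d = 2 ^ k" by simp
  have s: "bit_size (int d) \<le> k + 2" "bit_size (int k) \<le> k + 1" "vsize (tree k a) \<le> k + 2"
    subgoal by (rule bit_size_nat_le[OF 0(3)])
    subgoal using bit_size_of_nat[of k] by simp
    subgoal by (rule vsize_tree_range[OF 0(4)])
    done
  have v: "tree k (\<lambda>i. if \<exists>j\<ge>d. j dvd i \<and> 2 * j \<le> i then 1 else a i) = tree k a"
    by (rule tree_cong) (use d in auto)
  define Q where "Q = (k + 3) ^ 2"
  have sq: "3 * (k + 3) \<le> Q" unfolding Q_def power2_eq_square by (rule mult_le_mono1) simp
  show ?case
    unfolding v Q_def[symmetric]
    apply (rule computesI[OF sieve_code_def, where ws = "[(Atom (int d), k + 2), (Atom (int k), k + 1), (tree k a, k + 2)]"])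
    apply (rule bounded_Test_else, (rule bnds)+)
    subgoal using d by simp
    apply (rule bnds)
    subgoal by simp
    subgoal by simp
    subgoal using s by simp
    subgoal apply (simp add: d) using sq[simplified] by linarith
    done
next
  case (Suc x)
  have d: "d < 2 ^ k" using Suc.hyps(2) by linarith
  have s: "bit_size (int d) \<le> k + 2" "bit_size (int k) \<le> k + 1" "vsize (tree k a) \<le> k + 2"
    subgoal by (rule bit_size_nat_le[OF Suc.prems(2)])
    subgoal using bit_size_of_nat[of k] by simp
    subgoal by (rule vsize_tree_range[OF Suc.prems(3)])
    done
  have "int d < int (2 ^ k)" using d of_nat_less_iff by blast
  then have c: "int d < 1 * 2 ^ nat (int k)" by simp
  have dd: "d + d \<le> 2 ^ (k + 1)" using d by simp
  note st = computes_strike[OF Suc.prems(1,2) dd Suc.prems(3)]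
  have b: "\<bar>strike d (d + d) a i\<bar> \<le> 2 ^ k" if "i < 2 ^ k" for i using Suc.prems(3)[OF that] by (simp add: strike_def)
  have vst: "vsize (tree k (strike d (d + d) a)) \<le> k + 2" by (rule vsize_tree_range[OF b])
  have IH: "computes M sieve_code [Atom (int (d + 1)), Atom (int k), tree k (strike d (d + d) a)]
     (tree k (\<lambda>i. if \<exists>j\<ge>d + 1. j dvd i \<and> 2 * j \<le> i then 1 else strike d (d + d) a i))
    (((\<Sum>j = d + 1..<2 ^ k. 2 ^ k div j + 2) + 1) * (1000 * (k + 3) ^ 2))"
    by (rule Suc.hyps(1)) (use Suc.hyps(2) d b in auto)
  have val: "tree k (\<lambda>i. if \<exists>j\<ge>d + 1. j dvd i \<and> 2 * j \<le> i then 1 else strike d (d + d) a i) =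
    tree k (\<lambda>i. if \<exists>j\<ge>d. j dvd i \<and> 2 * j \<le> i then 1 else a i)"
  proof (rule tree_cong)
    fix i
    have "d + d \<le> i \<and> d dvd (i - (d + d)) \<longleftrightarrow> d dvd i \<and> 2 * d \<le> i"
      by (auto simp: mult_2 dvd_diff_nat dest: dvd_diffD)
    moreover have "(\<exists>j\<ge>d. Q j) \<longleftrightarrow> Q d \<or> (\<exists>j\<ge>d + 1. Q j)" for Q by (metis Suc_eq_plus1 Suc_leD le_refl not_less_eq_eq le_antisym)
    ultimately show "(if \<exists>j\<ge>d + 1. j dvd i \<and> 2 * j \<le> i then 1 else strike d (d + d) a i) = (if \<exists>j\<ge>d. j dvd i \<and> 2 * j \<le> i then 1 else a i)"
      unfolding strike_def by auto
  qed
  have vv: "vsize (tree k (\<lambda>i. if \<exists>j\<ge>d. j dvd i \<and> 2 * j \<le> i then 1 else a i)) \<le> k + 2"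
    by (rule vsize_tree_range) (use Suc.prems(3) in auto)
  define C where "C = ((\<Sum>j = d + 1..<2 ^ k. 2 ^ k div j + 2) + 1) * (1000 * (k + 3) ^ 2)"
  define E where "E = ((2 ^ k - (d + d) + d - 1) div d + 1) * (1000 * (k + 3) ^ 2)"
  have "(2 ^ k - (d + d) + d - 1) div d \<le> 2 ^ k div d" by (rule div_le_mono) (use d in linarith)
  then have E: "E + 1000 * (k + 3) ^ 2 \<le> (2 ^ k div d + 2) * (1000 * (k + 3) ^ 2)"
    unfolding E_def by (simp add: add_mult_distrib[symmetric])
  have "(\<Sum>j = d..<2 ^ k. 2 ^ k div j + 2) = (2 ^ k div d + 2) + (\<Sum>j = d + 1..<2 ^ k. 2 ^ k div j + 2)"
    using d by (simp add: sum.atLeast_Suc_lessThan)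
  then have cost: "((\<Sum>j = d..<2 ^ k. 2 ^ k div j + 2) + 1) * (1000 * (k + 3) ^ 2) = (2 ^ k div d + 2) * (1000 * (k + 3) ^ 2) + C"
    unfolding C_def by (simp add: algebra_simps)
  define Q where "Q = (k + 3) ^ 2"
  have sq: "3 * (k + 3) \<le> Q" unfolding Q_def power2_eq_square by (rule mult_le_mono1) simp
  show ?case
    unfolding cost unfolding Q_def[symmetric]
    apply (rule computesI[OF sieve_code_def, where ws = "[(Atom (int d), k + 2), (Atom (int k), k + 1), (tree k a, k + 2)]"])
    apply (rule bounded_Test_then, (rule bnds)+)
    subgoal using c by simp
    apply (rule bounded_Recur[OF IH[folded C_def, unfolded val] vv])
    apply (rule bnds)+
    apply (rule bounded_Call[OF st[folded E_def] vst], assumption)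
    apply (rule bnds | (simp; fail))+
    subgoal using s by simp
    subgoal apply simp using E[folded Q_def, simplified] sq[simplified] by linarith
    done
qed

definition odds_code :: fexp where
  "odds_code = Test (Var 0)
     (Join (Recur [Prim Sub (Var 0) (Const 1), Var 1])
           (Recur [Prim Sub (Var 0) (Const 1), Prim Add (Var 1) (Prim Shl (Const 1) (Prim Sub (Var 0) (Const 1)))]))
     (Test (Prim Rem (Var 1) (Const 2)) (Var 1) (Const 1))"

lemma computes_odds:
  assumes "l + 2 ^ h \<le> 2 ^ k" "h \<le> k"
  shows "computes M odds_code [Atom (int h), Atom (int l)] (tree h (\<lambda>i. if odd (l + i) then int (l + i) else 1)) (tree_cost' (200 * (k + 3)) h)"
  using assms
proof (induction h arbitrary: l)
  case 0
  have s: "bit_size (int l) \<le> k + 2" by (rule bit_size_nat_le) (use 0 in simp)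
  show ?case
  proof (cases "odd l")
    case True
    then have "int l mod 2 \<noteq> 0" by presburger
    then show ?thesis
      apply -
      apply (rule computesI[OF odds_code_def, where ws = "[(Atom (int 0), 1), (Atom (int l), k + 2)]"])
      apply (rule bounded_Test_else, (rule bnds | (simp; fail))+)
      apply (rule bounded_Test_then, (rule bnds | (simp; fail))+)
      using s True by (auto simp: tree_cost'_0)
  next
    case False
    then have "int l mod 2 = 0" by presburger
    then show ?thesis
      apply -
      apply (rule computesI[OF odds_code_def, where ws = "[(Atom (int 0), 1), (Atom (int l), k + 2)]"])
      apply (rule bounded_Test_else, (rule bnds | (simp; fail))+)
      apply (rule bounded_Test_else, (rule bnds | (simp; fail))+)
      using s False by (auto simp: tree_cost'_0)
  qed
next
  case (Suc h)
  have pre: "l + 2 ^ h \<le> 2 ^ k" "(l + 2 ^ h) + 2 ^ h \<le> 2 ^ k" "h \<le> k" using Suc.prems by auto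
  have s: "bit_size (int l) \<le> k + 2" by (rule bit_size_nat_le) (use pre in linarith)
  have v: "vsize (tree h (\<lambda>i. if odd (l + i) then int (l + i) else 1)) \<le> k + 2" if "l + 2 ^ h \<le> 2 ^ k" for l
  proof (rule vsize_tree_range)
    fix i :: nat assume "i < 2 ^ h"
    then have "l + i \<le> 2 ^ k" using that by linarith
    then have "int (l + i) \<le> int (2 ^ k)" using of_nat_le_iff by blast
    then show "\<bar>if odd (l + i) then int (l + i) else 1\<bar> \<le> 2 ^ k" by simp
  qed
  show ?case
    apply (rule computesI[OF odds_code_def, where ws = "[(Atom (int (Suc h)), k + 1), (Atom (int l), k + 2)]"])
    apply (rule bounded_Test_then, (rule bnds | (simp; fail))+)
    apply (rule bounded_Recur[OF Suc.IH[OF pre(1,3)] v[OF pre(1)]])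
    apply (rule bnds | (simp; fail))+
    apply (rule bounded_Recur[OF Suc.IH[OF pre(2,3)] v[OF pre(2)]])
    apply (rule bnds | (simp; fail))+
    subgoal unfolding tree.simps add.assoc ..
    subgoal by simp
    subgoal using s Suc.prems(2) bit_size_of_nat[of "Suc h"] by simp
    subgoal apply (simp add: tree_cost'_Suc) using Suc.prems(2) by linarith
    done
qed

definition primes_code :: fexp where
  "primes_code = Call sieve_code [Const 2, Var 0, Call odds_code [Var 0, Const 0]]"

text \<open>2 counts as padding because Montgomery reduction works with odd moduli.\<close>

definition odd_prime :: "nat => int" where
  "odd_prime i = (if odd i \<and> prime i then int i else 1)"

lemma odd_prime_divisors:
  fixes i :: nat
  assumes "odd i"
  shows "(\<exists>j\<ge>2. j dvd i \<and> 2 * j \<le> i) \<longleftrightarrow> \<not> prime i \<and> i \<noteq> 1"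
proof
  assume "\<exists>j\<ge>2. j dvd i \<and> 2 * j \<le> i"
  then obtain j where "2 \<le> j" "j dvd i" "2 * j \<le> i" by blast
  then show "\<not> prime i \<and> i \<noteq> 1" by (auto simp: prime_nat_iff)
next
  assume n: "\<not> prime i \<and> i \<noteq> 1"
  have i0: "0 < i" using assms odd_pos by blast
  obtain q where q: "prime q" "q dvd i" using n prime_factor_nat by blast
  obtain c where c: "i = q * c" using q(2) by blast
  have "c \<noteq> 1" using n q(1) c by auto
  then have "2 \<le> c" using i0 c by (cases c) auto
  then show "\<exists>j\<ge>2. j dvd i \<and> 2 * j \<le> i" using q prime_ge_2_nat[of q] c by (intro exI[of _ q]) auto
qed

lemma computes_primes:
  assumes "1 \<le> k"
  shows "computes M primes_code [Atom (int k)] (tree k odd_prime) (2 ^ k * (10000 * (k + 3) ^ 3))"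
proof -
  let ?a = "\<lambda>i. if odd (0 + i) then int (0 + i) else 1"
  have k2: "2 \<le> (2::nat) ^ k" using assms self_le_power[of 2 k] by simp
  have a: "\<bar>?a i\<bar> \<le> 2 ^ k" if "i < 2 ^ k" for i
  proof -
    have "int i \<le> int (2 ^ k)" using that of_nat_le_iff less_imp_le by blast
    then show ?thesis by simp
  qed
  have o: "computes M odds_code [Atom (int k), Atom (int 0)] (tree k ?a) (tree_cost' (200 * (k + 3)) k)" by (rule computes_odds) auto
  have vo: "vsize (tree k ?a) \<le> k + 2" by (rule vsize_tree_range[OF a])
  have "computes M sieve_code [Atom (int 2), Atom (int k), tree k ?a] (tree k (\<lambda>i. if \<exists>j\<ge>2. j dvd i \<and> 2 * j \<le> i then 1 else ?a i))
    (((\<Sum>j = 2..<2 ^ k. 2 ^ k div j + 2) + 1) * (1000 * (k + 3) ^ 2))"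
    by (rule computes_sieve[OF _ k2 a]) simp_all
  moreover have "tree k (\<lambda>i. if \<exists>j\<ge>2. j dvd i \<and> 2 * j \<le> i then 1 else ?a i) = tree k odd_prime"
    by (rule tree_cong) (use odd_prime_divisors in \<open>auto simp: odd_prime_def\<close>)
  ultimately have s: "computes M sieve_code [Atom (int 2), Atom (int k), tree k ?a] (tree k odd_prime)
    (((\<Sum>j = 2..<2 ^ k. 2 ^ k div j + 2) + 1) * (1000 * (k + 3) ^ 2))" by simp
  have vs: "vsize (tree k odd_prime) \<le> k + 2"
  proof (rule vsize_tree_range)
    fix i :: nat assume "i < 2 ^ k"
    then show "\<bar>odd_prime i\<bar> \<le> 2 ^ k" using a[of i] by (auto simp: odd_prime_def split: if_splits)
  qed
  define S where "S = ((\<Sum>j = 2..<2 ^ k. 2 ^ k div j + 2) + 1) * (1000 * (k + 3) ^ 2)"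
  define H where "H = 2 ^ k * (k + 3) ^ 3"
  have k3: "(k + 3) ^ 3 = (k + 3) * (k + 3) ^ 2" by (simp add: eval_nat_numeral)
  have S: "S \<le> 1000 * H"
  proof -
    have "(\<Sum>j = 2..<2 ^ k. 2 ^ k div j) \<le> (\<Sum>j = 1..<2 ^ k. (2::nat) ^ k div j)" by (rule sum_mono2) auto
    also have "\<dots> \<le> k * 2 ^ k" by (rule harmonic_sum)
    finally have "(\<Sum>j = 2..<2 ^ k. 2 ^ k div j) \<le> k * 2 ^ k" .
    moreover have "(\<Sum>j = 2..<2 ^ k. 2 ^ k div j + 2) = (\<Sum>j = 2..<2 ^ k. (2::nat) ^ k div j) + (2 ^ k - 2) * 2"
      by (simp only: sum.distrib sum_constant card_atLeastLessThan of_nat_id)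
    moreover have "((2::nat) ^ k - 2) * 2 \<le> 2 * 2 ^ k" by simp
    ultimately have "(\<Sum>j = 2..<2 ^ k. 2 ^ k div j + 2) + 1 \<le> k * 2 ^ k + 2 * 2 ^ k + 1" by linarith
    also have "\<dots> \<le> 2 ^ k * (k + 3)" by (simp add: algebra_simps)
    finally have "S \<le> 2 ^ k * (k + 3) * (1000 * (k + 3) ^ 2)" unfolding S_def by (rule mult_le_mono1)
    also have "\<dots> = 1000 * H" by (simp only: H_def k3 ac_simps)
    finally show ?thesis .
  qed
  have H1: "2 ^ k * (k + 3) \<le> H" unfolding H_def by (intro mult_le_mono2) (simp add: self_le_power)
  have T: "tree_cost' (200 * (k + 3)) k \<le> 400 * H"
  proof -
    have "tree_cost' (200 * (k + 3)) k \<le> 2 * 2 ^ k * (200 * (k + 3))" by (rule tree_cost'_le)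
    also have "\<dots> = 400 * (2 ^ k * (k + 3))" by simp
    finally show ?thesis using H1 by linarith
  qed
  have "1 * (k + 3) \<le> 2 ^ k * (k + 3)" by (intro mult_le_mono1) simp
  then have H2: "k + 3 \<le> H" using le_trans[OF mult_le_mono1[of 1 "2 ^ k" "k + 3"] H1] by simp
  have cost: "2 ^ k * (10000 * (k + 3) ^ 3) = 10000 * H" by (simp add: H_def)
  show ?thesis
    unfolding cost
    apply (rule computesI[OF primes_code_def, where ws = "[(Atom (int k), k + 1)]"])
    apply (rule bounded_Call[OF s[folded S_def] vs])
    apply (rule bnds)+
    apply (rule bounded_Call[OF o vo])
    apply (rule bnds | (simp; fail))+
    subgoal using bit_size_of_nat[of k] by simp
    subgoal apply simp using S T[simplified] H2 by linarith
    done
qed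

section \<open>The algorithm\<close>

text \<open>Reads the coefficients with the leading one first, as the division steps need them. The
  guard supplies zeros beyond the degree, where the address would run into the cells of
  \<open>t\<close>, \<open>b\<close> and \<open>n\<close>.\<close>

definition read_code :: fexp where
  "read_code = Test (Var 0)
     (Join (Recur [Prim Sub (Var 0) (Const 1), Var 1])
           (Recur [Prim Sub (Var 0) (Const 1), Prim Sub (Var 1) (Prim Shl (Const 1) (Prim Sub (Var 0) (Const 1)))]))
     (Test (Prim Lt (Var 1) (Const 0)) (Const 0) (Input (Prim Add (Const 3) (Var 1))))"

lemma computes_read:
  assumes M: "\<And>c. 0 \<le> c ==> bit_size (M (3 + c)) \<le> B"
    and "\<bar>c\<bar> + 2 ^ h \<le> 2 ^ W" "h \<le> W"
  shows "computes M read_code [Atom (int h), Atom c] (tree h (\<lambda>i. if c - int i < 0 then 0 else M (3 + (c - int i))))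
    (tree_cost' (300 * (B + W + 3)) h)"
  using assms(2,3)
proof (induction h arbitrary: c)
  case 0
  have s: "bit_size c \<le> W + 2" by (rule bit_size_le_power) (use 0 in simp)
  show ?case
  proof (cases "c < 0")
    case True
    then show ?thesis
      apply -
      apply (rule computesI[OF read_code_def, where ws = "[(Atom (int 0), 1), (Atom c, W + 2)]"])
      apply (rule bounded_Test_else, (rule bnds | (simp; fail))+)
      apply (rule bounded_Test_then, (rule bnds | (simp; fail))+)
      using s by (auto simp: tree_cost'_0)
  next
    case False
    then have B: "bit_size (M (3 + c)) \<le> B" using M by simp
    show ?thesis
      apply (rule computesI[OF read_code_def, where ws = "[(Atom (int 0), 1), (Atom c, W + 2)]"])
      apply (rule bounded_Test_else, (rule bnds | (simp; fail))+)
      apply (rule bounded_Test_else, (rule bnds)+)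
      subgoal using False by simp
      apply (rule bounded_Input[where M = M and x = "3 + c" and W = B, OF _ _ B])
      apply (rule bnds)+
      subgoal using False by simp
      using s False by (auto simp: tree_cost'_0)
  qed
next
  case (Suc h)
  let ?c = "c - 2 ^ h"
  have pre: "\<bar>c\<bar> + 2 ^ h \<le> 2 ^ W" "\<bar>?c\<bar> + 2 ^ h \<le> 2 ^ W" "h \<le> W"
    using Suc.prems power_Suc[of "2::int" h] zero_less_power[of "2::int" h] by linarith+
  have s: "bit_size c \<le> W + 2" by (rule bit_size_le_power) (use pre(1) zero_less_power[of "2::int" h] in linarith)
  have b: "bit_size (if c - int i < 0 then 0 else M (3 + (c - int i))) \<le> B + 2" for c i
    using M[of "c - int i"] bit_size_le_power[of 0 0] by auto
  have v: "vsize (tree h (\<lambda>i. if c - int i < 0 then 0 else M (3 + (c - int i)))) \<le> B + 2" for c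
    by (rule vsize_tree[OF b]) simp
  have e: "tree h (\<lambda>i. if ?c - int i < 0 then 0 else M (3 + (?c - int i))) = tree h (\<lambda>i. if c - int (2 ^ h + i) < 0 then 0 else M (3 + (c - int (2 ^ h + i))))"
    by (rule tree_cong) (simp add: algebra_simps)
  show ?case
    apply (rule computesI[OF read_code_def, where ws = "[(Atom (int (Suc h)), W + 1), (Atom c, W + 2)]"])
    apply (rule bounded_Test_then, (rule bnds | (simp; fail))+)
    apply (rule bounded_Recur[OF Suc.IH[OF pre(1,3)] v])
    apply (rule bnds | (simp; fail))+
    apply (rule bounded_Recur[OF Suc.IH[OF pre(2,3), unfolded e] v[of ?c, unfolded e]])
    apply (rule bnds | (simp; fail))+
    subgoal using s Suc.prems(2) bit_size_of_nat[of "Suc h"] by simp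
    subgoal apply (simp add: tree_cost'_Suc) using Suc.prems(2) by linarith
    done
qed

section \<open>Choice of the parameters\<close>

definition lg :: "nat => nat" where
  "lg x = (LEAST l. x \<le> 2 ^ l)"

lemma le_power_lg: "x \<le> 2 ^ lg x"
  unfolding lg_def by (rule LeastI[of _ x]) (simp add: less_imp_le)

lemma lg_le: "x \<le> 2 ^ l ==> lg x \<le> l"
  unfolding lg_def by (rule Least_le)

lemma less_lg: "l < lg x ==> 2 ^ l < x"
  using lg_le[of x l] by linarith

lemma power_lg: "1 \<le> x ==> 2 ^ lg x < 2 * x"
proof (cases "lg x")
  case (Suc l)
  then show ?thesis using less_lg[of l x] by simp
qed simp

definition lg_code :: fexp where
  "lg_code = Test (Prim Lt (Prim Shl (Const 1) (Var 1)) (Var 0)) (Recur [Var 0, Prim Add (Var 1) (Const 1)]) (Var 1)"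

lemma computes_lg:
  assumes "l \<le> lg x"
  shows "computes M lg_code [Atom (int x), Atom (int l)] (Atom (int (lg x))) ((lg x - l + 1) * (200 * (lg x + 3)))"
  using assms
proof (induction "lg x - l" arbitrary: l)
  case 0
  then have l: "l = lg x" by simp
  have "int x \<le> int (2 ^ lg x)" using le_power_lg of_nat_mono by blast
  then have c: "\<not> 1 * 2 ^ nat (int l) < int x" by (simp add: l)
  show ?case
    apply (rule computesI[OF lg_code_def, where ws = "[(Atom (int x), lg x + 2), (Atom (int l), lg x + 1)]"])
    apply (rule bounded_Test_else, (rule bnds)+)
    subgoal using c by simp
    apply (rule bnds)
    subgoal by (simp add: l)
    subgoal by simp
    subgoal using bit_size_nat_le[OF le_power_lg[of x]] bit_size_of_nat[of "lg x"] by (simp add: l)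
    subgoal by (simp add: l)
    done
next
  case (Suc y)
  then have l: "l + 1 \<le> lg x" "l < lg x" "y = lg x - (l + 1)" by auto
  have "int (2 ^ l) < int x" using less_lg[OF l(2)] of_nat_less_iff by blast
  then have c: "1 * 2 ^ nat (int l) < int x" by simp
  have IH: "computes M lg_code [Atom (int x), Atom (int (l + 1))] (Atom (int (lg x))) ((lg x - (l + 1) + 1) * (200 * (lg x + 3)))"
    by (rule Suc.hyps(1)[OF l(3,1)])
  have v: "vsize (Atom (int (lg x))) \<le> lg x + 1" using bit_size_of_nat[of "lg x"] by simp
  have "lg x - l + 1 = (lg x - (l + 1) + 1) + 1" using l by simp
  then have cost: "(lg x - l + 1) * (200 * (lg x + 3)) = (lg x - (l + 1) + 1) * (200 * (lg x + 3)) + 200 * (lg x + 3)" by (simp only: add_mult_distrib mult_1)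
  define C where "C = (lg x - (l + 1) + 1) * (200 * (lg x + 3))"
  have vl: "bit_size (int l) \<le> lg x + 1" using bit_size_of_nat[of l] l by linarith
  show ?case
    unfolding cost unfolding C_def[symmetric]
    apply (rule computesI[OF lg_code_def, where ws = "[(Atom (int x), lg x + 2), (Atom (int l), lg x + 1)]"])
    apply (rule bounded_Test_then, (rule bnds)+)
    subgoal using c by simp
    apply (rule bounded_Recur[OF IH[folded C_def] v])
    apply (rule bnds | (simp; fail))+
    subgoal using bit_size_nat_le[OF le_power_lg[of x]] vl by simp
    subgoal using l by simp
    done
qed

text \<open>By \<open>primes_lower_bound\<close> the inequality ensures more than \<open>g\<close>
  primes below \<open>2 ^ k\<close>. Taking the least such \<open>k\<close> keeps
  \<open>2 ^ k\<close> within a logarithmic factor of \<open>g\<close>.\<close>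

definition height :: "nat => nat" where
  "height g = (LEAST k. 2 \<le> k \<and> k * g + 1 < 2 ^ k)"

text \<open>\<open>g + 6\<close> is a witness, because \<open>m * m < 2 ^ m\<close> holds from 6
  on.\<close>

lemma height_exists: "\<exists>k. 2 \<le> k \<and> k * g + 1 < 2 ^ k"
proof -
  have sq: "m * m < 2 ^ m" if "6 \<le> m" for m :: nat
    using that
  proof (induction m rule: nat_induct_at_least)
    case (Suc m)
    have "6 * m \<le> m * m" using Suc.hyps by (rule mult_le_mono1)
    moreover have "Suc m * Suc m = m * m + 2 * m + 1" "(2::nat) ^ Suc m = 2 * 2 ^ m" by simp_all
    ultimately show ?case using Suc by linarith
  qed simp
  have "(g + 6) * g + 1 \<le> (g + 6) * (g + 6)" by (simp add: add_mult_distrib2)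
  also have "\<dots> < 2 ^ (g + 6)" by (rule sq) simp
  finally show ?thesis by (intro exI[of _ "g + 6"]) simp
qed

lemma height: "2 \<le> height g" "height g * g + 1 < 2 ^ height g"
  using LeastI_ex[OF height_exists[of g]] unfolding height_def by auto

lemma height_le: "2 \<le> k ==> k * g + 1 < 2 ^ k ==> height g \<le> k"
  unfolding height_def by (rule Least_le) simp

lemma less_height: "2 \<le> k ==> k < height g ==> 2 ^ k \<le> k * g + 1"
  using height_le[of k g] by linarith

definition height_code :: fexp where
  "height_code = Test (Prim Lt (Prim Add (Prim Mul (Var 1) (Var 0)) (Const 1)) (Prim Shl (Const 1) (Var 1)))
     (Var 1) (Recur [Var 0, Prim Add (Var 1) (Const 1)])"

lemma computes_height:
  assumes "2 \<le> k" "k \<le> height g"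
  shows "computes M height_code [Atom (int g), Atom (int k)] (Atom (int (height g))) ((height g - k + 1) * (200 * (height g + 3) ^ 2))"
  using assms
proof (induction "height g - k" arbitrary: k)
  case 0
  let ?h = "height g"
  have k: "k = ?h" using 0 by simp
  have "int (k * g + 1) < int (2 ^ k)" using height(2)[of g] k of_nat_less_iff by blast
  then have c: "int k * int g + 1 < 1 * 2 ^ nat (int k)" by simp
  define Q where "Q = (?h + 3) ^ 2"
  have Q: "(?h + 1) * (?h + 2) \<le> Q" "3 * (?h + 3) \<le> Q" unfolding Q_def power2_eq_square by (rule mult_le_mono; simp)+
  have "1 * g \<le> ?h * g" using height(1)[of g] by (intro mult_le_mono1) linarith
  then have "g \<le> 2 ^ ?h" using height(2)[of g] by linarith
  then have gs: "bit_size (int g) \<le> ?h + 2" by (rule bit_size_nat_le)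
  show ?case
    unfolding Q_def[symmetric]
    apply (rule computesI[OF height_code_def, where ws = "[(Atom (int g), ?h + 2), (Atom (int k), ?h + 1)]"])
    apply (rule bounded_Test_then, (rule bnds)+)
    subgoal using c by simp
    apply (rule bnds)
    subgoal by (simp add: k)
    subgoal by simp
    subgoal using gs bit_size_of_nat[of ?h] by (simp add: k)
    subgoal apply (simp add: k) using Q[simplified] by linarith
    done
next
  case (Suc y)
  let ?h = "height g"
  have k: "k < ?h" "k + 1 \<le> ?h" "2 \<le> k + 1" "y = ?h - (k + 1)" using Suc by auto
  have "int (2 ^ k) \<le> int (k * g + 1)" using less_height[OF Suc.prems(1) k(1)] of_nat_mono by blast
  then have c: "\<not> int k * int g + 1 < 1 * 2 ^ nat (int k)" by simp
  define Q where "Q = (?h + 3) ^ 2"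
  have Q: "(?h + 1) * (?h + 2) \<le> Q" "3 * (?h + 3) \<le> Q" unfolding Q_def power2_eq_square by (rule mult_le_mono; simp)+
  have "1 * g \<le> ?h * g" using height(1)[of g] by (intro mult_le_mono1) linarith
  then have "g \<le> 2 ^ ?h" using height(2)[of g] by linarith
  then have gs: "bit_size (int g) \<le> ?h + 2" by (rule bit_size_nat_le)
  have IH: "computes M height_code [Atom (int g), Atom (int (k + 1))] (Atom (int ?h)) ((?h - (k + 1) + 1) * (200 * Q))"
    unfolding Q_def by (rule Suc.hyps(1)[OF k(4,3,2)])
  have v: "vsize (Atom (int ?h)) \<le> ?h + 1" using bit_size_of_nat[of ?h] by simp
  have "?h - k + 1 = (?h - (k + 1) + 1) + 1" using k by simp
  then have cost: "(?h - k + 1) * (200 * Q) = (?h - (k + 1) + 1) * (200 * Q) + 200 * Q" by (simp only: add_mult_distrib mult_1)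
  define C where "C = (?h - (k + 1) + 1) * (200 * Q)"
  have vk: "bit_size (int k) \<le> ?h + 1" using bit_size_of_nat[of k] k by linarith
  show ?case
    unfolding Q_def[symmetric] unfolding cost unfolding C_def[symmetric]
    apply (rule computesI[OF height_code_def, where ws = "[(Atom (int g), ?h + 2), (Atom (int k), ?h + 1)]"])
    apply (rule bounded_Test_else, (rule bnds)+)
    subgoal using c by simp
    apply (rule bounded_Recur[OF IH[folded C_def] v])
    apply (rule bnds | (simp; fail))+
    subgoal using gs vk by simp
    subgoal using Q[simplified] k by simp
    done
qed

text \<open>An upper bound for the number of bad primes with room for the prime 2: the quotient
  bounds those that divide the resultant to the power \<open>t\<close>, and \<open>b\<close> those
  that divide the leading coefficient.\<close>

definition budget :: "nat => nat => nat => nat" where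
  "budget n b t = (4 * n * (b + 2 * lg n + 2)) div t + b + 3"

definition main_code :: fexp where
  "main_code =
    Let_in (Call lg_code [Input (Const 0), Const 0])
    (Let_in (Prim Add (Prim Add (Prim Quo (Prim Mul (Prim Mul (Const 4) (Input (Const 0)))
         (Prim Add (Prim Add (Input (Const 1)) (Prim Mul (Const 2) (Var 0))) (Const 2))) (Input (Const 2))) (Input (Const 1))) (Const 3))
    (Let_in (Call height_code [Var 0, Const 2])
    (Let_in (Call lg_code [Prim Mul (Const 2) (Input (Const 0)), Const 0])
    (Let_in (Call lg_code [Prim Add (Var 1) (Var 0), Const 0])
    (Call search_code [Var 2, Var 0, Var 1, Input (Const 0), Input (Const 2),
       Call read_code [Var 1, Input (Const 0)], Call primes_code [Var 2]])))))"

text \<open>\<open>E\<close> collects all logarithmic quantities, so that the logarithmic part of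
  every cost becomes a power of it.\<close>

lemma computes_main:
  fixes f :: "int poly" and b t :: nat
  defines "n \<equiv> degree f" and "g \<equiv> budget (degree f) b t" and "k \<equiv> height (budget (degree f) b t)"
    and "d \<equiv> lg (2 * degree f)"
    and "\<kappa> \<equiv> lg (height (budget (degree f) b t) + lg (2 * degree f))"
  defines "E \<equiv> 2 ^ \<kappa> + k + d + 10"
  assumes n: "1 \<le> n" and b: "1 \<le> b" and t: "1 \<le> t" "t \<le> n" and f: "\<And>i. \<bar>coeff f i\<bar> < 2 ^ b"
  shows "\<exists>r. computes (input_memory n b t f) main_code [] (Atom r) (2 ^ k * 2 ^ d * (2 ^ 110 * E ^ 7)) \<and>
    (if r = 0 then \<forall>p. odd p \<and> prime p \<and> p < 2 ^ k \<longrightarrow> bad (int p) f t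
     else r < 2 ^ k \<and> good r f t)"
proof -
  let ?M = "input_memory n b t f"
  let ?L = "lg n"
  have Min: "?M 0 = int n" "?M 1 = int b" "?M 2 = int t" "\<And>c. 0 \<le> c ==> ?M (3 + c) = coeff f (nat c)"
    by (simp_all add: input_memory_def)
  have g: "g = (4 * n * (b + 2 * ?L + 2)) div t + b + 3" by (simp add: g_def n_def budget_def)
  have k: "k = height g" by (simp add: k_def g_def)
  have k2: "2 \<le> k" "k * g + 1 < 2 ^ k" using height[of g] by (simp_all add: k)
  have gk: "g \<le> 2 ^ k"
  proof -
    have "1 * g \<le> k * g" using k2(1) by (intro mult_le_mono1) linarith
    then show ?thesis using k2(2) by linarith
  qed
  have bk: "b \<le> 2 ^ k" using gk by (simp add: g)
  have nd: "2 * n \<le> 2 ^ d" using le_power_lg[of "2 * n"] by (simp add: d_def n_def)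
  have \<kappa>: "\<kappa> = lg (k + d)" by (simp add: \<kappa>_def k_def d_def)
  have kd: "k + d \<le> 2 ^ \<kappa>" unfolding \<kappa> by (rule le_power_lg)
  have \<kappa>2: "\<kappa> < 2 ^ \<kappa>" by simp
  have Ld: "?L \<le> d" by (rule lg_le) (use nd in simp)
  have E: "2 ^ \<kappa> \<le> E" "k + 10 \<le> E" "d + 10 \<le> E" "\<kappa> + 10 \<le> E" "\<kappa> + k + 3 \<le> E" "k + d + 10 \<le> E" "10 \<le> E"
    using \<kappa>2 unfolding E_def by linarith+
  have M0: "bit_size (?M 0) \<le> d + 2" "bit_size (?M 1) \<le> k + 2" "bit_size (?M 2) \<le> d + 2"
    unfolding Min using bit_size_nat_le[of n d] bit_size_nat_le[of t d] bit_size_nat_le[OF bk] nd t by simp_all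
  have in0: "bounded ?M s ws (Input (Const 0)) (Atom (int n)) (d + 2) (9 + 1 + 8 + (d + 2))" for s ws
    using bounded_Input[where M = ?M and s = s and ws = ws and W = "d + 2", OF bounded_consts(1)] M0 by (simp add: Min)
  have in1: "bounded ?M s ws (Input (Const 1)) (Atom (int b)) (k + 2) (9 + 1 + 8 + (k + 2))" for s ws
    using bounded_Input[where M = ?M and s = s and ws = ws and W = "k + 2", OF bounded_consts(2)] M0 by (simp add: Min)
  have in2: "bounded ?M s ws (Input (Const 2)) (Atom (int t)) (d + 2) (9 + 1 + 8 + (d + 2))" for s ws
    using bounded_Input[where M = ?M and s = s and ws = ws and W = "d + 2", OF bounded_consts(3)] M0 by (simp add: Min)
  have c1: "computes ?M lg_code [Atom (int n), Atom (int 0)] (Atom (int ?L)) (200 * E ^ 2)"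
  proof (rule computes_mono[OF computes_lg])
    have "(?L - 0 + 1) * (200 * (?L + 3)) \<le> E * (200 * E)" using Ld E by (intro mult_le_mono) auto
    then show "(?L - 0 + 1) * (200 * (?L + 3)) \<le> 200 * E ^ 2" by (simp add: power2_eq_square)
  qed simp
  have c2: "computes ?M height_code [Atom (int g), Atom (int 2)] (Atom (int k)) (200 * E ^ 3)"
    unfolding k
  proof (rule computes_mono[OF computes_height])
    have "(height g - 2 + 1) * (200 * (height g + 3) ^ 2) \<le> E * (200 * E ^ 2)" using E unfolding k[symmetric] by (intro mult_le_mono power_mono) auto
    then show "(height g - 2 + 1) * (200 * (height g + 3) ^ 2) \<le> 200 * E ^ 3" by (simp add: power3_eq_cube power2_eq_square ac_simps)
  qed (use height(1) in auto)
  have d: "d = lg (2 * n)" by (simp add: d_def n_def)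
  have c3: "computes ?M lg_code [Atom (int (2 * n)), Atom (int 0)] (Atom (int d)) (200 * E ^ 2)"
    unfolding d
  proof (rule computes_mono[OF computes_lg])
    have "(lg (2 * n) - 0 + 1) * (200 * (lg (2 * n) + 3)) \<le> E * (200 * E)" using E unfolding d[symmetric] by (intro mult_le_mono) auto
    then show "(lg (2 * n) - 0 + 1) * (200 * (lg (2 * n) + 3)) \<le> 200 * E ^ 2" by (simp add: power2_eq_square)
  qed simp
  have c4: "computes ?M lg_code [Atom (int (k + d)), Atom (int 0)] (Atom (int \<kappa>)) (200 * E ^ 2)"
    unfolding \<kappa>
  proof (rule computes_mono[OF computes_lg])
    have "(lg (k + d) - 0 + 1) * (200 * (lg (k + d) + 3)) \<le> E * (200 * E)" using E unfolding \<kappa>[symmetric] by (intro mult_le_mono) auto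
    then show "(lg (k + d) - 0 + 1) * (200 * (lg (k + d) + 3)) \<le> 200 * E ^ 2" by (simp add: power2_eq_square)
  qed simp
  have c5: "computes ?M primes_code [Atom (int k)] (tree k odd_prime) (2 ^ k * (10000 * E ^ 3))"
  proof (rule computes_mono[OF computes_primes])
    have "(k + 3) ^ 3 \<le> E ^ 3" using E by (intro power_mono) auto
    then show "2 ^ k * (10000 * (k + 3) ^ 3) \<le> 2 ^ k * (10000 * E ^ 3)" by simp
  qed (use k2 in simp)
  let ?x = "\<lambda>i. if int n - int i < 0 then 0 else ?M (3 + (int n - int i))"
  have nd': "2 * int n \<le> 2 ^ d"
  proof -
    have "int (2 * n) \<le> int (2 ^ d)" using nd of_nat_mono by blast
    then show ?thesis by simp
  qed
  have c6: "computes ?M read_code [Atom (int d), Atom (int n)] (tree d ?x) (2 ^ d * (600 * (b + E)))"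
  proof (rule computes_mono[OF computes_read])
    show "bit_size (?M (3 + c)) \<le> b + 2" if "0 \<le> c" for c
      using f[of "nat c"] that by (intro bit_size_le_power) (simp add: Min(4) less_imp_le)
    have "(2::int) ^ (d + 1) = 2 * 2 ^ d" by simp
    then show "\<bar>int n\<bar> + 2 ^ d \<le> 2 ^ (d + 1)" using nd' by linarith
    show "d \<le> d + 1" by simp
    have "tree_cost' (300 * (b + 2 + (d + 1) + 3)) d \<le> 2 * 2 ^ d * (300 * (b + 2 + (d + 1) + 3))" by (rule tree_cost'_le)
    also have "\<dots> \<le> 2 * 2 ^ d * (300 * (b + E))" using E by (intro mult_le_mono) auto
    also have "\<dots> = 2 ^ d * (600 * (b + E))" by simp
    finally show "tree_cost' (300 * (b + 2 + (d + 1) + 3)) d \<le> 2 ^ d * (600 * (b + E))" .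
  qed
  have x: "?x i = reversal f i" for i
  proof (cases "i \<le> n")
    case True
    then have "0 \<le> int n - int i" "nat (int n - int i) = n - i" by auto
    then show ?thesis using Min(4)[of "int n - int i"] True by (simp add: reversal_def n_def[symmetric])
  qed (simp add: reversal_def n_def[symmetric])
  have xb: "\<bar>?x i\<bar> \<le> 2 ^ b" for i using f unfolding x by (auto simp: reversal_def less_imp_le)
  \<comment> \<open>At the root the coefficients must fit into \<open>2 ^ (\<kappa> + k)\<close>
    bits; \<open>b\<close> is a summand of the budget and hence at most
    \<open>2 ^ k\<close>.\<close>
  have bb: "b \<le> 2 ^ (\<kappa> + k)" using bk power_increasing[of k "\<kappa> + k" "2::nat"] by linarith
  have xb': "\<bar>?x i\<bar> \<le> 2 ^ 2 ^ (\<kappa> + k)" for i using xb[of i] power_increasing[OF bb, of "2::int"] by linarith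
  have m: "odd_prime i = 1 \<or> prime (odd_prime i) \<and> odd (odd_prime i)" for i
    by (auto simp: odd_prime_def)
  have mk: "odd_prime i < 2 ^ k" if "i < 2 ^ k" for i
  proof -
    have "int i < int (2 ^ k)" using that of_nat_less_iff by blast
    moreover have "(1::int) < 2 ^ k" using k2(1) by simp
    ultimately show ?thesis by (simp add: odd_prime_def)
  qed
  \<comment> \<open>Before any reduction the unit is 1.\<close>
  have u: "unit_multiple f d ?x (odd_prime i)" if "odd_prime i \<noteq> 1" for i
  proof -
    have "prime (odd_prime i)" using m[of i] that by blast
    then have "\<not> odd_prime i dvd 1" by (meson not_prime_unit)
    then show ?thesis unfolding unit_multiple_def by (intro exI[of _ 1]) (use x in simp)
  qed
  have "\<exists>r. computes ?M search_code [Atom (int k), Atom (int \<kappa>), Atom (int d), Atom (int (degree f)), Atom (int t), tree d ?x, tree k odd_prime]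
      (Atom r) (tree_cost (search_cost \<kappa> d (\<kappa> + k)) k) \<and>
    (if r = 0 then \<forall>i<2 ^ k. odd_prime i \<noteq> 1 \<longrightarrow> bad (odd_prime i) f t else \<exists>i<2 ^ k. odd_prime i = r \<and> good r f t)"
    by (rule computes_search[OF _ _ _ kd]) (use n nd t m mk xb' u in \<open>auto simp: n_def\<close>)
  then obtain r where r: "computes ?M search_code [Atom (int k), Atom (int \<kappa>), Atom (int d), Atom (int n), Atom (int t), tree d ?x, tree k odd_prime]
      (Atom r) (tree_cost (search_cost \<kappa> d (\<kappa> + k)) k)"
    "if r = 0 then \<forall>i<2 ^ k. odd_prime i \<noteq> 1 \<longrightarrow> bad (odd_prime i) f t else \<exists>i<2 ^ k. odd_prime i = r \<and> good r f t"
    unfolding n_def by blast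
  define H where "H = 2 ^ k * 2 ^ d * E ^ 7"
  have p: "E * E ^ 5 = E ^ 6" "E * E ^ 6 = E ^ 7" using power_Suc[of E 5] power_Suc[of E 6] by simp_all
  have sc: "tree_cost (search_cost \<kappa> d (\<kappa> + k)) k \<le> 2 ^ 109 * H"
  proof -
    have "tree_cost (9 * dot_cost (4 * 2 ^ \<kappa>)) d \<le> E * 2 ^ d * (9 * (2 ^ 92 * (4 * E) ^ 5))"
      unfolding tree_cost_def dot_cost_def using E by (intro mult_le_mono power_mono) auto
    also have "\<dots> = 9 * 2 ^ 102 * (2 ^ d * E ^ 6)" by (simp add: power_mult_distrib p(1)[symmetric] ac_simps)
    finally have 1: "tree_cost (9 * dot_cost (4 * 2 ^ \<kappa>)) d \<le> 9 * 2 ^ 102 * (2 ^ d * E ^ 6)" .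
    have "2 ^ 89 * (2 ^ d * 2 ^ \<kappa> * ((\<kappa> + k) + 3) ^ 5) \<le> 2 ^ 89 * (2 ^ d * E * E ^ 5)"
      using E by (intro mult_le_mono power_mono) auto
    also have "\<dots> = 2 ^ 89 * (2 ^ d * E ^ 6)" by (simp add: p(1)[symmetric] ac_simps)
    finally have 2: "2 ^ 89 * (2 ^ d * 2 ^ \<kappa> * (\<kappa> + k + 3) ^ 5) \<le> 2 ^ 89 * (2 ^ d * E ^ 6)" .
    have 3: "search_cost \<kappa> d (\<kappa> + k) \<le> 2 ^ 109 * (2 ^ d * E ^ 6)" unfolding search_cost_def
    proof -
      have aux: "x + y \<le> 2 ^ 109 * z" if "x \<le> 9 * 2 ^ 102 * z" "y \<le> 2 ^ 89 * z" for x y z :: nat using that by simp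
      show "tree_cost (9 * dot_cost (4 * 2 ^ \<kappa>)) d + 2 ^ 89 * (2 ^ d * 2 ^ \<kappa> * (\<kappa> + k + 3) ^ 5) \<le> 2 ^ 109 * (2 ^ d * E ^ 6)"
        by (rule aux[OF 1 2])
    qed
    have "tree_cost (search_cost \<kappa> d (\<kappa> + k)) k \<le> E * 2 ^ k * (2 ^ 109 * (2 ^ d * E ^ 6))"
      unfolding tree_cost_def using E 3 by (intro mult_le_mono) auto
    also have "\<dots> = 2 ^ 109 * H" by (simp add: H_def p(2)[symmetric] ac_simps)
    finally show ?thesis .
  qed
  have E1: "1 \<le> E" using E by simp
  have HE: "2 ^ k * E ^ 3 \<le> H" "E ^ 3 \<le> H" "E ^ 2 \<le> H" "E \<le> H" "2 ^ d * (b + E) \<le> 2 * H" "1 \<le> H"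
  proof -
    have "2 ^ k * 1 * E ^ 3 \<le> H" unfolding H_def using E1 by (intro mult_le_mono power_increasing) auto
    then show "2 ^ k * E ^ 3 \<le> H" by simp
    have "1 * 1 * E ^ 3 \<le> H" unfolding H_def using E1 by (intro mult_le_mono power_increasing) auto
    then show "E ^ 3 \<le> H" by simp
    have "1 * 1 * E ^ 2 \<le> H" unfolding H_def using E1 by (intro mult_le_mono power_increasing) auto
    then show "E ^ 2 \<le> H" by simp
    have "1 * 1 * E ^ 1 \<le> H" unfolding H_def using E1 by (intro mult_le_mono power_increasing) auto
    then show "E \<le> H" by simp
    then show "1 \<le> H" using E1 by linarith
    have "2 ^ k * 2 ^ d * 1 \<le> H" unfolding H_def using E1 by (intro mult_le_mono) auto
    then have a1: "2 ^ k * 2 ^ d \<le> H" by simp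
    have a2: "b * 2 ^ d \<le> 2 ^ k * 2 ^ d" using bk by (rule mult_le_mono1)
    have "1 * 2 ^ d * E ^ 1 \<le> H" unfolding H_def using E1 by (intro mult_le_mono power_increasing) auto
    then have a3: "2 ^ d * E \<le> H" by simp
    have "2 ^ d * (b + E) = b * 2 ^ d + 2 ^ d * E" by (simp add: add_mult_distrib2)
    then show "2 ^ d * (b + E) \<le> 2 * H" using a1 a2 a3 by linarith
  qed
  have cost0: "2 ^ 109 * H + 100000 * H \<le> 2 ^ k * 2 ^ d * (2 ^ 110 * E ^ 7)" unfolding H_def by simp
  have ig: "int g = (4 * int n * (int b + 2 * int ?L + 2)) div int t + int b + 3" unfolding g by (simp only: of_nat_add of_nat_mult zdiv_int of_nat_numeral)
  have vs: "vsize (Atom (int ?L)) \<le> d + 2" "vsize (Atom (int k)) \<le> k + 2" "vsize (Atom (int d)) \<le> d + 2" "vsize (Atom (int \<kappa>)) \<le> E"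
    using bit_size_of_nat[of ?L] bit_size_of_nat[of k] bit_size_of_nat[of d] bit_size_of_nat[of \<kappa>] Ld E by simp_all
  have vx: "vsize (tree d ?x) \<le> b + 2" by (rule vsize_tree_range[OF xb])
  have vp: "vsize (tree k odd_prime) \<le> k + 2"
  proof (rule vsize_tree_range)
    fix i :: nat assume "i < 2 ^ k"
    then show "\<bar>odd_prime i\<bar> \<le> 2 ^ k" using mk[of i] by (simp add: odd_prime_def)
  qed
  have vr: "vsize (Atom r) \<le> k + 2"
  proof -
    have "0 \<le> r \<and> r \<le> 2 ^ k"
    proof (cases "r = 0")
      case False
      then obtain i where "i < 2 ^ k" "odd_prime i = r" using r(2) by auto
      then show ?thesis using mk[of i] by (auto simp: odd_prime_def)
    qed simp
    then show ?thesis unfolding vsize.simps by (intro bit_size_le_power) simp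
  qed
  have t0: "0 < int t" using t by simp
  have bH: "b \<le> H"
  proof -
    have "1 * b \<le> 2 ^ d * (b + E)" by (intro mult_le_mono) auto
    have "2 ^ k * 1 * 1 \<le> H" unfolding H_def using E1 by (intro mult_le_mono) auto
    then show ?thesis using bk by simp
  qed
  define S Z C5 C6 where "S = tree_cost (search_cost \<kappa> d (\<kappa> + k)) k" and "Z = 2 ^ 109 * H" and "C5 = 2 ^ k * (10000 * E ^ 3)" and "C6 = 2 ^ d * (600 * (b + E))"
  have costs: "S \<le> Z" "C5 \<le> 10000 * H" "C6 \<le> 1200 * H" "d * d \<le> H" "d * k \<le> H" "k * d \<le> H" "E ^ 3 \<le> H" "E ^ 2 \<le> H" "E \<le> H"
  proof -
    show "S \<le> Z" unfolding S_def Z_def by (rule sc)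
    have "C5 = 10000 * (2 ^ k * E ^ 3)" by (simp add: C5_def)
    then show "C5 \<le> 10000 * H" using HE(1) by linarith
    have "C6 = 600 * (2 ^ d * (b + E))" by (simp add: C6_def)
    then show "C6 \<le> 1200 * H" using HE(5) by linarith
    have "d * d \<le> E ^ 2" "d * k \<le> E ^ 2" unfolding power2_eq_square using E by (intro mult_le_mono; linarith)+
    then show "d * d \<le> H" "d * k \<le> H" "k * d \<le> H" using HE(3) by (simp_all add: mult.commute)
  qed (rule HE)+
  note r1 = r(1)[folded S_def] and c5' = c5[folded C5_def] and c6' = c6[folded C6_def] and cost0' = cost0[folded Z_def]
  have main: "computes ?M main_code [] (Atom r) (2 ^ k * 2 ^ d * (2 ^ 110 * E ^ 7))"
    apply (rule computesI[OF main_code_def, where ws = "[]"])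
    apply (rule bounded_Let)
    apply (rule bounded_Call[OF c1 vs(1)])
    apply (rule in0 in1 in2 bnds t0 | (simp add: ig; fail))+
    apply (rule bounded_Call[OF c2 vs(2)])
    apply (rule in0 in1 in2 bnds | (simp add: ig t0; fail))+
    apply (rule bounded_Call[OF c3 vs(3)])
    apply (rule in0 in1 in2 bnds | (simp add: ig t0; fail))+
    apply (rule bounded_Call[OF c4 vs(4)])
    apply (rule in0 in1 in2 bnds | (simp add: ig t0; fail))+
    apply (rule bounded_Call[OF r1 vr])
    apply (rule in0 in1 in2 bnds | (simp add: ig t0; fail))+
    apply (rule bounded_Call[OF c6' vx])
    apply (rule in0 in1 in2 bnds | (simp add: ig t0; fail))+
    apply (rule bounded_Call[OF c5' vp])
    apply (rule in0 in1 in2 bnds | (simp add: ig t0; fail))+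
    subgoal
      apply (rule le_trans[OF _ cost0'])
      apply (simp add: algebra_simps)
      using costs bH E by linarith
    done
  have "if r = 0 then \<forall>p. odd p \<and> prime p \<and> p < 2 ^ k \<longrightarrow> bad (int p) f t else r < 2 ^ k \<and> good r f t"
  proof (cases "r = 0")
    case True
    have "bad (int p) f t" if "odd p" "prime p" "p < 2 ^ k" for p
    proof -
      have "odd_prime p = int p" using that by (simp add: odd_prime_def)
      moreover have "int p \<noteq> 1" using prime_gt_1_nat[OF that(2)] by simp
      ultimately show ?thesis using r(2) True that(3) by metis
    qed
    then show ?thesis using True by simp
  next
    case False
    then obtain i where "i < 2 ^ k" "odd_prime i = r" "good r f t" using r(2) by auto
    then show ?thesis using False mk[of i] by auto
  qed
  with main show ?thesis by blast
qed

section \<open>The number of primes\<close>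

text \<open>For \<open>a = k * (n - 1 choose k)\<close>, \<open>b = k * (n choose k)\<close> and
  \<open>c = Suc k * (n choose Suc k)\<close> one has \<open>1 / c = 1 / a - 1 / b\<close>, the rule
  of Leibniz's harmonic triangle. So \<open>L / c = L / a - L / b\<close> is an integer when
  \<open>L / a\<close> and \<open>L / b\<close> are.\<close>

lemma leibniz_triangle:
  fixes L :: nat
  assumes "0 < L" "1 \<le> k" "k \<le> n" "\<And>i. 1 \<le> i ==> i \<le> n ==> i dvd L"
  shows "k * (n choose k) dvd L"
  using assms(2-)
proof (induction k arbitrary: n)
  case (Suc k)
  show ?case
  proof (cases "k = 0")
    case True
    then show ?thesis using Suc.prems by simp
  next
    case False
    obtain n' where n: "n = Suc n'" using Suc.prems(2) by (cases n) auto
    obtain k' where k: "k = Suc k'" using False by (cases k) auto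
    let ?a = "k * (n' choose k)" and ?b = "k * (n choose k)" and ?c = "Suc k * (n choose Suc k)"
    have a: "?a dvd L" using Suc.prems n False by (intro Suc.IH) auto
    have b: "?b dvd L" using Suc.prems False by (intro Suc.IH) auto
    obtain x y where xy: "L = ?a * x" "L = ?b * y" using a b unfolding dvd_def by blast
    have ab: "?b = ?a + k * (n' choose k')" unfolding n k by (simp add: algebra_simps)
    have 1: "k * (n choose k) = n * (n' choose k')" unfolding n k by (rule Suc_times_binomial)
    have 2: "?c = n * (n' choose k)" unfolding n by (rule Suc_times_binomial)
    have pos: "0 < ?a" "0 < ?b" using False Suc.prems n by auto
    have "int L * (int ?a * int ?b) = int ?c * (int x - int y) * (int ?a * int ?b)"
    proof -
      have "int ?c * (int x - int y) * (int ?a * int ?b) = int ?c * (int (?a * x) * int ?b - int (?b * y) * int ?a)" by (simp add: algebra_simps)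
      also have "\<dots> = int L * (int ?c * (int ?b - int ?a))" unfolding xy(1)[symmetric] xy(2)[symmetric] by (simp add: algebra_simps)
      also have "int ?b - int ?a = int (k * (n' choose k'))" unfolding ab by simp
      also have "int ?c * int (k * (n' choose k')) = int ?a * int ?b" unfolding 2 1 by simp
      finally show ?thesis by (rule sym)
    qed
    then have "int L = int ?c * (int x - int y)" using pos by simp
    then have "int ?c dvd int L" by simp
    then show ?thesis by (simp only: of_nat_dvd_iff)
  qed
qed simp

text \<open>The product \<open>L\<close> of the largest prime powers up to \<open>N\<close> is a
  common multiple of the numbers up to \<open>N\<close> and at most \<open>N ^ card P\<close>. It is
  divisible by \<open>m * (2 * m choose m)\<close>, which for \<open>N = 2 * m\<close> is at least
  \<open>2 ^ (N - 1)\<close> by the estimate of the central binomial coefficient.\<close>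

lemma primes_lower_bound:
  assumes "2 \<le> k"
  shows "2 ^ k - 1 \<le> k * card {p :: nat. prime p \<and> p < 2 ^ k}"
proof -
  define N :: nat where "N = 2 ^ k"
  define P where "P = {p :: nat. prime p \<and> p < N}"
  define e where "e p = (GREATEST j. p ^ j \<le> N)" for p :: nat
  define L where "L = (\<Prod>p\<in>P. p ^ e p)"
  have N: "2 \<le> N" using assms self_le_power[of 2 k] by (simp add: N_def)
  have fin: "finite P" by (simp add: P_def)
  have bound: "j \<le> N" if "prime p" "p ^ j \<le> N" for p j
  proof -
    have "j < 2 ^ j" by simp
    also have "\<dots> \<le> p ^ j" using that(1) prime_ge_2_nat by (intro power_mono) auto
    finally show ?thesis using that(2) by simp
  qed
  have e: "p ^ e p \<le> N" if "p \<in> P" for p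
    unfolding e_def by (rule GreatestI_nat[of _ 0 N]) (use that N bound in \<open>auto simp: P_def\<close>)
  have e': "j \<le> e p" if "p \<in> P" "p ^ j \<le> N" for p j
    unfolding e_def by (rule Greatest_le_nat[of _ _ N]) (use that bound in \<open>auto simp: P_def\<close>)
  have L0: "0 < L" unfolding L_def by (rule prod_pos) (auto simp: P_def prime_gt_0_nat)
  \<comment> \<open>\<open>N\<close> is not a prime, so the primes below \<open>N\<close> are the
    primes up to \<open>N\<close>.\<close>
  have odd2: "\<not> prime N"
    using assms by (auto simp: N_def prime_power_iff)
  have dvdL: "i dvd L" if "1 \<le> i" "i \<le> N" for i
  proof (rule multiplicity_le_imp_dvd)
    fix p :: nat assume p: "prime p"
    show "multiplicity p i \<le> multiplicity p L"
    proof (cases "p \<in> P")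
      case True
      have "p ^ multiplicity p i dvd i" by (rule multiplicity_dvd)
      then have "p ^ multiplicity p i \<le> N" using that by (auto dest!: dvd_imp_le)
      then have "multiplicity p i \<le> e p" by (rule e'[OF True])
      also have "p ^ e p dvd L" unfolding L_def using True fin by (intro dvd_prodI)
      then have "e p \<le> multiplicity p L" using L0 p by (intro multiplicity_geI) (auto simp: prime_nat_iff)
      finally show ?thesis .
    next
      case False
      then have "N \<le> p" using p by (simp add: P_def)
      have "\<not> p dvd i"
      proof
        assume "p dvd i"
        then have "p \<le> i" using that by (auto dest: dvd_imp_le)
        then have "p = N" using \<open>N \<le> p\<close> that by auto
        then show False using odd2 p assms by auto
      qed
      then show ?thesis by (simp add: not_dvd_imp_multiplicity_0)
    qed
  qed (use that in auto)
  have LN: "L \<le> N ^ card P" unfolding L_def by (rule prod_le_power) (use e N fin in auto)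
    define m where "m = N div 2"
    have m: "N = 2 * m" "1 \<le> m" using assms N by (auto simp: m_def N_def)
    have "m * ((2 * m) choose m) dvd L" by (rule leibniz_triangle[OF L0]) (use dvdL m in auto)
    then have "m * ((2 * m) choose m) \<le> L" using L0 by (rule dvd_imp_le)
    moreover have "2 ^ (N - 1) \<le> m * ((2 * m) choose m)"
    proof -
      have "4 ^ m / (2 * real m) \<le> real ((2 * m) choose m)" using central_binomial_lower_bound[of m] m(2) by simp
      then have "4 ^ m \<le> real (2 * (m * ((2 * m) choose m)))" using m(2) by (simp add: field_simps)
      moreover have "(4::real) ^ m = real (2 * 2 ^ (N - 1))"
      proof -
        have "(4::real) ^ m = (2 ^ 2) ^ m" by simp
        also have "\<dots> = 2 ^ N" unfolding m(1) by (rule power_mult[symmetric])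
        also have "\<dots> = 2 * 2 ^ (N - 1)" using N by (cases N) auto
        finally show ?thesis by simp
      qed
      ultimately have "real (2 * 2 ^ (N - 1)) \<le> real (2 * (m * ((2 * m) choose m)))" by simp
      then show ?thesis unfolding of_nat_le_iff by simp
    qed
    ultimately have "2 ^ (N - 1) \<le> N ^ card P" using LN by linarith
    also have "\<dots> = 2 ^ (k * card P)" by (simp add: N_def power_mult)
    finally have "N - 1 \<le> k * card P" by (simp add: power_le_imp_le_exp)
    then show ?thesis by (simp add: N_def P_def)
qed

section \<open>Resultants and common divisors modulo a prime\<close>

lemma exists_highest_unit:
  fixes k :: "int poly"
  assumes "\<not> [:p:] dvd k"
  obtains j where "\<not> p dvd coeff k j" "\<And>i. j < i ==> p dvd coeff k i"
proof -
  let ?Q = "\<lambda>j. \<not> p dvd coeff k j"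
  have ex: "\<exists>j. ?Q j" using assms by (simp add: const_poly_dvd_iff)
  have b: "\<forall>j. ?Q j \<longrightarrow> j \<le> degree k" by (metis coeff_eq_0 dvd_0_right not_le)
  show thesis
  proof (rule that[of "GREATEST j. ?Q j"])
    show "?Q (GREATEST j. ?Q j)" using GreatestI_ex_nat[OF ex] b by blast
    show "p dvd coeff k i" if "(GREATEST j. ?Q j) < i" for i
      using Greatest_le_nat[of ?Q i] b that by (metis not_le)
  qed
qed

text \<open>The product of the leading terms modulo \<open>p\<close>: \<open>h\<close> is monic of
  degree \<open>D\<close>, and \<open>j\<close> is the degree of \<open>k\<close> modulo
  \<open>p\<close>.\<close>

lemma monic_mult_unit:
  fixes h k :: "int poly"
  assumes h: "coeff h D = 1" "degree h = D" and k: "\<not> [:p:] dvd k"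
  obtains j where "\<not> p dvd coeff (h * k) (D + j)"
proof -
  obtain j where j: "\<not> p dvd coeff k j" "\<And>i. j < i ==> p dvd coeff k i"
    using exists_highest_unit[OF k] by blast
  have "coeff (h * k) (D + j) = (\<Sum>i\<le>D + j. coeff h i * coeff k (D + j - i))" by (rule coeff_mult)
  also have "\<dots> = coeff k j + (\<Sum>i\<in>{..D + j} - {D}. coeff h i * coeff k (D + j - i))"
    by (subst sum.remove[of _ D]) (auto simp: h)
  finally have e: "coeff (h * k) (D + j) - (\<Sum>i\<in>{..D + j} - {D}. coeff h i * coeff k (D + j - i)) = coeff k j" by simp
  have "p dvd (\<Sum>i\<in>{..D + j} - {D}. coeff h i * coeff k (D + j - i))"
  proof (rule dvd_sum)
    fix i assume i: "i \<in> {..D + j} - {D}"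
    show "p dvd coeff h i * coeff k (D + j - i)"
    proof (cases "i < D")
      case True
      then show ?thesis using j(2)[of "D + j - i"] by simp
    next
      case False
      then show ?thesis using i h by (simp add: coeff_eq_0)
    qed
  qed
  then have "\<not> p dvd coeff (h * k) (D + j)" using j(1) unfolding e[symmetric] by auto
  then show thesis by (rule that)
qed

text \<open>Division by a monic polynomial is possible over the integers. The remainder has degree
  below \<open>D\<close> and is divisible by \<open>h\<close> modulo \<open>p\<close>, so it
  vanishes modulo \<open>p\<close>.\<close>

lemma monic_division_mod:
  fixes h r :: "int poly"
  assumes p: "p \<noteq> 0" and h: "coeff h D = 1" "degree h = D" and r: "divides_mod p h r" "degree r < N" and N: "D \<le> N"
  obtains u a where "r = h * u + smult p a" "\<And>i. N - D \<le> i ==> coeff u i = 0" "\<And>i. D \<le> i ==> coeff a i = 0"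
proof -
  have h0: "h \<noteq> 0" using h by auto
  \<comment> \<open>For a monic divisor pseudo-division is ordinary division.\<close>
  obtain u b where ub: "pseudo_divmod r h = (u, b)" by (cases "pseudo_divmod r h")
  from pseudo_divmod(1)[OF h0 ub] have rb: "r = h * u + b" using h by simp
  have b: "b = 0 \<or> degree b < D" using pseudo_divmod(2)[OF h0 ub] h by simp
  then have bD: "coeff b i = 0" if "D \<le> i" for i using that by (auto intro: coeff_eq_0)
  obtain k where "[:p:] dvd r - h * k" using r(1) unfolding divides_mod_def by blast
  then have k: "[:p:] dvd b - h * (k - u)" unfolding rb by (simp add: algebra_simps)
  have "[:p:] dvd (k - u)"
  proof (rule ccontr)
    assume "\<not> [:p:] dvd (k - u)"
    from monic_mult_unit[OF h this] obtain j where j: "\<not> p dvd coeff (h * (k - u)) (D + j)" by blast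
    have "p dvd coeff (b - h * (k - u)) (D + j)" using k by (simp only: const_poly_dvd_iff)
    then show False using j bD[of "D + j"] by simp
  qed
  then have "[:p:] dvd h * (k - u)" by (rule dvd_mult)
  from dvd_add[OF k this] have "[:p:] dvd b" by simp
  then obtain a where a: "b = smult p a" by (auto elim: dvdE)
  have "coeff u i = 0" if "N - D \<le> i" for i
  proof (cases "u = 0")
    case False
    have "degree (h * u) = D + degree u" using False h0 h by (simp add: degree_mult_eq)
    moreover have "h * u = r - b" using rb by simp
    then have "degree (h * u) \<le> max (degree r) (degree b)" by (simp add: degree_diff_le_max)
    moreover have "degree b < N \<or> b = 0" using b N by linarith
    ultimately have "D + degree u < N" using r(2) by (auto simp: max_def split: if_splits)
    then show ?thesis using that by (intro coeff_eq_0) linarith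
  qed simp
  moreover have "coeff a i = 0" if "D \<le> i" for i
    using bD[OF that] p unfolding a by simp
  ultimately show thesis using that[of u a] rb a by blast
qed

text \<open>Each row, read as a polynomial, is an integer combination of the \<open>N - D\<close>
  polynomials \<open>x^i * h\<close> and the \<open>D\<close> polynomials \<open>p * x^i\<close>. So
  \<open>A = S * W\<close> with these as the rows of \<open>W\<close>; sorted by falling degree they
  make \<open>W\<close> triangular, with \<open>N - D\<close> ones and \<open>D\<close> times
  \<open>p\<close> on the diagonal.\<close>

lemma det_dvd_power:
  fixes R :: "nat => int poly"
  assumes A: "A \<in> carrier_mat N N" "\<And>i j. i < N ==> j < N ==> A $$ (i, j) = coeff (R i) (N - 1 - j)"
    and p: "p \<noteq> 0" and h: "coeff h D = 1" "degree h = D" and D: "D \<le> N"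
    and R: "\<And>i. i < N ==> divides_mod p h (R i) \<and> degree (R i) < N"
  shows "p ^ D dvd Determinant.det A"
proof -
  have "\<forall>i. \<exists>u a. i < N \<longrightarrow> R i = h * u + smult p a \<and> (\<forall>j\<ge>N - D. coeff u j = 0) \<and> (\<forall>j\<ge>D. coeff a j = 0)"
    using monic_division_mod[OF p h _ _ D] R by metis
  then obtain u a where ua: "\<And>i. i < N ==> R i = h * u i + smult p (a i) \<and> (\<forall>j\<ge>N - D. coeff (u i) j = 0) \<and> (\<forall>j\<ge>D. coeff (a i) j = 0)"
    by metis
  define w where "w i = (if i < N - D then monom 1 (N - D - 1 - i) * h else monom p (N - 1 - i))" for i
  define S where "S = mat N N (\<lambda>(i, l). if l < N - D then coeff (u i) (N - D - 1 - l) else coeff (a i) (N - 1 - l))"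
  define W where "W = mat N N (\<lambda>(l, j). coeff (w l) (N - 1 - j))"
  have SW: "S \<in> carrier_mat N N" "W \<in> carrier_mat N N" by (simp_all add: S_def W_def)
  have poly_sum: "(\<Sum>l<n. smult (coeff q (n - 1 - l)) (monom 1 (n - 1 - l))) = q" if "\<And>j. n \<le> j ==> coeff q j = 0" for q :: "int poly" and n
  proof -
    have "(\<Sum>l<n. smult (coeff q (n - 1 - l)) (monom 1 (n - 1 - l))) = (\<Sum>l<n. monom (coeff q l) l)"
      by (rule sum.reindex_bij_witness[of _ "\<lambda>l. n - 1 - l" "\<lambda>l. n - 1 - l"]) (auto simp: smult_monom)
    also have "\<dots> = q" by (rule poly_eqI) (use that in \<open>auto simp: coeff_sum not_less\<close>)
    finally show ?thesis .
  qed
  have sum_split: "(\<Sum>l<m + n. f l) = (\<Sum>l<m. f l) + (\<Sum>l<n. f (m + l))" for m n and f :: "nat => int poly"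
    by (induction n) (simp_all add: add.assoc)
  have rows: "(\<Sum>l<N. smult (S $$ (i, l)) (w l)) = R i" if i: "i < N" for i
  proof -
    have "(\<Sum>l<N. smult (S $$ (i, l)) (w l)) = (\<Sum>l<N - D. smult (S $$ (i, l)) (w l)) + (\<Sum>l<D. smult (S $$ (i, N - D + l)) (w (N - D + l)))"
      using sum_split[where m = "N - D" and n = D and f = "\<lambda>l. smult (S $$ (i, l)) (w l)"] D by simp
    also have "(\<Sum>l<N - D. smult (S $$ (i, l)) (w l)) = (\<Sum>l<N - D. smult (coeff (u i) (N - D - 1 - l)) (monom 1 (N - D - 1 - l))) * h"
      unfolding sum_distrib_right by (rule sum.cong) (use i in \<open>auto simp: S_def w_def\<close>)
    also have "\<dots> = u i * h" by (subst poly_sum) (use ua[OF i] in auto)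
    also have "(\<Sum>l<D. smult (S $$ (i, N - D + l)) (w (N - D + l))) =
        smult p (\<Sum>l<D. smult (coeff (a i) (D - 1 - l)) (monom 1 (D - 1 - l)))"
      unfolding smult_sum2
    proof (rule sum.cong)
      fix l assume "l \<in> {..<D}"
      then have e: "N - D + l < N" "N - 1 - (N - D + l) = D - 1 - l" "\<not> N - D + l < N - D" using D by auto
      have w': "w (N - D + l) = monom p (D - 1 - l)" unfolding w_def e(2) by (rule if_not_P[OF e(3)])
      have "S $$ (i, N - D + l) = (if N - D + l < N - D then coeff (u i) (N - D - 1 - (N - D + l)) else coeff (a i) (N - 1 - (N - D + l)))"
        unfolding S_def using i e(1) by (simp only: index_mat case_prod_conv)
      also have "\<dots> = coeff (a i) (D - 1 - l)" unfolding e(2) by (rule if_not_P[OF e(3)])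
      finally show "smult (S $$ (i, N - D + l)) (w (N - D + l)) = smult p (smult (coeff (a i) (D - 1 - l)) (monom 1 (D - 1 - l)))"
        unfolding w' by (simp add: smult_monom mult.commute)
    qed simp
    also have "\<dots> = smult p (a i)" by (subst poly_sum) (use ua[OF i] in auto)
    finally show ?thesis using ua[OF i] by (simp add: mult.commute)
  qed
  have "A = S * W"
  proof (rule eq_matI)
    fix i j assume "i < dim_row (S * W)" "j < dim_col (S * W)"
    then have ij: "i < N" "j < N" using SW by auto
    have "(S * W) $$ (i, j) = (\<Sum>l<N. S $$ (i, l) * W $$ (l, j))"
      using ij SW by (simp add: scalar_prod_def atLeast0LessThan)
    also have "\<dots> = (\<Sum>l<N. coeff (smult (S $$ (i, l)) (w l)) (N - 1 - j))"
      using ij by (intro sum.cong) (auto simp: W_def)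
    also have "\<dots> = coeff (R i) (N - 1 - j)" unfolding rows[OF ij(1), symmetric] by (simp add: coeff_sum)
    finally show "A $$ (i, j) = (S * W) $$ (i, j)" using A(2)[OF ij] by simp
  qed (use A(1) SW in auto)
  then have "Determinant.det A = Determinant.det S * Determinant.det W" using SW by (simp add: det_mult)
  moreover have "Determinant.det W = p ^ D"
  proof -
    have diag: "W $$ (i, i) = (if i < N - D then 1 else p)" if "i < N" for i
    proof -
      have "N - 1 - i = (N - D - 1 - i) + D" if "i < N - D" using that D by simp
      then show ?thesis using \<open>i < N\<close> h by (auto simp: W_def w_def coeff_monom_mult)
    qed
    have "upper_triangular W"
    proof (rule upper_triangularI)
      fix i j assume ij: "j < i" "i < dim_row W"
      then have "i < N" using SW by auto
      then have "coeff (w i) (N - 1 - j) = 0"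
        using ij(1) h D by (auto simp: w_def coeff_monom_mult coeff_monom intro!: coeff_eq_0)
      then show "W $$ (i, j) = 0" using ij \<open>i < N\<close> by (simp add: W_def)
    qed
    then have "Determinant.det W = prod_list (diag_mat W)" using SW(2) by (rule det_upper_triangular)
    also have "\<dots> = (\<Prod>i<N. W $$ (i, i))" using SW(2) by (simp add: prod_list_diag_prod atLeast0LessThan)
    also have "\<dots> = (\<Prod>i<N. if i < N - D then 1 else p)" using diag by (intro prod.cong) auto
    also have "\<dots> = p ^ card {i\<in>{..<N}. \<not> i < N - D}" by (simp add: prod.If_cases Collect_neg_eq Diff_eq[symmetric]) (simp add: set_diff_eq)
    also have "{i\<in>{..<N}. \<not> i < N - D} = {N - D..<N}" by auto
    finally show ?thesis using D by simp
  qed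
  ultimately show ?thesis by simp
qed

lemma resultant_dvd_power:
  fixes f g :: "int poly"
  assumes p: "p \<noteq> 0" and h: "coeff h D = 1" "degree h = D" and D: "D \<le> degree f"
    and fg: "divides_mod p h f" "divides_mod p h g"
  shows "p ^ D dvd resultant f g"
proof -
  let ?m = "degree f" and ?n = "degree g"
  define R where "R i = (if i < ?n then monom 1 (?n - 1 - i) * f else monom 1 (?m + ?n - 1 - i) * g)" for i
  show ?thesis
    unfolding resultant_def
  proof (rule det_dvd_power[OF _ _ p h])
    show "sylvester_mat f g \<in> carrier_mat (?m + ?n) (?m + ?n)" by (rule carrier_matI) simp_all
    show "sylvester_mat f g $$ (i, j) = coeff (R i) (?m + ?n - 1 - j)" if "i < ?m + ?n" "j < ?m + ?n" for i j
    proof (cases "i < ?n")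
      case True
      show ?thesis
        using True that unfolding sylvester_mat_def sylvester_mat_sub_index[OF that] R_def
        by (auto simp: coeff_monom_mult intro!: arg_cong[of _ _ "coeff f"] coeff_eq_0 coeff_eq_0[symmetric])
    next
      case False
      show ?thesis
        using False that unfolding sylvester_mat_def sylvester_mat_sub_index[OF that] R_def
        by (auto simp: coeff_monom_mult intro!: arg_cong[of _ _ "coeff g"] coeff_eq_0 coeff_eq_0[symmetric])
    qed
    show "divides_mod p h (R i) \<and> degree (R i) < ?m + ?n" if "i < ?m + ?n" for i
    proof
      show "divides_mod p h (R i)" unfolding R_def using divides_mod_mult fg by auto
      show "degree (R i) < ?m + ?n"
        using that degree_mult_le[of "monom 1 (?n - 1 - i)" f] degree_mult_le[of "monom 1 (?m + ?n - 1 - i)" g]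
        by (auto simp: R_def degree_monom_eq)
    qed
  qed (use D in simp)
qed

text \<open>The Leibniz expansion; \<open>fact N\<close> adds about \<open>N * log N\<close> bits,
  which \<open>budget\<close> accounts for.\<close>

lemma det_bound:
  fixes A :: "int mat"
  assumes A: "A \<in> carrier_mat N N" and B: "\<And>i j. i < N ==> j < N ==> \<bar>A $$ (i, j)\<bar> \<le> B"
  shows "\<bar>Determinant.det A\<bar> \<le> int (fact N) * B ^ N"
proof -
  have "\<bar>Determinant.det A\<bar> \<le> (\<Sum>q | q permutes {0..<N}. \<bar>signof q * (\<Prod>i = 0..<N. A $$ (i, q i))\<bar>)"
    unfolding det_def'[OF A] by (rule sum_abs)
  also have "\<dots> \<le> (\<Sum>q | q permutes {0..<N}. B ^ N)"
  proof (rule sum_mono)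
    fix q assume q: "q \<in> {q. q permutes {0..<N}}"
    have "\<bar>signof q * (\<Prod>i = 0..<N. A $$ (i, q i))\<bar> = (\<Prod>i = 0..<N. \<bar>A $$ (i, q i)\<bar>)"
      by (simp add: abs_mult abs_prod sign_def)
    also have "\<dots> \<le> (\<Prod>i = 0..<N. B)"
    proof (rule prod_mono)
      fix i assume i: "i \<in> {0..<N}"
      then have "q i \<in> {0..<N}" using q permutes_in_image by auto
      then show "0 \<le> \<bar>A $$ (i, q i)\<bar> \<and> \<bar>A $$ (i, q i)\<bar> \<le> B" using B i by auto
    qed
    finally show "\<bar>signof q * (\<Prod>i = 0..<N. A $$ (i, q i))\<bar> \<le> B ^ N" by simp
  qed
  also have "\<dots> = int (card {q. q permutes {0..<N}}) * B ^ N" by simp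
  also have "card {q. q permutes {0..<N}} = fact N" using card_permutations[of "{0..<N}" N] by simp
  finally show ?thesis .
qed

section \<open>Greatest common divisors in the polynomial ring\<close>

context
  fixes p :: nat
  assumes p: "prime p"
begin

interpretation R: residues_prime p "residue_ring (int p)"
  by unfold_locales (rule p)

interpretation U: UP_domain "residue_ring (int p)" "UP (residue_ring (int p))"
  by unfold_locales simp

lemma reduce_mod_in_UP: "reduce_mod p f \<in> carrier (UP (residue_ring (int p)))"
  using p prime_gt_0_nat by (intro reduce_mod_carrier) blast

lemma reduce_mod_eq_iff: "reduce_mod p f = reduce_mod p g \<longleftrightarrow> [:int p:] dvd (f - g)"
  by (simp add: reduce_mod_def fun_eq_iff const_poly_dvd_iff mod_eq_dvd_iff)

text \<open>Every polynomial over the residue ring has an integer lift, so quantifiers over the ring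
  become quantifiers over \<open>int poly\<close>.\<close>

lemma UP_reduce_mod:
  assumes "g \<in> carrier (UP (residue_ring (int p)))"
  obtains G where "g = reduce_mod p G"
proof -
  have up: "g \<in> up (residue_ring (int p))" using assms by (simp add: UP_def)
  then obtain n where n: "bound \<zero>\<^bsub>residue_ring (int p)\<^esub> n g" by (auto simp: up_def)
  have g: "0 \<le> g i \<and> g i < int p" for i using up by (auto simp: up_def residue_ring_def)
  have z: "g i = 0" if "n < i" for i using n that by (auto simp: bound_def residue_ring_def)
  have "g = reduce_mod p (\<Sum>i\<le>n. monom (g i) i)"
  proof
    fix i
    have "coeff (\<Sum>i\<le>n. monom (g i) i) i = g i"
      using z[of i] by (auto simp: coeff_sum not_le)
    then show "g i = reduce_mod p (\<Sum>i\<le>n. monom (g i) i) i" using g[of i] by (simp add: reduce_mod_def)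
  qed
  then show thesis by (rule that)
qed

lemma finsum_residues:
  "finite A ==> finsum (residue_ring (int p)) (\<lambda>i. a i mod int p) A = (\<Sum>i\<in>A. a i) mod int p"
proof (induction A rule: finite_induct)
  case empty
  show ?case by (subst R.finsum_empty) (simp add: residue_ring_def)
next
  case (insert x A)
  have c: "a i mod int p \<in> carrier (residue_ring (int p))" for i
    using p prime_gt_0_nat[of p] by (simp add: residue_ring_def)
  show ?case
    using insert c by (subst R.finsum_insert) (auto simp: residue_ring_def mod_simps)
qed

lemma reduce_mod_mult: "reduce_mod p (f * g) = reduce_mod p f \<otimes>\<^bsub>UP (residue_ring (int p))\<^esub> reduce_mod p g"
proof
  fix n
  have up: "reduce_mod p f \<in> up (residue_ring (int p))" for f using reduce_mod_in_UP by (simp add: UP_def)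
  have "(reduce_mod p f \<otimes>\<^bsub>UP (residue_ring (int p))\<^esub> reduce_mod p g) n =
    finsum (residue_ring (int p)) (\<lambda>i. reduce_mod p f i \<otimes>\<^bsub>residue_ring (int p)\<^esub> reduce_mod p g (n - i)) {..n}"
    using up by (simp add: UP_def)
  also have "(\<lambda>i. reduce_mod p f i \<otimes>\<^bsub>residue_ring (int p)\<^esub> reduce_mod p g (n - i)) = (\<lambda>i. (coeff f i * coeff g (n - i)) mod int p)"
    by (simp add: residue_ring_def reduce_mod_def mod_simps)
  also have "finsum (residue_ring (int p)) (\<lambda>i. (coeff f i * coeff g (n - i)) mod int p) {..n} = reduce_mod p (f * g) n"
    by (subst finsum_residues) (simp_all add: reduce_mod_def coeff_mult)
  finally show "reduce_mod p (f * g) n = (reduce_mod p f \<otimes>\<^bsub>UP (residue_ring (int p))\<^esub> reduce_mod p g) n" by simp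
qed

lemma divides_reduce_mod:
  "reduce_mod p g divides\<^bsub>UP (residue_ring (int p))\<^esub> reduce_mod p f \<longleftrightarrow> divides_mod (int p) g f"
proof
  assume "reduce_mod p g divides\<^bsub>UP (residue_ring (int p))\<^esub> reduce_mod p f"
  then obtain c where c: "c \<in> carrier (UP (residue_ring (int p)))" "reduce_mod p f = reduce_mod p g \<otimes>\<^bsub>UP (residue_ring (int p))\<^esub> c"
    unfolding factor_def by blast
  obtain k where "c = reduce_mod p k" using UP_reduce_mod[OF c(1)] .
  then have "reduce_mod p f = reduce_mod p (g * k)" using c(2) by (simp add: reduce_mod_mult)
  then show "divides_mod (int p) g f" unfolding divides_mod_def reduce_mod_eq_iff by blast
next
  assume "divides_mod (int p) g f"
  then obtain k where "reduce_mod p f = reduce_mod p (g * k)" unfolding divides_mod_def reduce_mod_eq_iff by blast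
  then show "reduce_mod p g divides\<^bsub>UP (residue_ring (int p))\<^esub> reduce_mod p f"
    unfolding factor_def using reduce_mod_mult reduce_mod_in_UP by metis
qed

text \<open>\<open>somegcd\<close> is a choice, known to be a gcd once some gcd exists, and
  \<open>h\<close> provides one. Whatever is chosen divides \<open>h\<close>, which is nonzero of
  degree at most \<open>D\<close>, and in a domain degrees are additive.\<close>

lemma deg_somegcd:
  assumes "gcd_mod (int p) f g h D"
  shows "deg (residue_ring (int p)) (somegcd (UP (residue_ring (int p))) (reduce_mod p f) (reduce_mod p g)) \<le> D"
proof -
  let ?U = "UP (residue_ring (int p))"
  note * = assms[unfolded gcd_mod_def]
  have "reduce_mod p h gcdof\<^bsub>?U\<^esub> (reduce_mod p f) (reduce_mod p g)"
    unfolding isgcd_def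
  proof (intro conjI ballI impI)
    fix y assume y: "y \<in> carrier ?U" "y divides\<^bsub>?U\<^esub> reduce_mod p f \<and> y divides\<^bsub>?U\<^esub> reduce_mod p g"
    obtain k where "y = reduce_mod p k" using UP_reduce_mod[OF y(1)] .
    then show "y divides\<^bsub>?U\<^esub> reduce_mod p h" using y(2) * by (simp add: divides_reduce_mod)
  qed (use * in \<open>simp_all add: divides_reduce_mod\<close>)
  then have ex: "\<exists>x. x \<in> carrier ?U \<and> x gcdof\<^bsub>?U\<^esub> (reduce_mod p f) (reduce_mod p g)"
    using reduce_mod_in_UP by blast
  define c where "c = somegcd ?U (reduce_mod p f) (reduce_mod p g)"
  have c: "c \<in> carrier ?U" "c gcdof\<^bsub>?U\<^esub> (reduce_mod p f) (reduce_mod p g)"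
    using someI_ex[OF ex] unfolding c_def somegcd_def by auto
  obtain C where C: "c = reduce_mod p C" using UP_reduce_mod[OF c(1)] .
  have "divides_mod (int p) C h" using c(2) * unfolding C isgcd_def by (simp add: divides_reduce_mod)
  then have "c divides\<^bsub>?U\<^esub> reduce_mod p h" unfolding C by (simp add: divides_reduce_mod)
  then obtain e where e: "e \<in> carrier ?U" "reduce_mod p h = c \<otimes>\<^bsub>?U\<^esub> e" unfolding factor_def by blast
  have zero: "\<zero>\<^bsub>?U\<^esub> i = 0" for i by (simp add: UP_def residue_ring_def)
  have "reduce_mod p h D \<noteq> 0" using * by (simp add: reduce_mod_def dvd_eq_mod_eq_0)
  then have h0: "reduce_mod p h \<noteq> \<zero>\<^bsub>?U\<^esub>" using zero by metis
  have ce: "c \<noteq> \<zero>\<^bsub>?U\<^esub>" "e \<noteq> \<zero>\<^bsub>?U\<^esub>" using h0 e c(1) by auto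
  have "deg (residue_ring (int p)) (reduce_mod p h) = deg (residue_ring (int p)) c + deg (residue_ring (int p)) e"
    unfolding e(2) by (rule U.deg_mult[OF ce c(1) e(1)])
  moreover have "deg (residue_ring (int p)) (reduce_mod p h) \<le> D"
  proof (rule U.deg_aboveI[OF _ reduce_mod_in_UP])
    fix m assume "D < m"
    then have "reduce_mod p h m = 0" using * by (simp add: reduce_mod_def dvd_eq_mod_eq_0)
    moreover have "reduce_mod p h \<in> up (residue_ring (int p))" using reduce_mod_in_UP by (simp add: UP_def)
    ultimately show "UnivPoly.coeff ?U (reduce_mod p h) m = \<zero>\<^bsub>residue_ring (int p)\<^esub>"
      by (simp add: UP_def residue_ring_def)
  qed
  ultimately show ?thesis unfolding c_def by linarith
qed

end

text \<open>Scaling by an inverse of the coefficient at \<open>D\<close> and cutting off the higher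
  coefficients, which vanish modulo \<open>p\<close>, lifts the gcd to a monic integer polynomial.
  \<open>D <= degree f\<close> because \<open>f\<close> does not vanish modulo \<open>p\<close>,
  hence neither does its cofactor.\<close>

lemma gcd_mod_degree_resultant:
  fixes f :: "int poly"
  assumes p: "prime p" and lc: "\<not> p dvd lead_coeff f" and gcd: "gcd_mod p f g F D"
  shows "p ^ D dvd resultant f g"
proof -
  define a where "a = coeff F D"
  have F: "divides_mod p F f" "divides_mod p F g" "\<not> p dvd a" "\<And>i. D < i ==> p dvd coeff F i"
    using gcd unfolding gcd_mod_def a_def by auto
  obtain c where c: "p dvd (c * a - 1)" by (rule prime_inverse_mod[OF p F(3)])
  define h where "h = (\<Sum>i<D. monom (c * coeff F i) i) + monom 1 D"
  have ch: "coeff h i = (if i < D then c * coeff F i else if i = D then 1 else 0)" for i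
    by (simp add: h_def coeff_sum)
  have h: "coeff h D = 1" "degree h = D"
  proof -
    show "coeff h D = 1" by (simp add: ch)
    then show "degree h = D"
      using le_degree[of h D] degree_le[of D h] by (simp add: ch)
  qed
  have "[:p:] dvd F - h * [:a:]"
    unfolding const_poly_dvd_iff
  proof
    fix i
    have "coeff (F - h * [:a:]) i = coeff F i - a * coeff h i" by simp
    moreover have "p dvd coeff F i - a * coeff h i"
    proof -
      consider "i < D" | "i = D" | "D < i" by linarith
      then show ?thesis
      proof cases
        case 1
        have "coeff F i - a * coeff h i = - ((c * a - 1) * coeff F i)" using 1 by (simp add: ch algebra_simps)
        then show ?thesis using c by (simp only: dvd_minus_iff dvd_mult2)
      qed (use F(4) in \<open>auto simp: ch a_def\<close>)
    qed
    ultimately show "p dvd coeff (F - h * [:a:]) i" by simp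
  qed
  then have "divides_mod p h F" unfolding divides_mod_def by blast
  then have hf: "divides_mod p h f" "divides_mod p h g" using divides_mod_trans F(1,2) by blast+
  obtain k where k: "[:p:] dvd f - h * k" using hf(1) unfolding divides_mod_def by blast
  have "\<not> [:p:] dvd k"
  proof
    assume "[:p:] dvd k"
    then have "[:p:] dvd h * k" by (rule dvd_mult)
    from dvd_add[OF k this] have "[:p:] dvd f" by simp
    then show False using lc by (simp add: const_poly_dvd_iff)
  qed
  from monic_mult_unit[OF h this] obtain j where j: "\<not> p dvd coeff (h * k) (D + j)" by blast
  have "p dvd coeff f (D + j) - coeff (h * k) (D + j)" using k by (simp add: const_poly_dvd_iff)
  then have "coeff f (D + j) \<noteq> 0" using j by auto
  then have "D \<le> degree f" using le_degree[of f "D + j"] by simp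
  with p h show ?thesis by (intro resultant_dvd_power[OF _ h _ hf]) auto
qed

lemma bad_dvd_resultant:
  assumes "prime p" "bad p f t" "\<not> p dvd lead_coeff f"
  shows "p ^ t dvd resultant f (pderiv f)"
proof -
  obtain F D where "gcd_mod p f (pderiv f) F D" "t \<le> D" using assms(2,3) unfolding bad_def by blast
  then show ?thesis using gcd_mod_degree_resultant[OF assms(1,3)] power_le_dvd by blast
qed

text \<open>The entries of the Sylvester matrix are at most \<open>2 ^ (l + b)\<close>, the factor
  \<open>2 ^ l\<close> coming from the derivative; the rest is \<open>fact N <= N ^ N\<close> with
  \<open>N <= 2 * degree f\<close>.\<close>

lemma resultant_bound:
  fixes f :: "int poly"
  assumes n: "1 \<le> degree f" and l: "degree f \<le> 2 ^ l" and b: "\<And>i. \<bar>coeff f i\<bar> \<le> 2 ^ b"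
  shows "\<bar>resultant f (pderiv f)\<bar> \<le> 2 ^ (2 * degree f * (2 * l + b + 1))"
proof -
  let ?n = "degree f"
  define N where "N = ?n + degree (pderiv f)"
  have N: "N \<le> 2 * ?n" unfolding N_def by (simp add: degree_pderiv)
  have nl: "int ?n \<le> 2 ^ l" using l by simp
  have n1: "1 \<le> int ?n" using n by simp
  have cf: "\<bar>coeff f i\<bar> \<le> 2 ^ l * 2 ^ b" for i
  proof -
    have "1 * 2 ^ b \<le> (2::int) ^ l * 2 ^ b" by (intro mult_right_mono) auto
    then show ?thesis using b[of i] by linarith
  qed
  have cd: "\<bar>coeff (pderiv f) i\<bar> \<le> 2 ^ l * 2 ^ b" for i
  proof (cases "i < ?n")
    case True
    have "int (Suc i) \<le> int ?n" using True by simp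
    then have "int (Suc i) \<le> 2 ^ l" using nl by linarith
    then have "int (Suc i) * \<bar>coeff f (Suc i)\<bar> \<le> 2 ^ l * 2 ^ b" using b by (intro mult_mono) auto
    then show ?thesis by (simp only: coeff_pderiv abs_mult) (simp?)
  next
    case False
    then show ?thesis by (simp add: coeff_pderiv coeff_eq_0)
  qed
  have "\<bar>Determinant.det (sylvester_mat f (pderiv f))\<bar> \<le> int (fact N) * (2 ^ l * 2 ^ b) ^ N"
  proof (rule det_bound)
    show "sylvester_mat f (pderiv f) \<in> carrier_mat N N" unfolding N_def by (rule carrier_matI) simp_all
    show "\<bar>sylvester_mat f (pderiv f) $$ (i, j)\<bar> \<le> 2 ^ l * 2 ^ b" if "i < N" "j < N" for i j
      using cf cd unfolding sylvester_mat_def sylvester_mat_sub_index[OF that[unfolded N_def]] by auto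
  qed
  moreover have "int (fact N) \<le> (2 ^ (l + 1)) ^ N"
  proof -
    have "(fact N :: nat) \<le> N ^ N" using fact_le_power[of N, where 'a = nat] by simp
    also have "\<dots> \<le> (2 * 2 ^ l) ^ N" using N l by (intro power_mono) auto
    finally have "int (fact N) \<le> int ((2 * 2 ^ l) ^ N)" using of_nat_mono by blast
    then show ?thesis by simp
  qed
  then have "int (fact N) * (2 ^ l * 2 ^ b) ^ N \<le> (2 ^ (l + 1)) ^ N * (2 ^ l * 2 ^ b) ^ N" by (intro mult_right_mono) auto
  moreover have "(2 ^ (l + 1)) ^ N * (2 ^ l * 2 ^ b) ^ N = (2::int) ^ (N * (2 * l + b + 1))"
  proof -
    have "(2 ^ (l + 1)) ^ N * (2 ^ l * 2 ^ b) ^ N = ((2::int) ^ (l + 1 + (l + b))) ^ N" by (simp add: power_mult_distrib power_add)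
    also have "l + 1 + (l + b) = 2 * l + b + 1" by simp
    also have "((2::int) ^ (2 * l + b + 1)) ^ N = 2 ^ (N * (2 * l + b + 1))" by (simp only: power_mult[symmetric] mult.commute)
    finally show ?thesis .
  qed
  moreover have "(2::int) ^ (N * (2 * l + b + 1)) \<le> 2 ^ (2 * ?n * (2 * l + b + 1))"
    using N by (intro power_increasing mult_le_mono1) auto
  ultimately show ?thesis unfolding resultant_def by linarith
qed

section \<open>Counting the primes that fail\<close>

lemma prime_powers_bound:
  fixes x :: int
  assumes "finite S" "\<And>p. p \<in> S ==> prime p \<and> int p ^ e dvd x" "x \<noteq> 0"
  shows "2 ^ (e * card S) \<le> \<bar>x\<bar>"
proof -
  have "(\<Prod>p\<in>S. int p ^ e) dvd x" using assms(1,2)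
  proof (induction S rule: finite_induct)
    case (insert q S)
    have "coprime (int q ^ e) (\<Prod>p\<in>S. int p ^ e)"
    proof (rule prod_coprime_right)
      fix p assume "p \<in> S"
      then have "coprime q p" using insert by (intro primes_coprime) auto
      then show "coprime (int q ^ e) (int p ^ e)" by simp
    qed
    then show ?case using insert by (simp add: divides_mult)
  qed simp
  then have "\<bar>\<Prod>p\<in>S. int p ^ e\<bar> \<le> \<bar>x\<bar>" using assms(3) by (rule dvd_imp_le_int[rotated])
  moreover have "(\<Prod>p\<in>S. (2::int) ^ e) \<le> (\<Prod>p\<in>S. int p ^ e)"
  proof (rule prod_mono)
    fix p assume "p \<in> S"
    then have "2 \<le> int p" using assms(2)[of p] prime_ge_2_nat[of p] by auto
    then show "0 \<le> (2::int) ^ e \<and> (2::int) ^ e \<le> int p ^ e" by (auto intro: power_mono)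
  qed
  ultimately show ?thesis by (simp add: power_mult)
qed

text \<open>Primes that divide the leading coefficient are bounded by its length. Each of the others
  contributes \<open>p ^ t\<close> to the nonzero resultant, so \<open>t\<close> times their number
  is at most its length; this is where the division by \<open>t\<close> comes from.\<close>

lemma card_bad_primes:
  fixes f :: "int poly"
  assumes n: "1 \<le> degree f" and l: "degree f \<le> 2 ^ l" and b: "\<And>i. \<bar>coeff f i\<bar> < 2 ^ b"
    and r: "resultant f (pderiv f) \<noteq> 0" and t: "1 \<le> t"
    and S: "finite S" "\<And>p. p \<in> S ==> prime p \<and> bad (int p) f t"
  shows "card S \<le> b + (2 * degree f * (2 * l + b + 1)) div t"
proof -
  define S1 where "S1 = {p \<in> S. int p dvd lead_coeff f}"
  define S2 where "S2 = {p \<in> S. \<not> int p dvd lead_coeff f}"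
  have fin: "finite S1" "finite S2" using S(1) by (auto simp: S1_def S2_def)
  have "lead_coeff f \<noteq> 0" using n by auto
  then have "2 ^ (1 * card S1) \<le> \<bar>lead_coeff f\<bar>" using S fin by (intro prime_powers_bound) (auto simp: S1_def)
  then have "(2::int) ^ card S1 \<le> \<bar>lead_coeff f\<bar>" by simp
  then have "(2::int) ^ card S1 < 2 ^ b" using b[of "degree f"] by linarith
  then have 1: "card S1 \<le> b" by simp
  have "2 ^ (t * card S2) \<le> \<bar>resultant f (pderiv f)\<bar>"
    using S fin r by (intro prime_powers_bound) (auto simp: S2_def intro!: bad_dvd_resultant)
  also have "\<dots> \<le> 2 ^ (2 * degree f * (2 * l + b + 1))"
    using resultant_bound[OF n l] b by (simp add: less_imp_le)
  finally have "t * card S2 \<le> 2 * degree f * (2 * l + b + 1)" by (simp add: power_le_imp_le_exp)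
  then have 2: "card S2 \<le> (2 * degree f * (2 * l + b + 1)) div t"
    using t by (simp add: less_eq_div_iff_mult_less_eq mult.commute)
  have "S = S1 \<union> S2" "S1 \<inter> S2 = {}" by (auto simp: S1_def S2_def)
  then have "card S = card S1 + card S2" using fin card_Un_disjoint by metis
  then show ?thesis using 1 2 by linarith
qed

text \<open>A square factor over the integers is one over the rationals, where it has to be
  constant.\<close>

lemma squarefree_resultant:
  fixes f :: "int poly"
  assumes "squarefree (map_poly rat_of_int f)" "f \<noteq> 0"
  shows "resultant f (pderiv f) \<noteq> 0"
proof (rule square_free_imp_resultant_non_zero)
  show "square_free f"
    unfolding square_free_def
  proof (intro conjI allI impI notI)
    fix q :: "int poly" assume q: "0 < degree q" "q * q dvd f"
    then obtain r where "f = q * q * r" by auto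
    then have "map_poly rat_of_int f = (map_poly rat_of_int q) ^ 2 * map_poly rat_of_int r"
      by (simp add: power2_eq_square of_int_poly_hom.hom_mult)
    then have "(map_poly rat_of_int q) ^ 2 dvd map_poly rat_of_int f" by simp
    then have "is_unit (map_poly rat_of_int q)" using assms(1) by (rule squarefreeD[rotated])
    then have "degree (map_poly rat_of_int q) = 0" by (simp add: poly_dvd_1)
    then show False using q(1) by simp
  qed (use assms(2) in blast)
qed

text \<open>If all odd primes below \<open>2 ^ k\<close> were bad, then, even with 2 added, there
  would be fewer primes below \<open>2 ^ k\<close> than the choice of \<open>k\<close>
  guarantees.\<close>

lemma exists_good_prime:
  fixes f :: "int poly"
  assumes n: "1 \<le> degree f" and l: "degree f \<le> 2 ^ l" and b: "\<And>i. \<bar>coeff f i\<bar> < 2 ^ b"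
    and sf: "squarefree (map_poly rat_of_int f)" and t: "1 \<le> t"
    and k: "2 \<le> k" "k * ((4 * degree f * (b + 2 * l + 2)) div t + b + 3) + 1 < 2 ^ k"
  shows "\<exists>p. odd p \<and> prime p \<and> p < 2 ^ k \<and> \<not> bad (int p) f t"
proof (rule ccontr)
  assume neg: "\<not> ?thesis"
  define S where "S = {p :: nat. odd p \<and> prime p \<and> p < 2 ^ k}"
  have fin: "finite S" by (rule finite_subset[of _ "{..<2 ^ k}"]) (auto simp: S_def)
  have "f \<noteq> 0" using n by auto
  then have r: "resultant f (pderiv f) \<noteq> 0" using squarefree_resultant sf by blast
  have "card S \<le> b + (2 * degree f * (2 * l + b + 1)) div t"
    by (rule card_bad_primes[OF n l b r t fin]) (use neg in \<open>auto simp: S_def\<close>)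
  also have "(2 * degree f * (2 * l + b + 1)) div t \<le> (4 * degree f * (b + 2 * l + 2)) div t"
    by (intro div_le_mono mult_le_mono) auto
  finally have S: "card S \<le> (4 * degree f * (b + 2 * l + 2)) div t + b" by simp
  have "{p :: nat. prime p \<and> p < 2 ^ k} \<subseteq> insert 2 S"
    using primes_dvd_imp_eq[of "2::nat"] by (auto simp: S_def)
  then have "card {p :: nat. prime p \<and> p < 2 ^ k} \<le> card (insert 2 S)" using fin by (intro card_mono) auto
  also have "\<dots> \<le> card S + 1" using card_insert_le_m1[of 2 S] fin by (simp add: card_insert_if)
  finally have "k * card {p :: nat. prime p \<and> p < 2 ^ k} \<le> k * ((4 * degree f * (b + 2 * l + 2)) div t + b + 3)"
    using S by (intro mult_le_mono2) linarith
  then show False using primes_lower_bound[OF k(1)] k(2) by linarith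
qed

section \<open>Asymptotic bounds\<close>

text \<open>Everything is expressed in the one logarithm \<open>l\<close>. Only the first bound
  involves \<open>t\<close>, and it is multiplied out to avoid division.\<close>

lemma parameter_bounds:
  fixes n b t :: nat
  defines "l \<equiv> lg (n + b + 1)" and "g \<equiv> budget n b t" and "k \<equiv> height (budget n b t)" and "d \<equiv> lg (2 * n)"
    and "\<kappa> \<equiv> lg (height (budget n b t) + lg (2 * n))"
  assumes n: "1 \<le> n" and b: "1 \<le> b" and t: "1 \<le> t" "t \<le> n"
  shows "2 ^ k * t \<le> 448 * l ^ 2 * (n * b)" "2 ^ d \<le> 4 * n" "2 ^ \<kappa> + k + d + 10 \<le> 53 * l"
    "bit_size (300 * int (2 ^ k * 2 ^ d * (2 ^ 110 * (2 ^ \<kappa> + k + d + 10) ^ 7))) \<le> 104 * l"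
proof -
  have l: "n + b + 1 \<le> 2 ^ l" unfolding l_def by (rule le_power_lg)
  have l2: "2 \<le> l"
  proof (rule ccontr)
    assume "\<not> 2 \<le> l"
    then have "(2::nat) ^ l \<le> 2 ^ 1" by (intro power_increasing) auto
    then show False using l n b by simp
  qed
  have ll: "l < 2 ^ l" by simp
  have nL: "lg n \<le> l" by (rule lg_le) (use l in linarith)
  have d: "d \<le> l + 1" unfolding d_def by (rule lg_le) (use l in simp)
  show d4: "2 ^ d \<le> 4 * n" using power_lg[of "2 * n"] n unfolding d_def by linarith
  have g: "g = (4 * n * (b + 2 * lg n + 2)) div t + b + 3" unfolding g_def budget_def ..
  have gl: "g \<le> 2 ^ (2 * l + 5)"
  proof -
    have sq: "(2::nat) ^ (2 * l + 5) = 32 * (2 ^ l * 2 ^ l)" by (simp add: power_add power_even_eq power2_eq_square)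
    have "4 * n * (b + 2 * lg n + 2) \<le> 4 * 2 ^ l * (4 * 2 ^ l)" using l nL ll l2 by (intro mult_le_mono) linarith+
    then have "4 * n * (b + 2 * lg n + 2) \<le> 16 * (2 ^ l * 2 ^ l)" by simp
    from le_trans[OF div_le_dividend this] have "(4 * n * (b + 2 * lg n + 2)) div t \<le> 16 * (2 ^ l * 2 ^ l)" .
    moreover have "2 ^ l * 1 \<le> 2 ^ l * (2::nat) ^ l" by (intro mult_le_mono2) simp
    moreover have "b + 3 \<le> 3 * 2 ^ l" using l ll l2 by linarith
    ultimately show ?thesis unfolding g sq by linarith
  qed
  have k: "k = height g" by (simp add: k_def g_def)
  \<comment> \<open>\<open>g\<close> has about \<open>2 * l + 5\<close> bits, so
    \<open>4 * l + 20\<close> satisfies the inequality that defines \<open>height\<close>.\<close>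
  have k4: "k \<le> 4 * l + 20"
    unfolding k
  proof (rule height_le)
    have "(2::nat) ^ (l + 7) = 128 * 2 ^ l" by (simp add: power_add)
    then have "4 * l + 20 \<le> 2 ^ (l + 7)" using ll by linarith
    then have "(4 * l + 20) * g \<le> 2 ^ (l + 7) * 2 ^ (2 * l + 5)" using gl by (rule mult_le_mono)
    also have "\<dots> = 2 ^ (3 * l + 12)" by (simp add: power_add[symmetric])
    finally have "(4 * l + 20) * g + 1 \<le> 2 ^ (3 * l + 12) + 1" by simp
    also have "\<dots> < 2 ^ (3 * l + 12) + 2 ^ (3 * l + 12)"
      by (rule add_strict_left_mono, rule one_less_power) auto
    also have "\<dots> = 2 ^ (3 * l + 13)" by (simp add: power_add)
    also have "\<dots> \<le> 2 ^ (4 * l + 20)" by (intro power_increasing) auto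
    finally show "(4 * l + 20) * g + 1 < 2 ^ (4 * l + 20)" .
  qed simp
  have k14: "k \<le> 14 * l" using k4 l2 by linarith
  have kd: "1 \<le> k + d" using height(1)[of g] k by linarith
  have kap: "2 ^ \<kappa> \<le> 2 * (k + d)" using power_lg[OF kd] unfolding \<kappa>_def k_def d_def by simp
  have "2 ^ \<kappa> + (k + d + 10) \<le> 2 * (k + d) + (k + d + 10)" using kap by (rule add_right_mono)
  also have "\<dots> = 3 * k + (3 * d + 10)" by simp
  also have "\<dots> \<le> 3 * (14 * l) + (3 * (l + 1) + 10)" using k14 d by (intro add_mono mult_le_mono2) auto
  also have "\<dots> \<le> 53 * l" using l2 by simp
  finally show E: "2 ^ \<kappa> + k + d + 10 \<le> 53 * l" by simp
  have g4: "4 \<le> g" using b by (simp add: g)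
  \<comment> \<open>Unless \<open>k\<close> is the smallest admissible value 2, its predecessor
    violates the inequality by minimality, which bounds \<open>2 ^ k\<close> from above.\<close>
  have kg: "2 ^ k \<le> 2 * k * g"
  proof (cases "k = 2")
    case False
    then have "3 \<le> k" using height(1)[of g] k by linarith
    then have k': "2 \<le> k - 1" "k - 1 < height g" "k = Suc (k - 1)" using k by auto
    have "2 ^ (k - 1) \<le> (k - 1) * g + 1" by (rule less_height[OF k'(1,2)])
    moreover have "k * g = (k - 1) * g + g" by (subst k'(3)) simp
    moreover have "(2::nat) ^ k = 2 * 2 ^ (k - 1)" by (subst k'(3)) simp
    ultimately have "2 ^ k \<le> 2 * (k * g)" using g4 by linarith
    then show ?thesis by simp
  qed (use g4 in simp)
  \<comment> \<open>Here \<open>t <= n\<close> is used: the summand \<open>b + 3\<close> of the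
    budget, multiplied by \<open>t\<close>, is at most \<open>4 * (n * b)\<close>.\<close>
  have gt: "g * t \<le> 16 * l * (n * b)"
  proof -
    have "(4 * n * (b + 2 * lg n + 2)) div t * t \<le> 4 * n * (b + 2 * lg n + 2)" by (rule div_times_less_eq_dividend)
    also have "\<dots> \<le> 4 * n * (b * (2 * l + 3))"
    proof (rule mult_le_mono2)
      have "1 * (2 * lg n + 2) \<le> b * (2 * l + 2)" using b nL by (intro mult_le_mono) auto
      then show "b + 2 * lg n + 2 \<le> b * (2 * l + 3)" by (simp add: algebra_simps)
    qed
    also have "\<dots> = (8 * l + 12) * (n * b)" by (simp add: algebra_simps)
    finally have "(4 * n * (b + 2 * lg n + 2)) div t * t \<le> (8 * l + 12) * (n * b)" .
    moreover have "(b + 3) * t \<le> (4 * b) * n" using b t by (intro mult_le_mono) auto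
    ultimately have "g * t \<le> (8 * l + 12) * (n * b) + 4 * (n * b)" unfolding g add_mult_distrib by (simp add: algebra_simps)
    also have "\<dots> = (8 * l + 16) * (n * b)" by (simp add: add_mult_distrib)
    also have "\<dots> \<le> 16 * l * (n * b)" using l2 by (intro mult_le_mono1) linarith
    finally show ?thesis .
  qed
  show "2 ^ k * t \<le> 448 * l ^ 2 * (n * b)"
  proof -
    have "2 ^ k * t \<le> 2 * k * g * t" using kg by (rule mult_le_mono1)
    also have "\<dots> = 2 * k * (g * t)" by simp
    also have "\<dots> \<le> 2 * (14 * l) * (16 * l * (n * b))" by (rule mult_le_mono[OF mult_le_mono2[OF k14] gt])
    also have "\<dots> = 448 * l ^ 2 * (n * b)" by (simp add: power2_eq_square)
    finally show ?thesis .
  qed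
  let ?E = "2 ^ \<kappa> + k + d + 10"
  have "(2::nat) ^ (l + 6) = 64 * 2 ^ l" by (simp add: power_add)
  then have "?E \<le> 2 ^ (l + 6)" using E ll by linarith
  then have "?E ^ 7 \<le> (2 ^ (l + 6)) ^ 7" by (rule power_mono) simp
  also have "\<dots> = 2 ^ (7 * l + 42)" by (simp add: power_mult[symmetric] algebra_simps)
  finally have E7: "2 ^ 110 * ?E ^ 7 \<le> 2 ^ 110 * 2 ^ (7 * l + 42)" by (rule mult_le_mono2)
  have kl: "(2::nat) ^ k \<le> 2 ^ (4 * l + 20)" by (rule power_increasing[OF k4]) simp
  have dl: "(2::nat) ^ d \<le> 2 ^ (l + 1)" by (rule power_increasing[OF d]) simp
  have "2 ^ k * 2 ^ d * (2 ^ 110 * ?E ^ 7) \<le> 2 ^ (4 * l + 20) * 2 ^ (l + 1) * (2 ^ 110 * 2 ^ (7 * l + 42))"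
    by (rule mult_le_mono[OF mult_le_mono[OF kl dl] E7])
  \<comment> \<open>\<open>2 ^ 9\<close> makes room for the factor 300 in the bound on heap
    addresses.\<close>
  then have "2 ^ 9 * (2 ^ k * 2 ^ d * (2 ^ 110 * ?E ^ 7)) \<le> 2 ^ 9 * (2 ^ (4 * l + 20) * 2 ^ (l + 1) * (2 ^ 110 * 2 ^ (7 * l + 42)))"
    by (rule mult_le_mono2)
  also have "\<dots> = 2 ^ (12 * l + 182)" by (simp only: power_add[symmetric]) (simp add: algebra_simps)
  also have "\<dots> \<le> 2 ^ (103 * l)" using l2 by (intro power_increasing) auto
  finally have c: "2 ^ 9 * (2 ^ k * 2 ^ d * (2 ^ 110 * ?E ^ 7)) \<le> 2 ^ (103 * l)" .
  define c0 where "c0 = 2 ^ k * 2 ^ d * (2 ^ 110 * ?E ^ 7)"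
  have "300 * c0 \<le> 2 ^ (103 * l)" using c unfolding c0_def[symmetric] by simp
  then have "bit_size (int (300 * c0)) \<le> 103 * l + 2" by (rule bit_size_nat_le)
  then show "bit_size (300 * int (2 ^ k * 2 ^ d * (2 ^ 110 * ?E ^ 7))) \<le> 104 * l" unfolding c0_def[symmetric] using l2 by simp
qed

text \<open>\<open>2 ^ lg x < 2 * x\<close> and \<open>ln 2 >= 1 / 2\<close> give
  \<open>lg x - 1 <= 2 * ln x\<close>, and the missing 1 is at most \<open>ln x\<close> for
  \<open>x >= 3\<close>.\<close>

lemma lg_le_ln:
  assumes "3 \<le> x"
  shows "real (lg x) \<le> 3 * ln (real x)"
proof -
  have "real (2 ^ lg x) \<le> real (2 * x)" using power_lg[of x] assms by (simp only: of_nat_le_iff) linarith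
  then have "ln (2 ^ lg x) \<le> ln (2 * real x)" using assms by (intro ln_mono) auto
  then have a: "real (lg x) * ln 2 \<le> ln 2 + ln (real x)" using assms by (simp add: ln_realpow ln_mult)
  have "1 \<le> ln (real x)"
  proof -
    have "exp 1 \<le> real x" using exp_le assms by linarith
    then have "ln (exp 1) \<le> ln (real x)" by (intro ln_mono) auto
    then show ?thesis by simp
  qed
  moreover have "1 / 2 \<le> ln (2::real)"
  proof -
    have "exp 1 \<le> (4::real)" using exp_le by linarith
    then have "ln (exp 1) \<le> ln (4::real)" by (intro ln_mono) auto
    moreover have "ln (4::real) = 2 * ln 2" using ln_realpow[of "2::real" 2] by simp
    ultimately show ?thesis by simp
  qed
  then have "real (lg x - 1) * (1 / 2) \<le> real (lg x - 1) * ln 2" by (intro mult_left_mono) auto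
  moreover have "real (lg x) \<le> real (lg x - 1) + 1" by simp
  moreover have "real (lg x - 1) * ln 2 \<le> ln (real x)"
  proof (cases "lg x")
    case (Suc m)
    then show ?thesis using a by (simp add: algebra_simps)
  qed (use \<open>1 \<le> ln (real x)\<close> in simp)
  ultimately show ?thesis by linarith
qed

text \<open>The hypothesis is multiplied out by \<open>t\<close>, so that all estimates can be
  carried out on natural numbers.\<close>

lemma soft_O_I:
  fixes h :: "nat => nat => nat => nat" and w :: "nat => nat => nat => nat"
  assumes "\<And>n b t. 1 \<le> n ==> 1 \<le> b ==> 1 \<le> t ==> t \<le> n ==> h n b t * t \<le> C * lg (n + b + 1) ^ k * w n b t"
  shows "(\<lambda>n b t. real (h n b t)) \<in> soft_O (\<lambda>n b t. real (w n b t) / real t)"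
  unfolding soft_O_def
proof (rule CollectI, rule exI[of _ "real C * 3 ^ k"], rule exI[of _ k], intro allI impI)
  fix n b t :: nat
  assume *: "1 \<le> n \<and> 1 \<le> b \<and> 1 \<le> t \<and> t \<le> n"
  let ?x = "ln (real (n + b + 1))"
  have t: "0 < real t" using * by simp
  have "real (lg (n + b + 1)) \<le> 3 * ?x" using * by (intro lg_le_ln) simp
  then have l: "real (lg (n + b + 1)) ^ k \<le> (3 * ?x) ^ k" by (intro power_mono) auto
  have "real (h n b t * t) \<le> real (C * lg (n + b + 1) ^ k * w n b t)" using assms * by (simp only: of_nat_le_iff)
  then have "real (h n b t) * real t \<le> real C * real (lg (n + b + 1)) ^ k * real (w n b t)" by simp
  also have "\<dots> \<le> real C * (3 * ?x) ^ k * real (w n b t)" using l by (intro mult_right_mono mult_left_mono) auto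
  finally have "real (h n b t) \<le> real C * (3 * ?x) ^ k * real (w n b t) / real t" using t by (simp add: pos_le_divide_eq)
  then show "real (h n b t) \<le> real C * 3 ^ k * (real (w n b t) / real t) * ?x ^ k"
    by (simp add: power_mult_distrib ac_simps)
qed

definition cost :: "nat => nat => nat => nat" where
  "cost n b t = 2 ^ height (budget n b t) * 2 ^ lg (2 * n) *
     (2 ^ 110 * (2 ^ lg (height (budget n b t) + lg (2 * n)) + height (budget n b t) + lg (2 * n) + 10) ^ 7)"

lemma cost_soft_O: "(\<lambda>n b t. real (K * cost n b t * bit_size (300 * int (cost n b t)))) \<in> soft_O (\<lambda>n b t. real n ^ 2 * real b / real t)"
proof -
  have "(\<lambda>n b t. real (K * cost n b t * bit_size (300 * int (cost n b t)))) \<in> soft_O (\<lambda>n b t. real (n ^ 2 * b) / real t)"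
  \<comment> \<open>The exponent 10 is 2 from the range of the sieve, 7 from the logarithmic part
    \<open>E ^ 7\<close> of the work, and 1 from the address length in the compiled program.\<close>
  proof (rule soft_O_I[where C = "K * (448 * 4 * (2 ^ 110 * 53 ^ 7) * 104)" and k = 10])
    fix n b t :: nat
    assume *: "1 \<le> n" "1 \<le> b" "1 \<le> t" "t \<le> n"
    let ?l = "lg (n + b + 1)" and ?E = "2 ^ lg (height (budget n b t) + lg (2 * n)) + height (budget n b t) + lg (2 * n) + 10"
    note pb = parameter_bounds[OF *]
    have "?E ^ 7 \<le> (53 * ?l) ^ 7" using pb(3) by (rule power_mono) simp
    then have "cost n b t * t * bit_size (300 * int (cost n b t)) \<le> ((448 * ?l ^ 2 * (n * b)) * (4 * n) * (2 ^ 110 * (53 * ?l) ^ 7)) * (104 * ?l)"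
    proof -
      assume e: "?E ^ 7 \<le> (53 * ?l) ^ 7"
      have "cost n b t * t = (2 ^ height (budget n b t) * t) * 2 ^ lg (2 * n) * (2 ^ 110 * ?E ^ 7)" unfolding cost_def by (simp only: ac_simps)
      also have "\<dots> \<le> (448 * ?l ^ 2 * (n * b)) * (4 * n) * (2 ^ 110 * (53 * ?l) ^ 7)"
        by (rule mult_le_mono[OF mult_le_mono[OF pb(1,2)] mult_le_mono2[OF e]])
      finally have "cost n b t * t \<le> (448 * ?l ^ 2 * (n * b)) * (4 * n) * (2 ^ 110 * (53 * ?l) ^ 7)" .
      from mult_le_mono[OF this pb(4)[folded cost_def]] show ?thesis .
    qed
    then have "K * (cost n b t * t * bit_size (300 * int (cost n b t))) \<le> K * (((448 * ?l ^ 2 * (n * b)) * (4 * n) * (2 ^ 110 * (53 * ?l) ^ 7)) * (104 * ?l))"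
      by (rule mult_le_mono2)
    also have "\<dots> = K * (448 * 4 * (2 ^ 110 * 53 ^ 7) * 104) * (?l ^ 2 * ?l ^ 7 * ?l) * (n * n * b)"
      by (simp only: power_mult_distrib ac_simps)
    also have "?l ^ 2 * ?l ^ 7 * ?l = ?l ^ 10" by (simp only: power_add[symmetric] power_Suc2[symmetric]) simp
    finally show "K * cost n b t * bit_size (300 * int (cost n b t)) * t \<le> K * (448 * 4 * (2 ^ 110 * 53 ^ 7) * 104) * ?l ^ 10 * (n ^ 2 * b)"
      by (simp only: power2_eq_square ac_simps)
  qed
  then show ?thesis by simp
qed

lemma size_soft_O: "(\<lambda>n b t. real (2 ^ height (budget n b t))) \<in> soft_O (\<lambda>n b t. real n * real b / real t)"
proof -
  have "(\<lambda>n b t. real (2 ^ height (budget n b t))) \<in> soft_O (\<lambda>n b t. real (n * b) / real t)"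
    by (rule soft_O_I[where C = 448 and k = 2]) (rule parameter_bounds)
  then show ?thesis by simp
qed

lemma coeff_norm_inf_bound:
  assumes "coeff_norm_inf f < 2 ^ b"
  shows "\<bar>coeff f i\<bar> < 2 ^ b"
proof (cases "i \<le> degree f")
  case True
  then have "\<bar>coeff f i\<bar> \<le> coeff_norm_inf f" unfolding coeff_norm_inf_def by (intro Max_ge) auto
  then show ?thesis using assms by linarith
next
  case False
  then show ?thesis by (simp add: coeff_eq_0)
qed

text \<open>The program returns 0 only if every odd prime below the bound is bad, which
  \<open>exists_good_prime\<close> excludes.\<close>

lemma computes_good_prime:
  fixes f :: "int poly" and b t :: nat
  defines "n \<equiv> degree f"
  assumes n: "1 \<le> n" and b: "1 \<le> b" and t: "1 \<le> t" "t \<le> n"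
    and sf: "squarefree (map_poly rat_of_int f)" and f: "coeff_norm_inf f < 2 ^ b"
  shows "\<exists>p. computes (input_memory n b t f) main_code [] (Atom (int p)) (cost n b t) \<and>
    p < 2 ^ height (budget n b t) \<and> good (int p) f t"
proof -
  let ?k = "height (budget n b t)"
  note c = coeff_norm_inf_bound[OF f]
  obtain r where r: "computes (input_memory n b t f) main_code [] (Atom r) (cost n b t)"
    "if r = 0 then \<forall>p. odd p \<and> prime p \<and> p < 2 ^ ?k \<longrightarrow> bad (int p) f t else r < 2 ^ ?k \<and> good r f t"
    using computes_main[OF n[unfolded n_def] b t(1) t(2)[unfolded n_def] c] unfolding n_def cost_def by blast
  have "\<exists>p. odd p \<and> prime p \<and> p < 2 ^ ?k \<and> \<not> bad (int p) f t"
    by (rule exists_good_prime[where l = "lg n" and b = b])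
      (use n t sf c height[of "budget n b t"] le_power_lg[of n] in \<open>simp_all add: n_def budget_def\<close>)
  then have "r \<noteq> 0" using r(2) by auto
  then have g: "r < 2 ^ ?k" "good r f t" using r(2) by auto
  then have "0 \<le> r" unfolding good_def using prime_ge_0_int by blast
  then obtain p where p: "r = int p" by (metis nonneg_int_cases)
  have "int p < int (2 ^ ?k)" using g(1) p by simp
  then have "p < 2 ^ ?k" by (simp only: of_nat_less_iff)
  then show ?thesis using r(1) g(2) p by blast
qed

theorem theorem1p4:
  shows "\<exists>(A :: program).
    \<exists>time \<in> soft_O (\<lambda>n b t. real n ^ 2 * real b / real t).
    \<exists>size_bound \<in> soft_O (\<lambda>n b t. real n * real b / real t).
    \<forall>(n :: nat) (b :: nat) (t :: nat) (f :: int poly).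
      1 \<le> n \<and> 1 \<le> b \<and> 1 \<le> t \<and> t \<le> n \<and>
      Polynomial.degree f = n \<and>
      squarefree (map_poly rat_of_int f) \<and>
      coeff_norm_inf f < 2 ^ b \<longrightarrow>
      (\<exists>T s p.
        exec A (input_memory n b t f) T s \<and> real T \<le> time n b t \<and>
        s 0 = int p \<and> Factorial_Ring.prime p \<and>
        real p \<le> size_bound n b t \<and>
        (let R = residue_ring (int p); fp = reduce_mod p f
         in deg R (somegcd (UP R) fp (UP_deriv R fp)) < t) \<and>
        \<not> int p dvd lead_coeff f)"
proof -
  obtain K where K: "\<And>M r c. eval M main_code (Atom 0) main_code (Atom r) c \<Longrightarrow> (\<forall>a<0. M a = 0) \<Longrightarrow>
     \<exists>T m. exec (compile main_code) M T m \<and> m 0 = r \<and> T \<le> K * c * bit_size (300 * int c)"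
    using compile_correct[of main_code] by blast
  show ?thesis
  proof (rule exI[of _ "compile main_code"], rule bexI[OF _ cost_soft_O[of K]], rule bexI[OF _ size_soft_O], intro allI impI)
    fix n b t :: nat and f :: "int poly"
    assume *: "1 \<le> n \<and> 1 \<le> b \<and> 1 \<le> t \<and> t \<le> n \<and> degree f = n \<and>
      squarefree (map_poly rat_of_int f) \<and> coeff_norm_inf f < 2 ^ b"
    then obtain p where p: "computes (input_memory n b t f) main_code [] (Atom (int p)) (cost n b t)"
      "p < 2 ^ height (budget n b t)" "good (int p) f t"
      using computes_good_prime[of f b t] by blast
    obtain c where c: "c \<le> cost n b t" "eval (input_memory n b t f) main_code (Atom 0) main_code (Atom (int p)) c"
      using p(1) unfolding computes_def by auto
    have "\<forall>a<0. input_memory n b t f a = 0" by (simp add: input_memory_def)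
    then obtain T s where T: "exec (compile main_code) (input_memory n b t f) T s" "s 0 = int p" "T \<le> K * c * bit_size (300 * int c)"
      using K[OF c(2)] by blast
    \<comment> \<open>The actual cost \<open>c\<close> may depend on \<open>f\<close>; by
      monotonicity it is replaced by \<open>cost\<close>, a function of \<open>n\<close>,
      \<open>b\<close> and \<open>t\<close> only.\<close>
    have "K * c * bit_size (300 * int c) \<le> K * cost n b t * bit_size (300 * int (cost n b t))"
      using c(1) by (intro mult_le_mono bit_size_mono) auto
    then have time: "real T \<le> real (K * cost n b t * bit_size (300 * int (cost n b t)))"
      using T(3) by (simp only: of_nat_le_iff)
    have prime: "prime p" using p(3) unfolding good_def by simp
    obtain F D where "gcd_mod (int p) f (pderiv f) F D" "D < t" using p(3) unfolding good_def by blast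
    then have "deg (residue_ring (int p)) (somegcd (UP (residue_ring (int p))) (reduce_mod p f) (reduce_mod p (pderiv f))) < t"
      using deg_somegcd[OF prime] le_less_trans by blast
    then show "\<exists>T s p.
        exec (compile main_code) (input_memory n b t f) T s \<and> real T \<le> real (K * cost n b t * bit_size (300 * int (cost n b t))) \<and>
        s 0 = int p \<and> prime p \<and>
        real p \<le> real (2 ^ height (budget n b t)) \<and>
        (let R = residue_ring (int p); fp = reduce_mod p f
         in deg R (somegcd (UP R) fp (UP_deriv R fp)) < t) \<and>
        \<not> int p dvd lead_coeff f"
      using T(1,2) time prime p(2,3) unfolding good_def Let_def UP_deriv_reduce_mod
      by (intro exI[of _ T] exI[of _ s] exI[of _ p]) (auto simp only: of_nat_le_iff less_imp_le)
  qed
qed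

end
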